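(* Let $\{x_i,\widetilde V_i\}_{i=1}^N$ be an almost uniform Voronoi-Delaunay decomposition of $\mathbb{S}^2$ with mesh size $h$. Let $f\in L^\infty(\mathbb{S}^2)$ satisfy $\int_{\mathbb{S}^2} f\,ds=0$, and assume that the unique zero-mean weak solution $u$ of $-\Delta_s u=f$ on $\mathbb{S}^2$ belongs to $W^{2,\infty}(\mathbb{S}^2)\cap H^1_0(\mathbb{S}^2)$. Let $u_h\in\widetilde U_h$ be the unique solution of the discrete finite volume problem $$\overline{\mathcal A}_h(u_h,\widetilde I_h v_h)=(f,\widetilde I_h v_h)\quad\text{for all } v_h\in\widetilde U_h .$$ Then there exist positive constants $C$ and $h_0<1$, independent of $u$ and $h$, such that for $0<h\le h_0<1$, $$\|u-u_h\|_{L^\infty(\mathbb{S}^2)}\le C\,h\,|\ln h|\left(\|u\|_{W^{2,\infty}(\mathbb{S}^2)}+\|f\|_{L^\infty(\mathbb{S}^2)}\right).$$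
   Context: Sphere and spaces. $\mathbb{S}^2=\{x\in\mathbb{R}^3:\|x\|=1\}$, with surface measure $ds$, geodesic distance $d(x,y)=\arccos\langle x,y\rangle$; $m_a$ and $m_l$ denote area and curve length. $\nabla_s u=\nabla u-(\nabla u\cdot \vec n)\vec n$ is the tangential gradient ($\vec n$ the outer unit normal of $\mathbb{S}^2$), $\Delta_s=\nabla_s\cdot\nabla_s$. $L^p(\mathbb{S}^2)$, $W^{k,p}(\mathbb{S}^2)$, $H^k=W^{k,2}$ are the usual Sobolev spaces on the sphere, $(u,v)=\int_{\mathbb{S}^2}uv\,ds$, and here $H^1_0(\mathbb{S}^2)=\{u\in H^1(\mathbb{S}^2):\int_{\mathbb{S}^2}u\,ds=0\}$. The weak solution of $-\Delta_s u=f$ is the $u\in H^1_0(\mathbb{S}^2)$ with $\int_{\mathbb{S}^2}\nabla_su\cdot\nabla_sv\,ds=(f,v)$ for all $v\in H^1_0(\mathbb{S}^2)$. Voronoi-Delaunay decomposition. Given distinct points (vertices) $x_1,\dots,x_N\in\mathbb{S}^2$, the Voronoi cells are $\widetilde V_i=\{x\in\mathbb{S}^2: d(x,x_i)<d(x,x_j)\ \forall j\ne i\}$. The Voronoi edge is $\widetilde\Gamma_{ij}=\mathrm{cl}(\widetilde V_i)\cap\mathrm{cl}(\widetilde V_j)$ and $\Lambda(i)=\{j\neq i: m_l(\widetilde\Gamma_{ij})>0\}$ is the set of neighbors of $i$, so $\partial\widetilde V_i=\bigcup_{j\in\Lambda(i)}\widetilde\Gamma_{ij}$. The dual Delaunay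 decomposition $\widetilde{\mathcal T}_h$ consists of geodesic triangles $\widetilde T_{ijk}$ with mutually neighboring vertices $x_i,x_j,x_k$, and these triangles tile $\mathbb{S}^2$. The mesh size is $h=\max_i\max_{x\in\widetilde V_i}d(x_i,x)$. The decomposition is almost uniform if there are positive constants $C_0,C_1$ independent of $h$ with $h/C_0\le m_l(\widetilde\Gamma_{ij})\le C_0h$ and $h^2/C_1\le m_a(\widetilde V_i)\le C_1h^2$ for all $i$ and $j\in\Lambda(i)$. Constants "independent of $h$" may depend on these uniformity constants, but not on the decomposition otherwise nor on the functions involved. Discrete spaces. Let $T_{ijk}$ be the planar triangle with the same vertices as $\widetilde T_{ijk}$, $\mathbf S_h=\bigcup T_{ijk}$ the resulting polyhedral surface, and $\mathcal P:\mathbf S_h\to\mathbb{S}^2$, $\mathcal P(x^* )=x^*/\|x^*\|$, the (bijective) radial projection. $\widetilde U_h$ is the space of functions $u_h=\bar u_h\circ\mathcal P^{-1}$ with $\bar u_h$ continuous on $\mathbf S_h$ and affine on each $T_{ijk}$, such that $\int_{\mathbb{S}^2}u_h\,ds=0$. For $v_h\in\widetilde U_h$, $\widetilde I_hv_h$ is the piecewise constant function equal to $v_h(x_i)$ on $\widetilde V_i$. Finite volume form. $\overline{\mathcal F}_{ij}(u_h)=-m_l(\widetilde\Gamma_{ij})\dfrac{u_h(x_j)-u_h(x_i)}{\|x_j-x_i\|}$ and $\overline{\mathcal A}_h(u_h,\widetilde I_hv_h)=\sum_{i=1}^N v_h(x_i)\sum_{j\in\Lambda(i)}\overline{\mathcal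 F}_{ij}(u_h)$. *)

theory Defs
  imports "HOL-Probability.Essential_Supremum"
begin

section \<open>The unit sphere: distance, area and curve length\<close>

abbreviation S2 :: "(real ^ 3) set"
  where "S2 \<equiv> sphere 0 1"

text \<open>The radial projection \<open>y \<mapsto> y / \<parallel>y\<parallel>\<close>.\<close>

definition radial :: "real ^ 3 \<Rightarrow> real ^ 3"
  where "radial y = y /\<^sub>R norm y"

definition gdist :: "real ^ 3 \<Rightarrow> real ^ 3 \<Rightarrow> real"
  where "gdist y z = arccos (y \<bullet> z)"

text \<open>The surface measure \<open>ds\<close>, given by polar coordinates: the area of \<open>A\<close> is three times the
  volume of the cone \<open>{r y | 0 < r < 1, y \<in> A}\<close> (see \<open>emeasure_surface\<close> below). It is a Borel
  measure; every class of functions modulo null sets has a Borel representative.\<close>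

definition surface :: "(real ^ 3) measure"
  where "surface =
    scale_measure 3 (distr (restrict_space lborel (ball 0 1 - {0})) (restrict_space borel S2) radial)"

lemma space_surface: "space surface = S2"
  by (simp add: surface_def space_scale_measure space_restrict_space)

lemma sets_surface: "sets surface = sets (restrict_space borel S2)"
  by (simp add: surface_def)

lemma measurable_radial:
  "radial \<in> measurable (restrict_space lborel (ball 0 1 - {0})) (restrict_space borel S2)"
proof (rule measurable_restrict_space2)
  show "radial \<in> space (restrict_space lborel (ball 0 1 - {0})) \<rightarrow> S2"
    by (auto simp: radial_def space_restrict_space)
  have "radial \<in> borel_measurable borel"
    unfolding radial_def by measurable
  then show "radial \<in> borel_measurable (restrict_space lborel (ball 0 1 - {0}))"
    by (intro measurable_restrict_space1) simp
qed

lemma emeasure_surface: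
  assumes A: "A \<in> sets borel" "A \<subseteq> S2"
  shows "emeasure surface A = 3 * emeasure lborel {r *\<^sub>R y | r y. 0 < r \<and> r < 1 \<and> y \<in> A}"
proof -
  let ?M = "restrict_space lborel (ball 0 1 - {0}) :: (real ^ 3) measure"
  have A': "A \<in> sets (restrict_space borel S2)"
    using A by (auto simp: sets_restrict_space)
  have eq: "radial -` A \<inter> space ?M = {r *\<^sub>R y | r y. 0 < r \<and> r < 1 \<and> y \<in> A}"
  proof (intro subset_antisym subsetI)
    fix z assume "z \<in> radial -` A \<inter> space ?M"
    then have "z = norm z *\<^sub>R radial z" "0 < norm z" "norm z < 1" "radial z \<in> A"
      by (auto simp: radial_def space_restrict_space)
    then show "z \<in> {r *\<^sub>R y | r y. 0 < r \<and> r < 1 \<and> y \<in> A}" by blast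
  next
    fix z assume "z \<in> {r *\<^sub>R y | r y. 0 < r \<and> r < 1 \<and> y \<in> A}"
    then obtain r y where z: "z = r *\<^sub>R y" "0 < r" "r < 1" "y \<in> A" by blast
    then have "norm y = 1" using A by auto
    with z show "z \<in> radial -` A \<inter> space ?M"
      by (auto simp: radial_def space_restrict_space)
  qed
  have "emeasure (distr ?M (restrict_space borel S2) radial) A
      = emeasure ?M (radial -` A \<inter> space ?M)"
    by (rule emeasure_distr[OF measurable_radial A'])
  also have "\<dots> = emeasure lborel (radial -` A \<inter> space ?M)"
    by (rule emeasure_restrict_space) (auto simp: space_restrict_space)
  finally have "emeasure (distr ?M (restrict_space borel S2) radial) A =
      emeasure lborel {r *\<^sub>R y | r y. 0 < r \<and> r < 1 \<and> y \<in> A}"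
    unfolding eq .
  then show ?thesis
    by (simp only: surface_def emeasure_scale_measure)
qed

abbreviation area :: "(real ^ 3) set \<Rightarrow> real"
  where "area A \<equiv> measure surface A"

text \<open>The length of a curve, as a subset of space, is its one-dimensional Hausdorff measure.\<close>

definition hausdorff1 :: "'a::metric_space set \<Rightarrow> ennreal"
  where "hausdorff1 A =
    (SUP \<delta>\<in>{0::real<..}.
      INF E\<in>{E :: nat \<Rightarrow> 'a set. A \<subseteq> (\<Union>n. E n) \<and> (\<forall>n. bounded (E n) \<and> diameter (E n) \<le> \<delta>)}.
        (\<Sum>n. ennreal (diameter (E n))))"

definition curve_length :: "(real ^ 3) set \<Rightarrow> real"
  where "curve_length A = enn2real (hausdorff1 A)"


section \<open>Function spaces on the sphere\<close>

text \<open>Functions on the sphere are represented by functions on the whole space of which only the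
  values on the sphere matter.\<close>

text \<open>The tangential part of a vector \<open>w\<close> at a point \<open>y\<close> of the sphere, where the outer unit
  normal is \<open>y\<close> itself. The tangential gradient of a differentiable \<open>\<phi>\<close> with gradient \<open>D\<close> is
  \<open>\<lambda>y. tangential y (D y)\<close>.\<close>

definition tangential :: "real ^ 3 \<Rightarrow> real ^ 3 \<Rightarrow> real ^ 3"
  where "tangential y w = w - (w \<bullet> y) *\<^sub>R y"

text \<open>Weak tangential gradient: integration by parts against \<open>C\<^sup>1\<close> test functions. On a closed
  surface \<open>\<integral> \<nabla>\<^sub>s(u \<phi>) ds = \<integral> u \<phi> (\<nabla>\<^sub>s \<cdot> n) n ds\<close>, and \<open>\<nabla>\<^sub>s \<cdot> n = 2\<close> on the unit sphere.
  Every \<open>C\<^sup>1\<close> function on the sphere has a \<open>C\<^sup>1\<close> extension to the whole space.\<close>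

definition has_weak_sgrad :: "(real ^ 3 \<Rightarrow> real) \<Rightarrow> (real ^ 3 \<Rightarrow> real ^ 3) \<Rightarrow> bool"
  where "has_weak_sgrad u g \<longleftrightarrow>
    integrable surface u \<and> integrable surface g \<and>
    (\<forall>\<phi> D. (\<forall>y. GDERIV \<phi> y :> D y) \<and> continuous_on UNIV D \<longrightarrow>
      (LINT y|surface. u y *\<^sub>R tangential y (D y)) =
        - (LINT y|surface. \<phi> y *\<^sub>R g y) + 2 *\<^sub>R (LINT y|surface. (u y * \<phi> y) *\<^sub>R y))"

definition weakly_diff :: "(real ^ 3 \<Rightarrow> real) \<Rightarrow> bool"
  where "weakly_diff u \<longleftrightarrow> (\<exists>g. has_weak_sgrad u g)"

text \<open>The weak tangential gradient, unique up to null sets, and its Cartesian components.\<close>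

definition sgrad :: "(real ^ 3 \<Rightarrow> real) \<Rightarrow> real ^ 3 \<Rightarrow> real ^ 3"
  where "sgrad u = (SOME g. has_weak_sgrad u g)"

definition sderiv :: "3 \<Rightarrow> (real ^ 3 \<Rightarrow> real) \<Rightarrow> real ^ 3 \<Rightarrow> real"
  where "sderiv i u = (\<lambda>y. sgrad u y $ i)"

definition Linf_norm :: "(real ^ 3 \<Rightarrow> real) \<Rightarrow> ereal"
  where "Linf_norm u = esssup surface (\<lambda>y. ereal \<bar>u y\<bar>)"

definition Linf :: "(real ^ 3 \<Rightarrow> real) set"
  where "Linf = {u \<in> borel_measurable surface. Linf_norm u < \<infinity>}"

definition L2 :: "(real ^ 3 \<Rightarrow> real) set"
  where "L2 = {u \<in> borel_measurable surface. integrable surface (\<lambda>y. (u y)\<^sup>2)}"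

definition W2inf :: "(real ^ 3 \<Rightarrow> real) set"
  where "W2inf = {u \<in> Linf. weakly_diff u \<and>
    (\<forall>i. sderiv i u \<in> Linf \<and> weakly_diff (sderiv i u) \<and> (\<forall>j. sderiv j (sderiv i u) \<in> Linf))}"

text \<open>The tangential derivatives do not commute, so all ordered pairs of indices are used.\<close>

definition W2inf_norm :: "(real ^ 3 \<Rightarrow> real) \<Rightarrow> ereal"
  where "W2inf_norm u = Max ({Linf_norm u} \<union> range (\<lambda>i. Linf_norm (sderiv i u)) \<union>
    range (\<lambda>(i, j). Linf_norm (sderiv j (sderiv i u))))"

definition H1 :: "(real ^ 3 \<Rightarrow> real) set"
  where "H1 = {u \<in> L2. weakly_diff u \<and> (\<forall>i. sderiv i u \<in> L2)}"

definition H10 :: "(real ^ 3 \<Rightarrow> real) set"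
  where "H10 = {u \<in> H1. (LINT y|surface. u y) = 0}"

definition weak_solution :: "(real ^ 3 \<Rightarrow> real) \<Rightarrow> (real ^ 3 \<Rightarrow> real) \<Rightarrow> bool"
  where "weak_solution f u \<longleftrightarrow> u \<in> H10 \<and>
    (\<forall>v\<in>H10. (LINT y|surface. sgrad u y \<bullet> sgrad v y) = (LINT y|surface. f y * v y))"


section \<open>Voronoi-Delaunay decompositions\<close>

text \<open>The vertices are \<open>x 0, \<dots>, x (N - 1)\<close>.\<close>

definition vcell :: "nat \<Rightarrow> (nat \<Rightarrow> real ^ 3) \<Rightarrow> nat \<Rightarrow> (real ^ 3) set"
  where "vcell N x i = {y \<in> S2. \<forall>j<N. j \<noteq> i \<longrightarrow> gdist y (x i) < gdist y (x j)}"

definition vedge :: "nat \<Rightarrow> (nat \<Rightarrow> real ^ 3) \<Rightarrow> nat \<Rightarrow> nat \<Rightarrow> (real ^ 3) set"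
  where "vedge N x i j = closure (vcell N x i) \<inter> closure (vcell N x j)"

definition neighbors :: "nat \<Rightarrow> (nat \<Rightarrow> real ^ 3) \<Rightarrow> nat \<Rightarrow> nat set"
  where "neighbors N x i = {j. j < N \<and> j \<noteq> i \<and> curve_length (vedge N x i j) > 0}"

text \<open>The index triples of the triangles dual to the Voronoi vertices, that is, to the common points
  of three closed cells. Mutual adjacency alone would not do: three mutually neighboring vertices
  may enclose further vertices.\<close>

definition delaunay :: "nat \<Rightarrow> (nat \<Rightarrow> real ^ 3) \<Rightarrow> (nat \<times> nat \<times> nat) set"
  where "delaunay N x = {(i, j, k). i < j \<and> j < k \<and> k < N \<and>
    j \<in> neighbors N x i \<and> k \<in> neighbors N x j \<and> i \<in> neighbors N x k \<and>
    closure (vcell N x i) \<inter> closure (vcell N x j) \<inter> closure (vcell N x k) \<noteq> {}}"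

definition ptri :: "(nat \<Rightarrow> real ^ 3) \<Rightarrow> nat \<times> nat \<times> nat \<Rightarrow> (real ^ 3) set"
  where "ptri x = (\<lambda>(i, j, k). convex hull {x i, x j, x k})"

definition gtri :: "(nat \<Rightarrow> real ^ 3) \<Rightarrow> nat \<times> nat \<times> nat \<Rightarrow> (real ^ 3) set"
  where "gtri x t = radial ` ptri x t"

text \<open>The geodesic triangles tile the sphere: they cover it, and the interiors (relative to the
  sphere) of different triangles are disjoint.\<close>

definition voronoi_delaunay :: "nat \<Rightarrow> (nat \<Rightarrow> real ^ 3) \<Rightarrow> bool"
  where "voronoi_delaunay N x \<longleftrightarrow>
    x ` {..<N} \<subseteq> S2 \<and> inj_on x {..<N} \<and>
    (\<Union>t\<in>delaunay N x. gtri x t) = S2 \<and>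
    (\<forall>s\<in>delaunay N x. \<forall>t\<in>delaunay N x. s \<noteq> t \<longrightarrow>
      (top_of_set S2 interior_of gtri x s) \<inter> (top_of_set S2 interior_of gtri x t) = {})"

definition mesh_size :: "nat \<Rightarrow> (nat \<Rightarrow> real ^ 3) \<Rightarrow> real"
  where "mesh_size N x = Max ((\<lambda>i. SUP y\<in>vcell N x i. gdist (x i) y) ` {..<N})"

definition almost_uniform :: "real \<Rightarrow> real \<Rightarrow> nat \<Rightarrow> (nat \<Rightarrow> real ^ 3) \<Rightarrow> bool"
  where "almost_uniform C0 C1 N x \<longleftrightarrow>
    (let h = mesh_size N x in
      \<forall>i<N. h\<^sup>2 / C1 \<le> area (vcell N x i) \<and> area (vcell N x i) \<le> C1 * h\<^sup>2 \<and>
        (\<forall>j\<in>neighbors N x i.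
          h / C0 \<le> curve_length (vedge N x i j) \<and> curve_length (vedge N x i j) \<le> C0 * h))"


section \<open>Discrete spaces and the finite volume form\<close>

definition polysurf :: "nat \<Rightarrow> (nat \<Rightarrow> real ^ 3) \<Rightarrow> (real ^ 3) set"
  where "polysurf N x = (\<Union>t\<in>delaunay N x. ptri x t)"

definition Uh :: "nat \<Rightarrow> (nat \<Rightarrow> real ^ 3) \<Rightarrow> (real ^ 3 \<Rightarrow> real) set"
  where "Uh N x = {w.
    (\<exists>wbar. continuous_on (polysurf N x) wbar \<and>
      (\<forall>t\<in>delaunay N x. \<exists>a b. \<forall>y\<in>ptri x t. wbar y = a \<bullet> y + b) \<and>
      (\<forall>y\<in>S2. w y = wbar (inv_into (polysurf N x) radial y))) \<and>
    (LINT y|surface. w y) = 0}"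

text \<open>\<open>Ih\<close> is only determined up to the null set of Voronoi edges, where it is set to \<open>0\<close>.\<close>

definition Ih :: "nat \<Rightarrow> (nat \<Rightarrow> real ^ 3) \<Rightarrow> (real ^ 3 \<Rightarrow> real) \<Rightarrow> real ^ 3 \<Rightarrow> real"
  where "Ih N x v y = (\<Sum>i<N. v (x i) * indicator (vcell N x i) y)"

definition flux :: "nat \<Rightarrow> (nat \<Rightarrow> real ^ 3) \<Rightarrow> (real ^ 3 \<Rightarrow> real) \<Rightarrow> nat \<Rightarrow> nat \<Rightarrow> real"
  where "flux N x w i j =
    - curve_length (vedge N x i j) * ((w (x j) - w (x i)) / norm (x j - x i))"

text \<open>\<open>fv_form N x w v\<close> is the finite volume form at \<open>(w, Ih N x v)\<close>.\<close>

definition fv_form :: "nat \<Rightarrow> (nat \<Rightarrow> real ^ 3) \<Rightarrow> (real ^ 3 \<Rightarrow> real) \<Rightarrow> (real ^ 3 \<Rightarrow> real) \<Rightarrow> real"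
  where "fv_form N x w v = (\<Sum>i<N. v (x i) * (\<Sum>j\<in>neighbors N x i. flux N x w i j))"

definition fv_solution :: "nat \<Rightarrow> (nat \<Rightarrow> real ^ 3) \<Rightarrow> (real ^ 3 \<Rightarrow> real) \<Rightarrow> (real ^ 3 \<Rightarrow> real) \<Rightarrow> bool"
  where "fv_solution N x f w \<longleftrightarrow> w \<in> Uh N x \<and>
    (\<forall>v\<in>Uh N x. fv_form N x w v = (LINT y|surface. f y * Ih N x v y))"

end

theory Submission
  imports Defs "HOL-Complex_Analysis.Great_Picard"
begin

text \<open>The functions \<open>\<phi> i y = exp (l * (y \<bullet> x i)) / (\<Sum>k. exp (l * (y \<bullet> x k)))\<close> form a smooth partition of
  unity that converges to the indicator functions of the Voronoi cells as \<open>l\<close> tends to infinity.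
  With the nodal errors \<open>e i\<close> as coefficients they give an admissible test function
  \<open>V = (\<Sum>i. e i * \<phi> i)\<close> of the weak problem, and \<open>\<integral> f V\<close> converges to the right-hand side of the
  finite volume scheme. The gradient of \<open>V\<close> is half the double sum of
  \<open>l * \<phi> i * \<phi> j * (e i - e j)\<close> times \<open>x i - x j\<close>, and \<open>l * \<phi> i * \<phi> j\<close> concentrates on the common edge
  of the cells \<open>i\<close> and \<open>j\<close>, with total mass close to the edge length divided by the distance of the
  vertices. No integration by parts on a cell is needed. As a function in \<open>W\<^sup>2\<^sup>,\<^sup>\<infinity>\<close> has a Lipschitz gradient
  (by smoothing with zonal kernels), the exact and the discrete fluxes differ by a factor of order
  \<open>h\<close>, so the discrete energy of the nodal errors is of order \<open>h\<^sup>2\<close>. A discrete Sobolev inequality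
  bounds differences of nodal values by \<open>\<bar>ln h\<bar>\<close> times the square root of the energy: differences are
  telescoped along a one-parameter family of paths leaving a vertex, where an edge at distance \<open>r\<close> is
  met only for a fraction \<open>h / r\<close> of the parameters. The remaining constant is fixed by the zero
  means.\<close>

section \<open>Integration over the sphere\<close>

text \<open>The indicator of a cell is not weakly differentiable, so the continuous and the discrete
  problem cannot be tested with the same function; smooth functions that share the coefficients of a
  discrete test function bridge this gap. Subtracting the two equations leaves the energy of the
  nodal errors on one side and, on the other, \<open>K * h\<^sup>2\<close> times the sum of their
  differences over adjacent pairs, where \<open>K\<close> is the second order norm of the solution.
  Cells have area of order \<open>h\<^sup>2\<close>, so there are at most a multiple of
  \<open>1 / h\<^sup>2\<close> such pairs, and Cauchy-Schwarz gives \<open>K * h\<close> times the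
  root of the energy, which cancels one root. The logarithm comes from the fans of paths:
  Cauchy-Schwarz asks for the sum of \<open>(h / r)\<^sup>2\<close> over the pairs, to which each of
  about \<bar>ln h\<bar> dyadic annuli around a vertex contributes a bounded amount. All integration
  by parts descends from one fact, the rotation invariance of the surface measure.\<close>

lemma measurable_surface_borel:
  assumes "f \<in> borel_measurable borel"
  shows "f \<in> borel_measurable surface"
  using measurable_restrict_space1[OF assms, of S2] measurable_cong_sets[OF sets_surface refl]
  by blast

text \<open>A constant density is accessible to \<open>integral_density\<close>; this is the bridge
  from the scaled measure to \<open>integral_surface\<close>.\<close>

lemma surface_density:
  "surface = density (distr (restrict_space lborel (ball 0 1 - {0})) (restrict_space borel S2) radial) (\<lambda>_. 3)"
  by (rule measure_eqI) (auto simp: surface_def emeasure_density_const)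

lemma borel_measurable_radial [measurable]: "radial \<in> borel_measurable borel"
  unfolding radial_def by measurable

lemma integral_surface:
  fixes f :: "real ^ 3 \<Rightarrow> 'b::{banach,second_countable_topology}"
  assumes "f \<in> borel_measurable surface"
  shows "(LINT y|surface. f y) =
    3 *\<^sub>R (LINT y|restrict_space lborel (ball 0 1 - {0}). f (radial y))"
proof -
  let ?D = "distr (restrict_space lborel (ball 0 1 - {0})) (restrict_space borel S2) radial"
  have f: "f \<in> borel_measurable (restrict_space borel S2)"
    using assms measurable_cong_sets[OF sets_surface refl] by blast
  then have f': "f \<in> borel_measurable ?D" by simp
  have "(LINT y|surface. f y) = (LINT y|?D. 3 *\<^sub>R f y)"
    unfolding surface_density
    using integral_density[OF f', of "\<lambda>_. 3"] by simp
  also have "\<dots> = 3 *\<^sub>R (LINT y|?D. f y)" by simp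
  also have "(LINT y|?D. f y) = (LINT y|restrict_space lborel (ball 0 1 - {0}). f (radial y))"
    by (rule integral_distr[OF measurable_radial f])
  finally show ?thesis .
qed

lemma cone_eq_vimage:
  assumes "A \<subseteq> S2"
  shows "{r *\<^sub>R y | r y. 0 < r \<and> r < 1 \<and> y \<in> A} = radial -` A \<inter> (ball 0 1 - {0})"
proof (intro subset_antisym subsetI)
  fix z assume "z \<in> radial -` A \<inter> (ball 0 1 - {0})"
  then have "z = norm z *\<^sub>R radial z" "0 < norm z" "norm z < 1" "radial z \<in> A"
    by (auto simp: radial_def)
  then show "z \<in> {r *\<^sub>R y | r y. 0 < r \<and> r < 1 \<and> y \<in> A}" by blast
next
  fix z assume "z \<in> {r *\<^sub>R y | r y. 0 < r \<and> r < 1 \<and> y \<in> A}"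
  then obtain r y where z: "z = r *\<^sub>R y" "0 < r" "r < 1" "y \<in> A" by blast
  then have "norm y = 1" using assms by auto
  with z show "z \<in> radial -` A \<inter> (ball 0 1 - {0})"
    by (auto simp: radial_def)
qed

lemma sets_surface_iff: "A \<in> sets surface \<longleftrightarrow> A \<in> sets borel \<and> A \<subseteq> S2"
  unfolding sets_surface by (subst sets_restrict_space_iff) auto

lemma emeasure_surface':
  assumes "A \<in> sets surface"
  shows "emeasure surface A = 3 * emeasure lborel (radial -` A \<inter> (ball 0 1 - {0}))"
  using emeasure_surface[of A] cone_eq_vimage[of A] assms by (simp add: sets_surface_iff)

lemma finite_surface: "finite_measure surface"
proof
  have "S2 \<in> sets surface" by (simp add: sets_surface_iff)
  then have "emeasure surface S2 \<le> 3 * emeasure lborel (ball (0::real^3) 1)"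
    unfolding emeasure_surface'[OF \<open>S2 \<in> sets surface\<close>]
    by (intro mult_left_mono emeasure_mono) auto
  also have "\<dots> < \<infinity>"
    using emeasure_lborel_ball_finite[of "0::real^3" 1] by (simp add: ennreal_mult_less_top)
  finally show "emeasure surface (space surface) \<noteq> \<infinity>" by (simp add: space_surface)
qed

interpretation surface: finite_measure surface
  by (rule finite_surface)

lemma integrable_surface_continuous:
  fixes f :: "real ^ 3 \<Rightarrow> 'b::{banach,second_countable_topology}"
  assumes "continuous_on S2 f"
  shows "integrable surface f"
proof -
  have meas: "f \<in> borel_measurable surface"
    using borel_measurable_continuous_on_restrict[OF assms]
      measurable_cong_sets[OF sets_surface refl] by blast
  have "compact (f ` S2)" by (intro compact_continuous_image assms) simp
  then obtain B where B: "\<And>y. y \<in> S2 \<Longrightarrow> norm (f y) \<le> B"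
    using compact_imp_bounded[of "f ` S2"] unfolding bounded_iff by blast
  show ?thesis
    by (rule surface.integrable_const_bound[of _ B])
      (use B meas in \<open>auto simp: space_surface\<close>)
qed

lemma borel_measurable_surface_continuous:
  fixes f :: "real ^ 3 \<Rightarrow> 'b::topological_space"
  assumes "continuous_on S2 f"
  shows "f \<in> borel_measurable surface"
  using borel_measurable_continuous_on_restrict[OF assms]
      measurable_cong_sets[OF sets_surface refl] by blast

section \<open>Rotation invariance of the surface measure\<close>

lemma distr_orthogonal_lborel:
  fixes T :: "real ^ 3 \<Rightarrow> real ^ 3"
  assumes T: "orthogonal_transformation T"
  shows "distr lborel borel T = lborel"
proof (rule lborel_eqI[symmetric])
  fix l u :: "real ^ 3"
  assume le: "\<And>b. b \<in> Basis \<Longrightarrow> l \<bullet> b \<le> u \<bullet> b"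
  have lin: "linear T" using T orthogonal_transformation_linear by blast
  then have Tm: "T \<in> borel_measurable borel"
    by (intro borel_measurable_continuous_onI linear_continuous_on linear_conv_bounded_linear[THEN iffD1])
  have bij: "bij T" using T orthogonal_transformation_bij by blast
  have T': "orthogonal_transformation (inv T)" using T orthogonal_transformation_inv by blast
  have eq: "T -` box l u = inv T ` box l u"
    by (rule bij_vimage_eq_inv_image[OF bij])
  have box: "box l u \<in> lmeasurable" by simp
  have "emeasure (distr lborel borel T) (box l u) = emeasure lborel (T -` box l u)"
    using Tm by (subst emeasure_distr) auto
  also have "\<dots> = emeasure lebesgue (inv T ` box l u)"
    using Tm measurable_sets[OF Tm, of "box l u"] unfolding eq by simp
  also have "\<dots> = ennreal (measure lebesgue (inv T ` box l u))"
    using measurable_orthogonal_image[OF T' box] by (simp add: emeasure_eq_measure2)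
  also have "\<dots> = ennreal (measure lebesgue (box l u))"
    using measure_orthogonal_image[OF T' box] by simp
  also have "\<dots> = ennreal (\<Prod>b\<in>Basis. (u - l) \<bullet> b)"
    using le by (simp add: measure_lborel_box_eq)
  finally show "emeasure (distr lborel borel T) (box l u) = (\<Prod>b\<in>Basis. (u - l) \<bullet> b)" .
qed simp

lemma radial_orthogonal:
  assumes T: "orthogonal_transformation T"
  shows "radial (T y) = T (radial y)"
  using orthogonal_transformation_norm[OF T] orthogonal_transformation_scaleR[OF T]
  by (simp add: radial_def)

lemma measurable_orthogonal_surface:
  assumes T: "orthogonal_transformation T"
  shows "T \<in> measurable surface surface"
proof -
  have "continuous_on UNIV T"
    using orthogonal_transformation_linear[OF T] linear_continuous_on linear_conv_bounded_linear
    by blast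
  then have "T \<in> borel_measurable borel" by (rule borel_measurable_continuous_onI)
  then have "T \<in> measurable (restrict_space borel S2) (restrict_space borel S2)"
    by (intro measurable_restrict_space3)
      (auto simp: orthogonal_transformation_norm[OF T])
  then show ?thesis
    using measurable_cong_sets[OF sets_surface sets_surface] by blast
qed

text \<open>Orthogonal maps preserve norms and commute with \<open>radial\<close>, so they carry the
  cone over a set to the cone over its image, and the Lebesgue measure of cones is
  invariant.\<close>

lemma distr_orthogonal_surface:
  assumes T: "orthogonal_transformation T"
  shows "distr surface surface T = surface"
proof (rule measure_eqI)
  fix A assume "A \<in> sets (distr surface surface T)"
  then have A: "A \<in> sets surface" by simp
  note Tm = measurable_orthogonal_surface[OF T]
  have TA: "T -` A \<inter> space surface \<in> sets surface" using measurable_sets[OF Tm A] .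
  have Tb: "T \<in> borel_measurable borel"
    using orthogonal_transformation_linear[OF T] linear_continuous_on linear_conv_bounded_linear
    by (blast intro: borel_measurable_continuous_onI)
  have AB: "radial -` A \<inter> (ball 0 1 - {0}) \<in> sets borel"
    using A by (auto simp: sets_surface_iff intro!: sets.Int measurable_sets_borel[OF borel_measurable_radial])
  have z: "T y = 0 \<longleftrightarrow> y = 0" for y
    by (metis norm_eq_zero orthogonal_transformation_norm[OF T])
  have eq: "radial -` (T -` A \<inter> space surface) \<inter> (ball 0 1 - {0})
     = T -` (radial -` A \<inter> (ball 0 1 - {0}))"
    by (auto simp: space_surface radial_orthogonal[OF T] orthogonal_transformation_norm[OF T] z)
       (auto simp: radial_def z)
  have "emeasure (distr surface surface T) A = emeasure surface (T -` A \<inter> space surface)"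
    by (rule emeasure_distr[OF Tm A])
  also have "\<dots> = 3 * emeasure lborel (T -` (radial -` A \<inter> (ball 0 1 - {0})))"
    unfolding emeasure_surface'[OF TA] eq ..
  also have "emeasure lborel (T -` (radial -` A \<inter> (ball 0 1 - {0}))) =
      emeasure (distr lborel borel T) (radial -` A \<inter> (ball 0 1 - {0}))"
    using AB Tb by (subst emeasure_distr) auto
  also have "\<dots> = emeasure lborel (radial -` A \<inter> (ball 0 1 - {0}))"
    by (simp add: distr_orthogonal_lborel[OF T])
  finally show "emeasure (distr surface surface T) A = emeasure surface A"
    by (simp add: emeasure_surface'[OF A])
qed simp

lemma integral_surface_orthogonal:
  fixes f :: "real ^ 3 \<Rightarrow> 'b::{banach,second_countable_topology}"
  assumes "orthogonal_transformation T" "f \<in> borel_measurable surface"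
  shows "(LINT y|surface. f (T y)) = (LINT y|surface. f y)"
  using integral_distr[OF measurable_orthogonal_surface[OF assms(1)] assms(2)]
  by (simp add: distr_orthogonal_surface[OF assms(1)])

section \<open>Great circles and spherical caps\<close>

lemma emeasure_surface_hyperplane:
  assumes "a \<noteq> 0"
  shows "emeasure surface {y \<in> S2. y \<bullet> a = 0} = 0"
proof -
  have A: "{y \<in> S2. y \<bullet> a = 0} \<in> sets surface"
    by (auto simp: sets_surface_iff intro!: borel_closed closed_Collect_conj closed_Collect_eq continuous_intros)
  have "negligible {y. a \<bullet> y = 0}" using negligible_hyperplane[of a 0] assms by simp
  then have "{y. a \<bullet> y = 0} \<in> null_sets lborel"
    by (simp add: negligible_iff_null_sets null_sets_completion_iff closed_hyperplane borel_closed)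
  moreover have "radial -` {y \<in> S2. y \<bullet> a = 0} \<inter> (ball 0 1 - {0}) \<subseteq> {y. a \<bullet> y = 0}"
    by (auto simp: radial_def inner_commute)
  ultimately have "emeasure lborel (radial -` {y \<in> S2. y \<bullet> a = 0} \<inter> (ball 0 1 - {0})) \<le> 0"
    using emeasure_mono[of _ "{y. a \<bullet> y = 0}" lborel] by (auto simp: null_sets_def)
  then show ?thesis unfolding emeasure_surface'[OF A] by simp
qed

lemma sets_surface_cap [simp]: "S2 \<inter> cball p s \<in> sets surface"
  by (auto simp: sets_surface_iff intro!: sets.Int borel_closed)

lemma area_cap_pos:
  assumes "p \<in> S2" "0 < s"
  shows "0 < area (S2 \<inter> cball p s)"
proof -
  \<comment> \<open>A point of the ball of radius \<open>d\<close> around \<open>p / 2\<close> has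
    norm above 1/4, so projecting enlarges its deviation, at most \<open>2 * d\<close>, by a factor
    of at most 4; the bound \<open>d \<le> s / 8\<close> keeps the projection in the cap.\<close>
  define d where "d = min (1/4) (s/8)"
  have d: "0 < d" "d \<le> 1/4" "8 * d \<le> s" using assms by (auto simp: d_def)
  have np: "norm p = 1" using assms by simp
  have "ball ((1/2) *\<^sub>R p) d \<subseteq> radial -` (S2 \<inter> cball p s) \<inter> (ball 0 1 - {0})"
  proof
    fix z assume "z \<in> ball ((1/2) *\<^sub>R p) d"
    then have z: "norm (z - (1/2) *\<^sub>R p) < d" by (simp add: dist_norm norm_minus_commute)
    have "\<bar>norm z - norm ((1/2) *\<^sub>R p)\<bar> < d" using norm_triangle_ineq3[of z "(1/2) *\<^sub>R p"] z by linarith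
    then have nz: "\<bar>norm z - 1/2\<bar> < d" by (simp add: np)
    then have nz': "norm z > 1/4" "norm z < 1" using d by auto
    have "radial z - p = (1 / norm z) *\<^sub>R (z - (1/2) *\<^sub>R p) + ((1/2 - norm z) / norm z) *\<^sub>R p"
    proof -
      have "norm z *\<^sub>R (radial z - p) = (z - (1/2) *\<^sub>R p) + (1/2 - norm z) *\<^sub>R p"
      proof -
        have "norm z \<noteq> 0" using nz' by linarith
        then have "norm z *\<^sub>R radial z = z" unfolding radial_def by simp
        then show ?thesis by (simp add: algebra_simps)
      qed
      then have "(1 / norm z) *\<^sub>R (norm z *\<^sub>R (radial z - p)) = (1 / norm z) *\<^sub>R ((z - (1/2) *\<^sub>R p) + (1/2 - norm z) *\<^sub>R p)"
        by simp
      moreover have "(1 / norm z) *\<^sub>R (norm z *\<^sub>R (radial z - p)) = radial z - p"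
      proof -
        have "norm z \<noteq> 0" using nz' by linarith
        then show ?thesis by simp
      qed
      ultimately show ?thesis by (simp add: scaleR_add_right)
    qed
    then have "norm (radial z - p) \<le> (1 / norm z) * norm (z - (1/2) *\<^sub>R p) + \<bar>(1/2 - norm z) / norm z\<bar> * norm p"
      using norm_triangle_ineq[of "(1 / norm z) *\<^sub>R (z - (1/2) *\<^sub>R p)" "((1/2 - norm z) / norm z) *\<^sub>R p"]
      by simp
    also have "\<dots> = (norm (z - (1/2) *\<^sub>R p) + \<bar>1/2 - norm z\<bar>) / norm z"
      using np by (simp add: add_divide_distrib)
    also have "\<dots> \<le> (2 * d) / (1/4)"
      using z nz nz' d by (intro frac_le) auto
    also have "\<dots> \<le> s" using d by simp
    finally have "norm (radial z - p) \<le> s" .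
    moreover have "z \<noteq> 0" using nz' by auto
    ultimately show "z \<in> radial -` (S2 \<inter> cball p s) \<inter> (ball 0 1 - {0})"
      using nz' by (auto simp: dist_norm norm_minus_commute radial_def)
  qed
  then have le: "emeasure lborel (ball ((1/2) *\<^sub>R p) d)
      \<le> emeasure lborel (radial -` (S2 \<inter> cball p s) \<inter> (ball 0 1 - {0}))"
    using measurable_sets_borel[OF borel_measurable_radial, of "S2 \<inter> cball p s"]
    by (intro emeasure_mono) (auto intro!: borel_closed)
  have "0 < emeasure lborel (ball ((1/2) *\<^sub>R p) d)"
    using content_ball_pos[OF d(1), of "(1/2) *\<^sub>R p"] measure_zero_top
    by (auto simp: zero_less_measure_iff[symmetric] zero_less_iff_neq_zero measure_def)
  with le have "0 < emeasure surface (S2 \<inter> cball p s)"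
    unfolding emeasure_surface'[OF sets_surface_cap]
    by (auto simp: ennreal_zero_less_mult_iff)
  then show ?thesis by (simp add: surface.emeasure_eq_measure)
qed

lemma area_S2_pos: "0 < area S2"
proof -
  have "0 < area (S2 \<inter> cball (axis 1 1) 1)"
    by (rule area_cap_pos) (simp_all add: norm_axis_1)
  also have "area (S2 \<inter> cball (axis 1 1) 1) \<le> area S2"
    by (rule surface.finite_measure_mono) (auto simp: sets_surface_iff)
  finally show ?thesis .
qed

text \<open>The cone over a cap of radius \<open>s\<close> is a tube around the segment from 0 to
  \<open>p\<close>: about \<open>1 / s\<close> balls of radius \<open>2 * s\<close> cover it, with
  total volume of order \<open>s\<^sup>2\<close>. For \<open>s > 1\<close> the total area
  suffices.\<close>

lemma area_cap_le: "\<exists>C>0. \<forall>p\<in>S2. \<forall>s. 0 < s \<longrightarrow> area (S2 \<inter> cball p s) \<le> C * s\<^sup>2"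
proof -
  define V where "V = measure lborel (ball (0::real^3) 1)"
  have V: "0 < V" unfolding V_def by (rule content_ball_pos) simp
  have cap: "area (S2 \<inter> cball p s) \<le> 3 * (24 * V * (2 * s\<^sup>2))" if p: "p \<in> S2" and s: "0 < s" "s \<le> 1" for p s
  proof -
    define M where "M = nat \<lceil>1 / s\<rceil>"
    have "0 < 1 / s" using s by simp
    then have M: "1 / s \<le> real M" "real M < 1 / s + 1"
      unfolding M_def using ceiling_correct[of "1 / s"] by linarith+
    have M0: "0 < M" using M(1) \<open>0 < 1 / s\<close> by (cases M) auto
    have np: "norm p = 1" using p by simp
    define B where "B m = ball ((real m / real M) *\<^sub>R p) (2 * s)" for m :: nat
    have sub: "radial -` (S2 \<inter> cball p s) \<inter> (ball 0 1 - {0}) \<subseteq> (\<Union>m\<in>{..M}. B m)"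
    proof
      fix z assume z: "z \<in> radial -` (S2 \<inter> cball p s) \<inter> (ball 0 1 - {0})"
      then have nz: "0 < norm z" "norm z < 1" and c: "norm (p - radial z) \<le> s" by (auto simp: dist_norm)
      define m where "m = nat \<lfloor>norm z * M\<rfloor>"
      have m: "real m \<le> norm z * M" "norm z * M < real m + 1" unfolding m_def using nz by (auto simp: floor_less_iff)
      have "norm z * M \<le> M" using nz by (simp add: mult_left_le_one_le)
      with m have mM: "m \<le> M" by linarith
      have "z = norm z *\<^sub>R radial z" using nz by (simp add: radial_def)
      then have "(real m / real M) *\<^sub>R p - z = norm z *\<^sub>R (p - radial z) + (real m / real M - norm z) *\<^sub>R p"
        by (simp add: algebra_simps)
      then have "norm ((real m / real M) *\<^sub>R p - z) \<le> norm z * norm (p - radial z) + \<bar>real m / real M - norm z\<bar> * norm p"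
        using norm_triangle_ineq[of "norm z *\<^sub>R (p - radial z)" "(real m / real M - norm z) *\<^sub>R p"] by simp
      also have "\<bar>real m / real M - norm z\<bar> \<le> 1 / real M"
      proof -
        have "norm z - real m / real M = (norm z * M - real m) / real M" using M0 by (simp add: field_simps)
        also have "\<bar>\<dots>\<bar> \<le> 1 / real M" using m by (auto simp: intro!: divide_right_mono)
        finally show ?thesis by (simp add: abs_minus_commute)
      qed
      also have "1 / real M \<le> s" using M s M0 by (simp add: field_simps)
      also have "norm z * norm (p - radial z) < s"
        using mult_left_mono[OF c norm_ge_zero, of z] mult_strict_right_mono[OF nz(2) s(1)] by simp
      finally have "norm ((real m / real M) *\<^sub>R p - z) < 2 * s" using np by simp
      then show "z \<in> (\<Union>m\<in>{..M}. B m)" using mM by (auto simp: B_def dist_norm)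
    qed
    have mB: "measure lborel (B m) = V * (2 * s) ^ 3" for m
      unfolding B_def V_def using s by (simp add: content_ball)
    have "measure lborel (radial -` (S2 \<inter> cball p s) \<inter> (ball 0 1 - {0})) \<le> measure lborel (\<Union>m\<in>{..M}. B m)"
      using measurable_sets_borel[OF borel_measurable_radial, of "S2 \<inter> cball p s"] sub
      by (intro measure_mono_fmeasurable fmeasurable.finite_UN)
         (auto simp: B_def intro!: borel_closed fmeasurableI emeasure_lborel_ball_finite)
    also have "\<dots> \<le> (\<Sum>m\<in>{..M}. measure lborel (B m))"
      by (intro measure_UNION_le) (auto simp: B_def)
    also have "\<dots> = (real M + 1) * (V * (2 * s) ^ 3)" by (simp add: mB)
    also have "\<dots> \<le> (3 / s) * (V * (2 * s) ^ 3)"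
      using M s V by (intro mult_right_mono) (auto simp: field_simps)
    also have "\<dots> = 24 * V * s\<^sup>2" using s by (simp add: power3_eq_cube power2_eq_square)
    finally have "measure lborel (radial -` (S2 \<inter> cball p s) \<inter> (ball 0 1 - {0})) \<le> 24 * V * s\<^sup>2" .
    moreover have "area (S2 \<inter> cball p s) = 3 * measure lborel (radial -` (S2 \<inter> cball p s) \<inter> (ball 0 1 - {0}))"
      using emeasure_surface'[OF sets_surface_cap, of p s] by (simp add: measure_def enn2real_mult)
    moreover have "0 \<le> V * s\<^sup>2" using V by simp
    ultimately show ?thesis by linarith
  qed
  define A where "A = area S2"
  have A0: "0 \<le> A" by (simp add: A_def)
  show ?thesis
  proof (intro exI[of _ "144 * V + A"] conjI ballI allI impI)
    show "0 < 144 * V + A" using V A0 by simp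
    fix p s assume p: "p \<in> S2" and s: "(0::real) < s"
    show "area (S2 \<inter> cball p s) \<le> (144 * V + A) * s\<^sup>2"
    proof (cases "s \<le> 1")
      case True
      then have "area (S2 \<inter> cball p s) \<le> 144 * V * s\<^sup>2" using cap[OF p s] by simp
      then show ?thesis using A0 by (simp add: distrib_right add_increasing2)
    next
      case False
      then have "1 \<le> s\<^sup>2" by (simp add: one_le_power)
      have "area (S2 \<inter> cball p s) \<le> A" unfolding A_def
        by (rule surface.finite_measure_mono) (auto simp: sets_surface_iff)
      also have "\<dots> \<le> (144 * V + A) * 1" using V by simp
      also have "\<dots> \<le> (144 * V + A) * s\<^sup>2" using V A0 \<open>1 \<le> s\<^sup>2\<close> by (intro mult_left_mono) auto
      finally show ?thesis .
    qed
  qed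
qed

section \<open>Functions that vanish against all test functions\<close>

lemma integral_continuous_approx_closed:
  fixes w :: "real ^ 3 \<Rightarrow> real"
  assumes w: "integrable surface w"
    and zero: "\<And>\<psi>. continuous_on UNIV \<psi> \<Longrightarrow> (LINT y|surface. \<psi> y * w y) = 0"
    and K: "closed K" "K \<noteq> {}"
  shows "(LINT y|surface. indicator K y * w y) = 0"
proof -
  \<comment> \<open>Tent functions that are 1 on \<open>K\<close> and vanish beyond distance
    \<open>1 / n\<close>; they decrease to the indicator because \<open>K\<close> is closed.\<close>
  define \<psi> where "\<psi> n y = max 0 (1 - real n * infdist y K)" for n :: nat and y :: "real ^ 3"
  have c: "continuous_on UNIV (\<psi> n)" for n unfolding \<psi>_def
    by (intro continuous_intros)
  have m: "\<psi> n \<in> borel_measurable surface" for n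
    by (intro measurable_surface_borel borel_measurable_continuous_onI c)
  have "(\<lambda>n. LINT y|surface. \<psi> n y * w y) \<longlonglongrightarrow> (LINT y|surface. indicator K y * w y)"
  proof (rule integral_dominated_convergence[where w = "\<lambda>y. \<bar>w y\<bar>"])
    show "(\<lambda>y. indicator K y * w y) \<in> borel_measurable surface"
      using w K by (intro borel_measurable_times) (auto intro!: measurable_surface_borel simp: borel_closed)
    show "(\<lambda>y. \<psi> n y * w y) \<in> borel_measurable surface" for n
      using w m by (intro borel_measurable_times) auto
    show "integrable surface (\<lambda>y. \<bar>w y\<bar>)" using w by simp
    show "AE y in surface. norm (\<psi> n y * w y) \<le> \<bar>w y\<bar>" for n
      by (intro AE_I2) (auto simp: \<psi>_def abs_mult intro!: mult_left_le_one_le mult_nonneg_nonneg infdist_nonneg)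
    show "AE y in surface. (\<lambda>n. \<psi> n y * w y) \<longlonglongrightarrow> indicator K y * w y"
    proof (intro AE_I2 tendsto_mult tendsto_const)
      fix y :: "real ^ 3"
      show "(\<lambda>n. \<psi> n y) \<longlonglongrightarrow> indicator K y"
      proof (cases "y \<in> K")
        case True
        then show ?thesis by (simp add: \<psi>_def)
      next
        case False
        then have d: "0 < infdist y K"
          using K in_closed_iff_infdist_zero infdist_nonneg less_eq_real_def by metis
        obtain m :: nat where m: "1 / infdist y K < real m" using reals_Archimedean2 by blast
        have "\<psi> n y = 0" if "n \<ge> m" for n
        proof -
          have "1 / infdist y K < real n" using m that by linarith
          then have "1 < real n * infdist y K" using d by (simp add: field_simps)
          then show ?thesis by (simp add: \<psi>_def)
        qed
        then have "(\<lambda>n. \<psi> n y) \<longlonglongrightarrow> 0"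
          by (intro tendsto_eventually) (auto simp: eventually_sequentially)
        then show ?thesis using False by simp
      qed
    qed
  qed
  then show ?thesis using zero[OF c] by (simp add: LIMSEQ_const_iff)
qed

text \<open>Dynkin system argument: the sets over which \<open>w\<close> integrates to zero contain
  the intersection-stable system of closed sets and are stable under complements and countable
  disjoint unions.\<close>

lemma AE_zero_of_integral_continuous:
  fixes w :: "real ^ 3 \<Rightarrow> real"
  assumes w: "integrable surface w"
    and zero: "\<And>\<psi>. continuous_on UNIV \<psi> \<Longrightarrow> (LINT y|surface. \<psi> y * w y) = 0"
  shows "AE y in surface. w y = 0"
proof -
  have ib: "integrable surface (\<lambda>y. indicator A y * w y)" if "A \<in> sets borel" for A
    using that w by (intro Bochner_Integration.integrable_bound[OF w] borel_measurable_times)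
      (auto simp: indicator_def intro!: measurable_surface_borel)
  have all: "(LINT y|surface. indicator A y * w y) = 0" if "A \<in> sets borel" for A
  proof -
    have "Int_stable (Collect closed :: (real ^ 3) set set)" by (auto simp: Int_stable_def)
    moreover have "Collect closed \<subseteq> Pow (UNIV :: (real ^ 3) set)" by simp
    moreover have "A \<in> sigma_sets UNIV (Collect closed)"
      using that unfolding borel_eq_closed by simp
    ultimately show ?thesis
    proof (induct A rule: sigma_sets_induct_disjoint)
      case (basic A)
      then show ?case using integral_continuous_approx_closed[OF w zero] by (cases "A = {}") auto
    next
      case empty
      then show ?case by simp
    next
      case (compl A)
      then have A: "A \<in> sets borel" unfolding borel_eq_closed by simp
      have "(LINT y|surface. indicator (UNIV - A) y * w y) = (LINT y|surface. w y - indicator A y * w y)"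
        by (intro Bochner_Integration.integral_cong) (auto simp: indicator_def)
      also have "\<dots> = (LINT y|surface. w y) - (LINT y|surface. indicator A y * w y)"
        by (rule Bochner_Integration.integral_diff[OF w ib[OF A]])
      also have "\<dots> = 0" using compl zero[of "\<lambda>_. 1"] by simp
      finally show ?case .
    next
      case (union A)
      then have A: "A i \<in> sets borel" for i unfolding borel_eq_closed by auto
      have "(\<lambda>n. LINT y|surface. indicator (\<Union>i<n. A i) y * w y) \<longlonglongrightarrow> (LINT y|surface. indicator (\<Union>i. A i) y * w y)"
      proof (rule integral_dominated_convergence[where w = "\<lambda>y. \<bar>w y\<bar>"])
        show "AE y in surface. (\<lambda>n. indicator (\<Union>i<n. A i) y * w y) \<longlonglongrightarrow> indicator (\<Union>i. A i) y * w y"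
          by (intro AE_I2 tendsto_mult tendsto_const) (rule LIMSEQ_indicator_UN)
        show "AE y in surface. norm (indicator (\<Union>i<n. A i) y * w y) \<le> \<bar>w y\<bar>" for n
          by (intro AE_I2) (auto simp: indicator_def)
      qed (use w A ib in \<open>auto intro!: borel_measurable_integrable\<close>)
      moreover have "(LINT y|surface. indicator (\<Union>i<n. A i) y * w y) = 0" for n
      proof (induct n)
        case 0
        then show ?case by simp
      next
        case (Suc n)
        have U: "(\<Union>i<n. A i) \<in> sets borel" using A by auto
        have "y \<notin> A n" if "y \<in> (\<Union>i<n. A i)" for y
          using that union(1) by (auto simp: disjoint_family_on_def) (metis UNIV_I disjoint_iff nat_neq_iff)
        then have "(LINT y|surface. indicator (\<Union>i<Suc n. A i) y * w y) =
          (LINT y|surface. indicator (\<Union>i<n. A i) y * w y + indicator (A n) y * w y)"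
          by (intro Bochner_Integration.integral_cong) (auto simp: indicator_def lessThan_Suc)
        also have "\<dots> = (LINT y|surface. indicator (\<Union>i<n. A i) y * w y) + (LINT y|surface. indicator (A n) y * w y)"
          by (rule Bochner_Integration.integral_add[OF ib[OF U] ib[OF A]])
        finally show ?case using Suc union by simp
      qed
      ultimately show ?case by (simp add: LIMSEQ_const_iff)
    qed
  qed
  have "AE y in surface. w y = (\<lambda>_. 0) y"
  proof (rule density_unique_real)
    fix A assume "A \<in> sets surface"
    then have "A \<in> sets borel" by (simp add: sets_surface_iff)
    from all[OF this] show "set_lebesgue_integral surface A w = set_lebesgue_integral surface A (\<lambda>_. 0)"
      by (simp add: set_lebesgue_integral_def)
  qed (use w in auto)
  then show ?thesis by simp
qed

section \<open>Weak tangential gradients\<close>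

text \<open>Names the condition on test pairs in \<open>has_weak_sgrad\<close>, so that calculus
  rules can be stated for it.\<close>

definition C1_grad :: "(real ^ 3 \<Rightarrow> real) \<Rightarrow> (real ^ 3 \<Rightarrow> real ^ 3) \<Rightarrow> bool"
  where "C1_grad \<phi> D \<longleftrightarrow> (\<forall>y. GDERIV \<phi> y :> D y) \<and> continuous_on UNIV D"

lemma C1_grad_continuous: "C1_grad \<phi> D \<Longrightarrow> continuous_on A \<phi>"
  unfolding C1_grad_def gderiv_def
  by (meson has_derivative_continuous continuous_at_imp_continuous_on)

lemma C1_grad_continuous': "C1_grad \<phi> D \<Longrightarrow> continuous_on A D"
  unfolding C1_grad_def by (meson continuous_on_subset subset_UNIV)

lemma C1_grad_mult:
  "C1_grad f df \<Longrightarrow> C1_grad g dg \<Longrightarrow> C1_grad (\<lambda>y. f y * g y) (\<lambda>y. f y *\<^sub>R dg y + g y *\<^sub>R df y)"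
  unfolding C1_grad_def[of "\<lambda>y. f y * g y"]
  by (intro conjI allI GDERIV_mult continuous_intros)
     (simp_all add: C1_grad_continuous C1_grad_continuous' C1_grad_def)

lemma C1_grad_add:
  "C1_grad f df \<Longrightarrow> C1_grad g dg \<Longrightarrow> C1_grad (\<lambda>y. f y + g y) (\<lambda>y. df y + dg y)"
  unfolding C1_grad_def by (blast intro: GDERIV_add continuous_on_add)

lemma C1_grad_const: "C1_grad (\<lambda>_. c) (\<lambda>_. 0)"
  by (simp add: C1_grad_def GDERIV_const)

lemma C1_grad_inner: "C1_grad (\<lambda>y. y \<bullet> a) (\<lambda>_. a)"
  unfolding C1_grad_def gderiv_def
  by (simp add: bounded_linear_inner_left bounded_linear_imp_has_derivative)

lemma C1_grad_sum:
  "finite I \<Longrightarrow> (\<And>i. i \<in> I \<Longrightarrow> C1_grad (f i) (D i)) \<Longrightarrow> C1_grad (\<lambda>y. \<Sum>i\<in>I. f i y) (\<lambda>y. \<Sum>i\<in>I. D i y)"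
  by (induction I rule: finite_induct) (auto intro: C1_grad_const C1_grad_add)

lemma real_polynomial_function_C1:
  fixes p :: "real ^ 3 \<Rightarrow> real"
  shows "real_polynomial_function p \<Longrightarrow> \<exists>D. C1_grad p D"
proof (induct rule: real_polynomial_function.induct)
  case (linear f)
  then have "f = (\<lambda>y. y \<bullet> adjoint f 1)"
    using adjoint_works[of f _ 1] bounded_linear.linear[OF linear] by (auto simp: fun_eq_iff)
  then show ?case using C1_grad_inner by metis
next
  case (const c)
  show ?case using C1_grad_const by blast
next
  case (add f g)
  then show ?case using C1_grad_add by blast
next
  case (mult f g)
  then show ?case using C1_grad_mult by blast
qed

text \<open>Polynomials are C1 and, by Stone-Weierstrass, uniformly dense in the continuous
  functions on the sphere, so testing with C1 functions is as good as testing with continuous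
  ones.\<close>

lemma AE_zero_of_integral_C1:
  fixes w :: "real ^ 3 \<Rightarrow> real"
  assumes w: "integrable surface w"
    and zero: "\<And>\<phi> D. C1_grad \<phi> D \<Longrightarrow> (LINT y|surface. \<phi> y * w y) = 0"
  shows "AE y in surface. w y = 0"
proof (rule AE_zero_of_integral_continuous[OF w])
  fix \<psi> :: "real ^ 3 \<Rightarrow> real" assume \<psi>: "continuous_on UNIV \<psi>"
  define I where "I = (LINT y|surface. \<bar>w y\<bar>)"
  have I: "0 \<le> I" by (simp add: I_def)
  have "\<bar>LINT y|surface. \<psi> y * w y\<bar> \<le> 0 + e" if e: "e > 0" for e
  proof -
    \<comment> \<open>\<open>I + 1\<close> instead of \<open>I\<close> keeps the quotient meaningful
      when \<open>w\<close> vanishes.\<close>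
    have "e / (I + 1) > 0" using e I by simp
    then obtain p where p: "real_polynomial_function p" "\<And>y. y \<in> S2 \<Longrightarrow> \<bar>\<psi> y - p y\<bar> < e / (I + 1)"
      using Stone_Weierstrass_real_polynomial_function[of S2 \<psi> "e / (I + 1)"]
        continuous_on_subset[OF \<psi> subset_UNIV] compact_sphere by metis
    obtain D where D: "C1_grad p D" using real_polynomial_function_C1[OF p(1)] by blast
    have i: "integrable surface (\<lambda>y. f y * w y)" if f: "continuous_on S2 f" for f
    proof -
      have "compact (f ` S2)" by (intro compact_continuous_image f) simp
      then obtain B where B: "\<And>y. y \<in> S2 \<Longrightarrow> norm (f y) \<le> B"
        using compact_imp_bounded[of "f ` S2"] unfolding bounded_iff by blast
      show ?thesis
      proof (rule Bochner_Integration.integrable_bound)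
        show "integrable surface (\<lambda>y. B * w y)" using w by simp
        show "(\<lambda>y. f y * w y) \<in> borel_measurable surface"
          using w borel_measurable_surface_continuous[OF f] by (intro borel_measurable_times) auto
        show "AE y in surface. norm (f y * w y) \<le> norm (B * w y)"
          using B by (intro AE_I2) (force simp: space_surface abs_mult intro!: mult_right_mono)
      qed
    qed
    have i\<psi>: "integrable surface (\<lambda>y. \<psi> y * w y)"
      by (rule i) (rule continuous_on_subset[OF \<psi>], simp)
    have ip: "integrable surface (\<lambda>y. p y * w y)"
      by (rule i) (rule C1_grad_continuous[OF D])
    have "(LINT y|surface. \<psi> y * w y) = (LINT y|surface. \<psi> y * w y) - (LINT y|surface. p y * w y)"
      using zero[OF D] by simp
    also have "\<dots> = (LINT y|surface. \<psi> y * w y - p y * w y)"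
      by (rule Bochner_Integration.integral_diff[symmetric, OF i\<psi> ip])
    also have "\<bar>\<dots>\<bar> \<le> (LINT y|surface. (e / (I + 1)) * \<bar>w y\<bar>)"
    proof -
      have "norm (LINT y|surface. \<psi> y * w y - p y * w y) \<le> (LINT y|surface. norm (\<psi> y * w y - p y * w y))"
        by (rule Bochner_Integration.integral_norm_bound)
      also have "\<dots> \<le> (LINT y|surface. (e / (I + 1)) * \<bar>w y\<bar>)"
      proof (rule Bochner_Integration.integral_mono)
        show "integrable surface (\<lambda>y. norm (\<psi> y * w y - p y * w y))"
          by (rule integrable_norm[OF Bochner_Integration.integrable_diff[OF i\<psi> ip]])
        show "norm (\<psi> y * w y - p y * w y) \<le> e / (I + 1) * \<bar>w y\<bar>" if "y \<in> space surface" for y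
        proof -
          have "\<bar>\<psi> y - p y\<bar> \<le> e / (I + 1)" using p(2)[of y] that by (simp add: space_surface)
          from mult_right_mono[OF this, of "\<bar>w y\<bar>"] show ?thesis
            by (simp add: left_diff_distrib[symmetric] abs_mult)
        qed
      qed (use w in simp)
      finally show ?thesis by simp
    qed
    also have "\<dots> = e / (I + 1) * I" by (simp add: I_def)
    also have "\<dots> \<le> e" using I e by (simp add: field_simps)
    finally show ?thesis by simp
  qed
  then have "\<bar>LINT y|surface. \<psi> y * w y\<bar> \<le> 0" by (rule field_le_epsilon)
  then show "(LINT y|surface. \<psi> y * w y) = 0" by simp
qed

section \<open>Rotation fields and integration by parts\<close>

lemma integrable_surface_scaleR_continuous:
  fixes k :: "real ^ 3 \<Rightarrow> 'b::{banach,second_countable_topology}"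
  assumes c: "continuous_on S2 \<phi>" and k: "integrable surface k"
  shows "integrable surface (\<lambda>y. \<phi> y *\<^sub>R k y)"
proof -
  have "compact (\<phi> ` S2)" by (intro compact_continuous_image c) simp
  then obtain B where B: "\<And>y. y \<in> S2 \<Longrightarrow> norm (\<phi> y) \<le> B"
    using compact_imp_bounded[of "\<phi> ` S2"] unfolding bounded_iff by blast
  show ?thesis
  proof (rule Bochner_Integration.integrable_bound)
    show "integrable surface (\<lambda>y. B *\<^sub>R k y)" using k by simp
    show "(\<lambda>y. \<phi> y *\<^sub>R k y) \<in> borel_measurable surface"
      using k borel_measurable_surface_continuous[OF c] by (intro borel_measurable_scaleR) auto
    show "AE y in surface. norm (\<phi> y *\<^sub>R k y) \<le> norm (B *\<^sub>R k y)"
    proof (intro AE_I2)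
      fix y assume "y \<in> space surface"
      then have "norm (\<phi> y) \<le> \<bar>B\<bar>" using B[of y] by (simp add: space_surface)
      then show "norm (\<phi> y *\<^sub>R k y) \<le> norm (B *\<^sub>R k y)"
        by (simp add: mult_right_mono)
    qed
  qed
qed

text \<open>Rodrigues' formula for the rotation about the axis \<open>e\<close>.\<close>

definition rot :: "real ^ 3 \<Rightarrow> real \<Rightarrow> real ^ 3 \<Rightarrow> real ^ 3"
  where "rot e t y = y + sin t *\<^sub>R cross3 e y + (1 - cos t) *\<^sub>R cross3 e (cross3 e y)"

lemma rot_0 [simp]: "rot e 0 y = y"
  by (simp add: rot_def)

lemma rot_orthogonal:
  assumes "norm e = 1"
  shows "orthogonal_transformation (rot e t)"
proof -
  have ee: "e \<bullet> e = 1" using assms by (simp add: norm_eq_1)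
  have lin: "linear (rot e t)"
    by (rule linearI) (simp_all add: rot_def cross_add_right cross_mult_right algebra_simps)
  have tri: "cross3 e (cross3 e y) = (e \<bullet> y) *\<^sub>R e - y" for y
    using ee by (simp add: Lagrange)
  have dot: "cross3 e y \<bullet> cross3 e z = y \<bullet> z - (e \<bullet> y) * (e \<bullet> z)" for y z
    using ee by (simp add: dot_cross inner_commute)
  have "rot e t y \<bullet> rot e t z = y \<bullet> z" for y z
  proof -
    have r: "rot e t y = cos t *\<^sub>R y + sin t *\<^sub>R cross3 e y + ((1 - cos t) * (e \<bullet> y)) *\<^sub>R e" for y
      by (simp add: rot_def tri algebra_simps)
    have s: "z \<bullet> cross3 e y = - (y \<bullet> cross3 e z)"
      by (simp add: cross3_simps)
    have yy: "e \<bullet> cross3 e w = 0" "cross3 e w \<bullet> e = 0" for w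
      by (simp_all add: dot_cross_self)
    have s': "cross3 e y \<bullet> z = - (y \<bullet> cross3 e z)" using s by (simp add: inner_commute)
    have "rot e t y \<bullet> rot e t z = (cos t)\<^sup>2 * (y \<bullet> z) + (sin t)\<^sup>2 * (y \<bullet> z - (e \<bullet> y) * (e \<bullet> z))
      + (1 - cos t)\<^sup>2 * ((e \<bullet> y) * (e \<bullet> z)) + 2 * cos t * (1 - cos t) * ((e \<bullet> y) * (e \<bullet> z))"
      unfolding r
      by (simp add: inner_add_left inner_add_right yy s' ee dot inner_commute[of y e] power2_eq_square algebra_simps)
    also have "(sin t)\<^sup>2 = 1 - (cos t)\<^sup>2" by (simp add: sin_squared_eq)
    finally show ?thesis by (simp add: power2_eq_square algebra_simps)
  qed
  then show ?thesis unfolding orthogonal_transformation_def using lin by simp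
qed

text \<open>Identifies the rotations as the flow of the vector field \<open>cross3 e\<close>. The
  flow preserves area, so derivatives along such fields integrate to zero; all integration by parts
  starts here.\<close>

lemma rot_deriv:
  assumes "norm e = 1"
  shows "((\<lambda>t. rot e t y) has_vector_derivative cross3 e (rot e t y)) (at t)"
proof -
  have ee: "e \<bullet> e = 1" using assms by (simp add: norm_eq_1)
  have tri: "cross3 e (cross3 e y) = (e \<bullet> y) *\<^sub>R e - y" for y
    using ee by (simp add: Lagrange)
  have "((\<lambda>t. rot e t y) has_vector_derivative
      (0 + cos t *\<^sub>R cross3 e y + sin t *\<^sub>R cross3 e (cross3 e y))) (at t)"
    unfolding rot_def
    by (rule derivative_eq_intros refl | simp add: has_real_derivative_iff_has_vector_derivative[symmetric])+
  also have "0 + cos t *\<^sub>R cross3 e y + sin t *\<^sub>R cross3 e (cross3 e y) = cross3 e (rot e t y)"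
    by (simp add: rot_def cross_add_right cross_mult_right tri scaleR_diff_right scaleR_diff_left Cross3.right_diff_distrib algebra_simps)
  finally show ?thesis .
qed

lemma C1_grad_rot_deriv:
  assumes F: "C1_grad F D" and e: "norm e = 1"
  shows "((\<lambda>t. F (rot e t y)) has_real_derivative D (rot e t y) \<bullet> cross3 e (rot e t y)) (at t)"
proof -
  have "(F has_derivative (\<lambda>h. h \<bullet> D (rot e t y))) (at (rot e t y))"
    using F by (simp add: C1_grad_def gderiv_def)
  with rot_deriv[OF e, of y t, unfolded has_vector_derivative_def]
  have "((\<lambda>t. F (rot e t y)) has_derivative (\<lambda>h. (h *\<^sub>R cross3 e (rot e t y)) \<bullet> D (rot e t y))) (at t)"
    by (rule has_derivative_compose)
  then show ?thesis
    by (simp add: has_field_derivative_def inner_commute mult_commute_abs)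
qed

text \<open>The difference quotients of \<open>F\<close> along the flow have integral zero by
  invariance; the mean value theorem bounds them by \<open>B\<close>, so dominated convergence
  passes this on to the derivative.\<close>

lemma integral_surface_rot_field:
  assumes F: "C1_grad F D" and e: "norm e = 1"
  shows "(LINT y|surface. D y \<bullet> cross3 e y) = 0"
proof -
  have cD: "continuous_on A (\<lambda>y. D y \<bullet> cross3 e y)" for A
    using C1_grad_continuous'[OF F, of A]
    by (intro continuous_intros continuous_on_cross) auto
  have "compact ((\<lambda>y. D y \<bullet> cross3 e y) ` S2)" by (intro compact_continuous_image cD) simp
  then obtain B where B: "\<And>y. y \<in> S2 \<Longrightarrow> \<bar>D y \<bullet> cross3 e y\<bar> \<le> B"
    using compact_imp_bounded[of "(\<lambda>y. D y \<bullet> cross3 e y) ` S2"] unfolding bounded_iff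
    by (metis imageI real_norm_def)
  define q where "q n y = (F (rot e (1 / Suc n) y) - F y) / (1 / Suc n)" for n y
  have iF: "integrable surface F" by (rule integrable_surface_continuous[OF C1_grad_continuous[OF F]])
  have Fm: "F \<in> borel_measurable surface" using iF by simp
  have cr: "continuous_on S2 (\<lambda>y. F (rot e t y))" for t
  proof (rule continuous_on_compose2[OF C1_grad_continuous[OF F, of UNIV]])
    show "continuous_on S2 (rot e t)"
      using orthogonal_transformation_linear[OF rot_orthogonal[OF e, of t]]
        linear_continuous_on linear_conv_bounded_linear by blast
  qed simp
  have ir: "integrable surface (\<lambda>y. F (rot e t y))" for t
    by (rule integrable_surface_continuous[OF cr])
  have q0: "(LINT y|surface. q n y) = 0" for n
    unfolding q_def
    using integral_surface_orthogonal[OF rot_orthogonal[OF e] Fm] iF ir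
    by simp
  have "(\<lambda>n. LINT y|surface. q n y) \<longlonglongrightarrow> (LINT y|surface. D y \<bullet> cross3 e y)"
  proof (rule integral_dominated_convergence[where w = "\<lambda>_. B"])
    show "(\<lambda>y. D y \<bullet> cross3 e y) \<in> borel_measurable surface"
      by (intro borel_measurable_surface_continuous cD)
    show "q n \<in> borel_measurable surface" for n
      unfolding q_def using ir iF by simp
    show "integrable surface (\<lambda>_. B)" by simp
    show "AE y in surface. norm (q n y) \<le> B" for n
    proof (intro AE_I2)
      fix y assume y: "y \<in> space surface"
      have "\<exists>z. 0 < z \<and> z < 1 / Suc n \<and>
        F (rot e (1 / Suc n) y) - F (rot e 0 y) = (1 / Suc n - 0) * (D (rot e z y) \<bullet> cross3 e (rot e z y))"
        by (rule MVT2) (auto intro: C1_grad_rot_deriv[OF F e])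
      then obtain z where "q n y = D (rot e z y) \<bullet> cross3 e (rot e z y)"
        by (auto simp: q_def field_simps)
      moreover have "rot e z y \<in> S2"
        using y orthogonal_transformation_norm[OF rot_orthogonal[OF e]] by (simp add: space_surface)
      ultimately show "norm (q n y) \<le> B" using B by simp
    qed
    show "AE y in surface. (\<lambda>n. q n y) \<longlonglongrightarrow> D y \<bullet> cross3 e y"
    proof (intro AE_I2)
      fix y
      have "((\<lambda>h. (F (rot e (0 + h) y) - F (rot e 0 y)) / h) \<longlongrightarrow> D (rot e 0 y) \<bullet> cross3 e (rot e 0 y)) (at 0)"
        using C1_grad_rot_deriv[OF F e, of y 0] by (simp only: DERIV_def)
      then have "((\<lambda>h. (F (rot e h y) - F y) / h) \<longlongrightarrow> D y \<bullet> cross3 e y) (at 0)" by simp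
      moreover have "filterlim (\<lambda>n. 1 / real (Suc n)) (at 0) sequentially"
        unfolding filterlim_at using LIMSEQ_inverse_real_of_nat by (auto simp: inverse_eq_divide)
      ultimately show "(\<lambda>n. q n y) \<longlonglongrightarrow> D y \<bullet> cross3 e y"
        unfolding q_def by (rule filterlim_compose)
    qed
  qed
  then show ?thesis by (simp add: q0 LIMSEQ_const_iff)
qed

text \<open>Divergence theorem on the sphere. For fixed \<open>b\<close>, the field
  \<open>tangential y b\<close> is the sum over the coordinate axes \<open>e\<close> of
  \<open>y \<bullet> cross3 b e\<close> times \<open>cross3 e y\<close>, so three rotation fields
  suffice. Differentiating the coefficients along these fields produces
  \<open>-2 * (y \<bullet> b)\<close>, the curvature term.\<close>

lemma integral_surface_tangential:
  assumes F: "C1_grad F D"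
  shows "(LINT y|surface. tangential y (D y)) = 2 *\<^sub>R (LINT y|surface. F y *\<^sub>R y)"
proof -
  have cD: "continuous_on S2 D" by (rule C1_grad_continuous'[OF F])
  have cF: "continuous_on S2 F" by (rule C1_grad_continuous[OF F])
  have iT: "integrable surface (\<lambda>y. tangential y (D y))"
    unfolding tangential_def by (intro integrable_surface_continuous continuous_intros cD)
  have iY: "integrable surface (\<lambda>y. F y *\<^sub>R y)"
    by (intro integrable_surface_continuous continuous_intros cF)
  have "(LINT y|surface. tangential y (D y)) \<bullet> b = (2 *\<^sub>R (LINT y|surface. F y *\<^sub>R y)) \<bullet> b" for b
  proof -
    define H where "H e y = F y *\<^sub>R cross3 b e + (y \<bullet> cross3 b e) *\<^sub>R D y" for e y
    have z: "(LINT y|surface. H e y \<bullet> cross3 e y) = 0" if "norm e = 1" for e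
    proof -
      have "C1_grad (\<lambda>y. F y * (y \<bullet> cross3 b e)) (H e)"
        unfolding H_def by (rule C1_grad_mult[OF F C1_grad_inner])
      from integral_surface_rot_field[OF this that] show ?thesis .
    qed
    have iH: "integrable surface (\<lambda>y. H e y \<bullet> cross3 e y)" for e
      unfolding H_def by (intro integrable_surface_continuous continuous_intros continuous_on_cross cF cD)
    have pt: "tangential y (D y) \<bullet> b - 2 * (F y * (y \<bullet> b)) =
      H (axis 1 1) y \<bullet> cross3 (axis 1 1) y + H (axis 2 1) y \<bullet> cross3 (axis 2 1) y
        + H (axis 3 1) y \<bullet> cross3 (axis 3 1) y" if "y \<in> S2" for y
    proof -
      have yy: "y \<bullet> y = 1" using that by (simp add: norm_eq_1)
      have h: "H (axis k 1) y \<bullet> cross3 (axis k 1) y =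
        F y * (b $ k * y $ k - b \<bullet> y) + cross3 y b $ k * cross3 y (D y) $ k" for k
      proof -
        have "y \<bullet> cross3 b (axis k 1) = cross3 y b $ k"
          using cross_triple[of y b "axis k 1"] by (simp add: inner_axis inner_commute)
        moreover have "D y \<bullet> cross3 (axis k 1) y = cross3 y (D y) $ k"
          using cross_triple[of "axis k 1" y "D y"] by (simp add: inner_axis inner_commute[of "D y"])
        moreover have "cross3 b (axis k 1) \<bullet> cross3 (axis k 1) y = b $ k * y $ k - b \<bullet> y"
          by (simp add: dot_cross inner_axis inner_axis' inner_axis_axis)
        ultimately show ?thesis by (simp add: H_def inner_add_left)
      qed
      have "H (axis 1 1) y \<bullet> cross3 (axis 1 1) y + H (axis 2 1) y \<bullet> cross3 (axis 2 1) y
        + H (axis 3 1) y \<bullet> cross3 (axis 3 1) y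
        = F y * ((b $ 1 * y $ 1 + b $ 2 * y $ 2 + b $ 3 * y $ 3) - 3 * (b \<bullet> y)) + cross3 y b \<bullet> cross3 y (D y)"
        unfolding h by (simp add: inner_vec_def[of "cross3 y b"] sum_3 algebra_simps)
      also have "b $ 1 * y $ 1 + b $ 2 * y $ 2 + b $ 3 * y $ 3 = b \<bullet> y"
        by (simp add: inner_vec_def sum_3)
      also have "cross3 y b \<bullet> cross3 y (D y) = D y \<bullet> b - (D y \<bullet> y) * (y \<bullet> b)"
        by (simp add: dot_cross yy inner_commute)
      finally show ?thesis by (simp add: tangential_def inner_diff_left inner_commute algebra_simps)
    qed
    have "(LINT y|surface. tangential y (D y)) \<bullet> b - (2 *\<^sub>R (LINT y|surface. F y *\<^sub>R y)) \<bullet> b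
      = (LINT y|surface. tangential y (D y) \<bullet> b - 2 * (F y * (y \<bullet> b)))"
    proof -
      have "(LINT y|surface. tangential y (D y) \<bullet> b - 2 * (F y * (y \<bullet> b)))
        = (LINT y|surface. tangential y (D y) \<bullet> b) - (LINT y|surface. 2 * ((F y *\<^sub>R y) \<bullet> b))"
        using integrable_inner_left[of b, OF iT] integrable_inner_left[of b, OF iY]
        by (subst Bochner_Integration.integral_diff[symmetric]) auto
      also have "(LINT y|surface. tangential y (D y) \<bullet> b) = (LINT y|surface. tangential y (D y)) \<bullet> b"
        using iT by (intro integral_inner_left) auto
      also have "(LINT y|surface. 2 * ((F y *\<^sub>R y) \<bullet> b)) = 2 * (LINT y|surface. (F y *\<^sub>R y) \<bullet> b)"
        by simp
      also have "(LINT y|surface. (F y *\<^sub>R y) \<bullet> b) = (LINT y|surface. F y *\<^sub>R y) \<bullet> b"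
        using iY by (intro integral_inner_left) auto
      finally show ?thesis by simp
    qed
    also have "\<dots> = (LINT y|surface. H (axis 1 1) y \<bullet> cross3 (axis 1 1) y + H (axis 2 1) y \<bullet> cross3 (axis 2 1) y
        + H (axis 3 1) y \<bullet> cross3 (axis 3 1) y)"
      using pt by (intro Bochner_Integration.integral_cong) (auto simp: space_surface)
    also have "\<dots> = 0"
      using iH z by (simp add: Bochner_Integration.integral_add)
    finally show ?thesis by simp
  qed
  then show ?thesis by (rule vector_eq_rdot[THEN iffD1, OF allI])
qed

text \<open>The product rule inserted into \<open>integral_surface_tangential\<close>. It makes
  smooth functions admissible in the weak problem.\<close>

lemma has_weak_sgrad_C1:
  assumes V: "C1_grad V DV"
  shows "has_weak_sgrad V (\<lambda>y. tangential y (DV y))"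
  unfolding has_weak_sgrad_def
proof (intro conjI allI impI)
  have cV: "continuous_on S2 V" by (rule C1_grad_continuous[OF V])
  have cDV: "continuous_on S2 DV" by (rule C1_grad_continuous'[OF V])
  show "integrable surface V" by (rule integrable_surface_continuous[OF cV])
  show "integrable surface (\<lambda>y. tangential y (DV y))"
    unfolding tangential_def by (intro integrable_surface_continuous continuous_intros cDV)
  fix \<phi> :: "real ^ 3 \<Rightarrow> real" and D assume "(\<forall>y. GDERIV \<phi> y :> D y) \<and> continuous_on UNIV D"
  then have \<phi>: "C1_grad \<phi> D" by (simp add: C1_grad_def)
  have c\<phi>: "continuous_on S2 \<phi>" by (rule C1_grad_continuous[OF \<phi>])
  have cD: "continuous_on S2 D" by (rule C1_grad_continuous'[OF \<phi>])
  have i1: "integrable surface (\<lambda>y. V y *\<^sub>R tangential y (D y))"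
    unfolding tangential_def by (intro integrable_surface_continuous continuous_intros cD cV)
  have i2: "integrable surface (\<lambda>y. \<phi> y *\<^sub>R tangential y (DV y))"
    unfolding tangential_def by (intro integrable_surface_continuous continuous_intros cDV c\<phi>)
  have "(LINT y|surface. V y *\<^sub>R tangential y (D y)) + (LINT y|surface. \<phi> y *\<^sub>R tangential y (DV y))
     = (LINT y|surface. tangential y (V y *\<^sub>R D y + \<phi> y *\<^sub>R DV y))"
    using i1 i2 by (subst Bochner_Integration.integral_add[symmetric])
      (auto simp: tangential_def inner_add_left algebra_simps)
  also have "\<dots> = 2 *\<^sub>R (LINT y|surface. (V y * \<phi> y) *\<^sub>R y)"
    by (rule integral_surface_tangential[OF C1_grad_mult[OF V \<phi>]])
  finally show "(LINT y|surface. V y *\<^sub>R tangential y (D y)) =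
     - (LINT y|surface. \<phi> y *\<^sub>R tangential y (DV y)) + 2 *\<^sub>R (LINT y|surface. (V y * \<phi> y) *\<^sub>R y)"
    by (simp add: algebra_simps)
qed

text \<open>\<open>sgrad\<close> is a choice among all weak gradients; uniqueness is what ties it to
  concrete ones. Each Cartesian component of the difference vanishes against every C1
  function.\<close>

lemma has_weak_sgrad_unique:
  assumes g: "has_weak_sgrad u g" and g': "has_weak_sgrad u g'"
  shows "AE y in surface. g y = g' y"
proof -
  have i: "integrable surface g" "integrable surface g'"
    using g g' unfolding has_weak_sgrad_def by blast+
  have comp: "AE y in surface. (g y - g' y) \<bullet> b = 0" for b
  proof (rule AE_zero_of_integral_C1)
    show "integrable surface (\<lambda>y. (g y - g' y) \<bullet> b)" using i by simp
    fix \<phi> :: "real ^ 3 \<Rightarrow> real" and D assume \<phi>: "C1_grad \<phi> D"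
    have c: "continuous_on S2 \<phi>" by (rule C1_grad_continuous[OF \<phi>])
    note i' = integrable_surface_scaleR_continuous[OF c]
    have "(LINT y|surface. \<phi> y *\<^sub>R g y) = (LINT y|surface. \<phi> y *\<^sub>R g' y)"
    proof -
      have "- (LINT y|surface. \<phi> y *\<^sub>R g y) + 2 *\<^sub>R (LINT y|surface. (u y * \<phi> y) *\<^sub>R y)
          = - (LINT y|surface. \<phi> y *\<^sub>R g' y) + 2 *\<^sub>R (LINT y|surface. (u y * \<phi> y) *\<^sub>R y)"
      proof -
        have "(LINT y|surface. u y *\<^sub>R tangential y (D y)) =
          - (LINT y|surface. \<phi> y *\<^sub>R g y) + 2 *\<^sub>R (LINT y|surface. (u y * \<phi> y) *\<^sub>R y)"
          using g \<phi> unfolding has_weak_sgrad_def C1_grad_def by blast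
        moreover have "(LINT y|surface. u y *\<^sub>R tangential y (D y)) =
          - (LINT y|surface. \<phi> y *\<^sub>R g' y) + 2 *\<^sub>R (LINT y|surface. (u y * \<phi> y) *\<^sub>R y)"
          using g' \<phi> unfolding has_weak_sgrad_def C1_grad_def by blast
        ultimately show ?thesis by simp
      qed
      then show ?thesis by simp
    qed
    then have "(LINT y|surface. \<phi> y *\<^sub>R g y - \<phi> y *\<^sub>R g' y) = 0"
      using i'[OF i(1)] i'[OF i(2)] by (simp add: Bochner_Integration.integral_diff)
    then have "(LINT y|surface. (\<phi> y *\<^sub>R g y - \<phi> y *\<^sub>R g' y) \<bullet> b) = 0"
      using i'[OF i(1)] i'[OF i(2)] by (subst integral_inner_left) auto
    then show "(LINT y|surface. \<phi> y * ((g y - g' y) \<bullet> b)) = 0"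
      by (simp add: inner_diff_left algebra_simps)
  qed
  have "AE y in surface. \<forall>b\<in>Basis. (g y - g' y) \<bullet> b = 0"
    using comp by (intro AE_finite_allI) auto
  then show ?thesis
    by eventually_elim (auto intro: euclidean_eqI simp: inner_diff_left)
qed

lemma sgrad_eqI:
  assumes "has_weak_sgrad u g"
  shows "AE y in surface. sgrad u y = g y"
  using has_weak_sgrad_unique[of u "sgrad u" g] assms
  unfolding sgrad_def by (metis someI)

lemma continuous_image_S2_bounded:
  fixes f :: "real ^ 3 \<Rightarrow> 'b::real_normed_vector"
  assumes "continuous_on S2 f"
  obtains B where "0 < B" "\<And>y. y \<in> S2 \<Longrightarrow> norm (f y) \<le> B"
proof -
  have "compact (f ` S2)" by (intro compact_continuous_image assms) simp
  then obtain B where "\<forall>x\<in>f ` S2. norm x \<le> B"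
    using compact_imp_bounded[of "f ` S2"] unfolding bounded_iff by blast
  then have "norm (f y) \<le> \<bar>B\<bar> + 1" if "y \<in> S2" for y using that by force
  then show ?thesis by (intro that[of "\<bar>B\<bar> + 1"]) auto
qed

lemma integrable_scaleR_surface_continuous:
  fixes \<phi> :: "real ^ 3 \<Rightarrow> 'b::{banach,second_countable_topology}"
  assumes k: "integrable surface k" and c: "continuous_on S2 \<phi>"
  shows "integrable surface (\<lambda>y. k y *\<^sub>R \<phi> y)"
proof -
  obtain B where B: "0 < B" "\<And>y. y \<in> S2 \<Longrightarrow> norm (\<phi> y) \<le> B"
    using continuous_image_S2_bounded[OF c] by blast
  show ?thesis
  proof (rule Bochner_Integration.integrable_bound)
    show "integrable surface (\<lambda>y. k y *\<^sub>R B)" using k by simp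
    show "(\<lambda>y. k y *\<^sub>R \<phi> y) \<in> borel_measurable surface"
      using k borel_measurable_surface_continuous[OF c] by (intro borel_measurable_scaleR) auto
    show "AE y in surface. norm (k y *\<^sub>R \<phi> y) \<le> norm (k y *\<^sub>R B)"
    proof (intro AE_I2)
      fix y assume "y \<in> space surface"
      then have "norm (\<phi> y) \<le> \<bar>B\<bar>" using B(2)[of y] by (simp add: space_surface)
      then show "norm (k y *\<^sub>R \<phi> y) \<le> norm (k y *\<^sub>R B)"
        by (simp add: abs_mult mult_left_mono)
    qed
  qed
qed

text \<open>Some orthogonal map takes \<open>p\<close> to \<open>q\<close>. Hence the normalisation
  at one fixed pole serves every centre of the kernel.\<close>

lemma integral_zonal:
  fixes k :: "real \<Rightarrow> real"
  assumes k: "continuous_on {-1..1} k" and p: "p \<in> S2" and q: "q \<in> S2"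
  shows "(LINT y|surface. k (y \<bullet> p)) = (LINT y|surface. k (y \<bullet> q))"
proof -
  obtain T where T: "orthogonal_transformation T" "T p = q"
    using orthogonal_transformation_exists[of p q] p q by auto
  have dots: "y \<bullet> z \<in> {-1..1}" if "y \<in> S2" "z \<in> S2" for y z :: "real ^ 3"
    using Cauchy_Schwarz_ineq2[of y z] that by (auto simp: abs_le_iff)
  have "continuous_on S2 (\<lambda>y. k (y \<bullet> q))"
    using dots q by (intro continuous_on_compose2[OF k] continuous_intros) auto
  then have "(\<lambda>y. k (y \<bullet> q)) \<in> borel_measurable surface"
    by (rule borel_measurable_surface_continuous)
  from integral_surface_orthogonal[OF T(1) this]
  have "(LINT y|surface. k (y \<bullet> q)) = (LINT y|surface. k (T y \<bullet> T p))" by (simp add: T(2))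
  also have "\<dots> = (LINT y|surface. k (y \<bullet> p))"
    using T(1) by (simp add: orthogonal_transformation_def)
  finally show ?thesis ..
qed

section \<open>Zonal smoothing and Lipschitz representatives\<close>

text \<open>Convolution with a zonal kernel commutes with rotations, hence with the derivatives along rotation
  fields, and so preserves bounds of the weak gradient.\<close>

definition zonal_mass :: "nat \<Rightarrow> real"
  where "zonal_mass n = (LINT y|surface. ((1 + y \<bullet> axis 1 1) / 2) ^ n)"

text \<open>On the sphere the base equals \<open>1 - (norm (y - z))\<^sup>2 / 4\<close>. It lies
  between 0 and 1 and is 1 only at \<open>y = z\<close>: the powers concentrate there while staying
  polynomial in \<open>y\<close>, hence smooth.\<close>

definition zonal_kernel :: "nat \<Rightarrow> real ^ 3 \<Rightarrow> real ^ 3 \<Rightarrow> real"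
  where "zonal_kernel n y z = ((1 + y \<bullet> z) / 2) ^ n / zonal_mass n"

text \<open>The mean distance from the centre under the kernel; it measures every error made by
  smoothing.\<close>

definition zonal_spread :: "nat \<Rightarrow> real"
  where "zonal_spread n = (LINT y|surface. zonal_kernel n y (axis 1 1) * norm (y - axis 1 1))"

lemma zonal_kernel_base_bounds:
  assumes "y \<in> S2" "z \<in> S2"
  shows "0 \<le> (1 + y \<bullet> z) / 2" "(1 + y \<bullet> z) / 2 \<le> 1" "(1 + y \<bullet> z) / 2 = 1 - (norm (y - z))\<^sup>2 / 4"
proof -
  show "(1 + y \<bullet> z) / 2 = 1 - (norm (y - z))\<^sup>2 / 4"
    using assms by (simp add: power2_norm_eq_inner inner_diff_left inner_diff_right inner_commute norm_eq_1 field_simps)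
  show "0 \<le> (1 + y \<bullet> z) / 2" "(1 + y \<bullet> z) / 2 \<le> 1"
    using Cauchy_Schwarz_ineq2[of y z] assms by (auto simp: abs_le_iff)
qed

lemma continuous_zonal_kernel [continuous_intros]:
  "continuous_on A f \<Longrightarrow> continuous_on A g \<Longrightarrow> continuous_on A (\<lambda>x. zonal_kernel n (f x) (g x))"
  unfolding zonal_kernel_def divide_inverse by (intro continuous_intros) auto

lemma axis_S2 [simp]: "(axis k 1 :: real ^ 3) \<in> S2"
  by simp

lemma zonal_mass_lower:
  assumes "0 < d" "d \<le> 2"
  shows "(1 - d\<^sup>2 / 4) ^ n * area (S2 \<inter> cball (axis 1 1) d) \<le> zonal_mass n"
proof -
  let ?A = "S2 \<inter> cball (axis 1 1 :: real ^ 3) d"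
  have c: "continuous_on S2 (\<lambda>y::real^3. ((1 + y \<bullet> axis 1 1) / 2) ^ n)"
    by (intro continuous_intros) auto
  have d4: "0 \<le> 1 - d\<^sup>2 / 4" using assms power_mono[of d 2 2] by simp
  have "(LINT y|surface. (1 - d\<^sup>2 / 4) ^ n * indicator ?A y) \<le> zonal_mass n"
    unfolding zonal_mass_def
  proof (rule integral_mono)
    show "integrable surface (\<lambda>y. (1 - d\<^sup>2 / 4) ^ n * indicator ?A y)"
      by (intro integrable_mult_right integrable_real_indicator sets_surface_cap) (simp add: surface.emeasure_eq_measure)
    show "integrable surface (\<lambda>y. ((1 + y \<bullet> axis 1 1) / 2) ^ n)"
      by (rule integrable_surface_continuous[OF c])
    fix y :: "real ^ 3" assume "y \<in> space surface"
    then have y: "y \<in> S2" by (simp add: space_surface)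
    note b = zonal_kernel_base_bounds[OF y axis_S2[of 1]]
    show "(1 - d\<^sup>2 / 4) ^ n * indicator ?A y \<le> ((1 + y \<bullet> axis 1 1) / 2) ^ n"
    proof (cases "y \<in> ?A")
      case True
      then have "norm (y - axis 1 1) \<le> d" by (simp add: dist_norm norm_minus_commute)
      then have "(norm (y - axis 1 1))\<^sup>2 \<le> d\<^sup>2" by (intro power_mono) auto
      then have "1 - d\<^sup>2 / 4 \<le> (1 + y \<bullet> axis 1 1) / 2" unfolding b(3) by simp
      then have "(1 - d\<^sup>2 / 4) ^ n \<le> ((1 + y \<bullet> axis 1 1) / 2) ^ n" by (intro power_mono d4)
      then show ?thesis using True by simp
    next
      case False
      then show ?thesis using zero_le_power[OF b(1), of n] by simp
    qed
  qed
  then show ?thesis by simp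
qed

lemma zonal_mass_pos: "0 < zonal_mass n"
proof -
  have "0 < (1 - (1::real)\<^sup>2 / 4) ^ n * area (S2 \<inter> cball (axis 1 1) 1)"
    using area_cap_pos[of "axis 1 1" 1] by simp
  also have "\<dots> \<le> zonal_mass n" by (rule zonal_mass_lower) auto
  finally show ?thesis .
qed

lemma zonal_kernel_nonneg: "y \<in> S2 \<Longrightarrow> z \<in> S2 \<Longrightarrow> 0 \<le> zonal_kernel n y z"
  unfolding zonal_kernel_def using zonal_mass_pos[of n]
  by (intro divide_nonneg_pos zero_le_power zonal_kernel_base_bounds)

lemma integrable_zonal_kernel_mult:
  assumes "continuous_on S2 f"
  shows "integrable surface (\<lambda>y. zonal_kernel n y z * f y)"
  by (intro integrable_surface_continuous continuous_intros assms)

lemma integral_zonal_kernel: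
  assumes "z \<in> S2"
  shows "(LINT y|surface. zonal_kernel n y z) = 1"
proof -
  have "continuous_on {-1..1} (\<lambda>t::real. ((1 + t) / 2) ^ n)" by (intro continuous_intros) auto
  from integral_zonal[OF this assms axis_S2[of 1]]
  show ?thesis using zonal_mass_pos[of n] by (simp add: zonal_kernel_def zonal_mass_def)
qed

lemma integral_zonal_kernel_norm:
  assumes "z \<in> S2"
  shows "(LINT y|surface. zonal_kernel n y z * norm (y - z)) = zonal_spread n"
proof -
  have eq: "zonal_kernel n y z * norm (y - z) = ((1 + y \<bullet> z) / 2) ^ n / zonal_mass n * sqrt (2 - 2 * (y \<bullet> z))"
    if "y \<in> S2" "z \<in> S2" for y z
  proof -
    have "(norm (y - z))\<^sup>2 = 2 - 2 * (y \<bullet> z)"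
      using zonal_kernel_base_bounds(3)[OF that] by (simp add: field_simps)
    then have "norm (y - z) = sqrt (2 - 2 * (y \<bullet> z))" by (metis norm_ge_zero real_sqrt_unique)
    then show ?thesis by (simp add: zonal_kernel_def)
  qed
  have "continuous_on {-1..1} (\<lambda>t::real. ((1 + t) / 2) ^ n / zonal_mass n * sqrt (2 - 2 * t))"
    using zonal_mass_pos[of n] by (intro continuous_intros) auto
  from integral_zonal[OF this assms axis_S2[of 1]]
  have "(LINT y|surface. ((1 + y \<bullet> z) / 2) ^ n / zonal_mass n * sqrt (2 - 2 * (y \<bullet> z))) =
    (LINT y|surface. ((1 + y \<bullet> axis 1 1) / 2) ^ n / zonal_mass n * sqrt (2 - 2 * (y \<bullet> axis 1 1)))" .
  moreover have "(LINT y|surface. zonal_kernel n y z * norm (y - z)) =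
      (LINT y|surface. ((1 + y \<bullet> z) / 2) ^ n / zonal_mass n * sqrt (2 - 2 * (y \<bullet> z)))"
    using eq[OF _ assms] by (intro Bochner_Integration.integral_cong) (auto simp: space_surface)
  moreover have "zonal_spread n =
      (LINT y|surface. ((1 + y \<bullet> axis 1 1) / 2) ^ n / zonal_mass n * sqrt (2 - 2 * (y \<bullet> axis 1 1)))"
    unfolding zonal_spread_def
    using eq[OF _ axis_S2[of 1]] by (intro Bochner_Integration.integral_cong) (auto simp: space_surface)
  ultimately show ?thesis by simp
qed

lemma zonal_spread_nonneg: "0 \<le> zonal_spread n"
  unfolding zonal_spread_def
  by (intro Bochner_Integration.integral_nonneg_AE AE_I2) (auto simp: space_surface intro!: mult_nonneg_nonneg zonal_kernel_nonneg)

text \<open>Within distance \<open>d\<close> the mean distance is at most \<open>d\<close>. Outside,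
  the numerator of the kernel is at most \<open>(1 - d\<^sup>2 / 4) ^ n\<close>, while the mass
  contributed by the smaller cap of radius \<open>d / 2\<close> decays at a strictly slower
  geometric rate.\<close>

lemma zonal_spread_bound:
  assumes d: "0 < d" "d \<le> 1"
  shows "zonal_spread n \<le> d + 2 * area S2 / area (S2 \<inter> cball (axis 1 1) (d / 2)) *
    ((1 - d\<^sup>2 / 4) / (1 - (d/2)\<^sup>2 / 4)) ^ n"
proof -
  let ?e = "axis 1 1 :: real ^ 3" and ?a = "area (S2 \<inter> cball (axis 1 1) (d / 2))"
  let ?q = "(1 - d\<^sup>2 / 4) ^ n / zonal_mass n"
  have d2: "d\<^sup>2 \<le> 1" using d by (simp add: power_le_one)
  then have q0: "0 \<le> ?q" using zonal_mass_pos[of n] by simp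
  have "zonal_spread n \<le> (LINT y|surface. d * zonal_kernel n y ?e + 2 * ?q)"
    unfolding zonal_spread_def
  proof (rule integral_mono)
    show "integrable surface (\<lambda>y. zonal_kernel n y ?e * norm (y - ?e))"
      by (rule integrable_zonal_kernel_mult) (intro continuous_intros)
    show "integrable surface (\<lambda>y. d * zonal_kernel n y ?e + 2 * ?q)"
      by (intro integrable_surface_continuous continuous_intros)
    fix y :: "real ^ 3" assume "y \<in> space surface"
    then have y: "y \<in> S2" by (simp add: space_surface)
    note b = zonal_kernel_base_bounds[OF y axis_S2[of 1]]
    have z0: "0 \<le> zonal_kernel n y ?e" by (rule zonal_kernel_nonneg[OF y axis_S2])
    show "zonal_kernel n y ?e * norm (y - ?e) \<le> d * zonal_kernel n y ?e + 2 * ?q"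
    proof (cases "norm (y - ?e) \<le> d")
      case True
      then have "zonal_kernel n y ?e * norm (y - ?e) \<le> d * zonal_kernel n y ?e"
        using mult_left_mono[OF True z0] by (simp add: mult.commute)
      then show ?thesis using q0 by linarith
    next
      case False
      then have "d\<^sup>2 \<le> (norm (y - ?e))\<^sup>2" using d by (intro power_mono) auto
      then have "(1 + y \<bullet> ?e) / 2 \<le> 1 - d\<^sup>2 / 4" unfolding b(3) by simp
      then have "((1 + y \<bullet> ?e) / 2) ^ n \<le> (1 - d\<^sup>2 / 4) ^ n" by (intro power_mono b)
      then have "zonal_kernel n y ?e \<le> ?q" unfolding zonal_kernel_def using zonal_mass_pos[of n] by (intro divide_right_mono) auto
      moreover have "norm (y - ?e) \<le> 2" using norm_triangle_ineq4[of y ?e] y by simp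
      ultimately have "zonal_kernel n y ?e * norm (y - ?e) \<le> ?q * 2" using q0 by (intro mult_mono) auto
      moreover have "0 \<le> d * zonal_kernel n y ?e" using d z0 by simp
      ultimately have "zonal_kernel n y ?e * norm (y - ?e) \<le> d * zonal_kernel n y ?e + ?q * 2"
        by (rule order_trans[OF _ add_increasing[OF _ order_refl]])
      then show ?thesis by (simp only: mult.commute[of 2])
    qed
  qed
  also have "\<dots> = d * (LINT y|surface. zonal_kernel n y ?e) + 2 * ?q * area S2"
  proof -
    have "integrable surface (\<lambda>y. d * zonal_kernel n y ?e)"
      by (intro integrable_surface_continuous continuous_intros)
    then show ?thesis
      by (subst Bochner_Integration.integral_add) (auto simp: space_surface)
  qed
  also have "\<dots> = d + 2 * area S2 * ?q" using integral_zonal_kernel[OF axis_S2[of 1], of n] by simp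
  finally have zq: "zonal_spread n \<le> d + 2 * area S2 * ?q" .
  have "?q \<le> (1 - d\<^sup>2 / 4) ^ n / ((1 - (d/2)\<^sup>2 / 4) ^ n * ?a)"
  proof (rule divide_left_mono)
    show "(1 - (d/2)\<^sup>2 / 4) ^ n * ?a \<le> zonal_mass n" using d by (intro zonal_mass_lower) auto
    show "0 \<le> (1 - d\<^sup>2 / 4) ^ n" using d2 by simp
    have "0 < 1 - (d/2)\<^sup>2 / 4" using d2 by (simp add: power2_eq_square)
    then show "0 < zonal_mass n * ((1 - (d/2)\<^sup>2 / 4) ^ n * ?a)"
      using zonal_mass_pos[of n] area_cap_pos[OF axis_S2[of 1], of "d/2"] d by simp
  qed
  from mult_left_mono[OF this, of "2 * area S2"] zq
  have "zonal_spread n \<le> d + 2 * area S2 * ((1 - d\<^sup>2 / 4) ^ n / ((1 - (d/2)\<^sup>2 / 4) ^ n * ?a))"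
    by (simp del: times_divide_eq_right times_divide_eq_left)
  then show ?thesis by (simp add: power_divide mult_ac)
qed

lemma zonal_spread_tendsto: "zonal_spread \<longlonglongrightarrow> 0"
proof (rule LIMSEQ_I)
  fix r :: real assume r: "0 < r"
  define d where "d = min 1 (r / 2)"
  have d: "0 < d" "d \<le> 1" "d \<le> r / 2" using r by (auto simp: d_def)
  let ?c = "2 * area S2 / area (S2 \<inter> cball (axis 1 1) (d / 2))"
  let ?s = "(1 - d\<^sup>2 / 4) / (1 - (d/2)\<^sup>2 / 4)"
  have d2: "0 < d\<^sup>2" "d\<^sup>2 \<le> 1" using d by (simp_all add: power_le_one)
  have s: "0 \<le> ?s" "?s < 1" using d2 by (auto simp: field_simps power_divide)
  have "(\<lambda>n. ?c * ?s ^ n) \<longlonglongrightarrow> ?c * 0"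
  proof (intro tendsto_mult tendsto_const LIMSEQ_power_zero)
    show "norm ?s < 1" unfolding real_norm_def abs_of_nonneg[OF s(1)] by (rule s(2))
  qed
  then have "eventually (\<lambda>n. ?c * ?s ^ n < r / 2) sequentially"
    using r by (intro order_tendstoD(2)) auto
  then obtain m where m: "\<And>n. n \<ge> m \<Longrightarrow> ?c * ?s ^ n < r / 2" by (auto simp: eventually_sequentially)
  have "norm (zonal_spread n - 0) < r" if "n \<ge> m" for n
  proof -
    have "zonal_spread n < r" using zonal_spread_bound[OF d(1,2), of n] m[OF that] d(3) by linarith
    then show ?thesis using zonal_spread_nonneg[of n] by simp
  qed
  then show "\<exists>no. \<forall>n\<ge>no. norm (zonal_spread n - 0) < r" by blast
qed

section \<open>Smoothing and its increments along rotations\<close>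

definition smoothing :: "nat \<Rightarrow> (real ^ 3 \<Rightarrow> real) \<Rightarrow> real ^ 3 \<Rightarrow> real"
  where "smoothing n u z = (LINT y|surface. zonal_kernel n y z * u y)"

lemma integrable_zonal_kernel_mult':
  assumes "integrable surface u"
  shows "integrable surface (\<lambda>y. zonal_kernel n y z * u y)"
proof -
  have "continuous_on S2 (\<lambda>y. zonal_kernel n y z)" by (intro continuous_intros)
  from integrable_surface_scaleR_continuous[OF this assms] show ?thesis by simp
qed

text \<open>Markov's inequality: the kernel gives mass at most
  \<open>zonal_spread n / \<delta>\<close> to the points beyond distance \<open>\<delta>\<close>.
  There only the crude bound \<open>M\<close> is available; nearby the error is
  \<open>\<eta>\<close>.\<close>

lemma smoothing_bound:
  assumes z: "z \<in> S2" and w: "integrable surface w" and \<delta>: "0 < \<delta>"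
    and near: "AE y in surface. norm (y - z) \<le> \<delta> \<longrightarrow> \<bar>w y - p\<bar> \<le> \<eta>"
    and far: "AE y in surface. \<delta> < norm (y - z) \<longrightarrow> \<bar>w y - p\<bar> \<le> M" and "0 \<le> \<eta>" "0 \<le> M"
  shows "\<bar>smoothing n w z - p\<bar> \<le> \<eta> + M / \<delta> * zonal_spread n"
proof -
  have iK: "integrable surface (\<lambda>y. zonal_kernel n y z)" by (intro integrable_surface_continuous continuous_intros)
  have iw: "integrable surface (\<lambda>y. zonal_kernel n y z * w y)" by (rule integrable_zonal_kernel_mult'[OF w])
  have iN: "integrable surface (\<lambda>y. zonal_kernel n y z * norm (y - z))"
    by (intro integrable_surface_continuous continuous_intros)
  have "smoothing n w z - p = (LINT y|surface. zonal_kernel n y z * w y) - (LINT y|surface. zonal_kernel n y z * p)"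
    using integral_zonal_kernel[OF z, of n] by (simp add: smoothing_def)
  also have "\<dots> = (LINT y|surface. zonal_kernel n y z * w y - zonal_kernel n y z * p)"
    using iw iK by (intro Bochner_Integration.integral_diff[symmetric]) auto
  also have "\<bar>\<dots>\<bar> \<le> (LINT y|surface. \<bar>zonal_kernel n y z * w y - zonal_kernel n y z * p\<bar>)"
    by (rule integral_abs_bound)
  also have "\<dots> \<le> (LINT y|surface. \<eta> * zonal_kernel n y z + M / \<delta> * (zonal_kernel n y z * norm (y - z)))"
  proof (rule integral_mono_AE)
    show "integrable surface (\<lambda>y. \<bar>zonal_kernel n y z * w y - zonal_kernel n y z * p\<bar>)" using iw iK by simp
    show "integrable surface (\<lambda>y. \<eta> * zonal_kernel n y z + M / \<delta> * (zonal_kernel n y z * norm (y - z)))"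
      using iK iN by simp
    show "AE y in surface. \<bar>zonal_kernel n y z * w y - zonal_kernel n y z * p\<bar>
        \<le> \<eta> * zonal_kernel n y z + M / \<delta> * (zonal_kernel n y z * norm (y - z))"
      using near far AE_space
    proof eventually_elim
      case (elim y)
      then have y: "y \<in> S2" by (simp add: space_surface)
      have K: "0 \<le> zonal_kernel n y z" by (rule zonal_kernel_nonneg[OF y z])
      have "\<bar>w y - p\<bar> \<le> \<eta> + M / \<delta> * norm (y - z)"
      proof (cases "norm (y - z) \<le> \<delta>")
        case True
        then have "\<bar>w y - p\<bar> \<le> \<eta>" using elim by simp
        moreover have "0 \<le> M / \<delta> * norm (y - z)" using assms by simp
        ultimately show ?thesis by linarith
      next
        case False
        then have "M * 1 \<le> M * (norm (y - z) / \<delta>)" using assms by (intro mult_left_mono) auto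
        then show ?thesis using elim False \<open>0 \<le> \<eta>\<close> by simp
      qed
      then show ?case
      proof -
        have "\<bar>zonal_kernel n y z * w y - zonal_kernel n y z * p\<bar> = zonal_kernel n y z * \<bar>w y - p\<bar>"
          using K by (simp add: right_diff_distrib[symmetric] abs_mult)
        with mult_left_mono[OF \<open>\<bar>w y - p\<bar> \<le> \<eta> + M / \<delta> * norm (y - z)\<close> K]
        show ?thesis by (simp add: algebra_simps)
      qed
    qed
  qed
  also have "\<dots> = \<eta> * (LINT y|surface. zonal_kernel n y z) + M / \<delta> * (LINT y|surface. zonal_kernel n y z * norm (y - z))"
    using iK iN by (subst Bochner_Integration.integral_add) auto
  also have "\<dots> = \<eta> + M / \<delta> * zonal_spread n"
    using integral_zonal_kernel[OF z, of n] integral_zonal_kernel_norm[OF z, of n] by simp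
  finally show ?thesis .
qed

lemma smoothing_abs_le:
  assumes z: "z \<in> S2" and w: "integrable surface w" and "0 \<le> \<eta>"
    and near: "AE y in surface. \<bar>w y - p\<bar> \<le> \<eta>"
  shows "\<bar>smoothing n w z - p\<bar> \<le> \<eta>"
proof -
  have "norm (y - z) \<le> 2" if "y \<in> S2" for y
    using norm_triangle_ineq4[of y z] that z by simp
  then have far: "AE y in surface. 2 < norm (y - z) \<longrightarrow> \<bar>w y - p\<bar> \<le> 0"
    by (intro AE_I2) (force simp: space_surface)
  have "AE y in surface. norm (y - z) \<le> 2 \<longrightarrow> \<bar>w y - p\<bar> \<le> \<eta>" using near by eventually_elim simp
  \<comment> \<open>With radius 2 the near region is the whole sphere, so the far bound can be
    0.\<close>
  from smoothing_bound[OF z w _ this far] \<open>0 \<le> \<eta>\<close> show ?thesis by simp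
qed

lemma has_field_derivative_integral_kernel:
  fixes k k' :: "real \<Rightarrow> real ^ 3 \<Rightarrow> real"
  assumes w: "integrable surface w"
    and k: "\<And>t. continuous_on S2 (k t)" and k': "\<And>t. continuous_on S2 (k' t)"
    and deriv: "\<And>t y. y \<in> S2 \<Longrightarrow> ((\<lambda>t. k t y) has_real_derivative k' t y) (at t)"
    and B: "\<And>t y. y \<in> S2 \<Longrightarrow> \<bar>k' t y\<bar> \<le> B"
  shows "((\<lambda>t. LINT y|surface. k t y * w y) has_real_derivative (LINT y|surface. k' t y * w y)) (at t)"
proof -
  have ik: "integrable surface (\<lambda>y. k t y * w y)" for t
    using integrable_surface_scaleR_continuous[OF k w, of t] by simp
  have ik': "integrable surface (\<lambda>y. k' t y * w y)" for t
    using integrable_surface_scaleR_continuous[OF k' w, of t] by simp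
  have "((\<lambda>h. ((LINT y|surface. k (t + h) y * w y) - (LINT y|surface. k t y * w y)) / h)
      \<longlongrightarrow> (LINT y|surface. k' t y * w y)) (at 0)"
    unfolding tendsto_at_iff_sequentially o_def
  proof (intro allI impI)
    fix X :: "nat \<Rightarrow> real" assume X: "\<forall>i. X i \<in> UNIV - {0}" "X \<longlonglongrightarrow> 0"
    have X0: "X i \<noteq> 0" for i using X(1) by auto
    have "(\<lambda>i. LINT y|surface. (k (t + X i) y - k t y) / X i * w y) \<longlonglongrightarrow> (LINT y|surface. k' t y * w y)"
    proof (rule integral_dominated_convergence[where w = "\<lambda>y. B * \<bar>w y\<bar>"])
      show "(\<lambda>y. k' t y * w y) \<in> borel_measurable surface" using ik' by simp
      show "integrable surface (\<lambda>y. B * \<bar>w y\<bar>)" using w by simp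
      show "(\<lambda>y. (k (t + X i) y - k t y) / X i * w y) \<in> borel_measurable surface" for i
        using w borel_measurable_surface_continuous[OF k] by (intro borel_measurable_times borel_measurable_divide borel_measurable_diff) auto
      show "AE y in surface. norm ((k (t + X i) y - k t y) / X i * w y) \<le> B * \<bar>w y\<bar>" for i
      proof (intro AE_I2)
        fix y assume "y \<in> space surface"
        then have y: "y \<in> S2" by (simp add: space_surface)
        have "norm (k (t + X i) y - k t y) \<le> B * norm (t + X i - t)"
          by (rule field_differentiable_bound[of UNIV "\<lambda>t. k t y" "\<lambda>t. k' t y"])
            (use deriv[OF y] B[OF y] in auto)
        then have "\<bar>(k (t + X i) y - k t y) / X i\<bar> \<le> B"
          using X0[of i] by (simp add: field_simps)
        from mult_right_mono[OF this abs_ge_zero[of "w y"]]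
        show "norm ((k (t + X i) y - k t y) / X i * w y) \<le> B * \<bar>w y\<bar>" by (simp add: abs_mult)
      qed
      show "AE y in surface. (\<lambda>i. (k (t + X i) y - k t y) / X i * w y) \<longlonglongrightarrow> k' t y * w y"
      proof (intro AE_I2 tendsto_mult tendsto_const)
        fix y assume "y \<in> space surface"
        then have y: "y \<in> S2" by (simp add: space_surface)
        have "((\<lambda>h. (k (t + h) y - k t y) / h) \<longlongrightarrow> k' t y) (at 0)"
          using deriv[OF y, of t] by (simp only: DERIV_def)
        then show "(\<lambda>i. (k (t + X i) y - k t y) / X i) \<longlonglongrightarrow> k' t y"
          using X unfolding tendsto_at_iff_sequentially o_def by blast
      qed
    qed
    moreover have eq: "(LINT y|surface. (k (t + X i) y - k t y) / X i * w y) =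
        ((LINT y|surface. k (t + X i) y * w y) - (LINT y|surface. k t y * w y)) / X i" for i
    proof -
      have "(LINT y|surface. (k (t + X i) y - k t y) / X i * w y) =
        (LINT y|surface. (k (t + X i) y * w y - k t y * w y) / X i)"
        by (intro Bochner_Integration.integral_cong refl) (simp add: algebra_simps diff_divide_distrib)
      then show ?thesis using ik by simp
    qed
    ultimately show "(\<lambda>i. ((LINT y|surface. k (t + X i) y * w y) - (LINT y|surface. k t y * w y)) / X i)
        \<longlonglongrightarrow> (LINT y|surface. k' t y * w y)" by (simp only: eq)
  qed
  then show ?thesis by (simp add: DERIV_def)
qed

text \<open>Skew-adjointness of rotation fields in weak form. Each component of the defining
  identity is tested with \<open>\<phi>\<close> times the same component of
  \<open>cross3 e y\<close>; the curvature terms cancel in the sum because \<open>cross3 e y\<close>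
  is orthogonal to \<open>y\<close>.\<close>

lemma weak_sgrad_rot:
  assumes g: "has_weak_sgrad u g" and \<phi>: "C1_grad \<phi> D"
  shows "(LINT y|surface. u y * (cross3 e y \<bullet> D y)) = - (LINT y|surface. \<phi> y * (cross3 e y \<bullet> g y))"
proof -
  have iu: "integrable surface u" and ig: "integrable surface g"
    using g unfolding has_weak_sgrad_def by blast+
  have c\<phi>: "continuous_on S2 \<phi>" by (rule C1_grad_continuous[OF \<phi>])
  have cD: "continuous_on S2 D" by (rule C1_grad_continuous'[OF \<phi>])
  \<comment> \<open>The \<open>k\<close>-th component of \<open>cross3 e y\<close>, written as an
    inner product so that its gradient is the constant \<open>cross3 (axis k 1) e\<close>, whose own
    \<open>k\<close>-th component is zero.\<close>
  define l where "l k y = y \<bullet> cross3 (axis k 1) e" for k :: 3 and y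
  have l: "l k y = cross3 e y $ k" for k y
    using cross_triple[of "axis k 1" e y] by (simp add: l_def inner_axis' inner_axis inner_commute)
  define E where "E k y = \<phi> y *\<^sub>R cross3 (axis k 1) e + l k y *\<^sub>R D y" for k y
  have C: "C1_grad (\<lambda>y. \<phi> y * l k y) (E k)" for k
    unfolding E_def l_def by (rule C1_grad_mult[OF \<phi> C1_grad_inner])
  have i1: "integrable surface (\<lambda>y. u y *\<^sub>R tangential y (E k y))" for k
  proof -
    have "continuous_on S2 (\<lambda>y. tangential y (E k y))"
      unfolding tangential_def using C1_grad_continuous'[OF C] by (intro continuous_intros)
    then show ?thesis by (rule integrable_scaleR_surface_continuous[OF iu])
  qed
  have i2: "integrable surface (\<lambda>y. (\<phi> y * l k y) *\<^sub>R g y)" for k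
    by (intro integrable_surface_scaleR_continuous C1_grad_continuous[OF C] ig)
  have i3: "integrable surface (\<lambda>y. (u y * (\<phi> y * l k y)) *\<^sub>R y)" for k
  proof -
    have "continuous_on S2 (\<lambda>y. (\<phi> y * l k y) *\<^sub>R y)"
      by (intro continuous_intros C1_grad_continuous[OF C])
    from integrable_scaleR_surface_continuous[OF iu this] show ?thesis by simp
  qed
  have comp: "(LINT y|surface. (u y *\<^sub>R tangential y (E k y)) $ k) =
     - (LINT y|surface. ((\<phi> y * l k y) *\<^sub>R g y) $ k) + 2 * (LINT y|surface. ((u y * (\<phi> y * l k y)) *\<^sub>R y) $ k)" for k
  proof -
    have "(LINT y|surface. u y *\<^sub>R tangential y (E k y)) =
      - (LINT y|surface. (\<phi> y * l k y) *\<^sub>R g y) + 2 *\<^sub>R (LINT y|surface. (u y * (\<phi> y * l k y)) *\<^sub>R y)"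
      using g C[of k] unfolding has_weak_sgrad_def C1_grad_def by blast
    then have "(LINT y|surface. u y *\<^sub>R tangential y (E k y)) \<bullet> axis k 1 =
      (- (LINT y|surface. (\<phi> y * l k y) *\<^sub>R g y) + 2 *\<^sub>R (LINT y|surface. (u y * (\<phi> y * l k y)) *\<^sub>R y)) \<bullet> axis k 1"
      by simp
    then show ?thesis
      using integral_inner_left[of "axis k 1" surface, OF i1[of k]] integral_inner_left[of "axis k 1" surface, OF i2[of k]]
       integral_inner_left[of "axis k 1" surface, OF i3[of k]]
      by (simp add: inner_add_left inner_axis)
  qed
  have ic: "integrable surface (\<lambda>y. f y $ k)" if "integrable surface f" for f :: "real ^ 3 \<Rightarrow> real ^ 3" and k
    using integrable_inner_left[of "axis k 1", OF that] by (simp add: inner_axis)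
  have "(LINT y|surface. u y * (cross3 e y \<bullet> D y)) = (LINT y|surface. (\<Sum>k\<in>UNIV. (u y *\<^sub>R tangential y (E k y)) $ k))"
  proof (intro Bochner_Integration.integral_cong refl)
    fix y :: "real ^ 3" assume "y \<in> space surface"
    have z: "(\<Sum>k\<in>UNIV. l k y * y $ k) = 0"
      using dot_cross_self(3)[of e y] unfolding l by (simp add: inner_vec_def)
    have c0: "cross3 (axis k 1) e $ k = 0" for k
      using dot_cross_self(1)[of "axis k 1" e] by (simp add: inner_axis')
    have "(\<Sum>k\<in>UNIV. tangential y (E k y) $ k) =
      (\<Sum>k\<in>UNIV. l k y * D y $ k - \<phi> y * (l k y * y $ k) - (D y \<bullet> y) * (l k y * y $ k))"
      by (intro sum.cong refl)
        (simp add: tangential_def E_def inner_add_left c0 l_def[symmetric] inner_commute[of "cross3 _ e"] algebra_simps)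
    also have "\<dots> = (\<Sum>k\<in>UNIV. l k y * D y $ k)"
      by (simp add: sum_subtractf sum_distrib_left[symmetric] z)
    also have "\<dots> = cross3 e y \<bullet> D y" unfolding l by (simp add: inner_vec_def)
    finally show "u y * (cross3 e y \<bullet> D y) = (\<Sum>k\<in>UNIV. (u y *\<^sub>R tangential y (E k y)) $ k)"
      by (simp add: sum_distrib_left[symmetric])
  qed
  also have "\<dots> = (\<Sum>k\<in>UNIV. LINT y|surface. (u y *\<^sub>R tangential y (E k y)) $ k)"
    by (rule Bochner_Integration.integral_sum) (rule ic[OF i1])
  also have "\<dots> = (\<Sum>k\<in>UNIV. - (LINT y|surface. ((\<phi> y * l k y) *\<^sub>R g y) $ k)) +
      2 * (\<Sum>k\<in>UNIV. LINT y|surface. ((u y * (\<phi> y * l k y)) *\<^sub>R y) $ k)"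
    unfolding comp by (simp only: sum.distrib sum_distrib_left)
  also have "(\<Sum>k\<in>UNIV. LINT y|surface. ((u y * (\<phi> y * l k y)) *\<^sub>R y) $ k) =
      (LINT y|surface. (\<Sum>k\<in>UNIV. ((u y * (\<phi> y * l k y)) *\<^sub>R y) $ k))"
    by (rule Bochner_Integration.integral_sum[symmetric]) (rule ic[OF i3])
  also have "(\<lambda>y. \<Sum>k\<in>UNIV. ((u y * (\<phi> y * l k y)) *\<^sub>R y) $ k) = (\<lambda>y. 0)"
  proof
    fix y
    have z: "(\<Sum>k\<in>UNIV. l k y * y $ k) = 0"
      using dot_cross_self(3)[of e y] unfolding l by (simp add: inner_vec_def)
    have "(\<Sum>k\<in>UNIV. ((u y * (\<phi> y * l k y)) *\<^sub>R y) $ k) = u y * \<phi> y * (\<Sum>k\<in>UNIV. l k y * y $ k)"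
      by (simp add: sum_distrib_left mult_ac)
    then show "(\<Sum>k\<in>UNIV. ((u y * (\<phi> y * l k y)) *\<^sub>R y) $ k) = 0" by (simp add: z)
  qed
  also have "(\<Sum>k\<in>UNIV. - (LINT y|surface. ((\<phi> y * l k y) *\<^sub>R g y) $ k)) =
     - (LINT y|surface. (\<Sum>k\<in>UNIV. ((\<phi> y * l k y) *\<^sub>R g y) $ k))"
    using Bochner_Integration.integral_sum[of UNIV surface "\<lambda>k y. ((\<phi> y * l k y) *\<^sub>R g y) $ k"] ic[OF i2]
    by (simp add: sum_negf)
  also have "(\<lambda>y. \<Sum>k\<in>UNIV. ((\<phi> y * l k y) *\<^sub>R g y) $ k) = (\<lambda>y. \<phi> y * (cross3 e y \<bullet> g y))"
    unfolding l by (simp add: inner_vec_def sum_distrib_left mult_ac fun_eq_iff)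
  finally show ?thesis by simp
qed

lemma norm_cross_le: "norm (cross3 x y) \<le> norm x * norm y"
proof (rule power2_le_imp_le)
  show "(norm (cross3 x y))\<^sup>2 \<le> (norm x * norm y)\<^sup>2"
    unfolding norm_cross by (simp add: power_mult_distrib)
qed simp

lemma rot_S2: "norm e = 1 \<Longrightarrow> z \<in> S2 \<Longrightarrow> rot e t z \<in> S2"
  using orthogonal_transformation_norm[OF rot_orthogonal] by simp

lemma DERIV_zonal_kernel_profile:
  "((\<lambda>t. ((1 + t) / 2) ^ n / m) has_real_derivative (real n * ((1 + t) / 2) ^ (n - 1) / 2 / m)) (at t)" for m :: real
proof (cases "m = 0")
  case False
  have "((\<lambda>t. ((1 + t) / 2) ^ n) has_real_derivative (real n * ((1 + t) / 2) ^ (n - 1) / 2)) (at t)"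
    by (rule derivative_eq_intros refl | simp)+
  then show ?thesis by (rule DERIV_cdivide)
qed simp

lemma C1_grad_zonal_kernel:
  "C1_grad (\<lambda>y. zonal_kernel n y z) (\<lambda>y. (real n * ((1 + y \<bullet> z) / 2) ^ (n - 1) / 2 / zonal_mass n) *\<^sub>R z)"
  unfolding C1_grad_def
proof (intro conjI allI)
  fix y
  have "GDERIV (\<lambda>y. y \<bullet> z) y :> z" using C1_grad_inner[of z] by (simp add: C1_grad_def)
  from GDERIV_DERIV_compose[OF this DERIV_zonal_kernel_profile[of n "zonal_mass n"]]
  show "GDERIV (\<lambda>y. zonal_kernel n y z) y :> (real n * ((1 + y \<bullet> z) / 2) ^ (n - 1) / 2 / zonal_mass n) *\<^sub>R z"
    by (simp add: zonal_kernel_def)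
  show "continuous_on UNIV (\<lambda>y. (real n * ((1 + y \<bullet> z) / 2) ^ (n - 1) / 2 / zonal_mass n) *\<^sub>R z)"
    unfolding divide_inverse by (intro continuous_intros)
qed

lemma integrable_rot_field:
  assumes "integrable surface g"
  shows "integrable surface (\<lambda>y. cross3 e y \<bullet> g y)"
proof (rule Bochner_Integration.integrable_bound)
  show "integrable surface (\<lambda>y. norm e * norm (g y))" using assms by simp
  have "(\<lambda>y. cross3 e y) \<in> borel_measurable surface"
    by (intro borel_measurable_surface_continuous continuous_on_cross continuous_intros)
  then show "(\<lambda>y. cross3 e y \<bullet> g y) \<in> borel_measurable surface"
    using assms by (intro borel_measurable_inner) auto
  show "AE y in surface. norm (cross3 e y \<bullet> g y) \<le> norm (norm e * norm (g y))"
  proof (intro AE_I2)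
    fix y assume y: "y \<in> space surface"
    have "\<bar>cross3 e y \<bullet> g y\<bar> \<le> norm (cross3 e y) * norm (g y)" by (rule Cauchy_Schwarz_ineq2)
    also have "\<dots> \<le> norm e * norm (g y)"
      using norm_cross_le[of e y] y by (intro mult_right_mono) (auto simp: space_surface)
    finally show "norm (cross3 e y \<bullet> g y) \<le> norm (norm e * norm (g y))" by simp
  qed
qed

text \<open>Rotating the centre of a zonal kernel amounts to the opposite rotation of its argument;
  by skew-adjointness the derivative moves from the kernel to \<open>u\<close> and becomes
  \<open>cross3 e y \<bullet> g y\<close>. The result is again a smoothing, so bounds on
  \<open>g\<close> carry over.\<close>

lemma smoothing_rot_deriv:
  assumes g: "has_weak_sgrad u g" and z: "z \<in> S2" and e: "norm e = 1"
  shows "((\<lambda>t. smoothing n u (rot e t z)) has_real_derivative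
    smoothing n (\<lambda>y. cross3 e y \<bullet> g y) (rot e t z)) (at t)"
proof -
  have iu: "integrable surface u" using g unfolding has_weak_sgrad_def by blast
  define k' where "k' t y = real n * ((1 + y \<bullet> rot e t z) / 2) ^ (n - 1) / 2 / zonal_mass n * (y \<bullet> cross3 e (rot e t z))" for t y
  have "((\<lambda>t. LINT y|surface. zonal_kernel n y (rot e t z) * u y) has_real_derivative (LINT y|surface. k' t y * u y)) (at t)"
  proof (rule has_field_derivative_integral_kernel[OF iu])
    show "continuous_on S2 (\<lambda>y. zonal_kernel n y (rot e t z))" for t by (intro continuous_intros)
    show "continuous_on S2 (k' t)" for t
      unfolding k'_def divide_inverse by (intro continuous_intros)
    fix t y assume y: "y \<in> S2"
    have "((\<lambda>t. y \<bullet> rot e t z) has_vector_derivative y \<bullet> cross3 e (rot e t z)) (at t)"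
      by (rule bounded_linear.has_vector_derivative[OF bounded_linear_inner_right rot_deriv[OF e]])
    then have "((\<lambda>t. y \<bullet> rot e t z) has_real_derivative y \<bullet> cross3 e (rot e t z)) (at t)"
      by (simp add: has_real_derivative_iff_has_vector_derivative)
    from DERIV_chain2[OF DERIV_zonal_kernel_profile[of n "zonal_mass n"] this]
    show "((\<lambda>t. zonal_kernel n y (rot e t z)) has_real_derivative k' t y) (at t)"
      unfolding zonal_kernel_def k'_def .
    have r: "rot e t z \<in> S2" by (rule rot_S2[OF e z])
    have "\<bar>y \<bullet> cross3 e (rot e t z)\<bar> \<le> 1"
      using Cauchy_Schwarz_ineq2[of y "cross3 e (rot e t z)"] norm_cross_le[of e "rot e t z"] y r e by simp
    moreover have "\<bar>real n * ((1 + y \<bullet> rot e t z) / 2) ^ (n - 1) / 2 / zonal_mass n\<bar> \<le> real n * 1 / 2 / zonal_mass n"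
    proof -
      have p: "0 \<le> ((1 + y \<bullet> rot e t z) / 2) ^ (n - 1)" "((1 + y \<bullet> rot e t z) / 2) ^ (n - 1) \<le> 1"
        using zonal_kernel_base_bounds[OF y r] by (auto intro: power_le_one zero_le_power)
      have "0 \<le> real n * ((1 + y \<bullet> rot e t z) / 2) ^ (n - 1) / 2 / zonal_mass n"
        using p zonal_mass_pos[of n] by (intro divide_nonneg_pos mult_nonneg_nonneg) auto
      moreover have "real n * ((1 + y \<bullet> rot e t z) / 2) ^ (n - 1) / 2 / zonal_mass n \<le> real n * 1 / 2 / zonal_mass n"
        using p zonal_mass_pos[of n] by (intro divide_right_mono mult_left_mono) auto
      ultimately show ?thesis by linarith
    qed
    ultimately have "\<bar>real n * ((1 + y \<bullet> rot e t z) / 2) ^ (n - 1) / 2 / zonal_mass n\<bar> * \<bar>y \<bullet> cross3 e (rot e t z)\<bar>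
        \<le> real n * 1 / 2 / zonal_mass n * 1"
      using zonal_mass_pos[of n] by (intro mult_mono) auto
    then show "\<bar>k' t y\<bar> \<le> real n / 2 / zonal_mass n" unfolding k'_def abs_mult by simp
  qed
  moreover have "(LINT y|surface. k' t y * u y) = smoothing n (\<lambda>y. cross3 e y \<bullet> g y) (rot e t z)"
  proof -
    let ?z = "rot e t z"
    have "cross3 e y \<bullet> ?z = - (y \<bullet> cross3 e ?z)" for y by (simp add: cross3_simps)
    then have "(LINT y|surface. k' t y * u y) =
      - (LINT y|surface. u y * (cross3 e y \<bullet> ((real n * ((1 + y \<bullet> ?z) / 2) ^ (n - 1) / 2 / zonal_mass n) *\<^sub>R ?z)))"
      unfolding k'_def by (simp add: mult_ac)
    also have "\<dots> = (LINT y|surface. zonal_kernel n y ?z * (cross3 e y \<bullet> g y))"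
      using weak_sgrad_rot[OF g C1_grad_zonal_kernel[of n ?z], of e] by simp
    finally show ?thesis by (simp add: smoothing_def)
  qed
  ultimately show ?thesis by (simp add: smoothing_def)
qed

text \<open>Mean value theorem along the orbit. The hypothesis near the orbit is what survives when
  the kernels concentrate; the global bound \<open>M\<close> enters only with the factor
  \<open>zonal_spread n\<close>.\<close>

lemma smoothing_rot_increment:
  assumes g: "has_weak_sgrad u g" and z: "z \<in> S2" and e: "norm e = 1" and \<theta>: "0 \<le> \<theta>" and \<delta>: "0 < \<delta>"
    and near: "AE y in surface. (\<exists>t\<in>{0..\<theta>}. norm (y - rot e t z) \<le> \<delta>) \<longrightarrow> \<bar>cross3 e y \<bullet> g y - p\<bar> \<le> \<eta>"
    and far: "AE y in surface. norm (g y) \<le> M" and \<eta>: "0 \<le> \<eta>" and M: "0 \<le> M"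
  shows "\<bar>smoothing n u (rot e \<theta> z) - smoothing n u z - \<theta> * p\<bar> \<le> \<theta> * (\<eta> + (M + \<bar>p\<bar>) / \<delta> * zonal_spread n)"
proof (cases "\<theta> = 0")
  case False
  with \<theta> have \<theta>': "0 < \<theta>" by simp
  have ig: "integrable surface g" using g unfolding has_weak_sgrad_def by blast
  have "\<exists>t. 0 < t \<and> t < \<theta> \<and> smoothing n u (rot e \<theta> z) - smoothing n u (rot e 0 z) =
     (\<theta> - 0) * smoothing n (\<lambda>y. cross3 e y \<bullet> g y) (rot e t z)"
    by (rule MVT2[OF \<theta>']) (rule smoothing_rot_deriv[OF g z e])
  then obtain t where t: "0 < t" "t < \<theta>" "smoothing n u (rot e \<theta> z) - smoothing n u z =
     \<theta> * smoothing n (\<lambda>y. cross3 e y \<bullet> g y) (rot e t z)" by auto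
  have "\<bar>smoothing n (\<lambda>y. cross3 e y \<bullet> g y) (rot e t z) - p\<bar> \<le> \<eta> + (M + \<bar>p\<bar>) / \<delta> * zonal_spread n"
  proof (rule smoothing_bound[OF rot_S2[OF e z] integrable_rot_field[OF ig] \<delta> _ _ \<eta>])
    show "AE y in surface. norm (y - rot e t z) \<le> \<delta> \<longrightarrow> \<bar>cross3 e y \<bullet> g y - p\<bar> \<le> \<eta>"
      using near by eventually_elim (use t in force)
    show "AE y in surface. \<delta> < norm (y - rot e t z) \<longrightarrow> \<bar>cross3 e y \<bullet> g y - p\<bar> \<le> M + \<bar>p\<bar>"
      using far AE_space
    proof eventually_elim
      case (elim y)
      have "\<bar>cross3 e y \<bullet> g y\<bar> \<le> norm (cross3 e y) * norm (g y)" by (rule Cauchy_Schwarz_ineq2)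
      also have "\<dots> \<le> 1 * M"
        using norm_cross_le[of e y] elim e M by (intro mult_mono) (auto simp: space_surface)
      finally show ?case by linarith
    qed
  qed (use M in simp)
  from mult_left_mono[OF this \<theta>] show ?thesis
    unfolding t(3) using \<theta> by (simp add: right_diff_distrib[symmetric] abs_mult)
qed simp

section \<open>Arcs of great circles as rotation orbits\<close>

lemma sin_ge_quarter:
  fixes a :: real
  assumes "0 \<le> a" "a \<le> pi / 2"
  shows "a \<le> 4 * sin a"
proof -
  \<comment> \<open>\<open>cos\<close> is at least 1/2 up to \<open>pi / 3 > 1\<close>. Beyond 1,
    \<open>sin\<close> is at least 1/2 and the argument is below 2.\<close>
  have small: "b / 2 \<le> sin b" if b: "0 \<le> b" "b \<le> 1" for b :: real
  proof -
    have "(\<lambda>t. sin t - t / 2) 0 \<le> (\<lambda>t. sin t - t / 2) b"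
    proof (rule DERIV_nonneg_imp_nondecreasing[OF b(1)])
      fix t assume t: "0 \<le> t" "t \<le> b"
      have "cos (pi / 3) \<le> cos t"
        using t b pi_gt3 by (intro cos_monotone_0_pi_le) auto
      then have "0 \<le> cos t - 1 / 2" by (simp add: cos_60)
      moreover have "((\<lambda>t. sin t - t / 2) has_real_derivative cos t - 1 / 2) (at t)"
        by (rule derivative_eq_intros refl | simp)+
      ultimately show "\<exists>y. ((\<lambda>t. sin t - t / 2) has_real_derivative y) (at t) \<and> 0 \<le> y" by blast
    qed
    then show ?thesis by simp
  qed
  show ?thesis
  proof (cases "a \<le> 1")
    case True
    then show ?thesis using small[of a] assms by linarith
  next
    case False
    have "sin 1 \<le> sin a" using False assms pi_gt3 by (intro sin_monotone_2pi_le) auto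
    then show ?thesis using small[of 1] assms pi_less_4 by linarith
  qed
qed

text \<open>Rotate about \<open>cross3 x y\<close> by the angle between the vectors; if they are
  parallel, any perpendicular axis serves. The factor 4 combines
  \<open>norm (y - x) = 2 * sin (\<theta> / 2)\<close> with the crude bound
  \<open>sin_ge_quarter\<close>.\<close>

lemma geodesic_exists:
  assumes x: "x \<in> S2" and y: "y \<in> S2"
  obtains e \<theta> where "norm e = 1" "0 \<le> \<theta>" "\<theta> \<le> 4 * norm (y - x)" "rot e \<theta> x = y"
proof -
  define \<theta> where "\<theta> = arccos (x \<bullet> y)"
  have xy: "-1 \<le> x \<bullet> y" "x \<bullet> y \<le> 1" using Cauchy_Schwarz_ineq2[of x y] x y by (auto simp: abs_le_iff)
  have \<theta>: "0 \<le> \<theta>" "\<theta> \<le> pi" "cos \<theta> = x \<bullet> y"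
    using arccos_lbound[OF xy] arccos_ubound[OF xy] cos_arccos[OF xy] by (simp_all add: \<theta>_def)
  have xx: "x \<bullet> x = 1" using x by (simp add: norm_eq_1)
  have yy: "y \<bullet> y = 1" using y by (simp add: norm_eq_1)
  have len: "\<theta> \<le> 4 * norm (y - x)"
  proof -
    have "(norm (y - x))\<^sup>2 = 2 - 2 * cos \<theta>"
      using xx yy \<theta> by (simp add: power2_norm_eq_inner inner_diff_left inner_diff_right inner_commute)
    also have "\<dots> = (2 * sin (\<theta> / 2))\<^sup>2"
      using cos_double_sin[of "\<theta> / 2"] by (simp add: power2_eq_square)
    finally have n: "norm (y - x) = 2 * sin (\<theta> / 2)"
      by (rule power2_eq_imp_eq) (use sin_ge_zero[of "\<theta> / 2"] \<theta> in auto)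
    then show ?thesis using sin_ge_quarter[of "\<theta> / 2"] \<theta> by simp
  qed
  have rotx: "rot e t x = cos t *\<^sub>R x + sin t *\<^sub>R cross3 e x" if "e \<bullet> x = 0" "norm e = 1" for e t
  proof -
    have "cross3 e (cross3 e x) = - x"
      using that by (simp add: Lagrange norm_eq_1)
    then show ?thesis by (simp add: rot_def algebra_simps)
  qed
  show ?thesis
  proof (cases "cross3 x y = 0")
    case False
    define c where "c = cross3 x y"
    have c: "norm c > 0" using False by (simp add: c_def)
    have "(norm c)\<^sup>2 = 1 - (cos \<theta>)\<^sup>2" unfolding c_def norm_cross \<theta>(3) using x y by simp
    then have "(norm c)\<^sup>2 = (sin \<theta>)\<^sup>2" by (simp add: sin_squared_eq)
    then have s: "sin \<theta> = norm c" using sin_ge_zero[OF \<theta>(1,2)] by (simp add: power2_eq_iff_nonneg)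
    define e where "e = (1 / norm c) *\<^sub>R c"
    have e: "norm e = 1" using c by (simp add: e_def)
    have ex: "e \<bullet> x = 0" by (simp add: e_def c_def dot_cross_self)
    have "cross3 c x = y - (x \<bullet> y) *\<^sub>R x"
      using Lagrange[of x x y] xx cross_skew[of c x] by (simp add: c_def)
    then have "sin \<theta> *\<^sub>R cross3 e x = y - (x \<bullet> y) *\<^sub>R x"
      using c by (simp add: e_def cross_mult_left s)
    then have "rot e \<theta> x = y" using rotx[OF ex e, of \<theta>] \<theta>(3) by simp
    then show ?thesis using that[OF e \<theta>(1) len] by blast
  next
    case True
    obtain e' where e': "e' \<noteq> 0" "orthogonal x e'"
      using orthogonal_to_vector_exists[of x] by auto
    define e where "e = (1 / norm e') *\<^sub>R e'"
    have e: "norm e = 1" using e' by (simp add: e_def)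
    have ex: "e \<bullet> x = 0" using e' by (simp add: e_def orthogonal_def inner_commute)
    have "y = (x \<bullet> y) *\<^sub>R x" using Lagrange[of x x y] xx True by simp
    moreover have "sin \<theta> = 0"
    proof -
      have "(cos \<theta>)\<^sup>2 = 1" using norm_cross[of x y] True x y \<theta>(3) by simp
      then show ?thesis by (simp add: cos_squared_eq)
    qed
    ultimately have "rot e \<theta> x = y" using rotx[OF ex e, of \<theta>] \<theta>(3) by simp
    then show ?thesis using that[OF e \<theta>(1) len] by blast
  qed
qed

section \<open>Limits of smoothings\<close>

lemma smoothing_approx:
  assumes L: "\<And>y z. y \<in> S2 \<Longrightarrow> z \<in> S2 \<Longrightarrow> \<bar>\<psi> y - \<psi> z\<bar> \<le> L * norm (y - z)"
    and c: "continuous_on S2 \<psi>" and z: "z \<in> S2"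
  shows "\<bar>smoothing n \<psi> z - \<psi> z\<bar> \<le> L * zonal_spread n"
proof -
  have iK: "integrable surface (\<lambda>y. zonal_kernel n y z * \<psi> z)" by (intro integrable_surface_continuous continuous_intros)
  have iw: "integrable surface (\<lambda>y. zonal_kernel n y z * \<psi> y)" by (intro integrable_zonal_kernel_mult c)
  have iN: "integrable surface (\<lambda>y. L * (zonal_kernel n y z * norm (y - z)))"
    by (intro integrable_surface_continuous continuous_intros)
  have "smoothing n \<psi> z - \<psi> z = (LINT y|surface. zonal_kernel n y z * \<psi> y) - (LINT y|surface. zonal_kernel n y z * \<psi> z)"
    using integral_zonal_kernel[OF z, of n] by (simp add: smoothing_def)
  also have "\<dots> = (LINT y|surface. zonal_kernel n y z * \<psi> y - zonal_kernel n y z * \<psi> z)"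
    by (rule Bochner_Integration.integral_diff[symmetric, OF iw iK])
  also have "\<bar>\<dots>\<bar> \<le> (LINT y|surface. \<bar>zonal_kernel n y z * \<psi> y - zonal_kernel n y z * \<psi> z\<bar>)"
    by (rule integral_abs_bound)
  also have "\<dots> \<le> (LINT y|surface. L * (zonal_kernel n y z * norm (y - z)))"
  proof (rule integral_mono)
    show "integrable surface (\<lambda>y. \<bar>zonal_kernel n y z * \<psi> y - zonal_kernel n y z * \<psi> z\<bar>)" using iw iK by simp
    fix y assume "y \<in> space surface"
    then have y: "y \<in> S2" by (simp add: space_surface)
    have K: "0 \<le> zonal_kernel n y z" by (rule zonal_kernel_nonneg[OF y z])
    have "\<bar>zonal_kernel n y z * \<psi> y - zonal_kernel n y z * \<psi> z\<bar> = zonal_kernel n y z * \<bar>\<psi> y - \<psi> z\<bar>"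
      using K by (simp add: right_diff_distrib[symmetric] abs_mult)
    also have "\<dots> \<le> zonal_kernel n y z * (L * norm (y - z))" by (rule mult_left_mono[OF L[OF y z] K])
    finally show "\<bar>zonal_kernel n y z * \<psi> y - zonal_kernel n y z * \<psi> z\<bar> \<le> L * (zonal_kernel n y z * norm (y - z))" by (simp add: mult_ac)
  qed (rule iN)
  also have "\<dots> = L * zonal_spread n" using integral_zonal_kernel_norm[OF z, of n] by simp
  finally show ?thesis .
qed

lemma zonal_kernel_commute: "zonal_kernel n y z = zonal_kernel n z y"
  by (simp add: zonal_kernel_def inner_commute)

interpretation surface2: pair_sigma_finite surface surface ..

text \<open>Fubini and the symmetry of the kernel make smoothing self-adjoint, so that a test
  function can be smoothed in place of an irregular \<open>u\<close>.\<close>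

lemma integral_smoothing_swap:
  assumes u: "integrable surface u" and \<phi>: "continuous_on S2 \<phi>"
  shows "(LINT z|surface. smoothing n u z * \<phi> z) = (LINT y|surface. u y * smoothing n \<phi> y)"
proof -
  have id: "(\<lambda>y. y) \<in> borel_measurable surface" by (rule measurable_surface_borel) simp
  have um: "u \<in> borel_measurable surface" using u by simp
  have \<phi>m: "\<phi> \<in> borel_measurable surface" by (rule borel_measurable_surface_continuous[OF \<phi>])
  have m: "(\<lambda>p. zonal_kernel n (fst p) (snd p) * u (fst p) * \<phi> (snd p)) \<in> borel_measurable (surface \<Otimes>\<^sub>M surface)"
    unfolding zonal_kernel_def
    using measurable_compose[OF measurable_fst id] measurable_compose[OF measurable_snd id]
      measurable_compose[OF measurable_fst um] measurable_compose[OF measurable_snd \<phi>m]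
    by (intro borel_measurable_times borel_measurable_divide borel_measurable_power borel_measurable_add
        borel_measurable_inner borel_measurable_const)
  obtain B where B: "0 < B" "\<And>y. y \<in> S2 \<Longrightarrow> norm (\<phi> y) \<le> B"
    using continuous_image_S2_bounded[OF \<phi>] by blast
  have i1: "integrable (surface \<Otimes>\<^sub>M surface) (\<lambda>p. u (fst p))"
  proof (rule surface2.Fubini_integrable)
    show "(\<lambda>p. u (fst p)) \<in> borel_measurable (surface \<Otimes>\<^sub>M surface)"
      by (rule measurable_compose[OF measurable_fst um])
    show "integrable surface (\<lambda>x. LINT y|surface. norm (u (fst (x, y))))" using u by simp
    show "AE x in surface. integrable surface (\<lambda>y. u (fst (x, y)))" by simp
  qed
  have int: "integrable (surface \<Otimes>\<^sub>M surface) (\<lambda>p. zonal_kernel n (fst p) (snd p) * u (fst p) * \<phi> (snd p))"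
  proof (rule Bochner_Integration.integrable_bound)
    show "integrable (surface \<Otimes>\<^sub>M surface) (\<lambda>p. (1 / zonal_mass n * B) * u (fst p))" using i1 by simp
    show "AE p in surface \<Otimes>\<^sub>M surface. norm (zonal_kernel n (fst p) (snd p) * u (fst p) * \<phi> (snd p))
      \<le> norm ((1 / zonal_mass n * B) * u (fst p))"
    proof (intro AE_I2)
      fix p assume "p \<in> space (surface \<Otimes>\<^sub>M surface)"
      then have p: "fst p \<in> S2" "snd p \<in> S2" by (auto simp: space_pair_measure space_surface)
      have "zonal_kernel n (fst p) (snd p) \<le> 1 / zonal_mass n"
        unfolding zonal_kernel_def using zonal_mass_pos[of n] zonal_kernel_base_bounds[OF p]
        by (intro divide_right_mono power_le_one) auto
      then have "\<bar>zonal_kernel n (fst p) (snd p)\<bar> * \<bar>\<phi> (snd p)\<bar> \<le> 1 / zonal_mass n * B"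
        using zonal_kernel_nonneg[OF p, of n] B(2)[OF p(2)] zonal_mass_pos[of n] by (intro mult_mono) auto
      from mult_right_mono[OF this abs_ge_zero[of "u (fst p)"]] zonal_mass_pos[of n] B(1)
      show "norm (zonal_kernel n (fst p) (snd p) * u (fst p) * \<phi> (snd p)) \<le> norm ((1 / zonal_mass n * B) * u (fst p))"
        by (simp add: abs_mult mult_ac)
    qed
  qed (rule m)
  have "(LINT z|surface. smoothing n u z * \<phi> z) = (LINT z|surface. (LINT y|surface. zonal_kernel n y z * u y * \<phi> z))"
    by (simp add: smoothing_def)
  also have "\<dots> = (LINT y|surface. (LINT z|surface. zonal_kernel n y z * u y * \<phi> z))"
    by (rule surface2.Fubini_integral) (use int in \<open>simp add: case_prod_unfold\<close>)
  also have "\<dots> = (LINT y|surface. u y * smoothing n \<phi> y)"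
  proof (intro Bochner_Integration.integral_cong refl)
    fix y
    have "u y * smoothing n \<phi> y = (LINT z|surface. u y * (zonal_kernel n z y * \<phi> z))"
      unfolding smoothing_def by simp
    also have "\<dots> = (LINT z|surface. zonal_kernel n y z * u y * \<phi> z)"
      by (intro Bochner_Integration.integral_cong refl) (simp add: zonal_kernel_commute[of n _ y] mult_ac)
    finally show "(LINT z|surface. zonal_kernel n y z * u y * \<phi> z) = u y * smoothing n \<phi> y" ..
  qed
  finally show ?thesis .
qed

lemma borel_measurable_smoothing:
  assumes u: "integrable surface u"
  shows "smoothing n u \<in> borel_measurable surface"
  unfolding smoothing_def
proof (rule surface.borel_measurable_lebesgue_integral)
  have id: "(\<lambda>y. y) \<in> borel_measurable surface" by (rule measurable_surface_borel) simp
  have um: "u \<in> borel_measurable surface" using u by simp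
  show "(\<lambda>(z, y). zonal_kernel n y z * u y) \<in> borel_measurable (surface \<Otimes>\<^sub>M surface)"
    unfolding zonal_kernel_def case_prod_beta
    using measurable_compose[OF measurable_fst id] measurable_compose[OF measurable_snd id]
      measurable_compose[OF measurable_snd um]
    by (intro borel_measurable_times borel_measurable_divide borel_measurable_power borel_measurable_add
        borel_measurable_inner borel_measurable_const)
qed

text \<open>Chords of the sphere stay in the unit ball, which is convex and compact; the gradient is
  bounded there.\<close>

lemma C1_lipschitz_S2:
  assumes "C1_grad \<phi> D"
  obtains L where "0 \<le> L" "\<And>y z. y \<in> S2 \<Longrightarrow> z \<in> S2 \<Longrightarrow> \<bar>\<phi> y - \<phi> z\<bar> \<le> L * norm (y - z)"
proof -
  have "continuous_on (cball 0 1) D" by (rule C1_grad_continuous'[OF assms])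
  then have "compact (D ` cball 0 1)" by (intro compact_continuous_image) auto
  then obtain L where L: "\<forall>x\<in>D ` cball 0 1. norm x \<le> L"
    using compact_imp_bounded[of "D ` cball 0 1"] unfolding bounded_iff by blast
  have "\<bar>\<phi> y - \<phi> z\<bar> \<le> L * norm (y - z)" if "y \<in> S2" "z \<in> S2" for y z
  proof -
    have "norm (\<phi> y - \<phi> z) \<le> L * norm (y - z)"
    proof (rule differentiable_bound[of "cball 0 1" \<phi> "\<lambda>x h. h \<bullet> D x"])
      fix x :: "real ^ 3" assume x: "x \<in> cball 0 1"
      show "(\<phi> has_derivative (\<lambda>h. h \<bullet> D x)) (at x within cball 0 1)"
        using assms by (auto simp: C1_grad_def gderiv_def intro: has_derivative_at_withinI)
      have Lx: "norm (D x) \<le> L" using L x by blast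
      show "onorm (\<lambda>h. h \<bullet> D x) \<le> L"
      proof (rule onorm_le)
        fix h :: "real ^ 3"
        have "norm (h \<bullet> D x) \<le> norm h * norm (D x)" using Cauchy_Schwarz_ineq2 by simp
        also have "\<dots> \<le> norm h * L" using Lx by (rule mult_left_mono) simp
        finally show "norm (h \<bullet> D x) \<le> L * norm h" by (simp add: mult.commute)
      qed
    qed (use that in auto)
    then show ?thesis by simp
  qed
  moreover have "0 \<le> L"
  proof -
    have "norm (D 0) \<le> L" using L by force
    then show ?thesis using norm_ge_zero[of "D 0"] by linarith
  qed
  ultimately show ?thesis using that by blast
qed

text \<open>The limit is identified weakly: after the smoothing has moved to a C1 test function,
  convergence is elementary since that function is Lipschitz. No differentiation theorem for
  integrals is involved.\<close>

lemma AE_eq_limit_smoothing: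
  fixes k :: "nat \<Rightarrow> nat"
  assumes u: "integrable surface u" and c: "continuous_on S2 v"
    and lim: "\<And>e. 0 < e \<Longrightarrow> \<exists>N. \<forall>n z. n \<ge> N \<and> z \<in> S2 \<longrightarrow> norm (smoothing (k n) u z - v z) < e"
    and k: "strict_mono k" and U: "\<And>n z. z \<in> S2 \<Longrightarrow> \<bar>smoothing n u z\<bar> \<le> U"
  shows "AE y in surface. u y = v y"
proof -
  have iv: "integrable surface v" by (rule integrable_surface_continuous[OF c])
  have "AE y in surface. u y - v y = 0"
  proof (rule AE_zero_of_integral_C1)
    show "integrable surface (\<lambda>y. u y - v y)" using u iv by simp
    fix \<phi> D assume \<phi>: "C1_grad \<phi> D"
    have c\<phi>: "continuous_on S2 \<phi>" by (rule C1_grad_continuous[OF \<phi>])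
    obtain B where B: "0 < B" "\<And>y. y \<in> S2 \<Longrightarrow> norm (\<phi> y) \<le> B"
      using continuous_image_S2_bounded[OF c\<phi>] by blast
    obtain L where L: "0 \<le> L" "\<And>y z. y \<in> S2 \<Longrightarrow> z \<in> S2 \<Longrightarrow> \<bar>\<phi> y - \<phi> z\<bar> \<le> L * norm (y - z)"
      using C1_lipschitz_S2[OF \<phi>] by blast
    have iu\<phi>: "integrable surface (\<lambda>y. \<phi> y * u y)"
      using integrable_surface_scaleR_continuous[OF c\<phi> u] by simp
    have iv\<phi>: "integrable surface (\<lambda>y. \<phi> y * v y)"
      using integrable_surface_scaleR_continuous[OF c\<phi> iv] by simp
    have spr: "(\<lambda>n. zonal_spread (k n)) \<longlonglongrightarrow> 0"
      using LIMSEQ_subseq_LIMSEQ[OF zonal_spread_tendsto k] by (simp add: o_def)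
    have l1: "(\<lambda>n. LINT z|surface. smoothing (k n) u z * \<phi> z) \<longlonglongrightarrow> (LINT z|surface. \<phi> z * v z)"
    proof (rule integral_dominated_convergence[where w = "\<lambda>_. U * B"])
      show "(\<lambda>z. \<phi> z * v z) \<in> borel_measurable surface" using iv\<phi> by simp
      show "(\<lambda>z. smoothing (k n) u z * \<phi> z) \<in> borel_measurable surface" for n
        by (intro borel_measurable_times borel_measurable_smoothing[OF u] borel_measurable_surface_continuous[OF c\<phi>])
      show "AE z in surface. norm (smoothing (k n) u z * \<phi> z) \<le> U * B" for n
      proof (intro AE_I2)
        fix z assume "z \<in> space surface"
        then have z: "z \<in> S2" by (simp add: space_surface)
        have "0 \<le> U" using U[OF z, of 0] by linarith
        then show "norm (smoothing (k n) u z * \<phi> z) \<le> U * B"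
          using U[OF z, of "k n"] B(2)[OF z] by (auto simp: abs_mult intro!: mult_mono)
      qed
      show "AE z in surface. (\<lambda>n. smoothing (k n) u z * \<phi> z) \<longlonglongrightarrow> \<phi> z * v z"
      proof (intro AE_I2)
        fix z assume "z \<in> space surface"
        then have z: "z \<in> S2" by (simp add: space_surface)
        have "(\<lambda>n. smoothing (k n) u z) \<longlonglongrightarrow> v z"
          by (rule LIMSEQ_I) (use lim z in blast)
        from tendsto_mult[OF this tendsto_const[of "\<phi> z"]]
        show "(\<lambda>n. smoothing (k n) u z * \<phi> z) \<longlonglongrightarrow> \<phi> z * v z" by (simp add: mult.commute)
      qed
    qed simp
    have i\<phi>: "integrable surface \<phi>" by (rule integrable_surface_continuous[OF c\<phi>])
    have l2: "(\<lambda>n. LINT y|surface. u y * smoothing (k n) \<phi> y) \<longlonglongrightarrow> (LINT z|surface. \<phi> z * u z)"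
    proof (rule integral_dominated_convergence[where w = "\<lambda>y. B * \<bar>u y\<bar>"])
      show "(\<lambda>z. \<phi> z * u z) \<in> borel_measurable surface" using iu\<phi> by simp
      show "(\<lambda>z. u z * smoothing (k n) \<phi> z) \<in> borel_measurable surface" for n
        using u borel_measurable_smoothing[OF i\<phi>, of "k n"] by (intro borel_measurable_times) auto
      show "integrable surface (\<lambda>y. B * \<bar>u y\<bar>)" using u by simp
      show "AE z in surface. norm (u z * smoothing (k n) \<phi> z) \<le> B * \<bar>u z\<bar>" for n
      proof (intro AE_I2)
        fix z assume "z \<in> space surface"
        then have z: "z \<in> S2" by (simp add: space_surface)
        have "AE y in surface. \<bar>\<phi> y - 0\<bar> \<le> B" using B(2) by (intro AE_I2) (simp add: space_surface)
        then have "\<bar>smoothing (k n) \<phi> z\<bar> \<le> B"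
          using smoothing_abs_le[OF z i\<phi>, of B 0] B(1) by simp
        from mult_left_mono[OF this abs_ge_zero[of "u z"]]
        show "norm (u z * smoothing (k n) \<phi> z) \<le> B * \<bar>u z\<bar>" by (simp add: abs_mult mult.commute)
      qed
      show "AE z in surface. (\<lambda>n. u z * smoothing (k n) \<phi> z) \<longlonglongrightarrow> \<phi> z * u z"
      proof (intro AE_I2)
        fix z assume "z \<in> space surface"
        then have z: "z \<in> S2" by (simp add: space_surface)
        have "(\<lambda>n. smoothing (k n) \<phi> z - \<phi> z) \<longlonglongrightarrow> 0"
        proof (rule Lim_null_comparison)
          show "\<forall>\<^sub>F n in sequentially. norm (smoothing (k n) \<phi> z - \<phi> z) \<le> L * zonal_spread (k n)"
            using smoothing_approx[OF L(2) c\<phi> z] by simp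
          show "(\<lambda>n. L * zonal_spread (k n)) \<longlonglongrightarrow> 0"
            using tendsto_mult[OF tendsto_const[of L] spr] by simp
        qed
        then have "(\<lambda>n. smoothing (k n) \<phi> z) \<longlonglongrightarrow> \<phi> z" by (simp add: LIM_zero_iff)
        from tendsto_mult[OF tendsto_const[of "u z"] this]
        show "(\<lambda>n. u z * smoothing (k n) \<phi> z) \<longlonglongrightarrow> \<phi> z * u z" by (simp add: mult.commute)
      qed
    qed
    have "(LINT z|surface. \<phi> z * v z) = (LINT z|surface. \<phi> z * u z)"
      using LIMSEQ_unique[OF l1[unfolded integral_smoothing_swap[OF u c\<phi>]] l2] .
    then show "(LINT y|surface. \<phi> y * (u y - v y)) = 0"
      using iu\<phi> iv\<phi> by (simp add: right_diff_distrib)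
  qed
  then show ?thesis by eventually_elim simp
qed

text \<open>The smoothings of \<open>u\<close> are bounded and equi-Lipschitz, so Arzela-Ascoli
  gives a uniformly convergent subsequence, whose limit agrees with \<open>u\<close> almost
  everywhere. The last conclusion retains local information: an increment along an arc is governed
  by the values of \<open>g\<close> close to the arc. The Taylor estimate is built on it.\<close>

lemma lipschitz_version:
  assumes g: "has_weak_sgrad u g"
    and U: "AE y in surface. \<bar>u y\<bar> \<le> U" and M: "AE y in surface. norm (g y) \<le> M"
    and U0: "0 \<le> U" and M0: "0 \<le> M"
  obtains v where "AE y in surface. u y = v y"
    "\<And>x. x \<in> S2 \<Longrightarrow> \<bar>v x\<bar> \<le> U"
    "\<And>x y. x \<in> S2 \<Longrightarrow> y \<in> S2 \<Longrightarrow> \<bar>v y - v x\<bar> \<le> 4 * M * norm (y - x)"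
    "\<And>z e \<theta> p \<eta> \<delta>. z \<in> S2 \<Longrightarrow> norm e = 1 \<Longrightarrow> 0 \<le> \<theta> \<Longrightarrow> 0 < \<delta> \<Longrightarrow> 0 \<le> \<eta> \<Longrightarrow>
      (AE y in surface. (\<exists>t\<in>{0..\<theta>}. norm (y - rot e t z) \<le> \<delta>) \<longrightarrow> \<bar>cross3 e y \<bullet> g y - p\<bar> \<le> \<eta>) \<Longrightarrow>
      \<bar>v (rot e \<theta> z) - v z - \<theta> * p\<bar> \<le> \<theta> * \<eta>"
proof -
  have iu: "integrable surface u" using g unfolding has_weak_sgrad_def by blast
  have bd: "\<bar>smoothing n u z\<bar> \<le> U" if "z \<in> S2" for n z
    using smoothing_abs_le[OF that iu U0, of 0 n] U by simp
  have cross: "AE y in surface. \<bar>cross3 e y \<bullet> g y - 0\<bar> \<le> M" if e: "norm e = 1" for e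
    using M AE_space
  proof eventually_elim
    case (elim y)
    have "\<bar>cross3 e y \<bullet> g y\<bar> \<le> norm (cross3 e y) * norm (g y)" by (rule Cauchy_Schwarz_ineq2)
    also have "\<dots> \<le> 1 * M"
      using norm_cross_le[of e y] elim e M0 by (intro mult_mono) (auto simp: space_surface)
    finally show ?case by simp
  qed
  \<comment> \<open>A bound on all spreads gives a Lipschitz constant uniform in \<open>n\<close>;
    the better constant in the conclusion comes from the limit, where the spread disappears.\<close>
  obtain Z where Z: "\<And>n. zonal_spread n \<le> Z"
    using convergent_imp_bounded[OF zonal_spread_tendsto] unfolding bounded_iff by (auto simp: abs_le_iff)
  have Z0: "0 \<le> Z" using Z[of 0] zonal_spread_nonneg[of 0] by linarith
  have lip: "\<bar>smoothing n u y - smoothing n u x\<bar> \<le> (4 * (M + M * Z)) * norm (y - x)" if x: "x \<in> S2" and y: "y \<in> S2" for n x y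
  proof -
    obtain e \<theta> where e: "norm e = 1" "0 \<le> \<theta>" "\<theta> \<le> 4 * norm (y - x)" "rot e \<theta> x = y"
      using geodesic_exists[OF x y] .
    have "AE y in surface. (\<exists>t\<in>{0..\<theta>}. norm (y - rot e t x) \<le> 1) \<longrightarrow> \<bar>cross3 e y \<bullet> g y - 0\<bar> \<le> M"
      using cross[OF e(1)] by eventually_elim simp
    from smoothing_rot_increment[OF g x e(1,2) zero_less_one this M M0 M0, of n]
    have "\<bar>smoothing n u y - smoothing n u x\<bar> \<le> \<theta> * (M + M * zonal_spread n)" by (simp add: e(4))
    also have "\<dots> \<le> (4 * norm (y - x)) * (M + M * Z)"
      using e Z[of n] M0 zonal_spread_nonneg[of n] by (intro mult_mono add_mono mult_left_mono) auto
    finally show ?thesis by (simp add: algebra_simps)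
  qed
  define K where "K = 4 * (M + M * Z) + 1"
  have K: "0 < K" using M0 Z0 by (simp add: K_def add_nonneg_pos)
  have lipK: "norm (smoothing n u x - smoothing n u y) \<le> K * norm (x - y)" if "x \<in> S2" "y \<in> S2" for n x y
    using lip[OF that(2,1), of n] by (simp add: K_def distrib_right add_increasing2)
  have bd': "norm (smoothing n u z) \<le> U" if "z \<in> S2" for n z using bd[OF that] by simp
  have equi: "\<exists>d>0. \<forall>n y. y \<in> S2 \<and> norm (x - y) < d \<longrightarrow> norm (smoothing n u x - smoothing n u y) < e"
    if x: "x \<in> S2" and e: "0 < e" for x e
  proof (intro exI[of _ "e / K"] conjI allI impI)
    show "0 < e / K" using e K by simp
    fix n y assume y: "y \<in> S2 \<and> norm (x - y) < e / K"
    then have "K * norm (x - y) < e" using K by (simp add: field_simps)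
    then show "norm (smoothing n u x - smoothing n u y) < e" using lipK[OF x, of y n] y by linarith
  qed
  obtain v k where v: "continuous_on S2 v" "strict_mono (k :: nat \<Rightarrow> nat)"
    "\<And>e. 0 < e \<Longrightarrow> \<exists>N. \<forall>n x. n \<ge> N \<and> x \<in> S2 \<longrightarrow> norm (smoothing (k n) u x - v x) < e"
    using Arzela_Ascoli[of S2 "\<lambda>n. smoothing n u" U, OF compact_sphere bd' equi] by blast
  have lim: "(\<lambda>n. smoothing (k n) u z) \<longlonglongrightarrow> v z" if "z \<in> S2" for z
    by (rule LIMSEQ_I) (use v(3) that in blast)
  have spr: "(\<lambda>n. zonal_spread (k n)) \<longlonglongrightarrow> 0"
    using LIMSEQ_subseq_LIMSEQ[OF zonal_spread_tendsto v(2)] by (simp add: o_def)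
  have incr: "\<bar>v (rot e \<theta> z) - v z - \<theta> * p\<bar> \<le> \<theta> * \<eta>"
    if z: "z \<in> S2" and e: "norm e = 1" and \<theta>: "0 \<le> \<theta>" and \<delta>: "0 < \<delta>" and \<eta>: "0 \<le> \<eta>"
      and near: "AE y in surface. (\<exists>t\<in>{0..\<theta>}. norm (y - rot e t z) \<le> \<delta>) \<longrightarrow> \<bar>cross3 e y \<bullet> g y - p\<bar> \<le> \<eta>"
    for z e \<theta> p \<eta> \<delta>
  proof (rule LIMSEQ_le)
    show "(\<lambda>n. \<bar>smoothing (k n) u (rot e \<theta> z) - smoothing (k n) u z - \<theta> * p\<bar>) \<longlonglongrightarrow> \<bar>v (rot e \<theta> z) - v z - \<theta> * p\<bar>"
      by (intro tendsto_intros lim z rot_S2 e)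
    have "(\<lambda>n. \<theta> * (\<eta> + (M + \<bar>p\<bar>) / \<delta> * zonal_spread (k n))) \<longlonglongrightarrow> \<theta> * (\<eta> + (M + \<bar>p\<bar>) / \<delta> * 0)"
      by (intro tendsto_intros spr)
    then show "(\<lambda>n. \<theta> * (\<eta> + (M + \<bar>p\<bar>) / \<delta> * zonal_spread (k n))) \<longlonglongrightarrow> \<theta> * \<eta>" by simp
    show "\<exists>N. \<forall>n\<ge>N. \<bar>smoothing (k n) u (rot e \<theta> z) - smoothing (k n) u z - \<theta> * p\<bar> \<le> \<theta> * (\<eta> + (M + \<bar>p\<bar>) / \<delta> * zonal_spread (k n))"
      using smoothing_rot_increment[OF g z e \<theta> \<delta> near M \<eta> M0] by blast
  qed
  show ?thesis
  proof (rule that[of v])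
    show "AE y in surface. u y = v y"
      by (rule AE_eq_limit_smoothing[OF iu v(1) v(3) v(2) bd])
    show "\<bar>v x\<bar> \<le> U" if "x \<in> S2" for x
      by (rule LIMSEQ_le_const2[OF tendsto_rabs[OF lim[OF that]]]) (use bd[OF that] in blast)
    show "\<bar>v y - v x\<bar> \<le> 4 * M * norm (y - x)" if x: "x \<in> S2" and y: "y \<in> S2" for x y
    proof -
      obtain e \<theta> where e: "norm e = 1" "0 \<le> \<theta>" "\<theta> \<le> 4 * norm (y - x)" "rot e \<theta> x = y"
        using geodesic_exists[OF x y] .
      have "AE y in surface. (\<exists>t\<in>{0..\<theta>}. norm (y - rot e t x) \<le> 1) \<longrightarrow> \<bar>cross3 e y \<bullet> g y - 0\<bar> \<le> M"
        using cross[OF e(1)] by eventually_elim simp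
      from incr[OF x e(1,2) zero_less_one M0 this]
      have "\<bar>v y - v x\<bar> \<le> \<theta> * M" by (simp add: e(4))
      also have "\<dots> \<le> (4 * norm (y - x)) * M" using e M0 by (intro mult_right_mono) auto
      finally show ?thesis by (simp add: mult_ac)
    qed
  qed (rule incr)
qed

section \<open>Regular representatives of functions with bounded second derivatives\<close>

lemma vector_derivative_bound:
  fixes F :: "real \<Rightarrow> 'a::real_normed_vector"
  assumes "\<And>t. t \<in> {a..b} \<Longrightarrow> (F has_vector_derivative F' t) (at t)"
    and B: "\<And>t. t \<in> {a..b} \<Longrightarrow> norm (F' t) \<le> B" and x: "x \<in> {a..b}" and y: "y \<in> {a..b}"
  shows "norm (F y - F x) \<le> B * \<bar>y - x\<bar>"
proof -
  have "norm (F y - F x) \<le> B * norm (y - x)"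
  proof (rule differentiable_bound[of "{a..b}" F "\<lambda>t h. h *\<^sub>R F' t"])
    fix t assume t: "t \<in> {a..b}"
    show "(F has_derivative (\<lambda>h. h *\<^sub>R F' t)) (at t within {a..b})"
      using assms(1)[OF t] by (auto simp: has_vector_derivative_def intro: has_derivative_at_withinI)
    show "onorm (\<lambda>h. h *\<^sub>R F' t) \<le> B"
    proof (rule onorm_le)
      fix h :: real
      show "norm (h *\<^sub>R F' t) \<le> B * norm h"
        using mult_right_mono[OF B[OF t] abs_ge_zero[of h]] by (simp add: mult.commute)
    qed
  qed (use x y in auto)
  then show ?thesis by simp
qed

text \<open>Over a null space the essential supremum would be minus infinity; the positive area of
  the sphere excludes this.\<close>

lemma Linf_norm_nonneg: "0 \<le> Linf_norm g"
proof (rule ccontr)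
  assume "\<not> 0 \<le> Linf_norm g"
  then have neg: "Linf_norm g < 0" by simp
  have "AE y in surface. ereal \<bar>g y\<bar> \<le> Linf_norm g"
    unfolding Linf_norm_def by (rule esssup_AE)
  then have "AE y in surface. False"
  proof eventually_elim
    case (elim y)
    then have "ereal \<bar>g y\<bar> < 0" using neg by (rule le_less_trans)
    then show False by (simp add: zero_ereal_def)
  qed
  then have "emeasure surface S2 = 0"
    unfolding eventually_False ae_filter_eq_bot_iff space_surface .
  then show False using area_S2_pos by (simp add: measure_def)
qed

lemma Linf_normD:
  assumes "Linf_norm f \<le> ereal K"
  shows "AE y in surface. \<bar>f y\<bar> \<le> K"
proof -
  have "AE y in surface. ereal \<bar>f y\<bar> \<le> Linf_norm f"
    unfolding Linf_norm_def by (rule esssup_AE)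
  then show ?thesis
  proof eventually_elim
    case (elim y)
    then have "ereal \<bar>f y\<bar> \<le> ereal K" using assms by (rule order_trans)
    then show ?case by simp
  qed
qed

lemma weakly_diff_sgrad: "weakly_diff u \<Longrightarrow> has_weak_sgrad u (sgrad u)"
  unfolding weakly_diff_def by (subst sgrad_def) (rule someI_ex[of "has_weak_sgrad u"])

lemma AE_norm_sgrad:
  assumes "\<And>i. AE y in surface. \<bar>sderiv i u y\<bar> \<le> K"
  shows "AE y in surface. norm (sgrad u y) \<le> 3 * K"
proof -
  have "AE y in surface. \<forall>i\<in>UNIV. \<bar>sderiv i u y\<bar> \<le> K"
    using assms by (intro AE_finite_allI) auto
  then show ?thesis
  proof eventually_elim
    case (elim y)
    have "norm (sgrad u y) \<le> (\<Sum>i\<in>UNIV. \<bar>sgrad u y $ i\<bar>)" by (rule norm_le_l1_cart)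
    also have "\<dots> \<le> (\<Sum>i\<in>(UNIV::3 set). K)" using elim by (intro sum_mono) (simp add: sderiv_def)
    finally show ?case by simp
  qed
qed

text \<open>\<open>lipschitz_version\<close> is applied to \<open>u\<close> and to each component of
  its gradient, which yields a Lipschitz gradient \<open>G\<close>. For the Taylor estimate, the
  derivative of \<open>u\<close> along the arc from \<open>x\<close> to \<open>y\<close> is shown to
  be nearly constant.\<close>

lemma W2inf_regular:
  assumes u: "u \<in> W2inf" and K: "0 \<le> K"
    and K0: "Linf_norm u \<le> ereal K" and K1: "\<And>i. Linf_norm (sderiv i u) \<le> ereal K"
    and K2: "\<And>i j. Linf_norm (sderiv j (sderiv i u)) \<le> ereal K"
  obtains v G where "AE y in surface. u y = v y" "AE y in surface. sgrad u y = G y"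
    "\<And>x. x \<in> S2 \<Longrightarrow> \<bar>v x\<bar> \<le> K" "\<And>x. x \<in> S2 \<Longrightarrow> norm (G x) \<le> 3 * K" "continuous_on S2 G"
    "\<And>x y. x \<in> S2 \<Longrightarrow> y \<in> S2 \<Longrightarrow> \<bar>v y - v x\<bar> \<le> 12 * K * norm (y - x)"
    "\<And>x y z. x \<in> S2 \<Longrightarrow> y \<in> S2 \<Longrightarrow> z \<in> S2 \<Longrightarrow>
      \<bar>v y - v x - G z \<bullet> (y - x)\<bar> \<le> 2000 * K * norm (y - x) * (norm (y - x) + norm (z - x))"
proof -
  have wd: "weakly_diff u" "\<And>i. weakly_diff (sderiv i u)" using u by (auto simp: W2inf_def)
  have g1: "AE y in surface. norm (sgrad u y) \<le> 3 * K"
    by (rule AE_norm_sgrad) (rule Linf_normD[OF K1])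
  have g2: "AE y in surface. norm (sgrad (sderiv i u) y) \<le> 3 * K" for i
    by (rule AE_norm_sgrad) (rule Linf_normD[OF K2])
  have K3: "0 \<le> 3 * K" using K by simp
  obtain v where v: "AE y in surface. u y = v y"
    "\<And>x. x \<in> S2 \<Longrightarrow> \<bar>v x\<bar> \<le> K"
    "\<And>x y. x \<in> S2 \<Longrightarrow> y \<in> S2 \<Longrightarrow> \<bar>v y - v x\<bar> \<le> 4 * (3 * K) * norm (y - x)"
    and incr: "\<And>z e \<theta> p \<eta> \<delta>. z \<in> S2 \<Longrightarrow> norm e = 1 \<Longrightarrow> 0 \<le> \<theta> \<Longrightarrow> 0 < \<delta> \<Longrightarrow> 0 \<le> \<eta> \<Longrightarrow>
      (AE y in surface. (\<exists>t\<in>{0..\<theta>}. norm (y - rot e t z) \<le> \<delta>) \<longrightarrow> \<bar>cross3 e y \<bullet> sgrad u y - p\<bar> \<le> \<eta>) \<Longrightarrow>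
      \<bar>v (rot e \<theta> z) - v z - \<theta> * p\<bar> \<le> \<theta> * \<eta>"
  proof (rule lipschitz_version[OF weakly_diff_sgrad[OF wd(1)] Linf_normD[OF K0] g1 K K3], goal_cases)
    case (1 v)
    show ?case by (rule that[OF 1(2-)])
  qed
  have "\<exists>w. (AE y in surface. sderiv i u y = w y) \<and> (\<forall>x\<in>S2. \<bar>w x\<bar> \<le> K) \<and>
    (\<forall>x\<in>S2. \<forall>y\<in>S2. \<bar>w y - w x\<bar> \<le> 12 * K * norm (y - x))" for i
  proof -
    obtain w where w: "AE y in surface. sderiv i u y = w y"
      "\<And>x. x \<in> S2 \<Longrightarrow> \<bar>w x\<bar> \<le> K"
      "\<And>x y. x \<in> S2 \<Longrightarrow> y \<in> S2 \<Longrightarrow> \<bar>w y - w x\<bar> \<le> 4 * (3 * K) * norm (y - x)"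
    proof (rule lipschitz_version[OF weakly_diff_sgrad[OF wd(2)] Linf_normD[OF K1] g2 K K3, of i], goal_cases)
      case (1 w)
      show ?case by (rule that[OF 1(2-4)])
    qed
    then show ?thesis by (intro exI[of _ w]) auto
  qed
  then have "\<exists>Gi. \<forall>i. (AE y in surface. sderiv i u y = Gi i y) \<and> (\<forall>x\<in>S2. \<bar>Gi i x\<bar> \<le> K) \<and>
    (\<forall>x\<in>S2. \<forall>y\<in>S2. \<bar>Gi i y - Gi i x\<bar> \<le> 12 * K * norm (y - x))"
    by (intro choice allI)
  then obtain Gi where Gi: "\<And>i. AE y in surface. sderiv i u y = Gi i y"
    "\<And>i x. x \<in> S2 \<Longrightarrow> \<bar>Gi i x\<bar> \<le> K"
    "\<And>i x y. x \<in> S2 \<Longrightarrow> y \<in> S2 \<Longrightarrow> \<bar>Gi i y - Gi i x\<bar> \<le> 12 * K * norm (y - x)"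
    by blast
  define G where "G y = (\<chi> i. Gi i y)" for y
  have Gae: "AE y in surface. sgrad u y = G y"
  proof -
    have "AE y in surface. \<forall>i\<in>UNIV. sderiv i u y = Gi i y"
      using Gi(1) by (intro AE_finite_allI) auto
    then show ?thesis by eventually_elim (simp add: vec_eq_iff G_def sderiv_def)
  qed
  have Gb: "norm (G x) \<le> 3 * K" if "x \<in> S2" for x
  proof -
    have "norm (G x) \<le> (\<Sum>i\<in>UNIV. \<bar>G x $ i\<bar>)" by (rule norm_le_l1_cart)
    also have "\<dots> \<le> (\<Sum>i\<in>(UNIV::3 set). K)" using Gi(2)[OF that] by (intro sum_mono) (simp add: G_def)
    finally show ?thesis by simp
  qed
  have GL: "norm (G y - G x) \<le> 36 * K * norm (y - x)" if "x \<in> S2" "y \<in> S2" for x y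
  proof -
    have "norm (G y - G x) \<le> (\<Sum>i\<in>UNIV. \<bar>(G y - G x) $ i\<bar>)" by (rule norm_le_l1_cart)
    also have "\<dots> \<le> (\<Sum>i\<in>(UNIV::3 set). 12 * K * norm (y - x))"
      using Gi(3)[OF that] by (intro sum_mono) (simp add: G_def)
    finally show ?thesis by simp
  qed
  have Gc: "continuous_on S2 G"
  proof -
    have "(36 * K)-lipschitz_on S2 G"
      by (rule lipschitz_onI) (use GL K in \<open>auto simp: dist_norm\<close>)
    then show ?thesis by (rule lipschitz_on_continuous_on)
  qed
  have taylor: "\<bar>v y - v x - G z \<bullet> (y - x)\<bar> \<le> 2000 * K * norm (y - x) * (norm (y - x) + norm (z - x))"
    if x: "x \<in> S2" and y: "y \<in> S2" and z: "z \<in> S2" for x y z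
  proof -
    obtain e \<theta> where e: "norm e = 1" "0 \<le> \<theta>" "\<theta> \<le> 4 * norm (y - x)" "rot e \<theta> x = y"
      using geodesic_exists[OF x y] .
    show ?thesis
    proof (cases "\<theta> = 0")
      case True
      then have "y = x" using e(4) by simp
      then show ?thesis by simp
    next
      case False
      with e have \<theta>: "0 < \<theta>" by simp
      \<comment> \<open>The slope that the increment formula is to reproduce: multiplied by
        \<open>\<theta>\<close> it is exactly the linear term of the claim.\<close>
      define p where "p = G z \<bullet> (y - x) / \<theta>"
      \<comment> \<open>In the tube of radius \<open>\<theta>\<close> around the arc, the Lipschitz
        constant \<open>36 * K\<close> of \<open>G\<close> acts over a distance of at most
        \<open>2 * \<theta> + norm (z - x)\<close>, which gives 72 and 36; another
        \<open>6 * K * \<theta>\<close> is due to the deviation of the chord from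
        \<open>\<theta> *\<^sub>R cross3 e w\<close>.\<close>
      define \<eta> where "\<eta> = 78 * K * \<theta> + 36 * K * norm (z - x)"
      have \<eta>: "0 \<le> \<eta>" using K e by (simp add: \<eta>_def)
      have rot1: "norm (rot e s x - rot e t x) \<le> 1 * \<bar>s - t\<bar>" if "s \<in> {0..\<theta>}" "t \<in> {0..\<theta>}" for s t
        by (rule vector_derivative_bound[OF rot_deriv[OF e(1)] _ that(2,1)])
          (use norm_cross_le[of e "rot e _ x"] rot_S2[OF e(1) x] e(1) in auto)
      have "AE w in surface. (\<exists>t\<in>{0..\<theta>}. norm (w - rot e t x) \<le> \<theta>) \<longrightarrow> \<bar>cross3 e w \<bullet> sgrad u w - p\<bar> \<le> \<eta>"
        using Gae AE_space
      proof eventually_elim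
        case (elim w)
        then have w: "w \<in> S2" by (simp add: space_surface)
        show ?case
        proof
          assume "\<exists>t\<in>{0..\<theta>}. norm (w - rot e t x) \<le> \<theta>"
          then obtain t where t: "t \<in> {0..\<theta>}" "norm (w - rot e t x) \<le> \<theta>" by blast
          have near: "norm (rot e s x - w) \<le> 2 * \<theta>" if s: "s \<in> {0..\<theta>}" for s
          proof -
            have "norm (rot e s x - w) \<le> norm (rot e s x - rot e t x) + norm (rot e t x - w)"
              using norm_triangle_ineq[of "rot e s x - rot e t x" "rot e t x - w"] by simp
            moreover have "norm (rot e t x - w) \<le> \<theta>" using t(2) by (simp add: norm_minus_commute)
            moreover have "norm (rot e s x - rot e t x) \<le> \<theta>" using rot1[OF s t(1)] s t(1) by auto
            ultimately show ?thesis by linarith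
          qed
          have lin: "norm (y - x - \<theta> *\<^sub>R cross3 e w) \<le> 2 * \<theta> * \<theta>"
          proof -
            have "norm ((rot e \<theta> x - \<theta> *\<^sub>R cross3 e w) - (rot e 0 x - 0 *\<^sub>R cross3 e w)) \<le> (2 * \<theta>) * \<bar>\<theta> - 0\<bar>"
            proof (rule vector_derivative_bound[of 0 \<theta> "\<lambda>t. rot e t x - t *\<^sub>R cross3 e w" "\<lambda>t. cross3 e (rot e t x) - cross3 e w"])
              fix s assume s: "s \<in> {0..\<theta>}"
              show "((\<lambda>t. rot e t x - t *\<^sub>R cross3 e w) has_vector_derivative cross3 e (rot e s x) - cross3 e w) (at s)"
                by (rule derivative_eq_intros rot_deriv[OF e(1)] refl | simp)+
              have "cross3 e (rot e s x) - cross3 e w = cross3 e (rot e s x - w)"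
                by (simp add: Cross3.right_diff_distrib)
              then show "norm (cross3 e (rot e s x) - cross3 e w) \<le> 2 * \<theta>"
                using norm_cross_le[of e "rot e s x - w"] near[OF s] e(1) by simp
            qed (use \<theta> in auto)
            then show ?thesis using e(4) \<theta> by (simp add: algebra_simps)
          qed
          have p: "cross3 e w \<bullet> sgrad u w - p = cross3 e w \<bullet> (G w - G z) - (y - x - \<theta> *\<^sub>R cross3 e w) \<bullet> G z / \<theta>"
            using \<theta> elim by (simp add: p_def inner_diff_right inner_diff_left inner_commute[of "G z"] field_simps inner_add_left)
          have "\<bar>cross3 e w \<bullet> (G w - G z)\<bar> \<le> norm (cross3 e w) * norm (G w - G z)"
            by (rule Cauchy_Schwarz_ineq2)
          also have "\<dots> \<le> 1 * (36 * K * norm (w - z))"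
            using norm_cross_le[of e w] w e(1) GL[OF z w] by (intro mult_mono) auto
          also have "norm (w - z) \<le> 2 * \<theta> + norm (z - x)"
            using near[of 0] \<theta> norm_triangle_ineq[of "w - x" "x - z"]
            by (simp add: norm_minus_commute)
          finally have a: "\<bar>cross3 e w \<bullet> (G w - G z)\<bar> \<le> 36 * K * (2 * \<theta> + norm (z - x))"
            using K by (simp add: mult_left_mono)
          have "\<bar>(y - x - \<theta> *\<^sub>R cross3 e w) \<bullet> G z\<bar> \<le> norm (y - x - \<theta> *\<^sub>R cross3 e w) * norm (G z)"
            by (rule Cauchy_Schwarz_ineq2)
          also have "\<dots> \<le> (2 * \<theta> * \<theta>) * (3 * K)"
            using lin Gb[OF z] \<theta> by (intro mult_mono) auto
          finally have "\<bar>(y - x - \<theta> *\<^sub>R cross3 e w) \<bullet> G z / \<theta>\<bar> \<le> 6 * K * \<theta>"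
            using \<theta> by (simp add: field_simps)
          then show "\<bar>cross3 e w \<bullet> sgrad u w - p\<bar> \<le> \<eta>"
          proof -
            have "36 * K * (2 * \<theta> + norm (z - x)) + 6 * K * \<theta> = \<eta>" by (simp add: \<eta>_def algebra_simps)
            moreover have "\<bar>A - B\<bar> \<le> \<bar>A\<bar> + \<bar>B\<bar>" for A B :: real by linarith
            ultimately show ?thesis unfolding p using a
              \<open>\<bar>(y - x - \<theta> *\<^sub>R cross3 e w) \<bullet> G z / \<theta>\<bar> \<le> 6 * K * \<theta>\<close>
              by (smt (verit))
          qed
        qed
      qed
      from incr[OF x e(1,2) \<theta> \<eta> this]
      have "\<bar>v y - v x - G z \<bullet> (y - x)\<bar> \<le> \<theta> * \<eta>" using \<theta> e(4) by (simp add: p_def)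
      also have "\<dots> \<le> (4 * norm (y - x)) * (78 * K * (4 * norm (y - x)) + 36 * K * norm (z - x))"
        unfolding \<eta>_def using e K by (intro mult_mono add_mono mult_left_mono) auto
      \<comment> \<open>The coefficients \<open>78 * 4 = 312\<close> and 36 are rounded up to 500,
        and 4 times 500 is the stated 2000.\<close>
      also have "\<dots> \<le> (4 * norm (y - x)) * (500 * K * norm (y - x) + 500 * K * norm (z - x))"
        using K by (intro mult_left_mono add_mono mult_right_mono) auto
      also have "\<dots> = 2000 * K * norm (y - x) * (norm (y - x) + norm (z - x))" by (simp add: algebra_simps)
      finally show ?thesis .
    qed
  qed
  show ?thesis
    by (rule that[OF v(1) Gae v(2) Gb Gc _ taylor]) (use v(3) in auto)
qed

section \<open>Chords and inner products of unit vectors\<close>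

lemma S2_inner_self: "y \<in> S2 \<Longrightarrow> y \<bullet> y = 1"
  by (simp add: norm_eq_1)

lemma S2_inner_bounds:
  assumes "y \<in> S2" "z \<in> S2"
  shows "-1 \<le> y \<bullet> z" "y \<bullet> z \<le> 1" "\<bar>y \<bullet> z\<bar> \<le> 1"
  using Cauchy_Schwarz_ineq2[of y z] assms by (auto simp: abs_le_iff)

lemma S2_inner_eq_norm:
  assumes "y \<in> S2" "z \<in> S2"
  shows "y \<bullet> z = 1 - (norm (y - z))\<^sup>2 / 2"
  using zonal_kernel_base_bounds(3)[OF assms] by (simp add: field_simps)

lemma S2_inner_less_1:
  assumes "y \<in> S2" "z \<in> S2" "y \<noteq> z"
  shows "y \<bullet> z < 1"
  using S2_inner_eq_norm[OF assms(1,2)] assms(3) by simp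

lemma norm_le_gdist:
  assumes "y \<in> S2" "z \<in> S2"
  shows "norm (y - z) \<le> gdist y z"
proof -
  let ?t = "gdist y z"
  have t: "0 \<le> ?t" "?t \<le> pi" "cos ?t = y \<bullet> z"
    using S2_inner_bounds[OF assms] by (auto simp: gdist_def intro: arccos_lbound arccos_ubound)
  have "(norm (y - z))\<^sup>2 = 2 - 2 * cos ?t"
    using S2_inner_eq_norm[OF assms] t(3) by simp
  also have "\<dots> = (2 * sin (?t / 2))\<^sup>2"
    using cos_double_sin[of "?t / 2"] by (simp add: power2_eq_square)
  finally have "norm (y - z) = 2 * sin (?t / 2)"
    by (rule power2_eq_imp_eq) (use sin_ge_zero[of "?t / 2"] t in auto)
  then show ?thesis using sin_x_le_x[of "?t / 2"] t by simp
qed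

section \<open>Voronoi cells\<close>

locale voronoi =
  fixes N :: nat and x :: "nat \<Rightarrow> real ^ 3"
  assumes sites: "\<And>i. i < N \<Longrightarrow> x i \<in> S2"
    and inj_sites: "inj_on x {..<N}"
    and two_le_N: "2 \<le> N"
begin

text \<open>\<open>arccos\<close> is decreasing, so the nearest vertex has the largest inner
  product. In this form the cell is the intersection of the sphere with half-spaces; it turns out to
  be the closure of \<open>vcell\<close>.\<close>

definition wcell :: "nat \<Rightarrow> (real ^ 3) set"
  where "wcell i = {y \<in> S2. \<forall>j<N. y \<bullet> x j \<le> y \<bullet> x i}"

lemma sites_eq_iff: "i < N \<Longrightarrow> j < N \<Longrightarrow> x i = x j \<longleftrightarrow> i = j"
  using inj_sites by (auto simp: inj_on_def)

lemma vcell_eq: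
  assumes "i < N"
  shows "vcell N x i = {y \<in> S2. \<forall>j<N. j \<noteq> i \<longrightarrow> y \<bullet> x j < y \<bullet> x i}"
  unfolding vcell_def gdist_def
  using S2_inner_bounds(3)[OF _ sites] assms by (auto simp: arccos_less_mono)

lemma closed_wcell: "closed (wcell i)"
proof -
  have "wcell i = S2 \<inter> (\<Inter>j\<in>{..<N}. {y. y \<bullet> x j \<le> y \<bullet> x i})" by (auto simp: wcell_def)
  then show ?thesis by (auto intro!: closed_INT closed_Collect_le continuous_intros)
qed

lemma vcell_subset_wcell: "i < N \<Longrightarrow> vcell N x i \<subseteq> wcell i"
  by (force simp: vcell_eq wcell_def)

text \<open>From a point of the closed cell, move towards \<open>x i\<close> on the chord and
  project back: every comparison with another vertex becomes strict at once. The chord meets the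
  origin only for \<open>y = - x i\<close>, which cannot lie in the cell.\<close>

lemma closure_vcell:
  assumes i: "i < N"
  shows "closure (vcell N x i) = wcell i"
proof
  show "closure (vcell N x i) \<subseteq> wcell i"
    by (rule closure_minimal[OF vcell_subset_wcell[OF i] closed_wcell])
  show "wcell i \<subseteq> closure (vcell N x i)"
  proof
    fix y assume y: "y \<in> wcell i"
    then have y': "y \<in> S2" "\<And>j. j < N \<Longrightarrow> y \<bullet> x j \<le> y \<bullet> x i" by (auto simp: wcell_def)
    \<comment> \<open>At the antipode of \<open>x i\<close> the inner product with
      \<open>x i\<close> is -1, so any second vertex would be closer; this is where \<open>N\<close>
      being at least 2 enters.\<close>
    have ne: "y \<noteq> - x i"
    proof
      assume eq: "y = - x i"
      define j where "j = (if i = 0 then 1 else 0 :: nat)"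
      have j: "j < N" "j \<noteq> i" using two_le_N by (auto simp: j_def)
      have "y \<bullet> x i = -1" using S2_inner_self[OF sites[OF i]] by (simp add: eq)
      then have "- (x i \<bullet> x j) \<le> -1" using y'(2)[OF j(1)] by (simp add: eq)
      then show False using S2_inner_less_1[OF sites[OF i] sites[OF j(1)]] sites_eq_iff[OF i j(1)] j by auto
    qed
    define z where "z t = (1 - t) *\<^sub>R y + t *\<^sub>R x i" for t :: real
    have nz: "z t \<noteq> 0" if t: "0 \<le> t" "t \<le> 1" for t
    proof
      assume "z t = 0"
      then have e: "(1 - t) *\<^sub>R y = - t *\<^sub>R x i" by (simp add: z_def eq_neg_iff_add_eq_0)
      then have "norm ((1 - t) *\<^sub>R y) = norm (- t *\<^sub>R x i)" by simp
      then have "1 - t = t" using t y'(1) sites[OF i] by simp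
      then have "t = 1/2" by simp
      with e have "(1/2) *\<^sub>R y = (1/2) *\<^sub>R (- x i)" by simp
      then show False using ne by (simp only: scaleR_cancel_left) simp
    qed
    have lim: "((\<lambda>t. radial (z t)) \<longlongrightarrow> radial (z 0)) (at_right 0)"
      unfolding radial_def z_def
      by (intro tendsto_intros) (use nz[of 0] in \<open>auto simp: z_def\<close>)
    have r0: "radial (z 0) = y" using y'(1) by (simp add: z_def radial_def)
    have in_cell: "radial (z t) \<in> vcell N x i" if t: "0 < t" "t < 1" for t
    proof -
      have n: "0 < norm (z t)" using nz[of t] t by simp
      have "radial (z t) \<bullet> x j < radial (z t) \<bullet> x i" if j: "j < N" "j \<noteq> i" for j
      proof -
        have "x i \<bullet> x j < 1" using S2_inner_less_1[OF sites[OF i] sites[OF j(1)]] sites_eq_iff[OF i j(1)] j by auto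
        then have "(1 - t) * (y \<bullet> x j) + t * (x i \<bullet> x j) < (1 - t) * (y \<bullet> x i) + t * (x i \<bullet> x i)"
          using y'(2)[OF j(1)] t S2_inner_self[OF sites[OF i]]
          by (intro add_le_less_mono mult_left_mono mult_strict_left_mono) auto
        then have "z t \<bullet> x j < z t \<bullet> x i" by (simp add: z_def inner_add_left)
        then show ?thesis using n by (simp add: radial_def mult_strict_left_mono)
      qed
      moreover have "radial (z t) \<in> S2" using n by (simp add: radial_def)
      ultimately show ?thesis by (auto simp: vcell_eq[OF i])
    qed
    have "\<forall>\<^sub>F t in at_right 0. radial (z t) \<in> closure (vcell N x i)"
      using eventually_at_right_real[of 0 "1::real", OF zero_less_one]
    proof eventually_elim
      case (elim t)
      then show ?case using in_cell[of t] closure_subset by auto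
    qed
    from Lim_in_closed_set[OF closed_closure this _ lim] show "y \<in> closure (vcell N x i)"
      by (simp add: r0)
  qed
qed

lemma vedge_eq: "i < N \<Longrightarrow> j < N \<Longrightarrow> vedge N x i j = wcell i \<inter> wcell j"
  by (simp add: vedge_def closure_vcell)

lemma vedge_commute: "vedge N x i j = vedge N x j i"
  by (auto simp: vedge_def)

lemma wcell_cover:
  assumes "y \<in> S2"
  obtains i where "i < N" "y \<in> wcell i"
proof -
  have fin: "finite ((\<lambda>j. y \<bullet> x j) ` {..<N})" "(\<lambda>j. y \<bullet> x j) ` {..<N} \<noteq> {}"
    using two_le_N lessThan_empty_iff[of N] by (simp_all add: lessThan_empty_iff)
  from Max_in[OF fin] obtain i where i: "i < N" "y \<bullet> x i = Max ((\<lambda>j. y \<bullet> x j) ` {..<N})" by auto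
  have "y \<bullet> x j \<le> y \<bullet> x i" if "j < N" for j
    unfolding i(2) using that fin by (intro Max_ge) auto
  then show ?thesis using that[of i] i(1) assms by (auto simp: wcell_def)
qed

lemma sets_vcell [simp]: "i < N \<Longrightarrow> vcell N x i \<in> sets surface"
proof -
  assume i: "i < N"
  have "vcell N x i = S2 \<inter> (\<Inter>j\<in>{..<N} - {i}. {y. y \<bullet> x j < y \<bullet> x i})" by (auto simp: vcell_eq[OF i])
  moreover have "open (\<Inter>j\<in>{..<N} - {i}. {y. y \<bullet> x j < y \<bullet> x i})"
    by (auto intro!: open_INT open_Collect_less continuous_intros)
  ultimately show ?thesis unfolding sets_surface_iff by (auto intro: sets.Int borel_closed borel_open)
qed

lemma disjoint_vcell: "i < N \<Longrightarrow> j < N \<Longrightarrow> i \<noteq> j \<Longrightarrow> vcell N x i \<inter> vcell N x j = {}"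
  by (force simp: vcell_eq)

text \<open>Ties happen only on the finitely many great circles of points equidistant from two
  vertices.\<close>

lemma AE_vcell: "AE y in surface. \<exists>i<N. y \<in> vcell N x i"
proof -
  have "AE y in surface. \<forall>i\<in>{..<N}. \<forall>j\<in>{..<N}. i \<noteq> j \<longrightarrow> y \<bullet> (x i - x j) \<noteq> 0"
  proof (intro AE_finite_allI finite_lessThan)
    fix i j assume ij: "i \<in> {..<N}" "j \<in> {..<N}"
    show "AE y in surface. i \<noteq> j \<longrightarrow> y \<bullet> (x i - x j) \<noteq> 0"
    proof (cases "i = j")
      case False
      then have "x i - x j \<noteq> 0" using ij sites_eq_iff by auto
      from emeasure_surface_hyperplane[OF this]
      show ?thesis
        by (intro AE_I[where N = "{y \<in> S2. y \<bullet> (x i - x j) = 0}"])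
          (auto simp: space_surface sets_surface_iff intro!: borel_closed closed_Collect_conj closed_Collect_eq continuous_intros)
    qed simp
  qed
  then show ?thesis using AE_space
  proof eventually_elim
    case (elim y)
    then have "y \<in> S2" by (simp add: space_surface)
    then obtain i where i: "i < N" "y \<in> wcell i" by (rule wcell_cover)
    have "y \<bullet> x j < y \<bullet> x i" if "j < N" "j \<noteq> i" for j
    proof -
      have "y \<bullet> x j \<le> y \<bullet> x i" using i that by (simp add: wcell_def)
      moreover have "y \<bullet> (x i - x j) \<noteq> 0" using elim that i by simp
      ultimately show ?thesis by (simp add: inner_diff_right)
    qed
    then show ?case using i \<open>y \<in> S2\<close> by (auto simp: vcell_eq)
  qed
qed

lemma norm_wcell_le:
  assumes i: "i < N" and y: "y \<in> wcell i"
  shows "norm (y - x i) \<le> mesh_size N x"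
proof -
  have v: "norm (z - x i) \<le> mesh_size N x" if z: "z \<in> vcell N x i" for z
  proof -
    have zS: "z \<in> S2" using z by (simp add: vcell_def)
    have bdd: "bdd_above ((\<lambda>y. gdist (x i) y) ` vcell N x i)"
    proof (rule bdd_aboveI2)
      fix y assume "y \<in> vcell N x i"
      then have "y \<in> S2" by (simp add: vcell_def)
      then show "gdist (x i) y \<le> pi"
        unfolding gdist_def using S2_inner_bounds[OF sites[OF i]] by (intro arccos_ubound) auto
    qed
    have "norm (z - x i) = norm (x i - z)" by (rule norm_minus_commute)
    also have "\<dots> \<le> gdist (x i) z" by (rule norm_le_gdist[OF sites[OF i] zS])
    also have "\<dots> \<le> (SUP y\<in>vcell N x i. gdist (x i) y)" by (rule cSUP_upper[OF z bdd])
    also have "\<dots> \<le> mesh_size N x"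
      unfolding mesh_size_def by (intro Max_ge) (use i in auto)
    finally show ?thesis .
  qed
  have "wcell i \<subseteq> {y. norm (y - x i) \<le> mesh_size N x}"
    unfolding closure_vcell[OF i, symmetric]
    by (rule closure_minimal) (use v in \<open>auto intro!: closed_Collect_le continuous_intros\<close>)
  then show ?thesis using y by auto
qed

lemma norm_wcell_wcell_le:
  assumes "i < N" "j < N" "y \<in> wcell i" "y \<in> wcell j"
  shows "norm (x i - x j) \<le> 2 * mesh_size N x"
  using norm_wcell_le[OF assms(1,3)] norm_wcell_le[OF assms(2,4)] norm_triangle_ineq[of "x i - y" "y - x j"]
  by (simp add: norm_minus_commute)

lemma sum_area_le:
  assumes J: "J \<subseteq> {..<N}" and sub: "\<And>i. i \<in> J \<Longrightarrow> vcell N x i \<subseteq> A" and A: "A \<in> sets surface"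
  shows "(\<Sum>i\<in>J. area (vcell N x i)) \<le> area A"
proof -
  have fin: "finite J" using J finite_subset by blast
  have "(\<Sum>i\<in>J. area (vcell N x i)) = area (\<Union>i\<in>J. vcell N x i)"
  proof (rule surface.finite_measure_finite_Union[symmetric, OF fin])
    show "(\<lambda>i. vcell N x i) ` J \<subseteq> sets surface" using J by auto
    show "disjoint_family_on (\<lambda>i. vcell N x i) J"
      unfolding disjoint_family_on_def using J disjoint_vcell by (metis lessThan_iff subsetD)
  qed
  also have "\<dots> \<le> area A" by (rule surface.finite_measure_mono) (use sub A in auto)
  finally show ?thesis .
qed

end

section \<open>One-dimensional Hausdorff measure\<close>

lemma curve_length_nonneg: "0 \<le> curve_length E"
  by (simp add: curve_length_def)

lemma hausdorff1_leI:
  fixes A :: "'a::metric_space set"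
  assumes "\<And>\<delta>. 0 < \<delta> \<Longrightarrow> \<exists>E :: nat \<Rightarrow> 'a set. A \<subseteq> (\<Union>n. E n) \<and>
    (\<forall>n. bounded (E n) \<and> diameter (E n) \<le> \<delta>) \<and> (\<Sum>n. ennreal (diameter (E n))) \<le> L"
  shows "hausdorff1 A \<le> L"
  unfolding hausdorff1_def
proof (rule SUP_least)
  fix \<delta> :: real assume "\<delta> \<in> {0<..}"
  then obtain E :: "nat \<Rightarrow> 'a set" where E: "A \<subseteq> (\<Union>n. E n) \<and> (\<forall>n. bounded (E n) \<and> diameter (E n) \<le> \<delta>)"
    "(\<Sum>n. ennreal (diameter (E n))) \<le> L" using assms[of \<delta>] by auto
  show "(INF E\<in>{E :: nat \<Rightarrow> 'a set. A \<subseteq> (\<Union>n. E n) \<and> (\<forall>n. bounded (E n) \<and> diameter (E n) \<le> \<delta>)}.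
        (\<Sum>n. ennreal (diameter (E n)))) \<le> L"
    by (rule INF_lower2[of E]) (use E in auto)
qed

text \<open>A 1-Lipschitz function turns a cover of \<open>A\<close> into a cover of the interval by
  sets no longer than the original diameters. The closures of the images are taken because they are
  measurable and obey the same bound.\<close>

lemma hausdorff1_ge_projection:
  fixes A :: "'a::metric_space set" and f :: "'a \<Rightarrow> real"
  assumes lip: "\<And>y z. \<bar>f y - f z\<bar> \<le> dist y z" and ab: "{a..b} \<subseteq> f ` A" "a \<le> b"
  shows "ennreal (b - a) \<le> hausdorff1 A"
proof -
  have one: "emeasure lborel (closure (f ` E)) \<le> ennreal (diameter E)" if E: "bounded E" for E
  proof (cases "E = {}")
    case False
    have diam: "\<bar>f y - f z\<bar> \<le> diameter E" if "y \<in> E" "z \<in> E" for y z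
      using lip[of y z] diameter_bounded_bound[OF E that] by linarith
    obtain y0 where y0: "y0 \<in> E" using False by blast
    have bdd: "bdd_below (f ` E)"
      by (rule bdd_belowI2[of _ "f y0 - diameter E"]) (use diam[OF _ y0] in force)
    let ?i = "INF y\<in>E. f y"
    have "f ` E \<subseteq> {?i .. ?i + diameter E}"
    proof
      fix r assume "r \<in> f ` E"
      then obtain y where y: "y \<in> E" "r = f y" by blast
      have "?i \<le> f y" by (rule cINF_lower[OF bdd y(1)])
      moreover have "f y - diameter E \<le> ?i"
        by (rule cINF_greatest[OF False]) (use diam[OF y(1)] in force)
      ultimately show "r \<in> {?i .. ?i + diameter E}" using y by simp
    qed
    then have "closure (f ` E) \<subseteq> {?i .. ?i + diameter E}" by (rule closure_minimal) simp
    then have "emeasure lborel (closure (f ` E)) \<le> emeasure lborel {?i .. ?i + diameter E}"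
      by (intro emeasure_mono) auto
    also have "\<dots> = ennreal (diameter E)" using diameter_ge_0[OF E] by simp
    finally show ?thesis .
  qed simp
  have le: "ennreal (b - a) \<le> (\<Sum>n. ennreal (diameter (E n)))"
    if E: "A \<subseteq> (\<Union>n. E n)" "\<And>n. bounded (E n)" for E :: "nat \<Rightarrow> 'a set"
  proof -
    have "{a..b} \<subseteq> (\<Union>n. closure (f ` E n))"
    proof
      fix r assume "r \<in> {a..b}"
      then obtain y where y: "y \<in> A" "r = f y" using ab(1) by auto
      then obtain n where "y \<in> E n" using E(1) by blast
      then have "r \<in> closure (f ` E n)" using y closure_subset[of "f ` E n"] by auto
      then show "r \<in> (\<Union>n. closure (f ` E n))" by blast
    qed
    then have "emeasure lborel {a..b} \<le> emeasure lborel (\<Union>n. closure (f ` E n))"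
      by (intro emeasure_mono) auto
    also have "\<dots> \<le> (\<Sum>n. emeasure lborel (closure (f ` E n)))"
      by (intro emeasure_subadditive_countably) auto
    also have "\<dots> \<le> (\<Sum>n. ennreal (diameter (E n)))"
      by (intro suminf_le one E(2)) auto
    finally show ?thesis using ab(2) by simp
  qed
  have "ennreal (b - a) \<le> (INF E\<in>{E :: nat \<Rightarrow> 'a set. A \<subseteq> (\<Union>n. E n) \<and> (\<forall>n. bounded (E n) \<and> diameter (E n) \<le> 1)}.
        (\<Sum>n. ennreal (diameter (E n))))"
    by (rule INF_greatest) (use le in auto)
  also have "\<dots> \<le> hausdorff1 A"
    unfolding hausdorff1_def by (rule SUP_upper2[of 1]) auto
  finally show ?thesis .
qed

lemma hausdorff1_lipschitz_image_le:
  fixes g :: "real \<Rightarrow> 'a::metric_space"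
  assumes lip: "\<And>s t. s \<in> {0..1} \<Longrightarrow> t \<in> {0..1} \<Longrightarrow> dist (g s) (g t) \<le> L * \<bar>s - t\<bar>" and L: "0 \<le> L"
  shows "hausdorff1 (g ` {0..1}) \<le> ennreal L"
proof (rule hausdorff1_leI)
  fix \<delta> :: real assume \<delta>: "0 < \<delta>"
  obtain n :: nat where n: "L / \<delta> < real n" using reals_Archimedean2 by blast
  have n0: "0 < n" using n L \<delta> by (metis divide_nonneg_pos gr0I less_le_not_le of_nat_0)
  define E where "E k = (if k < n then g ` {real k / n .. real (Suc k) / n} else {})" for k
  have sub: "{real k / n .. real (Suc k) / n} \<subseteq> {0..1}" if "k < n" for k
  proof -
    have "real (Suc k) \<le> real n" using that by simp
    then have "0 \<le> real k / n" "real (Suc k) / n \<le> 1" using n0 by (auto simp: field_simps)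
    then show ?thesis by auto
  qed
  have d: "dist y z \<le> L / n" if k: "k < n" and y: "y \<in> E k" and z: "z \<in> E k" for k y z
  proof -
    obtain s t where st: "s \<in> {real k / n .. real (Suc k) / n}" "t \<in> {real k / n .. real (Suc k) / n}" "y = g s" "z = g t"
      using y z k by (auto simp: E_def)
    have "real (Suc k) / n - real k / n = 1 / n" using n0 by (simp add: field_simps)
    then have "\<bar>s - t\<bar> \<le> 1 / n" using st(1,2) by (auto simp: abs_le_iff)
    then have "L * \<bar>s - t\<bar> \<le> L * (1 / n)" using L by (rule mult_left_mono)
    moreover have "s \<in> {0..1}" "t \<in> {0..1}" using sub[OF k] st by blast+
    ultimately show ?thesis using lip[of s t] st(3,4) by auto
  qed
  have bdd: "bounded (E k)" for k
  proof (cases "k < n")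
    case True
    then show ?thesis unfolding bounded_two_points using d[OF True] by blast
  qed (simp add: E_def)
  have dm: "diameter (E k) \<le> L / n" if "k < n" for k
  proof (cases "E k = {}")
    case True
    then show ?thesis using L by simp
  next
    case False
    then show ?thesis unfolding diameter_def using d[OF that]
      by (auto intro!: cSUP_least)
  qed
  have dm0: "diameter (E k) = 0" if "\<not> k < n" for k using that by (simp add: E_def)
  show "\<exists>E :: nat \<Rightarrow> 'a set. g ` {0..1} \<subseteq> (\<Union>n. E n) \<and>
    (\<forall>n. bounded (E n) \<and> diameter (E n) \<le> \<delta>) \<and> (\<Sum>n. ennreal (diameter (E n))) \<le> ennreal L"
  proof (intro exI[of _ E] conjI allI bdd)
    show "g ` {0..1} \<subseteq> (\<Union>k. E k)"
    proof
      fix y assume "y \<in> g ` {0..1}"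
      then obtain t where t: "0 \<le> t" "t \<le> 1" "y = g t" by auto
      show "y \<in> (\<Union>k. E k)"
      \<comment> \<open>The end point has index \<open>n\<close> under the floor, one past the last
        piece, and is assigned to piece \<open>n - 1\<close>.\<close>
      proof (cases "t = 1")
        case True
        then have "y \<in> E (n - 1)" using t n0 by (auto simp: E_def)
        then show ?thesis by blast
      next
        case False
        define k where "k = nat \<lfloor>t * n\<rfloor>"
        have k: "real k \<le> t * n" "t * n < real k + 1" unfolding k_def using t by (auto simp: floor_less_iff)
        have "t * real n < 1 * real n" using False t n0 by (intro mult_strict_right_mono) auto
        then have "k < n" using k by simp
        moreover have "t \<in> {real k / n .. real (Suc k) / n}" using k n0 by (auto simp: field_simps)
        ultimately have "y \<in> E k" using t by (auto simp: E_def)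
        then show ?thesis by blast
      qed
    qed
    have "L / n \<le> \<delta>" using n \<delta> n0 by (simp add: field_simps)
    then show "diameter (E k) \<le> \<delta>" for k using dm[of k] dm0[of k] \<delta> by (cases "k < n") auto
    have "(\<Sum>k. ennreal (diameter (E k))) = (\<Sum>k<n. ennreal (diameter (E k)))"
      by (rule suminf_finite) (auto simp: dm0)
    also have "\<dots> \<le> (\<Sum>k<n. ennreal (L / n))" by (intro sum_mono ennreal_leI dm) auto
    also have "\<dots> = ennreal L" using n0 L by (simp add: ennreal_of_nat_eq_real_of_nat ennreal_mult[symmetric])
    finally show "(\<Sum>k. ennreal (diameter (E k))) \<le> ennreal L" .
  qed
qed

lemma hausdorff1_mono: "A \<subseteq> B \<Longrightarrow> hausdorff1 A \<le> hausdorff1 B"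
  unfolding hausdorff1_def
  by (intro SUP_mono' INF_superset_mono) auto

lemma hausdorff1_singleton: "hausdorff1 {c} = 0"
proof -
  have "hausdorff1 ((\<lambda>_::real. c) ` {0..1}) \<le> ennreal 0"
    by (rule hausdorff1_lipschitz_image_le) auto
  moreover have "(\<lambda>_::real. c) ` {0..1} = {c}" by (simp add: image_constant_conv)
  ultimately show ?thesis by simp
qed

lemma hausdorff1_empty: "hausdorff1 ({} :: 'a::metric_space set) = 0"
proof -
  have "hausdorff1 ({} :: 'a::metric_space set) \<le> 0"
    using hausdorff1_mono[of "{}" "{undefined :: 'a}"] hausdorff1_singleton[of "undefined :: 'a"] by simp
  then show "hausdorff1 ({} :: 'a set) = 0" by simp
qed

section \<open>Edge weights as limits of a partition of unity\<close>

text \<open>Coordinates with respect to the plane of \<open>m\<close> and \<open>q\<close> and its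
  normal \<open>n\<close>; the nested pair separates the normal coordinate, over which the inner
  integral is taken.\<close>

definition frame :: "real ^ 3 \<Rightarrow> real ^ 3 \<Rightarrow> real ^ 3 \<Rightarrow> (real \<times> real) \<times> real \<Rightarrow> real ^ 3"
  where "frame m q n p = fst (fst p) *\<^sub>R m + snd (fst p) *\<^sub>R q + snd p *\<^sub>R n"

definition orthonormal3 :: "real ^ 3 \<Rightarrow> real ^ 3 \<Rightarrow> real ^ 3 \<Rightarrow> bool"
  where "orthonormal3 m q n \<longleftrightarrow> m \<bullet> m = 1 \<and> q \<bullet> q = 1 \<and> n \<bullet> n = 1 \<and> m \<bullet> q = 0 \<and> m \<bullet> n = 0 \<and> q \<bullet> n = 0"

lemma frame_measurable [measurable]: "frame m q n \<in> borel_measurable borel"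
  unfolding frame_def by (intro borel_measurable_continuous_onI continuous_intros)

lemma distr_frame_axis: "distr lborel borel (frame (axis 1 1) (axis 2 1) (axis 3 1)) = lborel"
proof (rule lborel_eqI[symmetric])
  let ?F = "frame (axis 1 1) (axis 2 1) (axis 3 1)"
  fix l u :: "real ^ 3"
  assume le: "\<And>b. b \<in> Basis \<Longrightarrow> l \<bullet> b \<le> u \<bullet> b"
  have le': "l $ i \<le> u $ i" for i using le[of "axis i 1"] by (simp add: inner_axis)
  have comp: "?F p $ 1 = fst (fst p)" "?F p $ 2 = snd (fst p)" "?F p $ 3 = snd p" for p
    by (simp_all add: frame_def axis_def)
  have pre: "?F -` box l u = ({l $ 1 <..< u $ 1} \<times> {l $ 2 <..< u $ 2}) \<times> {l $ 3 <..< u $ 3}"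
    by (auto simp: mem_box_cart forall_3 comp)
  have "emeasure (distr lborel borel ?F) (box l u) = emeasure lborel (?F -` box l u)"
    by (subst emeasure_distr) auto
  also have "\<dots> = emeasure (lborel \<Otimes>\<^sub>M lborel) (({l $ 1 <..< u $ 1} \<times> {l $ 2 <..< u $ 2}) \<times> {l $ 3 <..< u $ 3})"
    by (simp add: pre lborel_prod)
  also have "\<dots> = emeasure lborel ({l $ 1 <..< u $ 1} \<times> {l $ 2 <..< u $ 2}) * emeasure lborel {l $ 3 <..< u $ 3}"
    by (rule lborel.emeasure_pair_measure_Times) (auto simp: lborel_prod[symmetric] borel_prod[symmetric])
  also have "emeasure lborel ({l $ 1 <..< u $ 1} \<times> {l $ 2 <..< u $ 2}) =
    emeasure (lborel \<Otimes>\<^sub>M lborel) ({l $ 1 <..< u $ 1} \<times> {l $ 2 <..< u $ 2})"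
    by (simp add: lborel_prod)
  also have "\<dots> = emeasure lborel {l $ 1 <..< u $ 1} * emeasure lborel {l $ 2 <..< u $ 2}"
    by (rule lborel.emeasure_pair_measure_Times) auto
  finally have "emeasure (distr lborel borel ?F) (box l u) = ennreal ((u $ 1 - l $ 1) * (u $ 2 - l $ 2) * (u $ 3 - l $ 3))"
    using le' by (simp add: ennreal_mult)
  also have "(u $ 1 - l $ 1) * (u $ 2 - l $ 2) * (u $ 3 - l $ 3) = (\<Prod>i\<in>UNIV. (u - l) $ i)"
    unfolding UNIV_3 by simp
  also have "\<dots> = (\<Prod>b\<in>Basis. (u - l) \<bullet> b)"
  proof -
    have B: "(Basis :: (real ^ 3) set) = (\<lambda>i. axis i 1) ` UNIV" by (auto simp: Basis_vec_def)
    have "inj (\<lambda>i. axis i 1 :: real ^ 3)" by (auto simp: inj_on_def axis_eq_axis)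
    then show ?thesis unfolding B by (subst prod.reindex) (auto simp: inner_axis)
  qed
  finally show "emeasure (distr lborel borel ?F) (box l u) = (\<Prod>b\<in>Basis. (u - l) \<bullet> b)" .
qed simp

text \<open>Factors by an orthogonal map through the standard axes, where boxes are products of
  intervals.\<close>

lemma distr_frame:
  assumes "orthonormal3 m q n"
  shows "distr lborel borel (frame m q n) = lborel"
proof -
  define T where "T v = v $ 1 *\<^sub>R m + v $ 2 *\<^sub>R q + v $ 3 *\<^sub>R n" for v :: "real ^ 3"
  have T: "orthogonal_transformation T"
    unfolding orthogonal_transformation_def
  proof (intro conjI allI)
    show "linear T" by (rule linearI) (simp_all add: T_def algebra_simps)
    fix v w show "T v \<bullet> T w = v \<bullet> w"
      using assms by (simp add: T_def orthonormal3_def inner_vec_def[of v w] sum_3 inner_add_left inner_add_right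
        inner_commute[of q m] inner_commute[of n m] inner_commute[of n q])
  qed
  have Tm: "T \<in> borel_measurable borel"
    unfolding T_def by (intro borel_measurable_continuous_onI continuous_intros)
  have "frame m q n = T \<circ> frame (axis 1 1) (axis 2 1) (axis 3 1)"
    by (auto simp: fun_eq_iff T_def frame_def axis_def)
  then have "distr lborel borel (frame m q n) = distr (distr lborel borel (frame (axis 1 1) (axis 2 1) (axis 3 1))) borel T"
    using Tm by (subst distr_distr) auto
  also have "\<dots> = lborel" unfolding distr_frame_axis by (rule distr_orthogonal_lborel[OF T])
  finally show ?thesis .
qed

lemma integral_frame:
  fixes f :: "real ^ 3 \<Rightarrow> real"
  assumes o: "orthonormal3 m q n" and f: "integrable lborel f"
  shows "(LINT y|lborel. f y) = (LINT p|lborel. (LINT t|lborel. f (frame m q n (p, t))))"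
proof -
  have "f \<in> borel_measurable borel" using borel_measurable_integrable[OF f] by simp
  have Fm: "frame m q n \<in> measurable lborel borel" by simp
  have "(LINT y|lborel. f y) = (LINT y|distr lborel borel (frame m q n). f y)"
    by (simp only: distr_frame[OF o])
  also have "\<dots> = (LINT p|lborel. f (frame m q n p))"
    by (rule integral_distr[OF Fm \<open>f \<in> borel_measurable borel\<close>])
  finally have "(LINT y|lborel. f y) = (LINT p|lborel. f (frame m q n p))" .
  moreover have "integrable lborel (\<lambda>p. f (frame m q n p))"
    using f integrable_distr_eq[OF Fm \<open>f \<in> borel_measurable borel\<close>] by (simp only: distr_frame[OF o])
  ultimately show ?thesis
    using lborel_pair.integral_fst'[of "\<lambda>p. f (frame m q n p)"] by (simp add: lborel_prod)
qed

text \<open>Derivative of the logistic function \<open>1 / (1 + exp (- s))\<close>. It is also the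
  product of that function with its reflection, which is how it arises when only two partition
  functions compete.\<close>

definition sigmoid_deriv :: "real \<Rightarrow> real"
  where "sigmoid_deriv s = exp (- s) / (1 + exp (- s))\<^sup>2"

lemma sigmoid_deriv_pos: "0 < sigmoid_deriv s"
  unfolding sigmoid_deriv_def by (intro divide_pos_pos zero_less_power add_pos_pos) auto

lemma sigmoid_deriv_symmetric: "sigmoid_deriv (- s) = sigmoid_deriv s"
proof -
  have "exp s * exp (- s) = 1" by (simp add: exp_minus)
  then have e: "1 + exp s = exp s * (1 + exp (- s))" by (simp add: algebra_simps)
  have "sigmoid_deriv (- s) = exp s / (exp s * (1 + exp (- s)))\<^sup>2" unfolding sigmoid_deriv_def minus_minus e ..
  also have "\<dots> = 1 / (exp s * (1 + exp (- s))\<^sup>2)" by (simp add: power2_eq_square)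
  also have "\<dots> = sigmoid_deriv s" by (simp add: sigmoid_deriv_def exp_minus divide_simps)
  finally show ?thesis .
qed

text \<open>Converts exponential decay away from a bisecting plane into a majorant whose integral is
  known.\<close>

lemma exp_neg_abs_le_sigmoid_deriv: "exp (- \<bar>s\<bar>) \<le> 4 * sigmoid_deriv s"
proof -
  have *: "exp (- t) \<le> 4 * sigmoid_deriv t" if t: "0 \<le> t" for t
  proof -
    have "(1 + exp (- t))\<^sup>2 \<le> 2\<^sup>2" using t by (intro power_mono) (auto simp: add_nonneg_nonneg)
    then have "exp (- t) * (1 + exp (- t))\<^sup>2 \<le> exp (- t) * 4" by (intro mult_left_mono) auto
    moreover have "0 < (1 + exp (- t))\<^sup>2" by (intro zero_less_power add_pos_pos) auto
    ultimately show ?thesis unfolding sigmoid_deriv_def times_divide_eq_right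
      by (subst pos_le_divide_eq) (auto simp: mult.commute)
  qed
  show ?thesis using *[of "\<bar>s\<bar>"] sigmoid_deriv_symmetric[of s] by (cases "0 \<le> s") auto
qed

lemma has_bochner_integral_sigmoid_deriv: "has_bochner_integral lborel sigmoid_deriv 1"
proof -
  define F where "F s = 1 / (1 + exp (- s))" for s :: real
  have ne: "1 + exp (- s) \<noteq> 0" for s :: real using add_pos_pos[OF zero_less_one exp_gt_zero[of "- s"]] by simp
  have d: "DERIV F s :> sigmoid_deriv s" for s
    unfolding F_def sigmoid_deriv_def
    by (rule derivative_eq_intros refl ne | simp add: power2_eq_square)+
  have lim0: "(F \<longlongrightarrow> 0) at_bot" unfolding F_def by real_asymp
  have lim1: "(F \<longlongrightarrow> 1) at_top" unfolding F_def by real_asymp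
  have c: "isCont sigmoid_deriv s" for s
    unfolding sigmoid_deriv_def by (intro continuous_intros) (simp add: ne)
  have 1: "((F \<circ> real_of_ereal) \<longlongrightarrow> 0) (at_right (-\<infinity>))" "((F \<circ> real_of_ereal) \<longlongrightarrow> 1) (at_left \<infinity>)"
    using lim0 lim1 unfolding at_right_MInf at_left_PInf
    by (simp_all add: filterlim_filtermap o_def)
  have ft: "set_integrable lborel (einterval (-\<infinity>) \<infinity>) sigmoid_deriv" "(LBINT s=-\<infinity>..\<infinity>. sigmoid_deriv s) = 1 - 0"
    using sigmoid_deriv_pos by (intro interval_integral_FTC_nonneg[OF _ d c _ 1]; force simp: order_less_imp_le)+
  have "integrable lborel sigmoid_deriv" using ft(1) by (simp add: set_integrable_def einterval_eq_UNIV)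
  moreover have "(LINT s|lborel. sigmoid_deriv s) = 1"
    using ft(2) by (simp add: interval_lebesgue_integral_def set_lebesgue_integral_def einterval_eq_UNIV)
  ultimately show ?thesis by (simp add: has_bochner_integral_iff)
qed

lemma integral_sigmoid_deriv_scale:
  assumes "c \<noteq> 0"
  shows "integrable lborel (\<lambda>s. sigmoid_deriv (c * s))" "(LINT s|lborel. sigmoid_deriv (c * s)) = 1 / \<bar>c\<bar>"
proof -
  have i: "integrable lborel sigmoid_deriv" "(LINT s|lborel. sigmoid_deriv s) = 1"
    using has_bochner_integral_sigmoid_deriv by (auto simp: has_bochner_integral_iff)
  show "integrable lborel (\<lambda>s. sigmoid_deriv (c * s))"
    using lborel_integrable_real_affine[OF i(1) assms, of 0] by simp
  show "(LINT s|lborel. sigmoid_deriv (c * s)) = 1 / \<bar>c\<bar>"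
    using lborel_integral_real_affine[OF assms, of sigmoid_deriv 0] i(2) assms by (simp add: field_simps)
qed

context voronoi
begin

section \<open>The smooth partition of unity and its pairwise products\<close>

definition soft :: "real \<Rightarrow> nat \<Rightarrow> real ^ 3 \<Rightarrow> real"
  where "soft l i y = exp (l * (y \<bullet> x i)) / (\<Sum>k<N. exp (l * (y \<bullet> x k)))"

lemma soft_denom_pos: "0 < (\<Sum>k<N. exp (l * (y \<bullet> x k)))"
  using two_le_N by (intro sum_pos) (auto simp: lessThan_empty_iff)

lemma soft_pos: "0 < soft l i y"
  unfolding soft_def by (intro divide_pos_pos soft_denom_pos) simp

lemma sum_soft: "(\<Sum>i<N. soft l i y) = 1"
  unfolding soft_def sum_divide_distrib[symmetric] using soft_denom_pos[of l y] by simp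

lemma soft_le_1: "i < N \<Longrightarrow> soft l i y \<le> 1"
  unfolding sum_soft[of l y, symmetric]
  by (intro member_le_sum) (auto intro: less_imp_le[OF soft_pos])

lemma soft_ratio: "soft l i y = soft l j y * exp (l * (y \<bullet> (x i - x j)))"
  by (simp add: soft_def inner_diff_right right_diff_distrib exp_diff)

lemma soft_le_exp: "j < N \<Longrightarrow> soft l i y \<le> exp (l * (y \<bullet> (x i - x j)))"
  unfolding soft_ratio[of l i y j] using soft_le_1[of j l y] by (simp add: mult_left_le_one_le less_imp_le[OF soft_pos])

text \<open>Of the two vertices, the one with the smaller inner product with \<open>y\<close>
  contributes the factor that carries the decay.\<close>

lemma soft_mult_le:
  assumes "i < N" "j < N" "0 \<le> l"
  shows "soft l i y * soft l j y \<le> exp (- (l * \<bar>y \<bullet> (x i - x j)\<bar>))"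
proof (cases "0 \<le> y \<bullet> (x i - x j)")
  case True
  have "soft l i y * soft l j y \<le> 1 * exp (l * (y \<bullet> (x j - x i)))"
    using assms soft_le_1 soft_le_exp by (intro mult_mono) (auto intro: less_imp_le[OF soft_pos])
  then show ?thesis using True by (simp add: inner_diff_right algebra_simps)
next
  case False
  have "soft l i y * soft l j y \<le> exp (l * (y \<bullet> (x i - x j))) * 1"
    using assms soft_le_1 soft_le_exp by (intro mult_mono) (auto intro: less_imp_le[OF soft_pos])
  then show ?thesis using False by (simp add: inner_diff_right algebra_simps)
qed

lemma soft_eq_inverse: "soft l i y = 1 / (\<Sum>k<N. exp (l * (y \<bullet> (x k - x i))))"
proof -
  have "(\<Sum>k<N. exp (l * (y \<bullet> x k))) = exp (l * (y \<bullet> x i)) * (\<Sum>k<N. exp (l * (y \<bullet> (x k - x i))))"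
    by (simp add: sum_distrib_left inner_diff_right right_diff_distrib exp_diff)
  then show ?thesis by (simp add: soft_def)
qed

lemma continuous_soft [continuous_intros]:
  "continuous_on A f \<Longrightarrow> continuous_on A (\<lambda>y. soft l i (f y))"
  unfolding soft_def using soft_denom_pos[THEN less_imp_neq, THEN not_sym]
  by (intro continuous_intros) auto

text \<open>A line meets the sphere at most twice: with \<open>x k\<close> on the line through
  \<open>x i\<close> and \<open>x j\<close>, the equation \<open>norm (x k) = 1\<close> leaves only
  \<open>\<mu> = 0\<close> and \<open>\<mu> = -1\<close>, which are \<open>x i\<close> and
  \<open>x j\<close> themselves.\<close>

lemma sites_not_collinear:
  assumes "i < N" "j < N" "k < N" "k \<noteq> i" "k \<noteq> j" "x k - x i = \<mu> *\<^sub>R (x i - x j)"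
  shows False
proof -
  let ?a = "x i - x j"
  have ia: "x i \<bullet> ?a = (norm ?a)\<^sup>2 / 2"
    using S2_inner_eq_norm[OF sites sites, of i j] S2_inner_self[OF sites, of i] assms by (simp add: inner_diff_right)
  have "x k = x i + \<mu> *\<^sub>R ?a" using assms(6) by (simp add: algebra_simps)
  moreover have "(u + \<mu> *\<^sub>R a) \<bullet> (u + \<mu> *\<^sub>R a) = u \<bullet> u + 2 * \<mu> * (u \<bullet> a) + \<mu>\<^sup>2 * (a \<bullet> a)" for u a :: "real ^ 3"
    by (simp add: inner_add_left inner_add_right inner_commute[of a u] power2_eq_square algebra_simps)
  ultimately have "x k \<bullet> x k = x i \<bullet> x i + 2 * \<mu> * (x i \<bullet> ?a) + \<mu>\<^sup>2 * (?a \<bullet> ?a)"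
    by simp
  then have "0 = (\<mu> + \<mu>\<^sup>2) * (norm ?a)\<^sup>2"
    using S2_inner_self[OF sites] assms ia by (simp add: power2_norm_eq_inner algebra_simps)
  then have "\<mu> + \<mu>\<^sup>2 = 0 \<or> x i = x j" by simp
  moreover have "\<mu> + \<mu>\<^sup>2 = \<mu> * (1 + \<mu>)" by (simp add: power2_eq_square algebra_simps)
  ultimately have "\<mu> * (1 + \<mu>) = 0 \<or> x i = x j" by simp
  then consider "\<mu> = 0" | "\<mu> = -1" | "x i = x j" by (auto simp: eq_neg_iff_add_eq_0 add.commute)
  then show False
  proof cases
    case 1
    then have "x k = x i" using assms(6) by simp
    then show ?thesis using sites_eq_iff assms by blast
  next
    case 2
    then have "x k = x j" using assms(6) by (simp add: algebra_simps)
    then show ?thesis using sites_eq_iff assms by blast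
  next
    case 3
    then have "x k = x i" using assms(6) by simp
    then show ?thesis using sites_eq_iff assms by blast
  qed
qed

end

lemma norm_frame:
  assumes "orthonormal3 m q n"
  shows "(norm (frame m q n (p, t)))\<^sup>2 = (norm p)\<^sup>2 + t\<^sup>2"
  using assms unfolding power2_norm_eq_inner inner_prod_def
  by (simp add: orthonormal3_def frame_def inner_add_left inner_add_right
      inner_commute[of q m] inner_commute[of n m] inner_commute[of n q] power2_eq_square algebra_simps)

lemma norm_frame_ge: "orthonormal3 m q n \<Longrightarrow> norm p \<le> norm (frame m q n (p, t))"
  using norm_frame[of m q n p t] by (metis le_add_same_cancel1 norm_ge_zero power2_le_imp_le zero_le_power2)

lemma null_line_prod:
  assumes "v \<noteq> (0 :: real \<times> real)"
  shows "AE p in lborel. v \<bullet> p \<noteq> 0"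
proof -
  have "negligible {p. v \<bullet> p = 0}" using negligible_hyperplane[of v 0] assms by simp
  then have "{p. v \<bullet> p = 0} \<in> null_sets lborel"
    by (simp add: negligible_iff_null_sets null_sets_completion_iff closed_hyperplane borel_closed)
  then show ?thesis by (rule AE_I') auto
qed

context voronoi
begin

definition soft_prod :: "real \<Rightarrow> nat \<Rightarrow> nat \<Rightarrow> real ^ 3 \<Rightarrow> real"
  where "soft_prod l i j y = soft l i y * soft l j y"

lemma soft_prod_bounds: "i < N \<Longrightarrow> j < N \<Longrightarrow> 0 \<le> soft_prod l i j y \<and> soft_prod l i j y \<le> 1"
  unfolding soft_prod_def
  using soft_le_1[of i l y] soft_le_1[of j l y] soft_pos[of l i y] soft_pos[of l j y]
  by (auto intro: mult_le_one simp: less_imp_le)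

text \<open>When \<open>n\<close> is parallel to \<open>x i - x j\<close>, the inner products with
  \<open>x i\<close> and \<open>x j\<close> agree on the plane of \<open>m\<close> and
  \<open>q\<close>, so this is the planar cone over the common edge of the two cells.\<close>

definition cone2 :: "real ^ 3 \<Rightarrow> real ^ 3 \<Rightarrow> nat \<Rightarrow> (real \<times> real) set"
  where "cone2 m q i = {p. \<forall>k<N. (fst p *\<^sub>R m + snd p *\<^sub>R q) \<bullet> x k \<le> (fst p *\<^sub>R m + snd p *\<^sub>R q) \<bullet> x i}"

text \<open>In the direction across an edge, the product of two partition functions approaches the profile
  \<open>sigmoid_deriv\<close>, whose integral is 1, on the length scale \<open>1 / l\<close>.\<close>

lemma soft_prod_scaled_limit:
  assumes i: "i < N" and j: "j < N" and ij: "i \<noteq> j" and o: "orthonormal3 m q n"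
    and a: "x i - x j = a *\<^sub>R n" "0 < a"
    and p0: "p \<noteq> 0"
    and tie: "\<And>k. k < N \<Longrightarrow> k \<noteq> i \<Longrightarrow> k \<noteq> j \<Longrightarrow> (fst p *\<^sub>R m + snd p *\<^sub>R q) \<bullet> (x k - x i) \<noteq> 0"
  shows "(\<lambda>l::nat. soft_prod (real l) i j (radial (frame m q n (p, s / real l)))) \<longlonglongrightarrow>
    indicator (cone2 m q i) p * sigmoid_deriv (a / norm p * s)"
proof -
  let ?P = "fst p *\<^sub>R m + snd p *\<^sub>R q"
  let ?y = "\<lambda>l::nat. frame m q n (p, s / real l)"
  have Pn: "norm ?P = norm p"
  proof -
    have "(norm (frame m q n (p, 0)))\<^sup>2 = (norm p)\<^sup>2" using norm_frame[OF o, of p 0] by simp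
    then show ?thesis by (simp add: frame_def)
  qed
  have np: "0 < norm p" using p0 by simp
  have ynz: "0 < norm (?y l)" for l using norm_frame_ge[OF o, of p "s / real l"] np by linarith
  have Pn0: "?P \<bullet> n = 0" using o by (simp add: orthonormal3_def inner_add_left)
  have ylim: "(\<lambda>l. norm (?y l)) \<longlonglongrightarrow> norm p"
  proof -
    have "(\<lambda>l. ?P + (s / real l) *\<^sub>R n) \<longlonglongrightarrow> ?P + 0 *\<^sub>R n"
      by (intro tendsto_intros lim_const_over_n)
    then have "(\<lambda>l. norm (?P + (s / real l) *\<^sub>R n)) \<longlonglongrightarrow> norm ?P" using tendsto_norm by fastforce
    then show ?thesis by (simp add: frame_def Pn)
  qed
  define E where "E k l = real l * (radial (?y l) \<bullet> (x k - x i))" for k l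
  have E: "E k l = (real l * (?P \<bullet> (x k - x i)) + s * (n \<bullet> (x k - x i))) / norm (?y l)" if "0 < l" for k l
  proof -
    let ?b = "x k - x i"
    have "radial (?y l) \<bullet> ?b = (?P \<bullet> ?b + s / real l * (n \<bullet> ?b)) / norm (?y l)"
      unfolding radial_def inner_scaleR_left by (simp add: frame_def inner_add_left divide_inverse mult.commute)
    moreover have "real l * (?P \<bullet> ?b + s / real l * (n \<bullet> ?b)) = real l * (?P \<bullet> ?b) + s * (n \<bullet> ?b)"
      using that by (simp add: distrib_left)
    ultimately show ?thesis unfolding E_def by (simp only: times_divide_eq_right)
  qed
  have xji: "x j - x i = - a *\<^sub>R n" using a(1) by (simp add: algebra_simps)
  have Ej: "(\<lambda>l. exp (E j l)) \<longlonglongrightarrow> exp (- (a / norm p * s))"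
  proof -
    have "(\<lambda>l. - (s * a) / norm (?y l)) \<longlonglongrightarrow> - (s * a) / norm p"
      using np by (intro tendsto_divide tendsto_const ylim) auto
    moreover have "\<forall>\<^sub>F l in sequentially. - (s * a) / norm (?y l) = E j l"
      using eventually_gt_at_top[of "0::nat"]
    proof eventually_elim
      case (elim l)
      have "n \<bullet> n = 1" using o by (simp add: orthonormal3_def)
      then show ?case using E[OF elim, of j] Pn0 unfolding xji by simp
    qed
    ultimately have "(\<lambda>l. E j l) \<longlonglongrightarrow> - (s * a) / norm p" using Lim_transform_eventually by fast
    from tendsto_exp[OF this] show ?thesis by (simp add: mult.commute)
  qed
  have Elim: "filterlim (\<lambda>l. E k l) (if 0 < ?P \<bullet> (x k - x i) then at_top else at_bot) sequentially"
    if k: "k < N" "k \<noteq> i" "k \<noteq> j" for k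
  proof -
    let ?b = "?P \<bullet> (x k - x i)"
    have b: "?b \<noteq> 0" by (rule tie[OF k])
    have "(\<lambda>l. (?b + s * (n \<bullet> (x k - x i)) / real l) / norm (?y l)) \<longlonglongrightarrow> (?b + 0) / norm p"
      using np by (intro tendsto_divide tendsto_add tendsto_const ylim lim_const_over_n) auto
    then have lim: "(\<lambda>l. (?b + s * (n \<bullet> (x k - x i)) / real l) / norm (?y l)) \<longlonglongrightarrow> ?b / norm p" by simp
    have ev: "\<forall>\<^sub>F l in sequentially. (?b + s * (n \<bullet> (x k - x i)) / real l) / norm (?y l) * real l = E k l"
      using eventually_gt_at_top[of "0::nat"]
    proof eventually_elim
      case (elim l)
      have scale: "(b + c / L) / v * L = (L * b + c) / v" if "L \<noteq> 0" for b c L v :: real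
      proof -
        have "(b + c / L) * L = L * b + c" using that by (simp add: field_simps)
        then show ?thesis by (metis times_divide_eq_left)
      qed
      show ?case unfolding E[OF elim] by (rule scale) (use elim in simp)
    qed
    show ?thesis
    proof (cases "0 < ?b")
      case True
      then have "0 < ?b / norm p" using np by simp
      from filterlim_cong[OF refl refl ev, THEN iffD1, OF filterlim_tendsto_pos_mult_at_top[OF lim this filterlim_real_sequentially]]
      show ?thesis using True by simp
    next
      case False
      then have "?b / norm p < 0" using np b by (simp add: divide_neg_pos)
      from filterlim_cong[OF refl refl ev, THEN iffD1, OF filterlim_tendsto_neg_mult_at_bot[OF lim this filterlim_real_sequentially]]
      show ?thesis using False by simp
    qed
  qed
  show ?thesis
  proof (cases "p \<in> cone2 m q i")
    case True
    have neg: "(\<lambda>l. exp (E k l)) \<longlonglongrightarrow> 0" if k: "k < N" "k \<noteq> i" "k \<noteq> j" for k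
    proof -
      have "?P \<bullet> (x k - x i) \<le> 0" using True k by (simp add: cone2_def inner_diff_right)
      then have "filterlim (\<lambda>l. E k l) at_bot sequentially" using Elim[OF k] by simp
      from filterlim_compose[OF exp_at_bot this] show ?thesis .
    qed
    define e where "e = exp (- (a / norm p * s))"
    have e1: "0 < 1 + e" by (simp add: e_def add_pos_pos)
    have sum_eq: "(\<Sum>k<N. f k) = f i + f j + (\<Sum>k\<in>{..<N} - {i, j}. f k)" for f :: "nat \<Rightarrow> real"
    proof -
      have "{..<N} = insert i (insert j ({..<N} - {i, j}))" using i j by auto
      then show ?thesis using ij by (metis (no_types) DiffD2 add.assoc finite_Diff finite_insert finite_lessThan insertCI insertE sum.insert)
    qed
    have i0: "E i l = 0" for l by (simp add: E_def)
    have "(\<lambda>l. \<Sum>k<N. exp (E k l)) \<longlonglongrightarrow> 1 + e + (\<Sum>k\<in>{..<N} - {i, j}. 0)"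
      unfolding sum_eq i0 exp_zero e_def by (intro tendsto_intros Ej neg) auto
    then have "(\<lambda>l. 1 / (\<Sum>k<N. exp (E k l))) \<longlonglongrightarrow> 1 / (1 + e)"
      using e1 by (intro tendsto_divide tendsto_const) auto
    then have si: "(\<lambda>l. soft (real l) i (radial (?y l))) \<longlonglongrightarrow> 1 / (1 + e)"
      unfolding soft_eq_inverse[of _ i] E_def .
    have "(\<lambda>l. soft (real l) i (radial (?y l)) * (soft (real l) i (radial (?y l)) * exp (E j l)))
        \<longlonglongrightarrow> 1 / (1 + e) * (1 / (1 + e) * e)"
      by (intro tendsto_mult si) (use Ej in \<open>simp add: e_def\<close>)
    then have "(\<lambda>l. soft_prod (real l) i j (radial (?y l))) \<longlonglongrightarrow> 1 / (1 + e) * (1 / (1 + e) * e)"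
      unfolding soft_prod_def soft_ratio[of _ j _ i] E_def .
    moreover have "1 / (1 + e) * (1 / (1 + e) * e) = sigmoid_deriv (a / norm p * s)"
      by (simp add: sigmoid_deriv_def e_def power2_eq_square)
    ultimately show ?thesis using True by simp
  next
    case False
    then obtain k where k: "k < N" "0 < ?P \<bullet> (x k - x i)" by (auto simp: cone2_def inner_diff_right not_le)
    have "k \<noteq> i" using k by auto
    moreover have "k \<noteq> j" using k Pn0 unfolding xji by (auto simp: xji)
    ultimately have "filterlim (\<lambda>l. E k l) at_top sequentially" using Elim[of k] k by simp
    then have "filterlim (\<lambda>l. - E k l) at_bot sequentially" by (simp add: filterlim_uminus_at_top)
    from filterlim_compose[OF exp_at_bot this] have lim: "(\<lambda>l. exp (- E k l)) \<longlonglongrightarrow> 0" .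
    have "(\<lambda>l. soft_prod (real l) i j (radial (?y l))) \<longlonglongrightarrow> 0"
    proof (rule tendsto_sandwich[OF _ _ tendsto_const lim])
      show "\<forall>\<^sub>F l in sequentially. 0 \<le> soft_prod (real l) i j (radial (?y l))"
        using soft_prod_bounds[OF i j] by simp
      have "soft_prod (real l) i j (radial (?y l)) \<le> exp (- E k l)" for l
      proof -
        have "soft_prod (real l) i j (radial (?y l)) \<le> exp (- E k l) * 1"
          unfolding soft_prod_def
          using soft_le_exp[OF k(1), of "real l" i "radial (?y l)"] soft_le_1[OF j] soft_pos
          by (intro mult_mono) (auto simp: E_def inner_diff_right algebra_simps less_imp_le)
        then show ?thesis by simp
      qed
      then show "\<forall>\<^sub>F l in sequentially. soft_prod (real l) i j (radial (?y l)) \<le> exp (- E k l)" by simp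
    qed
    then show ?thesis using False by simp
  qed
qed

end

context voronoi
begin

text \<open>Extension of the product to the punctured ball, constant along rays. Surface integrals
  become volume integrals, to which orthonormal coordinates apply.\<close>

definition soft_ball :: "real \<Rightarrow> nat \<Rightarrow> nat \<Rightarrow> real ^ 3 \<Rightarrow> real"
  where "soft_ball l i j y = indicator (ball 0 1 - {0}) y * soft_prod l i j (radial y)"

lemma borel_measurable_soft_prod [measurable]: "soft_prod l i j \<in> borel_measurable borel"
  unfolding soft_prod_def by (intro borel_measurable_continuous_onI continuous_intros)

lemma borel_measurable_soft_ball [measurable]: "soft_ball l i j \<in> borel_measurable borel"
  unfolding soft_ball_def
  by (intro borel_measurable_times measurable_compose[OF borel_measurable_radial borel_measurable_soft_prod]
    borel_measurable_indicator) auto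

lemma soft_ball_nonneg: "i < N \<Longrightarrow> j < N \<Longrightarrow> 0 \<le> soft_ball l i j y"
  using soft_prod_bounds by (simp add: soft_ball_def)

lemma integral_soft_prod:
  assumes "i < N" "j < N"
  shows "integrable lborel (soft_ball l i j)"
    "(LINT y|surface. soft_prod l i j y) = 3 * (LINT y|lborel. soft_ball l i j y)"
proof -
  show "integrable lborel (soft_ball l i j)"
  proof (rule Bochner_Integration.integrable_bound)
    show "integrable lborel (indicator (ball 0 1) :: real ^ 3 \<Rightarrow> real)"
      using emeasure_lborel_ball_finite[of "0::real^3" 1] by simp
    show "AE y in lborel. norm (soft_ball l i j y) \<le> norm (indicator (ball 0 1) y :: real)"
      using soft_prod_bounds[OF assms] by (intro AE_I2) (auto simp: soft_ball_def indicator_def)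
  qed simp
  have "(LINT y|surface. soft_prod l i j y) =
    3 *\<^sub>R (LINT y|restrict_space lborel (ball 0 1 - {0}). soft_prod l i j (radial y))"
    by (intro integral_surface measurable_surface_borel borel_measurable_soft_prod)
  also have "(LINT y|restrict_space lborel (ball 0 1 - {0}). soft_prod l i j (radial y)) =
    (LINT y|lborel. indicator (ball 0 1 - {0}) y *\<^sub>R soft_prod l i j (radial y))"
    by (rule integral_restrict_space) auto
  finally show "(LINT y|surface. soft_prod l i j y) = 3 * (LINT y|lborel. soft_ball l i j y)"
    by (simp add: soft_ball_def)
qed

text \<open>Projection from inside the unit ball to the sphere increases the distance from the
  bisecting plane, so the bound is uniform in \<open>l\<close> and \<open>p\<close>. It is the
  majorant for dominated convergence.\<close>

lemma soft_ball_le_sigmoid_deriv: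
  assumes i: "i < N" and j: "j < N" and o: "orthonormal3 m q n"
    and a: "x i - x j = a *\<^sub>R n" "0 < a" and l: "0 < l"
  shows "soft_ball l i j (frame m q n (p, s / l)) \<le> 4 * sigmoid_deriv (a * s)"
proof (cases "frame m q n (p, s / l) \<in> ball 0 1 - {0}")
  case True
  let ?y = "frame m q n (p, s / l)"
  have ny: "0 < norm ?y" "norm ?y < 1" using True by auto
  have yn: "?y \<bullet> n = s / l" using o by (simp add: frame_def orthonormal3_def inner_add_left)
  have "l * (radial ?y \<bullet> (x i - x j)) = a * s / norm ?y"
    unfolding a(1) radial_def inner_scaleR_left inner_scaleR_right yn using l by (simp add: field_simps)
  then have "l * \<bar>radial ?y \<bullet> (x i - x j)\<bar> = \<bar>a * s\<bar> / norm ?y"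
    using l ny by (metis abs_divide abs_mult abs_norm_cancel abs_of_pos)
  also have "\<dots> \<ge> \<bar>a * s\<bar>"
    using ny mult_left_mono[of "norm ?y" 1 "\<bar>a * s\<bar>"] by (simp add: pos_le_divide_eq)
  finally have "exp (- (l * \<bar>radial ?y \<bullet> (x i - x j)\<bar>)) \<le> exp (- \<bar>a * s\<bar>)" by simp
  moreover have "soft_ball l i j ?y \<le> exp (- (l * \<bar>radial ?y \<bullet> (x i - x j)\<bar>))"
    using soft_mult_le[OF i j less_imp_le[OF l], of "radial ?y"] True by (simp add: soft_ball_def soft_prod_def)
  ultimately show ?thesis using exp_neg_abs_le_sigmoid_deriv[of "a * s"] by linarith
next
  case False
  then show ?thesis using sigmoid_deriv_pos[of "a * s"] by (simp add: soft_ball_def)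
qed

lemma soft_ball_scaled_limit:
  assumes i: "i < N" and j: "j < N" and ij: "i \<noteq> j" and o: "orthonormal3 m q n"
    and a: "x i - x j = a *\<^sub>R n" "0 < a"
    and p0: "p \<noteq> 0"
    and tie: "\<And>k. k < N \<Longrightarrow> k \<noteq> i \<Longrightarrow> k \<noteq> j \<Longrightarrow> (fst p *\<^sub>R m + snd p *\<^sub>R q) \<bullet> (x k - x i) \<noteq> 0"
  shows "(\<lambda>l::nat. soft_ball (real l) i j (frame m q n (p, s / real l))) \<longlonglongrightarrow>
    indicator (cone2 m q i \<inter> ball 0 1) p * sigmoid_deriv (a / norm p * s)"
proof (cases "norm p < 1")
  case True
  have "(\<lambda>l. sqrt ((norm p)\<^sup>2 + (s / real l)\<^sup>2)) \<longlonglongrightarrow> sqrt ((norm p)\<^sup>2 + 0\<^sup>2)"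
    by (intro tendsto_intros lim_const_over_n)
  moreover have "norm (frame m q n (p, t)) = sqrt ((norm p)\<^sup>2 + t\<^sup>2)" for t
    using norm_frame[OF o, of p t] by (metis norm_ge_zero real_sqrt_unique)
  ultimately have "(\<lambda>l. norm (frame m q n (p, s / real l))) \<longlonglongrightarrow> norm p" by simp
  then have "\<forall>\<^sub>F l in sequentially. norm (frame m q n (p, s / real l)) < 1"
    using True by (rule order_tendstoD)
  then have "\<forall>\<^sub>F l in sequentially. soft_prod (real l) i j (radial (frame m q n (p, s / real l)))
      = soft_ball (real l) i j (frame m q n (p, s / real l))"
  proof eventually_elim
    case (elim l)
    have "0 < norm (frame m q n (p, s / real l))" using norm_frame_ge[OF o, of p "s / real l"] p0
      by (metis less_le_trans zero_less_norm_iff)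
    then show ?case using elim by (simp add: soft_ball_def)
  qed
  with soft_prod_scaled_limit[OF i j ij o a p0 tie, of s]
  have "(\<lambda>l::nat. soft_ball (real l) i j (frame m q n (p, s / real l))) \<longlonglongrightarrow> indicator (cone2 m q i) p * sigmoid_deriv (a / norm p * s)"
    by (rule Lim_transform_eventually)
  then show ?thesis using True by (simp add: indicator_inter_arith)
next
  case False
  then have "1 \<le> norm (frame m q n (p, t))" for t using norm_frame_ge[OF o, of p t] by linarith
  then have "soft_ball (real l) i j (frame m q n (p, s / real l)) = 0" for l
    by (simp add: soft_ball_def not_less)
  then show ?thesis using False by (simp add: indicator_inter_arith)
qed

text \<open>A third vertex ties with \<open>x i\<close> on the whole plane only if
  \<open>x k - x i\<close> is normal to it, hence parallel to \<open>x i - x j\<close>, which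
  non-collinearity forbids. Otherwise the ties form a line, a null set of the plane.\<close>

lemma AE_no_ties:
  assumes i: "i < N" and j: "j < N" and ij: "i \<noteq> j" and o: "orthonormal3 m q n"
    and a: "x i - x j = a *\<^sub>R n" "0 < a"
  shows "AE p in lborel. p \<noteq> 0 \<and> (\<forall>k<N. k \<noteq> i \<longrightarrow> k \<noteq> j \<longrightarrow> (fst p *\<^sub>R m + snd p *\<^sub>R q) \<bullet> (x k - x i) \<noteq> 0)"
proof -
  have "AE p in lborel. \<forall>k\<in>{..<N}. k \<noteq> i \<longrightarrow> k \<noteq> j \<longrightarrow> (fst p *\<^sub>R m + snd p *\<^sub>R q) \<bullet> (x k - x i) \<noteq> 0"
  proof (intro AE_finite_allI finite_lessThan)
    fix k assume k: "k \<in> {..<N}"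
    show "AE p in lborel. k \<noteq> i \<longrightarrow> k \<noteq> j \<longrightarrow> (fst p *\<^sub>R m + snd p *\<^sub>R q) \<bullet> (x k - x i) \<noteq> 0"
    proof (cases "k = i \<or> k = j")
      case False
      let ?b = "x k - x i"
      have "(m \<bullet> ?b, q \<bullet> ?b) \<noteq> 0"
      proof
        assume z: "(m \<bullet> ?b, q \<bullet> ?b) = 0"
        \<comment> \<open>The part of \<open>x k - x i\<close> orthogonal to \<open>n\<close>. It is
          orthogonal to all three frame vectors, and four orthogonal nonzero vectors do not fit into
          three dimensions.\<close>
        define c where "c = ?b - (n \<bullet> ?b) *\<^sub>R n"
        have perp: "m \<bullet> c = 0" "q \<bullet> c = 0" "n \<bullet> c = 0"
          using z o by (simp_all add: c_def inner_diff_right orthonormal3_def zero_prod_def)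
        have "c = 0"
        proof (rule ccontr)
          assume "c \<noteq> 0"
          then have ind: "independent {m, q, n, c}" and card: "card {m, q, n, c} = 4"
          proof -
            have ne: "m \<noteq> 0" "q \<noteq> 0" "n \<noteq> 0" using o by (auto simp: orthonormal3_def)
            have d: "m \<noteq> q" "m \<noteq> n" "q \<noteq> n" "m \<noteq> c" "q \<noteq> c" "n \<noteq> c"
              using o perp by (auto simp: orthonormal3_def)
            show "independent {m, q, n, c}"
              by (rule pairwise_orthogonal_independent)
                (use o perp ne \<open>c \<noteq> 0\<close> in \<open>auto simp: pairwise_def orthogonal_def orthonormal3_def inner_commute\<close>)
            show "card {m, q, n, c} = 4" using d by simp
          qed
          from independent_bound[OF ind] card show False by simp
        qed
        then have "?b = ((n \<bullet> ?b) / a) *\<^sub>R (x i - x j)" using a by (simp add: c_def)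
        then show False using sites_not_collinear[OF i j, of k] k False by auto
      qed
      from null_line_prod[OF this] show ?thesis
        by eventually_elim (simp add: inner_prod_def inner_add_left mult.commute)
    qed auto
  qed
  moreover have "AE p in lborel. p \<noteq> (0 :: real \<times> real)"
    by (rule AE_I'[of "{0}"]) auto
  ultimately show ?thesis by eventually_elim auto
qed

text \<open>Substituting \<open>s / l\<close> for the normal coordinate absorbs the factor
  \<open>l\<close>. The inner integrals tend to \<open>norm p / a\<close> over the cone in the unit
  disc and to 0 elsewhere; 3 is the ratio of area to cone volume. For a cone of opening angle
  \<alpha> the limit is thus \<alpha> over \<open>a\<close>: edge length over vertex
  distance.\<close>

lemma soft_prod_integral_limit:
  assumes i: "i < N" and j: "j < N" and ij: "i \<noteq> j" and o: "orthonormal3 m q n"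
    and a: "x i - x j = a *\<^sub>R n" "0 < a"
  shows "(\<lambda>l::nat. real l * (LINT y|surface. soft_prod (real l) i j y)) \<longlonglongrightarrow>
    3 / a * (LINT p|lborel. indicator (cone2 m q i \<inter> ball 0 1) p * norm p)"
proof -
  define H where "H l p = (LINT s|lborel. soft_ball (real l) i j (frame m q n (p, s / real l)))" for l :: nat and p
  have Hm: "H l \<in> borel_measurable lborel" for l
    unfolding H_def by measurable
  have fm: "(\<lambda>s. soft_ball (real l) i j (frame m q n (p, s / real l))) \<in> borel_measurable lborel" for l p
    by measurable
  have dsi: "integrable lborel (\<lambda>s. 4 * sigmoid_deriv (a * s))" "(LINT s|lborel. 4 * sigmoid_deriv (a * s)) = 4 / a"
    using integral_sigmoid_deriv_scale[of a] a(2) by simp_all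
  have eq: "real l * (LINT y|surface. soft_prod (real l) i j y) = 3 * (LINT p|lborel. H l p)" if l: "0 < l" for l
  proof -
    have "(LINT y|lborel. soft_ball (real l) i j y) = (LINT p|lborel. (LINT t|lborel. soft_ball (real l) i j (frame m q n (p, t))))"
      by (rule integral_frame[OF o integral_soft_prod(1)[OF i j]])
    also have "\<dots> = (LINT p|lborel. 1 / real l * H l p)"
    proof (intro Bochner_Integration.integral_cong refl)
      fix p
      show "(LINT t|lborel. soft_ball (real l) i j (frame m q n (p, t))) = 1 / real l * H l p"
        using lborel_integral_real_affine[of "1 / real l" "\<lambda>t. soft_ball (real l) i j (frame m q n (p, t))" 0] l
        by (simp add: H_def)
    qed
    finally show ?thesis using integral_soft_prod(2)[OF i j, of "real l"] l by simp
  qed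
  \<comment> \<open>The index shift avoids the meaningless scaling by \<open>1 / l\<close> at
    \<open>l = 0\<close>.\<close>
  have lim: "(\<lambda>l. LINT p|lborel. H (Suc l) p) \<longlonglongrightarrow>
     (LINT p|lborel. indicator (cone2 m q i \<inter> ball 0 1) p * (norm p / a))"
  proof (rule integral_dominated_convergence[where w = "\<lambda>p. 4 / a * indicator (ball 0 1) p"])
    have cc: "closed (cone2 m q i)"
    proof -
      have "cone2 m q i = (\<Inter>k\<in>{..<N}. {p. (fst p *\<^sub>R m + snd p *\<^sub>R q) \<bullet> x k \<le> (fst p *\<^sub>R m + snd p *\<^sub>R q) \<bullet> x i})"
        by (auto simp: cone2_def)
      then show ?thesis by (auto intro!: closed_INT closed_Collect_le continuous_intros)
    qed
    have "(\<lambda>p::real \<times> real. norm p / a) \<in> borel_measurable borel"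
      using a(2) by (intro borel_measurable_continuous_onI continuous_intros) auto
    then show "(\<lambda>p. indicator (cone2 m q i \<inter> ball 0 1) p * (norm p / a)) \<in> borel_measurable lborel"
      using cc by (intro borel_measurable_times borel_measurable_indicator) (auto intro: borel_closed)
    show "H (Suc l) \<in> borel_measurable lborel" for l by (rule Hm)
    show "integrable lborel (\<lambda>p::real \<times> real. 4 / a * indicator (ball 0 1) p)"
      using emeasure_lborel_ball_finite[of "0::real \<times> real" 1] by (intro integrable_mult_right) simp
    show "AE p in lborel. norm (H (Suc l) p) \<le> 4 / a * indicator (ball 0 1) p" for l
    proof (intro AE_I2)
      fix p :: "real \<times> real"
      show "norm (H (Suc l) p) \<le> 4 / a * indicator (ball 0 1) p"
      proof (cases "norm p < 1")
        case True
        have nn: "0 \<le> H (Suc l) p" unfolding H_def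
          by (rule Bochner_Integration.integral_nonneg) (rule soft_ball_nonneg[OF i j])
        have bd: "soft_ball (real (Suc l)) i j (frame m q n (p, s / real (Suc l))) \<le> 4 * sigmoid_deriv (a * s)" for s
          by (rule soft_ball_le_sigmoid_deriv[OF i j o a]) simp
        have "H (Suc l) p \<le> (LINT s|lborel. 4 * sigmoid_deriv (a * s))" unfolding H_def
        proof (rule integral_mono)
          show "integrable lborel (\<lambda>s. soft_ball (real (Suc l)) i j (frame m q n (p, s / real (Suc l))))"
          proof (rule Bochner_Integration.integrable_bound[OF dsi(1) fm])
            show "AE s in lborel. norm (soft_ball (real (Suc l)) i j (frame m q n (p, s / real (Suc l)))) \<le> norm (4 * sigmoid_deriv (a * s))"
              using bd soft_ball_nonneg[OF i j] sigmoid_deriv_pos by (intro AE_I2) (simp add: less_imp_le)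
          qed
        qed (use dsi bd in auto)
        then show ?thesis using nn dsi(2) True by simp
      next
        case False
        then have "1 \<le> norm (frame m q n (p, t))" for t using norm_frame_ge[OF o, of p t] by linarith
        then have "soft_ball (real (Suc l)) i j (frame m q n (p, t)) = 0" for t
          by (simp add: soft_ball_def not_less)
        then show ?thesis using False by (simp add: H_def)
      qed
    qed
    show "AE p in lborel. (\<lambda>l. H (Suc l) p) \<longlonglongrightarrow> indicator (cone2 m q i \<inter> ball 0 1) p * (norm p / a)"
      using AE_no_ties[OF i j ij o a]
    proof eventually_elim
      case (elim p)
      have c: "a / norm p \<noteq> 0" using elim a(2) by simp
      have "(\<lambda>l. H (Suc l) p) \<longlonglongrightarrow> (LINT s|lborel. indicator (cone2 m q i \<inter> ball 0 1) p * sigmoid_deriv (a / norm p * s))"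
        unfolding H_def
      proof (rule integral_dominated_convergence[where w = "\<lambda>s. 4 * sigmoid_deriv (a * s)"])
        show "(\<lambda>s. indicator (cone2 m q i \<inter> ball 0 1) p * sigmoid_deriv (a / norm p * s)) \<in> borel_measurable lborel"
          using integral_sigmoid_deriv_scale(1)[OF c] by (intro borel_measurable_times) auto
        show "AE s in lborel. (\<lambda>l. soft_ball (real (Suc l)) i j (frame m q n (p, s / real (Suc l))))
          \<longlonglongrightarrow> indicator (cone2 m q i \<inter> ball 0 1) p * sigmoid_deriv (a / norm p * s)"
          using soft_ball_scaled_limit[OF i j ij o a, of p] elim
          by (intro AE_I2 LIMSEQ_Suc) blast
        show "AE s in lborel. norm (soft_ball (real (Suc l)) i j (frame m q n (p, s / real (Suc l)))) \<le> 4 * sigmoid_deriv (a * s)" for l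
          using soft_ball_le_sigmoid_deriv[OF i j o a, of "real (Suc l)" p] soft_ball_nonneg[OF i j]
          by (intro AE_I2) simp
      qed (use dsi fm in auto)
      moreover have "(LINT s|lborel. indicator (cone2 m q i \<inter> ball 0 1) p * sigmoid_deriv (a / norm p * s)) =
          indicator (cone2 m q i \<inter> ball 0 1) p * (norm p / a)"
        using integral_sigmoid_deriv_scale(2)[OF c] a(2) by (simp add: abs_of_pos)
      ultimately show ?case by simp
    qed
  qed
  have "(\<lambda>l. real (Suc l) * (LINT y|surface. soft_prod (real (Suc l)) i j y)) \<longlonglongrightarrow>
     3 * (LINT p|lborel. indicator (cone2 m q i \<inter> ball 0 1) p * (norm p / a))"
    unfolding eq[OF zero_less_Suc] by (intro tendsto_mult tendsto_const lim)
  then have "(\<lambda>l::nat. real l * (LINT y|surface. soft_prod (real l) i j y)) \<longlonglongrightarrow>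
     3 * (LINT p|lborel. indicator (cone2 m q i \<inter> ball 0 1) p * (norm p / a))"
    by (rule LIMSEQ_imp_Suc)
  then show ?thesis by simp
qed

end

section \<open>Edge weight against edge length\<close>

lemma orthonormal3_exists:
  assumes "norm n = 1"
  obtains m q where "orthonormal3 m q n"
proof -
  have nn: "n \<bullet> n = 1" using assms by (simp add: norm_eq_1)
  obtain m' where m': "m' \<noteq> 0" "orthogonal n m'"
    using orthogonal_to_vector_exists[of n] by auto
  define m where "m = (1 / norm m') *\<^sub>R m'"
  have mm: "m \<bullet> m = 1" using m' by (simp add: m_def power2_norm_eq_inner[symmetric] power2_eq_square)
  have mn: "m \<bullet> n = 0" using m' by (simp add: m_def orthogonal_def inner_commute)
  have "orthonormal3 m (cross3 n m) n"
    using mm mn nn by (simp add: orthonormal3_def dot_cross dot_cross_self inner_commute)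
  then show ?thesis by (rule that)
qed

lemma radial_diff_le:
  assumes u: "0 < \<rho>" "\<rho> \<le> norm u" "\<rho> \<le> norm v"
  shows "norm (radial u - radial v) \<le> norm (u - v) / \<rho>"
proof (rule power2_le_imp_le)
  have nz: "0 < norm u" "0 < norm v" using u by linarith+
  have "(norm (radial u - radial v))\<^sup>2 = 2 - 2 * (u \<bullet> v) / (norm u * norm v)"
  proof -
    have "radial u \<bullet> radial u = 1" "radial v \<bullet> radial v = 1"
      using nz by (simp_all add: radial_def power2_norm_eq_inner[symmetric] power2_eq_square)
    moreover have "radial u \<bullet> radial v = (u \<bullet> v) / (norm u * norm v)"
      by (simp add: radial_def divide_inverse mult.commute)
    ultimately show ?thesis
      by (simp add: power2_norm_eq_inner inner_diff_left inner_diff_right inner_commute)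
  qed
  also have "\<dots> = (2 * (norm u * norm v) - 2 * (u \<bullet> v)) / (norm u * norm v)"
    using nz by (simp add: diff_divide_distrib)
  also have "\<dots> \<le> (norm (u - v))\<^sup>2 / (norm u * norm v)"
  proof (rule divide_right_mono)
    have "(norm (u - v))\<^sup>2 = (norm u)\<^sup>2 + (norm v)\<^sup>2 - 2 * (u \<bullet> v)"
      by (simp add: power2_norm_eq_inner inner_diff_left inner_diff_right inner_commute)
    moreover have "2 * (norm u * norm v) \<le> (norm u)\<^sup>2 + (norm v)\<^sup>2"
      using sum_squares_bound[of "norm u" "norm v"] by (simp add: mult.assoc)
    ultimately show "2 * (norm u * norm v) - 2 * (u \<bullet> v) \<le> (norm (u - v))\<^sup>2" by linarith
  qed (use nz in simp)
  also have "\<dots> \<le> (norm (u - v))\<^sup>2 / (\<rho> * \<rho>)"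
    using u nz by (intro divide_left_mono mult_mono mult_pos_pos) auto
  finally show "(norm (radial u - radial v))\<^sup>2 \<le> (norm (u - v) / \<rho>)\<^sup>2"
    by (simp add: power_divide power2_eq_square)
qed (use u in simp)

text \<open>A triangle with apex at the origin, symmetric about the first axis. Triangles inside and
  around a circular sector replace polar coordinates in the estimate of its integral.\<close>

definition wedge :: "real \<Rightarrow> real \<Rightarrow> (real \<times> real) set"
  where "wedge \<kappa> r = {p. 0 < fst p \<and> fst p < r \<and> \<bar>snd p\<bar> \<le> \<kappa> * fst p}"

lemma integral_wedge:
  assumes "0 \<le> \<kappa>" "0 \<le> r"
  shows "integrable lborel (\<lambda>p. indicator (wedge \<kappa> r) p * fst p)"
    "(LINT p|lborel. indicator (wedge \<kappa> r) p * fst p) = 2 * \<kappa> * r ^ 3 / 3"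
proof -
  have W: "wedge \<kappa> r \<in> sets borel"
  proof -
    have "wedge \<kappa> r = {p. 0 < fst p} \<inter> {p. fst p < r} \<inter> {p. \<bar>snd p\<bar> \<le> \<kappa> * fst p}" by (auto simp: wedge_def)
    moreover have "open {p::real \<times> real. 0 < fst p}" "open {p::real \<times> real. fst p < r}"
      "closed {p::real \<times> real. \<bar>snd p\<bar> \<le> \<kappa> * fst p}"
      by (intro open_Collect_less closed_Collect_le continuous_intros)+
    ultimately show ?thesis by (auto intro!: sets.Int borel_open borel_closed)
  qed
  have fm: "(\<lambda>p::real \<times> real. fst p) \<in> borel_measurable borel"
    by (intro borel_measurable_continuous_onI continuous_intros)
  have m: "(\<lambda>p. indicator (wedge \<kappa> r) p * fst p) \<in> borel_measurable lborel"
    using W fm by (intro borel_measurable_times borel_measurable_indicator) auto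
  let ?B = "box (-1, - \<kappa> * r - 1) (r + 1, \<kappa> * r + 1) :: (real \<times> real) set"
  show int: "integrable lborel (\<lambda>p. indicator (wedge \<kappa> r) p * fst p)"
  proof (rule Bochner_Integration.integrable_bound[OF _ m])
    show "integrable lborel (\<lambda>p. r * indicator ?B p)"
      using emeasure_lborel_box_finite[of "(-1, - \<kappa> * r - 1)" "(r + 1, \<kappa> * r + 1)"]
      by (intro integrable_mult_right) simp
    show "AE p in lborel. norm (indicator (wedge \<kappa> r) p * fst p) \<le> norm (r * indicator ?B p)"
    proof (intro AE_I2)
      fix p :: "real \<times> real"
      show "norm (indicator (wedge \<kappa> r) p * fst p) \<le> norm (r * indicator ?B p)"
      proof (cases "p \<in> wedge \<kappa> r")
        case True
        then have p: "0 < fst p" "fst p < r" "\<bar>snd p\<bar> \<le> \<kappa> * fst p" by (auto simp: wedge_def)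
        have "\<kappa> * fst p \<le> \<kappa> * r" using p assms by (intro mult_left_mono) auto
        then have "p \<in> ?B" using p by (cases p) (auto simp: box_prod abs_le_iff)
        then show ?thesis using True p by simp
      qed simp
    qed
  qed
  have "(LINT p|lborel. indicator (wedge \<kappa> r) p * fst p) =
      (LINT a|lborel. (LINT b|lborel. indicator (wedge \<kappa> r) (a, b) * a))"
    using lborel_pair.integral_fst'[of "\<lambda>p. indicator (wedge \<kappa> r) p * fst p"] int by (simp add: lborel_prod)
  also have "\<dots> = (LINT a|lborel. 2 * \<kappa> * a\<^sup>2 * indicator {0..r} a)"
  proof (rule Bochner_Integration.integral_cong_AE)
    show "(\<lambda>a. LINT b|lborel. indicator (wedge \<kappa> r) (a, b) * a) \<in> borel_measurable lborel"
      using lborel_pair.integrable_fst'[of "\<lambda>p. indicator (wedge \<kappa> r) p * fst p"] int by (simp add: lborel_prod)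
    have "AE a in lborel. a \<noteq> 0 \<and> a \<noteq> r"
      using AE_lborel_singleton[of 0] AE_lborel_singleton[of r] by eventually_elim simp
    then show "AE a in lborel. (LINT b|lborel. indicator (wedge \<kappa> r) (a, b) * a) = 2 * \<kappa> * a\<^sup>2 * indicator {0..r} a"
    proof eventually_elim
      case (elim a)
      show ?case
      proof (cases "0 < a \<and> a < r")
        case True
        then have "(\<lambda>b. indicator (wedge \<kappa> r) (a, b) * a) = (\<lambda>b. a * indicator {- (\<kappa> * a)..\<kappa> * a} b)"
          by (auto simp: fun_eq_iff wedge_def indicator_def abs_le_iff)
        moreover have "- (\<kappa> * a) \<le> \<kappa> * a" using True assms by simp
        ultimately show ?thesis using True by (simp add: power2_eq_square)
      next
        case False
        then have "(\<lambda>b. indicator (wedge \<kappa> r) (a, b) * a) = (\<lambda>b. 0)"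
          by (auto simp: fun_eq_iff wedge_def indicator_def)
        then show ?thesis using False elim by (auto simp: indicator_def)
      qed
    qed
  qed simp
  also have "\<dots> = 2 * \<kappa> * r ^ 3 / 3 - 2 * \<kappa> * 0 ^ 3 / 3"
    by (rule integral_FTC_Icc_real[OF assms(2)])
      (auto intro!: derivative_eq_intros continuous_intros simp: power2_eq_square)
  finally show "(LINT p|lborel. indicator (wedge \<kappa> r) p * fst p) = 2 * \<kappa> * r ^ 3 / 3" by simp
qed

context voronoi
begin

text \<open>The planar cone over an edge with at most one point is at most a ray. Rays are null sets
  of the plane, so the limiting integral vanishes along with the length.\<close>

lemma edge_weight_degenerate:
  assumes i: "i < N" and j: "j < N" and ij: "i \<noteq> j"
    and sub: "\<And>y z. y \<in> vedge N x i j \<Longrightarrow> z \<in> vedge N x i j \<Longrightarrow> y = z"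
  shows "curve_length (vedge N x i j) = 0"
    "(\<lambda>l::nat. real l * (LINT y|surface. soft_prod (real l) i j y)) \<longlonglongrightarrow> 0"
proof -
  have "vedge N x i j = {} \<or> (\<exists>c. vedge N x i j = {c})" using sub by blast
  then show "curve_length (vedge N x i j) = 0"
    by (auto simp: curve_length_def hausdorff1_empty hausdorff1_singleton)
  define a where "a = norm (x i - x j)"
  have a: "0 < a" using sites_eq_iff[OF i j] ij by (simp add: a_def)
  define n where "n = (1 / a) *\<^sub>R (x i - x j)"
  have n: "norm n = 1" "x i - x j = a *\<^sub>R n" using a by (simp_all add: n_def a_def)
  obtain m q where o: "orthonormal3 m q n" using orthonormal3_exists[OF n(1)] .
  \<comment> \<open>For an empty edge any unit vector of the plane can play the role of the single
    point.\<close>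
  obtain c where c: "c \<in> S2" "c \<bullet> n = 0" "\<And>y. y \<in> vedge N x i j \<Longrightarrow> y = c"
  proof (cases "vedge N x i j = {}")
    case True
    then show ?thesis using that[of m] o by (auto simp: orthonormal3_def norm_eq_1)
  next
    case False
    then obtain c where c: "c \<in> vedge N x i j" by blast
    then have "c \<in> wcell i" "c \<in> wcell j" using vedge_eq[OF i j] by auto
    then have "c \<bullet> x i = c \<bullet> x j" "c \<in> S2" using i j by (auto simp: wcell_def intro: antisym)
    then show ?thesis using that[of c] sub[OF _ c] by (simp add: n_def inner_diff_right)
  qed
  have nullp: "indicator (cone2 m q i \<inter> ball 0 1) p * norm p = (0::real)"
    if p: "(- (c \<bullet> q), c \<bullet> m) \<bullet> p \<noteq> 0" for p
  proof (cases "p \<in> cone2 m q i \<and> p \<noteq> 0")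
    case True
    let ?P = "fst p *\<^sub>R m + snd p *\<^sub>R q"
    have P0: "?P = frame m q n (p, 0)" by (simp add: frame_def)
    have nP: "norm ?P = norm p"
    proof -
      have "(norm ?P)\<^sup>2 = (norm p)\<^sup>2" unfolding P0 using norm_frame[OF o, of p 0] by simp
      then show ?thesis by simp
    qed
    have pos: "0 < norm ?P" using nP True by simp
    have Pn: "?P \<bullet> n = 0" using o by (simp add: orthonormal3_def inner_add_left)
    then have "?P \<bullet> (x i - x j) = 0" by (simp add: n(2))
    then have eq: "?P \<bullet> x i = ?P \<bullet> x j" by (simp add: inner_diff_right)
    have le: "?P \<bullet> x k \<le> ?P \<bullet> x i" if "k < N" for k using True that by (simp add: cone2_def)
    have "radial ?P \<in> vedge N x i j"
      unfolding vedge_eq[OF i j]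
      using pos le eq by (auto simp: wcell_def radial_def intro!: mult_left_mono)
    then have "radial ?P = c" by (rule c(3))
    then have Pc: "?P = norm p *\<^sub>R c" using pos nP by (auto simp: radial_def)
    have "fst p = ?P \<bullet> m" "snd p = ?P \<bullet> q"
      using o by (simp_all add: orthonormal3_def inner_add_left inner_commute[of q m])
    then have "fst p = norm p * (c \<bullet> m)" "snd p = norm p * (c \<bullet> q)" unfolding Pc by simp_all
    then show ?thesis using p by (simp add: inner_prod_def)
  qed (auto simp: indicator_def)
  have "(- (c \<bullet> q), c \<bullet> m) \<noteq> 0"
  proof
    assume z: "(- (c \<bullet> q), c \<bullet> m) = 0"
    then have z': "c \<bullet> q = 0" "c \<bullet> m = 0" "c \<bullet> n = 0" using c by (auto simp: zero_prod_def)
    have ind: "independent {m, q, n, c}"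
      by (rule pairwise_orthogonal_independent)
        (use o z' c in \<open>auto simp: pairwise_def orthogonal_def orthonormal3_def inner_commute\<close>)
    have "c \<bullet> c = 1" using c by (simp add: norm_eq_1)
    then have d: "m \<noteq> q" "m \<noteq> n" "q \<noteq> n" "m \<noteq> c" "q \<noteq> c" "n \<noteq> c"
      using o z' by (auto simp: orthonormal3_def)
    then have "card {m, q, n, c} = 4" by simp
    with independent_bound[OF ind] show False by simp
  qed
  from null_line_prod[OF this]
  have "AE p in lborel. indicator (cone2 m q i \<inter> ball 0 1) p * norm p = (0::real)"
    by eventually_elim (rule nullp)
  then have "(LINT p|lborel. indicator (cone2 m q i \<inter> ball 0 1) p * norm p) = 0"
    by (rule integral_eq_zero_AE)
  with soft_prod_integral_limit[OF i j ij o n(2) a]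
  show "(\<lambda>l::nat. real l * (LINT y|surface. soft_prod (real l) i j y)) \<longlonglongrightarrow> 0" by simp
qed

end

context voronoi
begin

lemma vedge_inner_eq: "i < N \<Longrightarrow> j < N \<Longrightarrow> y \<in> vedge N x i j \<Longrightarrow> y \<bullet> x i = y \<bullet> x j"
  by (auto simp: vedge_eq wcell_def intro: antisym)

lemma vedge_coneI:
  assumes ij: "i < N" "j < N" and q: "q1 \<in> vedge N x i j" "q2 \<in> vedge N x i j"
    and c: "0 \<le> c1" "0 \<le> c2" and k: "k < N"
  shows "(c1 *\<^sub>R q1 + c2 *\<^sub>R q2) \<bullet> x k \<le> (c1 *\<^sub>R q1 + c2 *\<^sub>R q2) \<bullet> x i"
    "(c1 *\<^sub>R q1 + c2 *\<^sub>R q2) \<bullet> x i = (c1 *\<^sub>R q1 + c2 *\<^sub>R q2) \<bullet> x j"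
proof -
  have "q1 \<bullet> x k \<le> q1 \<bullet> x i" "q2 \<bullet> x k \<le> q2 \<bullet> x i"
    using q k by (auto simp: vedge_eq[OF ij] wcell_def)
  then show "(c1 *\<^sub>R q1 + c2 *\<^sub>R q2) \<bullet> x k \<le> (c1 *\<^sub>R q1 + c2 *\<^sub>R q2) \<bullet> x i"
    using c by (simp add: inner_add_left add_mono mult_left_mono)
  show "(c1 *\<^sub>R q1 + c2 *\<^sub>R q2) \<bullet> x i = (c1 *\<^sub>R q1 + c2 *\<^sub>R q2) \<bullet> x j"
    using vedge_inner_eq[OF ij q(1)] vedge_inner_eq[OF ij q(2)] by (simp add: inner_add_left)
qed

text \<open>Neither the weight nor the length is computed. With \<open>L\<close> the diameter of the
  edge and \<open>\<rho>\<^sup>2 = 1 - L\<^sup>2 / 4\<close>, the scaled weight \<open>S\<close>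
  lies between \<open>L * \<rho>\<^sup>2\<close> and \<open>L / \<rho>\<^sup>2\<close>, and the
  length between \<open>L\<close> and \<open>L / \<rho>\<close>. So they differ by at most
  \<open>L\<^sup>2\<close>, while \<open>L\<close> is at most twice the mesh size.\<close>

lemma edge_weight_nondegenerate:
  assumes i: "i < N" and j: "j < N" and ij: "i \<noteq> j" and h: "mesh_size N x \<le> 1/8"
    and yz: "y0 \<in> vedge N x i j" "z0 \<in> vedge N x i j" "y0 \<noteq> z0"
  obtains T where "(\<lambda>l::nat. real l * (LINT y|surface. soft_prod (real l) i j y)) \<longlonglongrightarrow> T" "0 \<le> T"
    "\<bar>T * norm (x i - x j) - curve_length (vedge N x i j)\<bar> \<le> 4 * (mesh_size N x)\<^sup>2"
    "0 < curve_length (vedge N x i j)"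
proof -
  let ?A = "vedge N x i j" and ?h = "mesh_size N x"
  have Aeq: "?A = wcell i \<inter> wcell j" by (rule vedge_eq[OF i j])
  have AS: "?A \<subseteq> S2" unfolding Aeq by (auto simp: wcell_def)
  have cA: "compact ?A"
    unfolding compact_eq_bounded_closed
  proof
    show "bounded ?A" by (rule bounded_subset[OF bounded_sphere AS])
    show "closed ?A" unfolding Aeq by (intro closed_Int closed_wcell)
  qed
  \<comment> \<open>A pair at maximal distance serves as the end points of the edge, before the edge
    is known to be an arc.\<close>
  have "\<exists>p\<in>?A \<times> ?A. \<forall>p'\<in>?A \<times> ?A. norm (fst p' - snd p') \<le> norm (fst p - snd p)"
  proof (rule continuous_attains_sup)
    show "compact (?A \<times> ?A)" by (rule compact_Times[OF cA cA])
    show "?A \<times> ?A \<noteq> {}" using yz by blast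
    show "continuous_on (?A \<times> ?A) (\<lambda>p. norm (fst p - snd p))" by (intro continuous_intros)
  qed
  then obtain p where p: "p \<in> ?A \<times> ?A" "\<forall>p'\<in>?A \<times> ?A. norm (fst p' - snd p') \<le> norm (fst p - snd p)" ..
  define q1 where "q1 = fst p"
  define q2 where "q2 = snd p"
  define L where "L = norm (q1 - q2)"
  have q: "q1 \<in> ?A" "q2 \<in> ?A" using p(1) by (simp_all add: q1_def q2_def mem_Times_iff)
  have qmax: "norm (y - z) \<le> L" if "y \<in> ?A" "z \<in> ?A" for y z
    using p(2)[rule_format, of "(y, z)"] that by (simp add: L_def q1_def q2_def)
  have L0: "0 < L"   proof -
    have "0 < norm (y0 - z0)" using yz(3) by simp
    then show ?thesis using qmax[OF yz(1,2)] by linarith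
  qed
  have Lh: "L \<le> 2 * ?h"
  proof -
    have "norm (q1 - x i) \<le> ?h" "norm (q2 - x i) \<le> ?h"
      using q norm_wcell_le[OF i] unfolding Aeq by auto
    then show ?thesis using norm_triangle_ineq4[of "q1 - x i" "q2 - x i"] by (simp add: L_def)
  qed
  have L1: "L \<le> 1/4" using Lh h by linarith
  have L2: "L\<^sup>2 \<le> 1/16"
  proof -
    have "L\<^sup>2 \<le> (1/4)\<^sup>2" using L0 L1 by (intro power_mono) auto
    then show ?thesis by (simp add: power2_eq_square)
  qed
  define \<rho> where "\<rho> = sqrt (1 - L\<^sup>2 / 4)"
  have \<rho>2: "\<rho>\<^sup>2 = 1 - L\<^sup>2 / 4" using L2 by (simp add: \<rho>_def)
  have \<rho>0: "0 < \<rho>" using L2 by (simp add: \<rho>_def)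
  have qS: "q1 \<in> S2" "q2 \<in> S2" using q AS by auto
  have q11: "q1 \<bullet> q1 = 1" "q2 \<bullet> q2 = 1" using qS S2_inner_self by auto
  have q12: "q1 \<bullet> q2 = 1 - L\<^sup>2 / 2" using S2_inner_eq_norm[OF qS] by (simp add: L_def)
  define a where "a = norm (x i - x j)"
  have a: "0 < a" using sites_eq_iff[OF i j] ij by (simp add: a_def)
  define n where "n = (1 / a) *\<^sub>R (x i - x j)"
  have n: "norm n = 1" "x i - x j = a *\<^sub>R n" using a by (simp_all add: n_def a_def)
  have qn: "q1 \<bullet> n = 0" "q2 \<bullet> n = 0"
    using vedge_inner_eq[OF i j q(1)] vedge_inner_eq[OF i j q(2)] by (simp_all add: n_def inner_diff_right)
  define m where "m = (1 / (2 * \<rho>)) *\<^sub>R (q1 + q2)"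
  define r where "r = (1 / L) *\<^sub>R (q2 - q1)"
  have o: "orthonormal3 m r n"
    unfolding orthonormal3_def
  proof (intro conjI)
    have "(q1 + q2) \<bullet> (q1 + q2) = 4 * \<rho>\<^sup>2"
      using q11 q12 by (simp add: inner_add_left inner_add_right inner_commute \<rho>2)
    then show "m \<bullet> m = 1" using \<rho>0 by (simp add: m_def power2_eq_square)
    have "(q2 - q1) \<bullet> (q2 - q1) = L\<^sup>2" by (simp add: L_def norm_minus_commute dot_square_norm)
    then show "r \<bullet> r = 1" using L0 by (simp add: r_def power2_eq_square)
    show "n \<bullet> n = 1" using n(1) by (simp add: norm_eq_1)
    have "(q1 + q2) \<bullet> (q2 - q1) = 0"
      using q11 by (simp add: inner_add_left inner_diff_right inner_commute[of q2 q1])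
    then show "m \<bullet> r = 0" by (simp add: m_def r_def)
    show "m \<bullet> n = 0" "r \<bullet> n = 0" using qn by (simp_all add: m_def r_def inner_add_left inner_diff_left)
  qed
  have mm: "m \<bullet> m = 1" "r \<bullet> r = 1" "m \<bullet> r = 0" "r \<bullet> m = 0" "m \<bullet> n = 0" "r \<bullet> n = 0"
    using o by (auto simp: orthonormal3_def inner_commute)
  have q1e: "q1 = \<rho> *\<^sub>R m - (L / 2) *\<^sub>R r" and q2e: "q2 = \<rho> *\<^sub>R m + (L / 2) *\<^sub>R r"
  proof -
    have "\<rho> *\<^sub>R m = (1/2) *\<^sub>R (q1 + q2)" using \<rho>0 by (simp add: m_def)
    moreover have "(L / 2) *\<^sub>R r = (1/2) *\<^sub>R (q2 - q1)" using L0 by (simp add: r_def)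
    moreover have "q1 = (1/2) *\<^sub>R (q1 + q2) - (1/2) *\<^sub>R (q2 - q1)"
      "q2 = (1/2) *\<^sub>R (q1 + q2) + (1/2) *\<^sub>R (q2 - q1)"
      by (simp_all add: vec_eq_iff field_simps)
    ultimately show "q1 = \<rho> *\<^sub>R m - (L / 2) *\<^sub>R r" "q2 = \<rho> *\<^sub>R m + (L / 2) *\<^sub>R r" by simp_all
  qed
  \<comment> \<open>The tangent of half the angle between \<open>q1\<close> and
    \<open>q2\<close>.\<close>
  define \<kappa> where "\<kappa> = L / (2 * \<rho>)"
  have \<kappa>0: "0 \<le> \<kappa>" using L0 \<rho>0 by (simp add: \<kappa>_def)
  have \<kappa>2: "1 + \<kappa>\<^sup>2 = 1 / \<rho>\<^sup>2"
  proof -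
    have "(1 + \<kappa>\<^sup>2) * \<rho>\<^sup>2 = \<rho>\<^sup>2 + L\<^sup>2 / 4" using \<rho>0 by (simp add: \<kappa>_def power_divide power_mult_distrib field_simps)
    also have "\<dots> = 1" by (simp add: \<rho>2)
    finally show ?thesis using \<rho>0 by (simp add: field_simps)
  qed
  have nP: "norm (fst p *\<^sub>R m + snd p *\<^sub>R r) = norm p" for p
  proof -
    have "(norm (fst p *\<^sub>R m + snd p *\<^sub>R r))\<^sup>2 = (norm p)\<^sup>2"
      using norm_frame[OF o, of p 0] by (simp add: frame_def)
    then show ?thesis by simp
  qed
  have np2: "(norm p)\<^sup>2 = (fst p)\<^sup>2 + (snd p)\<^sup>2" for p :: "real \<times> real"
    by (simp add: norm_prod_def)
  have comb: "\<exists>c1 c2. 0 \<le> c1 \<and> 0 \<le> c2 \<and> \<alpha> *\<^sub>R m + \<beta> *\<^sub>R r = c1 *\<^sub>R q1 + c2 *\<^sub>R q2"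
    if "\<bar>\<beta>\<bar> \<le> \<kappa> * \<alpha>" for \<alpha> \<beta>
  proof (intro exI conjI)
    have b: "\<bar>\<beta>\<bar> / L \<le> \<alpha> / (2 * \<rho>)"
      using that L0 \<rho>0 by (simp add: \<kappa>_def field_simps)
    then show "0 \<le> \<alpha> / (2 * \<rho>) - \<beta> / L" "0 \<le> \<alpha> / (2 * \<rho>) + \<beta> / L"
    proof -
      have "\<bar>\<beta> / L\<bar> \<le> \<alpha> / (2 * \<rho>)" using b L0 by (simp add: abs_divide)
      then show "0 \<le> \<alpha> / (2 * \<rho>) - \<beta> / L" "0 \<le> \<alpha> / (2 * \<rho>) + \<beta> / L" by linarith+
    qed
    show "\<alpha> *\<^sub>R m + \<beta> *\<^sub>R r = (\<alpha> / (2 * \<rho>) - \<beta> / L) *\<^sub>R q1 + (\<alpha> / (2 * \<rho>) + \<beta> / L) *\<^sub>R q2"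
    proof -
      have "(\<alpha> / (2 * \<rho>) - \<beta> / L) * \<rho> + (\<alpha> / (2 * \<rho>) + \<beta> / L) * \<rho> = \<alpha>"
        "(\<alpha> / (2 * \<rho>) + \<beta> / L) * (L / 2) - (\<alpha> / (2 * \<rho>) - \<beta> / L) * (L / 2) = \<beta>"
        using L0 \<rho>0 by (simp_all add: field_simps)
      moreover have "c *\<^sub>R q1 + d *\<^sub>R q2 =
        (c * \<rho> + d * \<rho>) *\<^sub>R m + (d * (L / 2) - c * (L / 2)) *\<^sub>R r" for c d
        unfolding q1e q2e by (simp add: algebra_simps)
      ultimately show ?thesis by simp
    qed
  qed
  have in_edge: "\<alpha> *\<^sub>R m + \<beta> *\<^sub>R r \<in> ?A" if b: "\<bar>\<beta>\<bar> \<le> \<kappa> * \<alpha>" and u: "\<alpha>\<^sup>2 + \<beta>\<^sup>2 = 1" for \<alpha> \<beta>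
  proof -
    obtain c1 c2 where c: "0 \<le> c1" "0 \<le> c2" "\<alpha> *\<^sub>R m + \<beta> *\<^sub>R r = c1 *\<^sub>R q1 + c2 *\<^sub>R q2"
      using comb[OF b] by blast
    have "norm (\<alpha> *\<^sub>R m + \<beta> *\<^sub>R r) = 1"
    proof -
      have "(norm (\<alpha> *\<^sub>R m + \<beta> *\<^sub>R r))\<^sup>2 = 1" using nP[of "(\<alpha>, \<beta>)"] np2[of "(\<alpha>, \<beta>)"] u by simp
      then show ?thesis by (simp add: power2_eq_1_iff) (metis norm_ge_zero not_one_le_zero neg_0_le_iff_le)
    qed
    then show ?thesis unfolding Aeq wcell_def
      using vedge_coneI[OF i j q c(1,2)] unfolding c(3) by auto
  qed
  have edge_form: "y = (y \<bullet> m) *\<^sub>R m + (y \<bullet> r) *\<^sub>R r \<and> \<rho> \<le> y \<bullet> m \<and> \<bar>y \<bullet> r\<bar> \<le> \<kappa> * (y \<bullet> m)" if y: "y \<in> ?A" for y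
  proof -
    have yS: "y \<in> S2" using y AS by auto
    have yn: "y \<bullet> n = 0" using vedge_inner_eq[OF i j y] by (simp add: n_def inner_diff_right)
    define c where "c = y - (y \<bullet> m) *\<^sub>R m - (y \<bullet> r) *\<^sub>R r"
    have perp: "m \<bullet> c = 0" "r \<bullet> c = 0" "n \<bullet> c = 0"
      using mm yn by (simp_all add: c_def inner_diff_right inner_commute)
    have "c = 0"
    proof (rule ccontr)
      assume c0: "c \<noteq> 0"
      have ind: "independent {m, r, n, c}"
        by (rule pairwise_orthogonal_independent)
          (use o perp c0 in \<open>auto simp: pairwise_def orthogonal_def orthonormal3_def inner_commute\<close>)
      have d: "m \<noteq> r" "m \<noteq> n" "r \<noteq> n" "m \<noteq> c" "r \<noteq> c" "n \<noteq> c"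
        using o perp by (auto simp: orthonormal3_def)
      then have "card {m, r, n, c} = 4" by simp
      with independent_bound[OF ind] show False by simp
    qed
    then have ye: "y = (y \<bullet> m) *\<^sub>R m + (y \<bullet> r) *\<^sub>R r"
      unfolding c_def by (simp only: diff_eq_eq add_0_left add.commute)
    define \<alpha> where "\<alpha> = y \<bullet> m"
    define \<beta> where "\<beta> = y \<bullet> r"
    have ab: "\<alpha>\<^sup>2 + \<beta>\<^sup>2 = 1"
    proof -
      have "y \<bullet> y = ((y \<bullet> m) *\<^sub>R m + (y \<bullet> r) *\<^sub>R r) \<bullet> ((y \<bullet> m) *\<^sub>R m + (y \<bullet> r) *\<^sub>R r)"
        using ye by (rule arg_cong[where f = "\<lambda>v. v \<bullet> v"])
      then have "1 = ((y \<bullet> m) *\<^sub>R m + (y \<bullet> r) *\<^sub>R r) \<bullet> ((y \<bullet> m) *\<^sub>R m + (y \<bullet> r) *\<^sub>R r)"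
        using S2_inner_self[OF yS] by simp
      then show ?thesis unfolding \<alpha>_def[symmetric] \<beta>_def[symmetric]
        by (simp add: inner_add_left inner_add_right mm power2_eq_square)
    qed
    have dots: "1 - L\<^sup>2 / 2 \<le> y \<bullet> z" if z: "z \<in> ?A" for z
    proof -
      have "(norm (y - z))\<^sup>2 \<le> L\<^sup>2" using qmax[OF y z] by (intro power_mono) auto
      then show ?thesis using S2_inner_eq_norm[OF yS] z AS by (auto simp: subset_iff)
    qed
    have d1: "1 - L\<^sup>2 / 2 \<le> \<rho> * \<alpha> - L / 2 * \<beta>" using dots[OF q(1)] by (simp add: q1e inner_diff_right \<alpha>_def \<beta>_def)
    have d2: "1 - L\<^sup>2 / 2 \<le> \<rho> * \<alpha> + L / 2 * \<beta>" using dots[OF q(2)] by (simp add: q2e inner_add_right \<alpha>_def \<beta>_def)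
    have "0 < \<rho> * \<alpha>" using d1 d2 L2 by linarith
    then have \<alpha>0: "0 < \<alpha>" using \<rho>0 by (simp add: zero_less_mult_iff)
    have d3: "1 - L\<^sup>2 / 2 \<le> \<rho> * \<alpha> - L / 2 * \<bar>\<beta>\<bar>" using d1 d2 by (auto simp: abs_if)
    \<comment> \<open>A point beyond one end of the arc would be farther than \<open>L\<close> from
      the other end, against \<open>d3\<close>, which bounds the smaller of the two inner products
      with the end points from below.\<close>
    have bL: "\<bar>\<beta>\<bar> \<le> L / 2"
    proof (rule ccontr)
      assume "\<not> \<bar>\<beta>\<bar> \<le> L / 2"
      then have g: "L / 2 < \<bar>\<beta>\<bar>" by simp
      then have "(L / 2)\<^sup>2 < \<bar>\<beta>\<bar>\<^sup>2" using L0 by (intro power_strict_mono) auto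
      then have "\<alpha>\<^sup>2 < \<rho>\<^sup>2" using ab \<rho>2 by (simp add: power_divide)
      then have "\<alpha> < \<rho>" using \<rho>0 power_less_imp_less_base[of \<alpha> 2 \<rho>] by simp
      then have "\<rho> * \<alpha> < \<rho> * \<rho>" using \<rho>0 by simp
      moreover have "L / 2 * (L / 2) < L / 2 * \<bar>\<beta>\<bar>" using g L0 by (intro mult_strict_left_mono) auto
      ultimately show False using d3 \<rho>2 by (simp add: power2_eq_square)
    qed
    then have "\<bar>\<beta>\<bar>\<^sup>2 \<le> (L / 2)\<^sup>2" by (intro power_mono) auto
    then have "\<rho>\<^sup>2 \<le> \<alpha>\<^sup>2" using ab \<rho>2 by (simp add: power_divide)
    then have ra: "\<rho> \<le> \<alpha>" using \<alpha>0 by (simp add: power2_le_iff_abs_le abs_le_square_iff \<rho>0 less_imp_le)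
    have "\<kappa> * \<rho> = L / 2" using \<rho>0 by (simp add: \<kappa>_def)
    then have "\<bar>\<beta>\<bar> \<le> \<kappa> * \<alpha>" using bL mult_left_mono[OF ra \<kappa>0] by linarith
    then show ?thesis using ye ra by (simp add: \<alpha>_def \<beta>_def)
  qed
  define S where "S = 3 * (LINT p|lborel. indicator (cone2 m r i \<inter> ball 0 1) p * norm p)"
  have cc: "cone2 m r i \<inter> ball 0 1 \<in> sets borel"
  proof -
    have "cone2 m r i = (\<Inter>k\<in>{..<N}. {p. (fst p *\<^sub>R m + snd p *\<^sub>R r) \<bullet> x k \<le> (fst p *\<^sub>R m + snd p *\<^sub>R r) \<bullet> x i})"
      by (auto simp: cone2_def)
    then have "closed (cone2 m r i)" by (auto intro!: closed_INT closed_Collect_le continuous_intros)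
    then show ?thesis by (intro sets.Int borel_closed borel_open) auto
  qed
  have iS: "integrable lborel (\<lambda>p. indicator (cone2 m r i \<inter> ball 0 1) p * norm p :: real)"
  proof (rule Bochner_Integration.integrable_bound)
    show "integrable lborel (indicator (ball 0 1) :: real \<times> real \<Rightarrow> real)"
      using emeasure_lborel_ball_finite[of "0::real \<times> real" 1] by simp
    show "(\<lambda>p. indicator (cone2 m r i \<inter> ball 0 1) p * norm p :: real) \<in> borel_measurable lborel"
      using cc by (intro borel_measurable_times borel_measurable_indicator) auto
    show "AE p in lborel. norm (indicator (cone2 m r i \<inter> ball 0 1) p * norm p :: real) \<le> norm (indicator (ball 0 1) p :: real)"
      by (intro AE_I2) (auto simp: indicator_def)
  qed
  have lowS: "L * \<rho>\<^sup>2 \<le> S"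
  proof -
    have "(LINT p|lborel. indicator (wedge \<kappa> \<rho>) p * fst p) \<le> (LINT p|lborel. indicator (cone2 m r i \<inter> ball 0 1) p * norm p)"
    proof (rule integral_mono[OF integral_wedge(1) iS])
      fix p :: "real \<times> real"
      show "indicator (wedge \<kappa> \<rho>) p * fst p \<le> indicator (cone2 m r i \<inter> ball 0 1) p * norm p"
      proof (cases "p \<in> wedge \<kappa> \<rho>")
        case True
        then have p: "0 < fst p" "fst p < \<rho>" "\<bar>snd p\<bar> \<le> \<kappa> * fst p" by (auto simp: wedge_def)
        obtain c1 c2 where c: "0 \<le> c1" "0 \<le> c2" "fst p *\<^sub>R m + snd p *\<^sub>R r = c1 *\<^sub>R q1 + c2 *\<^sub>R q2"
          using comb[OF p(3)] by blast
        have "p \<in> cone2 m r i" unfolding cone2_def mem_Collect_eq c(3) using vedge_coneI(1)[OF i j q c(1,2)] by simp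
        moreover have "norm p < 1"
        proof -
          have "\<bar>snd p\<bar>\<^sup>2 \<le> (\<kappa> * fst p)\<^sup>2" using p by (intro power_mono) auto
          then have "(norm p)\<^sup>2 \<le> (fst p)\<^sup>2 * (1 + \<kappa>\<^sup>2)" by (simp add: np2 power_mult_distrib algebra_simps)
          also have "\<dots> = (fst p)\<^sup>2 / \<rho>\<^sup>2" by (simp add: \<kappa>2)
          also have "\<dots> < 1" using p \<rho>0 power_strict_mono[of "fst p" \<rho> 2] by simp
          finally show ?thesis by (simp add: power_less_one_iff)
        qed
        moreover have "fst p \<le> norm p" using norm_fst_le[of "fst p" "snd p"] by simp
        ultimately show ?thesis using True by simp
      qed simp
    qed (use \<kappa>0 \<rho>0 in auto)
    also have "(LINT p|lborel. indicator (wedge \<kappa> \<rho>) p * fst p) = 2 * \<kappa> * \<rho> ^ 3 / 3"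
      using \<kappa>0 \<rho>0 by (intro integral_wedge) auto
    finally have "2 * \<kappa> * \<rho> ^ 3 \<le> S" by (simp add: S_def)
    moreover have "2 * \<kappa> * \<rho> ^ 3 = L * \<rho>\<^sup>2" using \<rho>0 by (simp add: \<kappa>_def power3_eq_cube power2_eq_square)
    ultimately show ?thesis by simp
  qed
  have upS: "S \<le> L / \<rho>\<^sup>2"
  proof -
    have "(LINT p|lborel. indicator (cone2 m r i \<inter> ball 0 1) p * norm p) \<le> (LINT p|lborel. (1 / \<rho>) * (indicator (wedge \<kappa> 1) p * fst p))"
    proof (rule integral_mono[OF iS])
      show "integrable lborel (\<lambda>p. (1 / \<rho>) * (indicator (wedge \<kappa> 1) p * fst p))"
        using integral_wedge(1)[OF \<kappa>0, of 1] by (intro integrable_mult_right) simp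
      fix p :: "real \<times> real"
      show "indicator (cone2 m r i \<inter> ball 0 1) p * norm p \<le> (1 / \<rho>) * (indicator (wedge \<kappa> 1) p * fst p)"
      proof (cases "p \<in> cone2 m r i \<and> norm p < 1 \<and> p \<noteq> 0")
        case True
        let ?P = "fst p *\<^sub>R m + snd p *\<^sub>R r"
        have np: "0 < norm p" using True by simp
        have "?P \<bullet> n = 0" using mm by (simp add: inner_add_left)
        then have "?P \<bullet> (x i - x j) = 0" by (simp add: n(2))
        then have eq: "?P \<bullet> x i = ?P \<bullet> x j" by (simp add: inner_diff_right)
        have le: "?P \<bullet> x k \<le> ?P \<bullet> x i" if "k < N" for k using True that by (simp add: cone2_def)
        have pos: "0 < norm ?P" using np by (simp add: nP)
        have rA: "radial ?P \<in> ?A"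
          unfolding Aeq using pos le eq by (auto simp: wcell_def radial_def intro!: mult_left_mono)
        have comps: "radial ?P \<bullet> m = fst p / norm p" "radial ?P \<bullet> r = snd p / norm p"
          by (simp_all add: radial_def nP inner_add_left mm divide_inverse mult.commute)
        from edge_form[OF rA] have e: "\<rho> \<le> fst p / norm p" "\<bar>snd p / norm p\<bar> \<le> \<kappa> * (fst p / norm p)"
          unfolding comps by auto
        have f: "\<rho> * norm p \<le> fst p" using e(1) np by (simp add: pos_le_divide_eq)
        have s: "\<bar>snd p\<bar> \<le> \<kappa> * fst p" using e(2) np by (simp add: divide_simps)
        have "0 < \<rho> * norm p" using \<rho>0 np by simp
        then have f0: "0 < fst p" using f by linarith
        have "fst p \<le> norm p" using norm_fst_le[of "fst p" "snd p"] by simp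
        then have "fst p < 1" using True by linarith
        then have "p \<in> wedge \<kappa> 1" using f0 s by (simp add: wedge_def)
        moreover have "norm p \<le> (1 / \<rho>) * fst p" using f \<rho>0 by (simp add: field_simps)
        ultimately show ?thesis using True by simp
      next
        case False
        then have "indicator (cone2 m r i \<inter> ball 0 1) p * norm p = (0::real)" by (auto simp: indicator_def)
        moreover have "0 \<le> (1 / \<rho>) * (indicator (wedge \<kappa> 1) p * fst p)"
          using \<rho>0 by (auto simp: indicator_def wedge_def)
        ultimately show ?thesis by linarith
      qed
    qed
    also have "\<dots> = (1 / \<rho>) * (2 * \<kappa> * 1 ^ 3 / 3)"
      using integral_wedge(2)[OF \<kappa>0 zero_le_one] by (simp only: integral_mult_right_zero)
    finally have "S \<le> (1 / \<rho>) * (2 * \<kappa>)" by (simp add: S_def)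
    also have "\<dots> = L / \<rho>\<^sup>2" using \<rho>0 by (simp add: \<kappa>_def power2_eq_square)
    finally show ?thesis .
  qed
  have lowH: "ennreal L \<le> hausdorff1 ?A"
  proof -
    have "ennreal (L / 2 - (- (L / 2))) \<le> hausdorff1 ?A"
    proof (rule hausdorff1_ge_projection[where f = "\<lambda>y. y \<bullet> r"])
      show "\<bar>y \<bullet> r - z \<bullet> r\<bar> \<le> dist y z" for y z
      proof -
        have "\<bar>(y - z) \<bullet> r\<bar> \<le> norm (y - z) * norm r" by (rule Cauchy_Schwarz_ineq2)
        moreover have "norm r = 1" using mm by (simp add: norm_eq_1)
        ultimately show ?thesis by (simp add: inner_diff_left dist_norm)
      qed
      show "{- (L / 2)..L / 2} \<subseteq> (\<lambda>y. y \<bullet> r) ` ?A"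
      proof
        fix \<beta> assume "\<beta> \<in> {- (L / 2)..L / 2}"
        then have b: "\<bar>\<beta>\<bar> \<le> L / 2" by (auto simp: abs_le_iff)
        then have "\<bar>\<beta>\<bar>\<^sup>2 \<le> (L / 2)\<^sup>2" by (intro power_mono) auto
        then have b2: "\<beta>\<^sup>2 \<le> L\<^sup>2 / 4" by (simp add: power_divide)
        define \<alpha> where "\<alpha> = sqrt (1 - \<beta>\<^sup>2)"
        have \<alpha>2: "\<alpha>\<^sup>2 + \<beta>\<^sup>2 = 1" using b2 L2 by (simp add: \<alpha>_def)
        have "\<rho> \<le> \<alpha>" unfolding \<rho>_def \<alpha>_def using b2 by simp
        moreover have "\<kappa> * \<rho> = L / 2" using \<rho>0 by (simp add: \<kappa>_def)
        ultimately have "\<bar>\<beta>\<bar> \<le> \<kappa> * \<alpha>" using b mult_left_mono[of \<rho> \<alpha> \<kappa>] \<kappa>0 by linarith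
        from in_edge[OF this \<alpha>2] show "\<beta> \<in> (\<lambda>y. y \<bullet> r) ` ?A"
          by (intro image_eqI[of _ _ "\<alpha> *\<^sub>R m + \<beta> *\<^sub>R r"]) (simp_all add: inner_add_left mm)
      qed
    qed (use L0 in simp)
    then show ?thesis by simp
  qed
  have upH: "hausdorff1 ?A \<le> ennreal (L / \<rho>)"
  proof -
    \<comment> \<open>Radial projection of the chord from \<open>q1\<close> to \<open>q2\<close>.
      The chord keeps distance at least \<open>\<rho>\<close> from the origin, so projection
      stretches it by at most \<open>1 / \<rho>\<close>.\<close>
    define g where "g t = radial (\<rho> *\<^sub>R m + ((t - 1/2) * L) *\<^sub>R r)" for t
    have nb: "\<rho> \<le> norm (\<rho> *\<^sub>R m + s *\<^sub>R r)" for s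
      using nP[of "(\<rho>, s)"] norm_fst_le[of \<rho> s] \<rho>0 by simp
    have "?A \<subseteq> g ` {0..1}"
    proof
      fix y assume y: "y \<in> ?A"
      define \<alpha> where "\<alpha> = y \<bullet> m"
      define \<beta> where "\<beta> = y \<bullet> r"
      have f: "y = \<alpha> *\<^sub>R m + \<beta> *\<^sub>R r" "\<rho> \<le> \<alpha>" "\<bar>\<beta>\<bar> \<le> \<kappa> * \<alpha>"
        using edge_form[OF y] by (auto simp: \<alpha>_def \<beta>_def)
      have \<alpha>0: "0 < \<alpha>" using f(2) \<rho>0 by linarith
      define t where "t = \<beta> * \<rho> / (\<alpha> * L) + 1/2"
      have "\<bar>\<beta>\<bar> * \<rho> \<le> \<alpha> * L / 2"
        using mult_right_mono[OF f(3), of \<rho>] \<rho>0 by (simp add: \<kappa>_def field_simps)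
      then have "\<bar>\<beta> * \<rho> / (\<alpha> * L)\<bar> \<le> 1/2" using \<alpha>0 L0 \<rho>0 by (simp add: abs_mult field_simps)
      then have "0 \<le> t" "t \<le> 1" unfolding t_def by linarith+
      then have t: "t \<in> {0..1}" by simp
      have "(t - 1/2) * L = \<beta> * \<rho> / \<alpha>" using \<alpha>0 L0 by (simp add: t_def)
      then have "\<rho> *\<^sub>R m + ((t - 1/2) * L) *\<^sub>R r = (\<rho> / \<alpha>) *\<^sub>R y"
        using \<alpha>0 by (simp add: f(1) scaleR_add_right)
      moreover have "norm y = 1" using y AS by auto
      ultimately have "g t = y" using \<alpha>0 \<rho>0 by (simp add: g_def radial_def)
      then show "y \<in> g ` {0..1}" using t by blast
    qed
    then have "hausdorff1 ?A \<le> hausdorff1 (g ` {0..1})" by (rule hausdorff1_mono)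
    also have "\<dots> \<le> ennreal (L / \<rho>)"
    proof (rule hausdorff1_lipschitz_image_le)
      fix s t :: real
      have "norm (g s - g t) \<le> norm ((\<rho> *\<^sub>R m + ((s - 1/2) * L) *\<^sub>R r) - (\<rho> *\<^sub>R m + ((t - 1/2) * L) *\<^sub>R r)) / \<rho>"
        unfolding g_def by (rule radial_diff_le[OF \<rho>0 nb nb])
      also have "(\<rho> *\<^sub>R m + ((s - 1/2) * L) *\<^sub>R r) - (\<rho> *\<^sub>R m + ((t - 1/2) * L) *\<^sub>R r) = ((s - t) * L) *\<^sub>R r"
        by (simp add: algebra_simps flip: scaleR_diff_left)
      also have "norm (((s - t) * L) *\<^sub>R r) = \<bar>s - t\<bar> * L"
        using mm L0 by (simp add: abs_mult norm_eq_1)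
      finally show "dist (g s) (g t) \<le> L / \<rho> * \<bar>s - t\<bar>" by (simp add: dist_norm mult.commute)
    qed (use L0 \<rho>0 in simp)
    finally show ?thesis .
  qed
  have cl: "L \<le> curve_length ?A" "curve_length ?A \<le> L / \<rho>"
  proof -
    have fin: "hausdorff1 ?A < top" using upH by (rule le_less_trans) simp
    show "L \<le> curve_length ?A"
      using enn2real_mono[OF lowH fin] L0 by (simp add: curve_length_def)
    show "curve_length ?A \<le> L / \<rho>"
      using enn2real_mono[OF upH] L0 \<rho>0 by (simp add: curve_length_def)
  qed
  have \<rho>1: "\<rho> \<le> 1" using \<rho>2 L2 by (simp add: \<rho>_def)
  have gap: "L / \<rho>\<^sup>2 - L * \<rho>\<^sup>2 \<le> L\<^sup>2"
  proof -
    have r2: "1/2 \<le> \<rho>\<^sup>2" using \<rho>2 L2 by simp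
    have "1 - \<rho>\<^sup>2 * \<rho>\<^sup>2 \<le> L\<^sup>2 / 2"
    proof -
      have "\<rho>\<^sup>2 * \<rho>\<^sup>2 = 1 - L\<^sup>2 / 2 + (L\<^sup>2 / 4)\<^sup>2" unfolding \<rho>2 by (simp add: power2_eq_square algebra_simps)
      then show ?thesis by simp
    qed
    then have "L * (1 - \<rho>\<^sup>2 * \<rho>\<^sup>2) \<le> L * (L\<^sup>2 / 2)" using L0 by (intro mult_left_mono) auto
    also have "\<dots> \<le> 1 * (L\<^sup>2 / 2)" using L1 by (intro mult_right_mono) auto
    also have "\<dots> \<le> L\<^sup>2 * \<rho>\<^sup>2" using mult_left_mono[OF r2, of "L\<^sup>2"] by simp
    finally have "L * (1 - \<rho>\<^sup>2 * \<rho>\<^sup>2) / \<rho>\<^sup>2 \<le> L\<^sup>2" using \<rho>0 by (simp add: pos_divide_le_eq)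
    moreover have "L * (1 - \<rho>\<^sup>2 * \<rho>\<^sup>2) / \<rho>\<^sup>2 = L / \<rho>\<^sup>2 - L * \<rho>\<^sup>2" using \<rho>0 by (simp add: field_simps)
    ultimately show ?thesis by simp
  qed
  have "L / \<rho> \<le> L / \<rho>\<^sup>2"
    using L0 \<rho>0 \<rho>1 by (intro divide_left_mono) (auto simp: power2_eq_square mult_le_cancel_left1)
  moreover have "L * \<rho>\<^sup>2 \<le> L" using L0 \<rho>1 \<rho>0 by (simp add: mult_le_cancel_left1 power_le_one)
  ultimately have close: "\<bar>S - curve_length ?A\<bar> \<le> L\<^sup>2" using lowS upS cl gap by linarith
  have "L\<^sup>2 \<le> (2 * ?h)\<^sup>2" using Lh L0 by (intro power_mono) auto
  then have L2h: "L\<^sup>2 \<le> 4 * ?h\<^sup>2" by (simp add: power_mult_distrib)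
  show ?thesis
  proof (rule that[of "S / a"])
    show "(\<lambda>l::nat. real l * (LINT y|surface. soft_prod (real l) i j y)) \<longlonglongrightarrow> S / a"
      using soft_prod_integral_limit[OF i j ij o n(2) a] by (simp add: S_def)
    have "0 \<le> S" using lowS L0 by (meson mult_nonneg_nonneg less_imp_le order_trans zero_le_power2)
    then show "0 \<le> S / a" using a by simp
    show "\<bar>S / a * norm (x i - x j) - curve_length ?A\<bar> \<le> 4 * ?h\<^sup>2"
      using close L2h a by (simp add: a_def[symmetric])
    show "0 < curve_length ?A" using cl(1) L0 by linarith
  qed
qed

lemma edge_weight_limit:
  assumes i: "i < N" and j: "j < N" and ij: "i \<noteq> j" and h: "mesh_size N x \<le> 1/8"
  obtains T where "(\<lambda>l::nat. real l * (LINT y|surface. soft_prod (real l) i j y)) \<longlonglongrightarrow> T" "0 \<le> T"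
    "\<bar>T * norm (x i - x j) - curve_length (vedge N x i j)\<bar> \<le> 4 * (mesh_size N x)\<^sup>2"
    "j \<notin> neighbors N x i \<Longrightarrow> T = 0"
proof (cases "\<forall>y\<in>vedge N x i j. \<forall>z\<in>vedge N x i j. y = z")
  case True
  from edge_weight_degenerate[OF i j ij] True show ?thesis by (intro that[of 0]) auto
next
  case False
  then obtain y z where yz: "y \<in> vedge N x i j" "z \<in> vedge N x i j" "y \<noteq> z" by blast
  obtain T where "(\<lambda>l::nat. real l * (LINT y|surface. soft_prod (real l) i j y)) \<longlonglongrightarrow> T" "0 \<le> T"
    "\<bar>T * norm (x i - x j) - curve_length (vedge N x i j)\<bar> \<le> 4 * (mesh_size N x)\<^sup>2"
    "0 < curve_length (vedge N x i j)"
    using edge_weight_nondegenerate[OF i j ij h yz] .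
  then show ?thesis using j ij by (intro that[of T]) (auto simp: neighbors_def)
qed

text \<open>Cells that are not neighbours may still touch, but in one point only, as two common
  points force an edge of positive length.\<close>

lemma not_neighbor_unique:
  assumes i: "i < N" and j: "j < N" and ij: "i \<noteq> j" and h: "mesh_size N x \<le> 1/8"
    and nb: "j \<notin> neighbors N x i" and yz: "y \<in> vedge N x i j" "z \<in> vedge N x i j"
  shows "y = z"
proof (rule ccontr)
  assume "y \<noteq> z"
  obtain T where "0 < curve_length (vedge N x i j)"
    using edge_weight_nondegenerate[OF i j ij h yz \<open>y \<noteq> z\<close>] by metis
  then show False using nb j ij by (auto simp: neighbors_def)
qed

end

section \<open>A discrete Sobolev inequality\<close>

text \<open>Meant for the parameters at which a path lies in each cell. For a level \<open>c\<close>
  strictly between the end values and attained by no index, the parameters with values below and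
  above \<open>c\<close> form two closed sets that cover the path; by connectedness they meet, so
  \<open>c\<close> lies between the values of a touching pair. Comparing lengths of intervals
  replaces the choice of an ordered chain of cells.\<close>

lemma closed_cover_oscillation:
  fixes C :: "nat \<Rightarrow> real set" and v :: "nat \<Rightarrow> real"
  assumes closed: "\<And>i. i < N \<Longrightarrow> closed (C i)"
    and cover: "{0..1} \<subseteq> (\<Union>i<N. C i)"
    and i0: "i0 < N" "0 \<in> C i0" and j0: "j0 < N" "1 \<in> C j0"
    and T: "\<And>i j. i < N \<Longrightarrow> j < N \<Longrightarrow> i \<noteq> j \<Longrightarrow> C i \<inter> C j \<inter> {0..1} \<noteq> {} \<Longrightarrow> (i, j) \<in> T"
    and Tsub: "T \<subseteq> {..<N} \<times> {..<N}"
  shows "\<bar>v i0 - v j0\<bar> \<le> (\<Sum>(i, j)\<in>T. \<bar>v i - v j\<bar>)"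
proof -
  have finT: "finite T" using Tsub finite_subset by blast
  define lo where "lo = min (v i0) (v j0)"
  define hi where "hi = max (v i0) (v j0)"
  have sub: "{lo<..<hi} \<subseteq> (\<Union>(i, j)\<in>T. {v i<..<v j}) \<union> v ` {..<N}"
  proof
    fix c assume c: "c \<in> {lo<..<hi}"
    show "c \<in> (\<Union>(i, j)\<in>T. {v i<..<v j}) \<union> v ` {..<N}"
    proof (cases "c \<in> v ` {..<N}")
      case False
      define A where "A = (\<Union>i\<in>{i. i < N \<and> v i < c}. C i)"
      define B where "B = (\<Union>i\<in>{i. i < N \<and> c < v i}. C i)"
      have cl: "closed A" "closed B" unfolding A_def B_def using closed by auto
      have un: "{0..1} \<subseteq> A \<union> B"
      proof
        fix t :: real assume "t \<in> {0..1}"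
        then obtain i where i: "i < N" "t \<in> C i" using cover by blast
        then have "v i \<noteq> c" using False by blast
        then show "t \<in> A \<union> B" using i by (cases "v i < c") (auto simp: A_def B_def)
      qed
      have ne: "A \<inter> {0..1} \<noteq> {}" "B \<inter> {0..1} \<noteq> {}"
      proof -
        have z: "(0::real) \<in> {0..1}" "(1::real) \<in> {0..1}" by auto
        have "(v i0 < c \<and> c < v j0) \<or> (v j0 < c \<and> c < v i0)" using c by (auto simp: lo_def hi_def min_def max_def split: if_splits)
        then show "A \<inter> {0..1} \<noteq> {}" "B \<inter> {0..1} \<noteq> {}"
          using i0 j0 z unfolding A_def B_def by blast+
      qed
      have "connected {0..1::real}" by simp
      then have "A \<inter> B \<inter> {0..1} \<noteq> {}"
        unfolding connected_closed using cl un ne by blast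
      then obtain t where tA: "t \<in> A" and tB: "t \<in> B" and t01: "t \<in> {0..1}" by blast
      obtain i where i: "i < N" "v i < c" "t \<in> C i" using tA by (auto simp: A_def)
      obtain j where j: "j < N" "c < v j" "t \<in> C j" using tB by (auto simp: B_def)
      note t = t01 i j
      have "i \<noteq> j" using i j by auto
      moreover have "C i \<inter> C j \<inter> {0..1} \<noteq> {}" using i j t01 by blast
      ultimately have "(i, j) \<in> T" using T[of i j] i j by blast
      then show ?thesis using t by (intro UnI1 UN_I[of "(i, j)"]) auto
    qed simp
  qed
  have mU: "(\<Union>(i, j)\<in>T. {v i<..<v j}) \<in> sets lborel" using finT by auto
  have mV: "v ` {..<N} \<in> sets lborel" by (auto intro!: borel_closed finite_imp_closed)
  have "ennreal (hi - lo) = emeasure lborel {lo<..<hi}" by (simp add: lo_def hi_def)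
  also have "\<dots> \<le> emeasure lborel ((\<Union>(i, j)\<in>T. {v i<..<v j}) \<union> v ` {..<N})"
    by (rule emeasure_mono[OF sub]) (use mU mV in auto)
  also have "\<dots> \<le> emeasure lborel (\<Union>(i, j)\<in>T. {v i<..<v j}) + emeasure lborel (v ` {..<N})"
    by (rule emeasure_subadditive) (use mU mV in auto)
  also have "emeasure lborel (v ` {..<N}) = 0" by (intro emeasure_lborel_countable countable_finite) auto
  finally have "ennreal (hi - lo) \<le> emeasure lborel (\<Union>(i, j)\<in>T. {v i<..<v j})" by simp
  also have "\<dots> \<le> (\<Sum>p\<in>T. emeasure lborel (case p of (i, j) \<Rightarrow> {v i<..<v j}))"
  proof (rule emeasure_subadditive_finite[OF finT])
    show "(\<lambda>(i, j). {v i<..<v j}) ` T \<subseteq> sets lborel" by auto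
  qed
  also have "\<dots> \<le> (\<Sum>p\<in>T. ennreal \<bar>v (fst p) - v (snd p)\<bar>)"
  proof (intro sum_mono, clarify)
    fix i j
    show "emeasure lborel {v i<..<v j} \<le> ennreal \<bar>v (fst (i, j)) - v (snd (i, j))\<bar>"
      by (cases "v i \<le> v j") (auto intro: ennreal_leI)
  qed
  also have "\<dots> = ennreal (\<Sum>p\<in>T. \<bar>v (fst p) - v (snd p)\<bar>)"
    by simp
  finally have "hi - lo \<le> (\<Sum>p\<in>T. \<bar>v (fst p) - v (snd p)\<bar>)"
    by (subst (asm) ennreal_le_iff) (auto intro: sum_nonneg)
  then have "hi - lo \<le> (\<Sum>(i, j)\<in>T. \<bar>v i - v j\<bar>)" by (simp add: case_prod_unfold)
  moreover have "hi - lo = \<bar>v i0 - v j0\<bar>" by (auto simp: hi_def lo_def)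
  ultimately show ?thesis by simp
qed

context voronoi
begin

section \<open>Fans of segments leaving a vertex\<close>

definition cone3 :: "nat \<Rightarrow> (real ^ 3) set"
  where "cone3 i = {y. \<forall>k<N. y \<bullet> x k \<le> y \<bullet> x i}"

lemma closed_cone3: "closed (cone3 i)"
proof -
  have "cone3 i = (\<Inter>k\<in>{..<N}. {y. y \<bullet> x k \<le> y \<bullet> x i})" by (auto simp: cone3_def)
  then show ?thesis by (auto intro!: closed_INT closed_Collect_le continuous_intros)
qed

lemma cone3_cover: obtains i where "i < N" "y \<in> cone3 i"
proof -
  have fin: "finite ((\<lambda>j. y \<bullet> x j) ` {..<N})" "(\<lambda>j. y \<bullet> x j) ` {..<N} \<noteq> {}"
    using two_le_N lessThan_empty_iff[of N] by (simp_all add: lessThan_empty_iff)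
  from Max_in[OF fin] obtain i where i: "i < N" "y \<bullet> x i = Max ((\<lambda>j. y \<bullet> x j) ` {..<N})" by auto
  have "y \<bullet> x j \<le> y \<bullet> x i" if "j < N" for j
    unfolding i(2) using that fin by (intro Max_ge) auto
  then show ?thesis using that[of i] i(1) by (auto simp: cone3_def)
qed

lemma radial_cone3: "y \<noteq> 0 \<Longrightarrow> y \<in> cone3 i \<Longrightarrow> radial y \<in> wcell i"
  by (auto simp: cone3_def wcell_def radial_def intro!: mult_left_mono)

lemma site_cone3_iff: "k < N \<Longrightarrow> i < N \<Longrightarrow> x k \<in> cone3 i \<longleftrightarrow> i = k"
  using S2_inner_less_1[OF sites sites, of k i] S2_inner_self[OF sites, of k] sites_eq_iff[of k i]
  by (auto simp: cone3_def intro: S2_inner_bounds(2)[OF sites sites] dest: spec[of _ k])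

text \<open>The end points run over a segment that does not depend on \<open>p\<close>, so the fans
  of two vertices share their targets. The points lie off the sphere in general; only their
  directions matter.\<close>

definition fan_point :: "real ^ 3 \<Rightarrow> real ^ 3 \<Rightarrow> real ^ 3 \<Rightarrow> real \<Rightarrow> real \<Rightarrow> real ^ 3"
  where "fan_point p z0 z1 s t = (1 - t) *\<^sub>R p + t *\<^sub>R (z0 + s *\<^sub>R z1)"

text \<open>The parameters \<open>s\<close> for which the segment from \<open>p\<close> to \<open>z0 + s *\<^sub>R z1\<close> crosses from cell \<open>i\<close> to cell \<open>j\<close>.
  Working with cones instead of cells allows straight segments.\<close>

definition fan_set :: "real ^ 3 \<Rightarrow> real ^ 3 \<Rightarrow> real ^ 3 \<Rightarrow> nat \<Rightarrow> nat \<Rightarrow> real set"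
  where "fan_set p z0 z1 i j = {s \<in> {0..1}. \<exists>t\<in>{0..1}. fan_point p z0 z1 s t \<in> cone3 i \<inter> cone3 j}"

text \<open>\<open>closed_cover_oscillation\<close> along one segment of the fan. Every crossing is
  counted in both orders of the pair.\<close>

lemma fan_path:
  fixes v :: "nat \<Rightarrow> real"
  assumes "k < N" "l < N" "z0 + s *\<^sub>R z1 \<in> cone3 l" "s \<in> {0..1}"
  shows "\<bar>v k - v l\<bar> \<le> (\<Sum>(i, j)\<in>{..<N} \<times> {..<N}. (if i \<noteq> j \<and> s \<in> fan_set (x k) z0 z1 i j then \<bar>v i - v j\<bar> else 0))"
proof -
  define C where "C i = {t. fan_point (x k) z0 z1 s t \<in> cone3 i}" for i
  define T where "T = {(i, j) \<in> {..<N} \<times> {..<N}. i \<noteq> j \<and> s \<in> fan_set (x k) z0 z1 i j}"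
  have "\<bar>v k - v l\<bar> \<le> (\<Sum>(i, j)\<in>T. \<bar>v i - v j\<bar>)"
  proof (rule closed_cover_oscillation[where C = C])
    show "closed (C i)" if "i < N" for i
    proof -
      have "continuous_on UNIV (fan_point (x k) z0 z1 s)" unfolding fan_point_def by (intro continuous_intros)
      then have "closed (fan_point (x k) z0 z1 s -` cone3 i)"
        using closed_cone3 by (simp add: continuous_on_closed_vimage)
      then show ?thesis by (simp add: C_def vimage_def)
    qed
    show "{0..1} \<subseteq> (\<Union>i<N. C i)"
    proof
      fix t :: real
      obtain i where "i < N" "fan_point (x k) z0 z1 s t \<in> cone3 i" using cone3_cover .
      then show "t \<in> (\<Union>i<N. C i)" by (auto simp: C_def)
    qed
    show "0 \<in> C k" using site_cone3_iff[OF assms(1,1)] by (simp add: C_def fan_point_def)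
    show "1 \<in> C l" using assms by (simp add: C_def fan_point_def)
    show "(i, j) \<in> T" if "i < N" "j < N" "i \<noteq> j" "C i \<inter> C j \<inter> {0..1} \<noteq> {}" for i j
      using that assms by (auto simp: T_def fan_set_def C_def)
    show "T \<subseteq> {..<N} \<times> {..<N}" by (auto simp: T_def)
  qed (use assms in auto)
  also have "\<dots> = (\<Sum>(i, j)\<in>{..<N} \<times> {..<N}. (if i \<noteq> j \<and> s \<in> fan_set (x k) z0 z1 i j then \<bar>v i - v j\<bar> else 0))"
    by (rule sum.mono_neutral_cong_left) (auto simp: T_def split: if_splits)
  finally show ?thesis .
qed

text \<open>The functional in the conclusions vanishes at \<open>p\<close> and thus forgets the part
  of the segment along \<open>p\<close>: with \<open>z0\<close> it returns
  \<open>t / norm y\<close>, with \<open>z1\<close> it returns \<open>t * s / norm y\<close>. So for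
  \<open>t > 0\<close> the direction of \<open>y\<close> determines \<open>s\<close>, and the first
  value controls the distance from \<open>p\<close>. The factor 12 combines
  \<open>norm (radial y - p) \<le> 6 * t\<close> with \<open>norm y \<le> 2\<close>.\<close>

lemma fan_geometry:
  assumes o: "orthonormal3 n z0 z1" and p: "p \<in> S2" and np: "1/2 \<le> (n \<bullet> p)\<^sup>2"
    and s: "s \<in> {0..1}" and t: "t \<in> {0..1}" and y: "y = fan_point p z0 z1 s t"
  shows "y \<noteq> 0" "s * (radial y \<bullet> z0 - (radial y \<bullet> n) / (n \<bullet> p) * (p \<bullet> z0)) = radial y \<bullet> z1 - (radial y \<bullet> n) / (n \<bullet> p) * (p \<bullet> z1)"
    "norm (radial y - p) \<le> 12 * (radial y \<bullet> z0 - (radial y \<bullet> n) / (n \<bullet> p) * (p \<bullet> z0))"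
    "0 < t \<Longrightarrow> 0 < radial y \<bullet> z0 - (radial y \<bullet> n) / (n \<bullet> p) * (p \<bullet> z0)"
proof -
  have n0: "n \<bullet> p \<noteq> 0" using np by auto
  have d: "n \<bullet> n = 1" "z0 \<bullet> z0 = 1" "z1 \<bullet> z1 = 1" "n \<bullet> z0 = 0" "n \<bullet> z1 = 0" "z0 \<bullet> z1 = 0"
    "z0 \<bullet> n = 0" "z1 \<bullet> n = 0" "z1 \<bullet> z0 = 0"
    using o by (auto simp: orthonormal3_def inner_commute)
  have nz: "norm z0 = 1" "norm z1 = 1" using d by (simp_all add: norm_eq_1)
  have t01: "0 \<le> t" "t \<le> 1" and s01: "0 \<le> s" "s \<le> 1" using s t by auto
  have yn: "y \<bullet> n = (1 - t) * (n \<bullet> p)"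
    unfolding y fan_point_def using d by (simp add: inner_add_left inner_commute[of p n])
  have yz0: "y \<bullet> z0 = (1 - t) * (p \<bullet> z0) + t" and yz1: "y \<bullet> z1 = (1 - t) * (p \<bullet> z1) + t * s"
    unfolding y fan_point_def using d by (simp_all add: inner_add_left)
  show y0: "y \<noteq> 0"
  proof
    assume "y = 0"
    then have "t = 1" using yn n0 by simp
    moreover have "y \<bullet> z0 = 0" using \<open>y = 0\<close> by simp
    ultimately show False using yz0 by simp
  qed
  then have ny: "0 < norm y" by simp
  have rad: "radial y \<bullet> v = (y \<bullet> v) / norm y" for v by (simp add: radial_def divide_inverse mult.commute)
  have B: "radial y \<bullet> z0 - (radial y \<bullet> n) / (n \<bullet> p) * (p \<bullet> z0) = t / norm y"
    unfolding rad yn yz0 using n0 ny by (simp add: field_simps)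
  have C: "radial y \<bullet> z1 - (radial y \<bullet> n) / (n \<bullet> p) * (p \<bullet> z1) = t * s / norm y"
    unfolding rad yn yz1 using n0 ny by (simp add: field_simps)
  show "s * (radial y \<bullet> z0 - (radial y \<bullet> n) / (n \<bullet> p) * (p \<bullet> z0)) = radial y \<bullet> z1 - (radial y \<bullet> n) / (n \<bullet> p) * (p \<bullet> z1)"
    unfolding B C by simp
  show "0 < t \<Longrightarrow> 0 < radial y \<bullet> z0 - (radial y \<bullet> n) / (n \<bullet> p) * (p \<bullet> z0)"
    unfolding B using ny by simp
  have zs: "norm (z0 + s *\<^sub>R z1) \<le> 2"
    using norm_triangle_ineq[of z0 "s *\<^sub>R z1"] nz s01 by simp
  have np1: "norm p = 1" using p by simp
  have yp: "norm (y - p) \<le> 3 * t"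
  proof -
    have "y - p = t *\<^sub>R (z0 + s *\<^sub>R z1 - p)" by (simp add: y fan_point_def algebra_simps)
    then have "norm (y - p) = t * norm (z0 + s *\<^sub>R z1 - p)" using t01 by simp
    also have "\<dots> \<le> t * 3" using norm_triangle_ineq4[of "z0 + s *\<^sub>R z1" p] zs np1 t01 by (intro mult_left_mono) auto
    finally show ?thesis by simp
  qed
  have ny2: "norm y \<le> 2"
  proof -
    have "norm y \<le> norm ((1 - t) *\<^sub>R p) + norm (t *\<^sub>R (z0 + s *\<^sub>R z1))"
      unfolding y fan_point_def by (rule norm_triangle_ineq)
    also have "\<dots> \<le> (1 - t) * 1 + t * 2" using t01 np1 zs by (intro add_mono) (auto intro: mult_left_mono)
    finally show ?thesis using t01 by simp
  qed
  have "radial y - y = ((1 - norm y) / norm y) *\<^sub>R y"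
    using ny by (simp add: radial_def diff_divide_distrib algebra_simps divide_inverse)
  then have "norm (radial y - y) = \<bar>1 - norm y\<bar>" using ny by simp
  also have "\<dots> \<le> norm (y - p)" using norm_triangle_ineq3[of p y] np1 by (simp add: norm_minus_commute)
  finally have "norm (radial y - p) \<le> 6 * t"
    using norm_triangle_ineq[of "radial y - y" "y - p"] yp by simp
  also have "\<dots> \<le> 12 * (t / norm y)"
  proof -
    have "t / 2 \<le> t / norm y" using ny ny2 t01 by (intro divide_left_mono) auto
    then show ?thesis by simp
  qed
  finally show "norm (radial y - p) \<le> 12 * (radial y \<bullet> z0 - (radial y \<bullet> n) / (n \<bullet> p) * (p \<bullet> z0))"
    unfolding B .
qed

lemma fan_functional_bound:
  assumes o: "orthonormal3 n z0 z1" and p: "p \<in> S2" and np: "1/2 \<le> (n \<bullet> p)\<^sup>2" and z: "z \<in> {z0, z1}"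
  shows "\<bar>w \<bullet> z - (w \<bullet> n) / (n \<bullet> p) * (p \<bullet> z)\<bar> \<le> 3 * norm w"
proof -
  have nn: "norm n = 1" "norm z = 1" using o z by (auto simp: orthonormal3_def norm_eq_1)
  have np1: "norm p = 1" using p by simp
  have "(1/2)\<^sup>2 \<le> \<bar>n \<bullet> p\<bar>\<^sup>2" using np by (simp add: power2_eq_square)
  then have half: "1/2 \<le> \<bar>n \<bullet> p\<bar>" using power2_le_imp_le by (metis abs_ge_zero)
  have a: "\<bar>w \<bullet> z\<bar> \<le> norm w" using Cauchy_Schwarz_ineq2[of w z] nn by simp
  have b: "\<bar>w \<bullet> n\<bar> \<le> norm w" using Cauchy_Schwarz_ineq2[of w n] nn by simp
  have c: "\<bar>p \<bullet> z\<bar> \<le> 1" using Cauchy_Schwarz_ineq2[of p z] nn np1 by simp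
  have "\<bar>(w \<bullet> n) / (n \<bullet> p) * (p \<bullet> z)\<bar> = \<bar>w \<bullet> n\<bar> / \<bar>n \<bullet> p\<bar> * \<bar>p \<bullet> z\<bar>" by (simp add: abs_mult abs_divide)
  also have "\<dots> \<le> norm w / (1/2) * 1" using a b c half by (intro mult_mono frac_le) auto
  also have "\<dots> = 2 * norm w" by simp
  finally show ?thesis using a by linarith
qed

text \<open>Two crossings in cell \<open>i\<close> are at most two mesh sizes apart, and the
  functionals of \<open>fan_geometry\<close> have Lipschitz constant 3. So
  \<open>\<bar>s - s'\<bar>\<close> times the first functional is at most 12 mesh sizes, and that
  functional is at least a twelfth of the distance from \<open>p\<close>, which gives 144. The other
  2 pay for passing from the crossing to \<open>x i\<close> and adding the mesh size.\<close>

lemma fan_set_spread: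
  assumes o: "orthonormal3 n z0 z1" and p: "p \<in> S2" and np: "1/2 \<le> (n \<bullet> p)\<^sup>2"
    and i: "i < N" and s: "s \<in> fan_set p z0 z1 i j" and s': "s' \<in> fan_set p z0 z1 i j"
  shows "\<bar>s - s'\<bar> * (mesh_size N x + norm (x i - p)) \<le> 146 * mesh_size N x"
proof -
  let ?h = "mesh_size N x"
  obtain t t' where t: "s \<in> {0..1}" "t \<in> {0..1}" "fan_point p z0 z1 s t \<in> cone3 i"
    and t': "s' \<in> {0..1}" "t' \<in> {0..1}" "fan_point p z0 z1 s' t' \<in> cone3 i"
    using s s' by (auto simp: fan_set_def)
  define w where "w = radial (fan_point p z0 z1 s t)"
  define w' where "w' = radial (fan_point p z0 z1 s' t')"
  define B where "B w = w \<bullet> z0 - (w \<bullet> n) / (n \<bullet> p) * (p \<bullet> z0)" for w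
  define C where "C w = w \<bullet> z1 - (w \<bullet> n) / (n \<bullet> p) * (p \<bullet> z1)" for w
  note f = fan_geometry[OF o p np t(1,2) refl, folded w_def B_def C_def]
  note f' = fan_geometry[OF o p np t'(1,2) refl, folded w'_def B_def C_def]
  have w: "w \<in> wcell i" unfolding w_def by (rule radial_cone3[OF f(1) t(3)])
  have w': "w' \<in> wcell i" unfolding w'_def by (rule radial_cone3[OF f'(1) t'(3)])
  have wi: "norm (w - x i) \<le> ?h" "norm (w' - x i) \<le> ?h" using norm_wcell_le[OF i] w w' by auto
  have ww: "norm (w - w') \<le> 2 * ?h" using norm_triangle_ineq4[of "w - x i" "w' - x i"] wi by simp
  have Bd: "\<bar>B w - B w'\<bar> \<le> 3 * norm (w - w')"
  proof -
    have "B w - B w' = (w - w') \<bullet> z0 - ((w - w') \<bullet> n) / (n \<bullet> p) * (p \<bullet> z0)"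
      by (simp add: B_def inner_diff_left diff_divide_distrib left_diff_distrib)
    then show ?thesis using fan_functional_bound[OF o p np, of z0 "w - w'"] by simp
  qed
  have Cd: "\<bar>C w - C w'\<bar> \<le> 3 * norm (w - w')"
  proof -
    have "C w - C w' = (w - w') \<bullet> z1 - ((w - w') \<bullet> n) / (n \<bullet> p) * (p \<bullet> z1)"
      by (simp add: C_def inner_diff_left diff_divide_distrib left_diff_distrib)
    then show ?thesis using fan_functional_bound[OF o p np, of z1 "w - w'"] by simp
  qed
  have "(s - s') * B w = (C w - C w') - s' * (B w - B w')"
    using f(2) f'(2) by (simp add: algebra_simps)
  then have "\<bar>(s - s') * B w\<bar> \<le> \<bar>C w - C w'\<bar> + \<bar>s' * (B w - B w')\<bar>" by linarith
  also have "\<bar>s' * (B w - B w')\<bar> \<le> 1 * \<bar>B w - B w'\<bar>"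
    unfolding abs_mult using t'(1) by (intro mult_right_mono) auto
  finally have sB: "\<bar>s - s'\<bar> * \<bar>B w\<bar> \<le> 12 * ?h" using Bd Cd ww by (simp add: abs_mult)
  have "\<bar>s - s'\<bar> * norm (w - p) \<le> \<bar>s - s'\<bar> * (12 * \<bar>B w\<bar>)"
    using f(3) by (intro mult_left_mono) auto
  also have "\<dots> = 12 * (\<bar>s - s'\<bar> * \<bar>B w\<bar>)" by (rule mult.left_commute)
  also have "\<dots> \<le> 144 * ?h" using sB by linarith
  finally have 1: "\<bar>s - s'\<bar> * norm (w - p) \<le> 144 * ?h" .
  have h0: "0 \<le> ?h" using wi(1) norm_ge_zero[of "w - x i"] by linarith
  have "norm (x i - p) \<le> norm (w - p) + ?h"
    using norm_triangle_ineq4[of "w - p" "w - x i"] wi(1) by (simp add: norm_minus_commute)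
  then have "\<bar>s - s'\<bar> * (?h + norm (x i - p)) \<le> \<bar>s - s'\<bar> * (2 * ?h + norm (w - p))"
    by (intro mult_left_mono) auto
  also have "\<dots> \<le> 1 * (2 * ?h) + 144 * ?h"
  proof -
    have "\<bar>s - s'\<bar> \<le> 1" using t(1) t'(1) by (auto simp: abs_le_iff)
    then have "\<bar>s - s'\<bar> * (2 * ?h) \<le> 1 * (2 * ?h)" using h0 by (intro mult_right_mono) auto
    then show ?thesis using 1 by (simp add: distrib_left)
  qed
  finally show ?thesis by simp
qed

text \<open>All crossings project to the one point that the two cells share. A vertex lies in its
  own cone only, so \<open>t > 0\<close> and the functional of \<open>fan_geometry\<close>, being
  positive, fixes \<open>s\<close>.\<close>

lemma fan_set_unique:
  assumes o: "orthonormal3 n z0 z1" and np: "1/2 \<le> (n \<bullet> x k)\<^sup>2" and k: "k < N"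
    and i: "i < N" and j: "j < N" and ij: "i \<noteq> j" and h: "mesh_size N x \<le> 1/8"
    and nb: "j \<notin> neighbors N x i"
    and s: "s \<in> fan_set (x k) z0 z1 i j" and s': "s' \<in> fan_set (x k) z0 z1 i j"
  shows "s = s'"
proof -
  obtain t t' where t: "s \<in> {0..1}" "t \<in> {0..1}" "fan_point (x k) z0 z1 s t \<in> cone3 i" "fan_point (x k) z0 z1 s t \<in> cone3 j"
    and t': "s' \<in> {0..1}" "t' \<in> {0..1}" "fan_point (x k) z0 z1 s' t' \<in> cone3 i" "fan_point (x k) z0 z1 s' t' \<in> cone3 j"
    using s s' by (auto simp: fan_set_def)
  define w where "w = radial (fan_point (x k) z0 z1 s t)"
  define w' where "w' = radial (fan_point (x k) z0 z1 s' t')"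
  define B where "B w = w \<bullet> z0 - (w \<bullet> n) / (n \<bullet> x k) * (x k \<bullet> z0)" for w
  define C where "C w = w \<bullet> z1 - (w \<bullet> n) / (n \<bullet> x k) * (x k \<bullet> z1)" for w
  note f = fan_geometry[OF o sites[OF k] np t(1,2) refl, folded w_def B_def C_def]
  note f' = fan_geometry[OF o sites[OF k] np t'(1,2) refl, folded w'_def B_def C_def]
  have w: "w \<in> vedge N x i j" unfolding w_def vedge_eq[OF i j] using radial_cone3[OF f(1)] t by auto
  have w': "w' \<in> vedge N x i j" unfolding w'_def vedge_eq[OF i j] using radial_cone3[OF f'(1)] t' by auto
  have eq: "w = w'" by (rule not_neighbor_unique[OF i j ij h nb w w'])
  have "t \<noteq> 0"
  proof
    assume "t = 0"
    then have "x k \<in> cone3 i" "x k \<in> cone3 j" using t(3,4) by (simp_all add: fan_point_def)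
    then show False using site_cone3_iff k i j ij by auto
  qed
  then have "0 < B w" using f(4) t(2) by auto
  moreover have "s * B w = s' * B w" using f(2) f'(2) eq by simp
  ultimately show ?thesis by simp
qed

end

text \<open>\<open>A\<close> stands for the absolute constant of \<open>area_cap_le\<close>. It is a
  parameter, so that the constants defined in this context depend on \<open>C0\<close>,
  \<open>C1\<close> and \<open>A\<close> only and can be named before a mesh is given.\<close>

locale uniform_voronoi = voronoi N x for N :: nat and x :: "nat \<Rightarrow> real ^ 3" +
  fixes C0 C1 A h :: real
  assumes C0: "0 < C0" and C1: "0 < C1" and A: "0 < A"
    and cap: "\<And>p s. p \<in> S2 \<Longrightarrow> 0 < s \<Longrightarrow> area (S2 \<inter> cball p s) \<le> A * s\<^sup>2"
    and h_eq: "h = mesh_size N x" and h_pos: "0 < h" and h_le: "h \<le> 1/16"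
    and cell_lower: "\<And>i. i < N \<Longrightarrow> h\<^sup>2 / C1 \<le> area (vcell N x i)"
    and edge_lower: "\<And>i j. i < N \<Longrightarrow> j \<in> neighbors N x i \<Longrightarrow> h / C0 \<le> curve_length (vedge N x i j)"
    and edge_upper: "\<And>i j. i < N \<Longrightarrow> j \<in> neighbors N x i \<Longrightarrow> curve_length (vedge N x i j) \<le> C0 * h"
begin

text \<open>Known as the transmissibility of an edge in finite volume methods: the flux is this
  number times a difference of nodal values.\<close>

definition trans :: "nat \<Rightarrow> nat \<Rightarrow> real"
  where "trans i j = curve_length (vedge N x i j) / norm (x j - x i)"

lemma trans_nonneg: "0 \<le> trans i j"
  by (simp add: trans_def curve_length_nonneg)

lemma trans_commute: "trans i j = trans j i"
  by (simp add: trans_def vedge_commute[of i j] norm_minus_commute)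

lemma trans_self: "trans i i = 0"
  by (simp add: trans_def)

lemma neighborsD: "j \<in> neighbors N x i \<Longrightarrow> j < N \<and> j \<noteq> i \<and> 0 < curve_length (vedge N x i j)"
  by (simp add: neighbors_def)

lemma trans_not_neighbor: "j < N \<Longrightarrow> j \<notin> neighbors N x i \<Longrightarrow> trans i j = 0"
  using curve_length_nonneg[of "vedge N x i j"] trans_self
  by (cases "j = i") (auto simp: neighbors_def trans_def)

lemma neighbor_dist:
  assumes i: "i < N" and j: "j \<in> neighbors N x i"
  shows "norm (x i - x j) \<le> 2 * h"
proof -
  have j': "j < N" "0 < curve_length (vedge N x i j)" using neighborsD[OF j] by auto
  then have "vedge N x i j \<noteq> {}" by (auto simp: curve_length_def hausdorff1_empty)
  then obtain y where "y \<in> wcell i" "y \<in> wcell j" using vedge_eq[OF i j'(1)] by blast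
  then show ?thesis using norm_wcell_wcell_le[OF i j'(1)] h_eq by simp
qed

lemma trans_lower:
  assumes i: "i < N" and j: "j \<in> neighbors N x i"
  shows "1 / (2 * C0) \<le> trans i j"
proof -
  have j': "j < N" "j \<noteq> i" using neighborsD[OF j] by auto
  have pos: "0 < norm (x j - x i)" using sites_eq_iff[OF j'(1) i] j' by simp
  have "1 / (2 * C0) = (h / C0) / (2 * h)" using h_pos by simp
  also have "\<dots> \<le> curve_length (vedge N x i j) / norm (x j - x i)"
    using edge_lower[OF i j] neighbor_dist[OF i j] pos h_pos C0
    by (intro frac_le) (auto simp: norm_minus_commute curve_length_nonneg)
  finally show ?thesis by (simp add: trans_def)
qed

text \<open>Packing argument: the disjoint cells of these vertices have area at least
  \<open>h\<^sup>2 / C1\<close> each and lie in a cap of radius \<open>s + h\<close>.\<close>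

lemma card_sites_near:
  assumes p: "p \<in> S2" and s: "0 \<le> s" and J: "J \<subseteq> {..<N}" and near: "\<And>i. i \<in> J \<Longrightarrow> norm (x i - p) \<le> s"
  shows "real (card J) * h\<^sup>2 \<le> C1 * A * (s + h)\<^sup>2"
proof -
  have sub: "vcell N x i \<subseteq> S2 \<inter> cball p (s + h)" if "i \<in> J" for i
  proof
    fix y assume y: "y \<in> vcell N x i"
    have i: "i < N" using that J by auto
    have "norm (y - x i) \<le> h" using norm_wcell_le[OF i, of y] vcell_subset_wcell[OF i] y h_eq by auto
    then have "norm (y - p) \<le> s + h" using norm_triangle_ineq[of "y - x i" "x i - p"] near[OF that] by simp
    moreover have "y \<in> S2" using y by (simp add: vcell_def)
    ultimately show "y \<in> S2 \<inter> cball p (s + h)" by (simp add: dist_norm norm_minus_commute)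
  qed
  have "real (card J) * (h\<^sup>2 / C1) = (\<Sum>i\<in>J. h\<^sup>2 / C1)" by simp
  also have "\<dots> \<le> (\<Sum>i\<in>J. area (vcell N x i))" using J cell_lower by (intro sum_mono) auto
  also have "\<dots> \<le> area (S2 \<inter> cball p (s + h))" by (rule sum_area_le[OF J sub]) auto
  also have "\<dots> \<le> A * (s + h)\<^sup>2" using cap[OF p, of "s + h"] s h_pos by simp
  finally show ?thesis using C1 by (simp add: field_simps)
qed

text \<open>The 9 is the square of \<open>(2 * h + h) / h\<close>, neighbours being within
  \<open>2 * h\<close>. The same number bounds \<open>real N * h\<^sup>2\<close>, because
  \<open>2 + h\<close> is at most 3.\<close>

definition neighbor_bound :: real
  where "neighbor_bound = 9 * C1 * A"

lemma card_neighbors: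
  assumes i: "i < N"
  shows "real (card (neighbors N x i)) \<le> neighbor_bound"
proof -
  have "real (card (neighbors N x i)) * h\<^sup>2 \<le> C1 * A * (2 * h + h)\<^sup>2"
    by (rule card_sites_near[OF sites[OF i]])
      (use h_pos neighborsD neighbor_dist[OF i] in \<open>auto simp: norm_minus_commute\<close>)
  also have "\<dots> = neighbor_bound * h\<^sup>2" by (simp add: neighbor_bound_def power2_eq_square)
  finally show ?thesis using h_pos by simp
qed

lemma card_sites: "real N * h\<^sup>2 \<le> neighbor_bound"
proof -
  have p: "x 0 \<in> S2" using sites[of 0] two_le_N by simp
  have "real (card {..<N}) * h\<^sup>2 \<le> C1 * A * (2 + h)\<^sup>2"
  proof (rule card_sites_near[OF p])
    fix i assume "i \<in> {..<N}"
    then show "norm (x i - x 0) \<le> 2" using norm_triangle_ineq4[of "x i" "x 0"] sites[of i] p by simp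
  qed auto
  also have "\<dots> \<le> C1 * A * 3\<^sup>2" using h_pos h_le C1 A by (intro mult_left_mono power_mono) auto
  finally show ?thesis by (simp add: neighbor_bound_def)
qed

lemma abs_ln_h_ge_1: "1 \<le> \<bar>ln h\<bar>"
proof -
  have "exp 1 \<le> (3 :: real)" by (rule exp_le)
  then have "1 / 3 \<le> exp (- 1 :: real)" by (simp add: exp_minus field_simps)
  then have "h \<le> exp (- 1)" using h_le by linarith
  then have "ln h \<le> ln (exp (- 1))" using h_pos by (subst ln_le_cancel_iff) auto
  then have "ln h \<le> - 1" by simp
  then show ?thesis by linarith
qed

text \<open>Dyadic decomposition: the disc of radius \<open>2 ^ m * h\<close> holds at most a
  multiple of \<open>4 ^ m\<close> vertices, and those outside the previous disc contribute at most
  \<open>4 * (1/4) ^ m\<close> each. About \<open>ln (2 / h) / ln 2\<close> discs reach the diameter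
  of the sphere.\<close>

lemma sum_decay:
  assumes p: "p \<in> S2"
  shows "(\<Sum>i<N. (h / (h + norm (x i - p)))\<^sup>2) \<le> 80 * C1 * A * \<bar>ln h\<bar>"
proof -
  obtain K :: nat where K: "ln (2 / h) / ln 2 \<le> real K" "real K < ln (2 / h) / ln 2 + 1"
  proof -
    define K where "K = nat \<lceil>ln (2 / h) / ln 2\<rceil>"
    have "0 < ln (2 / h) / ln 2" using h_pos h_le by simp
    then have "ln (2 / h) / ln 2 \<le> real K" "real K < ln (2 / h) / ln 2 + 1"
      unfolding K_def using ceiling_correct[of "ln (2 / h) / ln 2"] by linarith+
    then show ?thesis by (rule that)
  qed
  have "ln (2 / h) \<le> real K * ln 2" using K(1) by (simp add: pos_divide_le_eq)
  then have "2 / h \<le> 2 ^ K" using h_pos by (simp add: ln_realpow[symmetric])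
  then have K2: "2 \<le> 2 ^ K * h" using h_pos by (simp add: pos_divide_le_eq)
  define J where "J m = {i. i < N \<and> norm (x i - p) \<le> 2 ^ m * h}" for m :: nat
  have bnd: "(h / (h + norm (x i - p)))\<^sup>2 \<le> (\<Sum>m\<le>K. 4 * (1/4) ^ m * (if i \<in> J m then 1 else 0))" if i: "i < N" for i
  proof -
    have "norm (x i - p) \<le> 2 ^ K * h"
      using norm_triangle_ineq4[of "x i" p] sites[OF i] p K2 by simp
    then have ex: "i \<in> J K" using i by (simp add: J_def)
    \<comment> \<open>The smallest disc containing \<open>x i\<close>; missing the previous disc
      bounds its distance from below.\<close>
    define m where "m = (LEAST m. i \<in> J m)"
    have m: "i \<in> J m" "m \<le> K" unfolding m_def using ex by (auto intro: LeastI Least_le)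
    have "(h / (h + norm (x i - p)))\<^sup>2 \<le> 4 * (1/4) ^ m"
    proof (cases m)
      case 0
      have "0 < h + norm (x i - p)" using h_pos by (simp add: add_pos_nonneg)
      then have "h / (h + norm (x i - p)) \<le> 1" by (simp add: pos_divide_le_eq)
      then have "(h / (h + norm (x i - p)))\<^sup>2 \<le> 1" using h_pos by (intro power_le_one) auto
      then show ?thesis using 0 by simp
    next
      case (Suc m')
      then have "i \<notin> J m'" using not_less_Least[of m' "\<lambda>m. i \<in> J m"] by (simp add: m_def)
      then have g: "2 ^ m' * h < norm (x i - p)" using i by (simp add: J_def)
      have "h / (h + norm (x i - p)) \<le> h / (2 ^ m' * h)"
        using g h_pos by (intro divide_left_mono mult_pos_pos add_pos_nonneg) auto
      also have "\<dots> = (1/2) ^ m'" using h_pos by (simp add: power_divide)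
      finally have "(h / (h + norm (x i - p)))\<^sup>2 \<le> ((1/2) ^ m')\<^sup>2" using h_pos by (intro power_mono) auto
      also have "\<dots> = 4 * (1/4) ^ m" using Suc by (simp add: power2_eq_square power_mult_distrib[symmetric])
      finally show ?thesis .
    qed
    also have "\<dots> = (\<Sum>m'\<in>{m}. 4 * (1/4) ^ m' * (if i \<in> J m' then 1 else 0))" using m by simp
    also have "\<dots> \<le> (\<Sum>m\<le>K. 4 * (1/4) ^ m * (if i \<in> J m then 1 else 0))"
      using m by (intro sum_mono2) auto
    finally show ?thesis .
  qed
  have cJ: "(1/4) ^ m * real (card (J m)) \<le> 4 * C1 * A" for m
  proof -
    have "real (card (J m)) * h\<^sup>2 \<le> C1 * A * (2 ^ m * h + h)\<^sup>2"
      by (rule card_sites_near[OF p]) (use h_pos in \<open>auto simp: J_def\<close>)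
    also have "\<dots> \<le> C1 * A * (2 ^ m * h + 2 ^ m * h)\<^sup>2"
      using h_pos C1 A by (intro mult_left_mono power_mono add_left_mono) auto
    also have "\<dots> = 4 * C1 * A * 4 ^ m * h\<^sup>2"
    proof -
      have "(2 ^ m * h + 2 ^ m * h)\<^sup>2 = 4 * ((2 ^ m)\<^sup>2 * h\<^sup>2)" by (simp add: power2_eq_square)
      also have "(2 ^ m)\<^sup>2 = (4 ^ m :: real)" by (simp add: power2_eq_square power_mult_distrib[symmetric])
      finally show ?thesis by simp
    qed
    finally have "real (card (J m)) \<le> 4 * C1 * A * 4 ^ m" using h_pos by simp
    then show ?thesis by (simp add: power_divide field_simps)
  qed
  have "(\<Sum>i<N. (h / (h + norm (x i - p)))\<^sup>2) \<le> (\<Sum>i<N. \<Sum>m\<le>K. 4 * (1/4) ^ m * (if i \<in> J m then 1 else 0))"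
    using bnd by (intro sum_mono) auto
  also have "\<dots> = (\<Sum>m\<le>K. \<Sum>i<N. 4 * (1/4) ^ m * (if i \<in> J m then 1 else 0))" by (rule sum.swap)
  also have "\<dots> = (\<Sum>m\<le>K. 4 * ((1/4) ^ m * real (card (J m))))"
  proof (intro sum.cong refl)
    fix m
    have "(\<Sum>i<N. 4 * (1/4) ^ m * (if i \<in> J m then 1 else 0 :: real)) = 4 * (1/4) ^ m * (\<Sum>i<N. if i \<in> J m then 1 else 0)"
      by (rule sum_distrib_left[symmetric])
    also have "(\<Sum>i<N. if i \<in> J m then 1 else 0) = real (card (J m))"
    proof -
      have "(\<Sum>i<N. if i \<in> J m then 1 else (0::real)) = (\<Sum>i\<in>{..<N} \<inter> J m. 1)"
        by (rule sum.inter_restrict[symmetric]) simp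
      also have "{..<N} \<inter> J m = J m" by (auto simp: J_def)
      finally show ?thesis by simp
    qed
    finally show "(\<Sum>i<N. 4 * (1/4) ^ m * (if i \<in> J m then 1 else 0)) = 4 * ((1/4) ^ m * real (card (J m)))" by simp
  qed
  also have "\<dots> \<le> (\<Sum>m\<le>K. 4 * (4 * C1 * A))" using cJ by (intro sum_mono mult_left_mono) auto
  also have "\<dots> = (real K + 1) * (16 * C1 * A)" by simp
  \<comment> \<open>\<open>real K + 1\<close> is at most 3 plus \<open>2 * \<bar>ln h\<bar>\<close>,
    and \<open>\<bar>ln h\<bar>\<close> is at least 1.\<close>
  also have "\<dots> \<le> (5 * \<bar>ln h\<bar>) * (16 * C1 * A)"
  proof (intro mult_right_mono)
    have l2: "1/2 \<le> ln (2::real)" using ln2_ge_two_thirds by simp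
    have lh: "ln (2 / h) = ln 2 + \<bar>ln h\<bar>" using h_pos h_le by (simp add: ln_div)
    have "ln (2 / h) / ln 2 = 1 + \<bar>ln h\<bar> / ln 2" unfolding lh by (simp add: add_divide_distrib)
    also have "\<bar>ln h\<bar> / ln 2 \<le> \<bar>ln h\<bar> / (1/2)" using l2 by (intro divide_left_mono) auto
    finally show "real K + 1 \<le> 5 * \<bar>ln h\<bar>" using K(2) abs_ln_h_ge_1 by simp
  qed (use C1 A in simp)
  finally show ?thesis by (simp add: mult_ac)
qed

text \<open>The sum runs over ordered pairs, so every edge counts twice; this accounts for the
  factor 1/2 in the double sum for the finite volume form.\<close>

definition energy :: "(nat \<Rightarrow> real) \<Rightarrow> real"
  where "energy v = (\<Sum>i<N. \<Sum>j<N. trans i j * (v i - v j)\<^sup>2)"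

lemma energy_nonneg: "0 \<le> energy v"
  unfolding energy_def by (intro sum_nonneg mult_nonneg_nonneg trans_nonneg) auto

section \<open>Averaging over the fan\<close>

lemma fan_set_interval:
  assumes o: "orthonormal3 n z0 z1" and np: "1/2 \<le> (n \<bullet> x k)\<^sup>2" and k: "k < N"
    and i: "i < N" and j: "j < N" and ij: "i \<noteq> j"
  defines "d \<equiv> (if j \<in> neighbors N x i then 146 * (h / (h + norm (x i - x k))) else 0)"
  shows "\<exists>a. fan_set (x k) z0 z1 i j \<subseteq> {a..a + d}"
proof (cases "fan_set (x k) z0 z1 i j = {}")
  case False
  let ?J = "fan_set (x k) z0 z1 i j"
  have pos: "0 < h + norm (x i - x k)" using h_pos by (simp add: add_pos_nonneg)
  have diff: "\<bar>s - s'\<bar> \<le> d" if "s \<in> ?J" "s' \<in> ?J" for s s'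
  proof (cases "j \<in> neighbors N x i")
    case True
    have "\<bar>s - s'\<bar> * (h + norm (x i - x k)) \<le> 146 * h"
      using fan_set_spread[OF o sites[OF k] np i that] h_eq by simp
    then show ?thesis using True pos by (simp add: d_def pos_le_divide_eq)
  next
    case nb: False
    have "s = s'" by (rule fan_set_unique[OF o np k i j ij _ nb that]) (use h_eq h_le in simp)
    then show ?thesis using nb by (simp add: d_def)
  qed
  have bdd: "bdd_below ?J" by (rule bdd_belowI[of _ 0]) (auto simp: fan_set_def)
  have "?J \<subseteq> {Inf ?J..Inf ?J + d}"
  proof
    fix s assume s: "s \<in> ?J"
    have "Inf ?J \<le> s" by (rule cInf_lower[OF s bdd])
    moreover have "s - d \<le> Inf ?J"
      by (rule cInf_greatest[OF False]) (use diff[OF s] in force)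
    ultimately show "s \<in> {Inf ?J..Inf ?J + d}" by simp
  qed
  then show ?thesis by blast
qed simp

text \<open>By \<open>fan_set_interval\<close>, the length of an interval that contains
  \<open>fan_set\<close>. The value 0 fits cells that touch in a single point.\<close>

definition fan_width :: "nat \<Rightarrow> nat \<Rightarrow> nat \<Rightarrow> real"
  where "fan_width k i j = (if j \<in> neighbors N x i then 146 * (h / (h + norm (x i - x k))) else 0)"

lemma fan_width_nonneg: "0 \<le> fan_width k i j"
  using h_pos by (simp add: fan_width_def)

text \<open>For each \<open>s\<close> both fans end in a common cell \<open>c\<close>, and
  \<open>fan_path\<close> bounds \<open>\<bar>v k - v c\<bar>\<close> and
  \<open>\<bar>v l - v c\<bar>\<close>. Integrating over \<open>s\<close> turns the indicator of a
  crossing into its width. Enclosing intervals, rather than the sets themselves, keep the integrand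
  measurable.\<close>

lemma difference_le_fan_widths:
  assumes k: "k < N" and l: "l < N"
  shows "\<bar>v k - v l\<bar> \<le> (\<Sum>(i, j)\<in>{..<N} \<times> {..<N}. (fan_width k i j + fan_width l i j) * \<bar>v i - v j\<bar>)"
proof -
  let ?P = "{..<N} \<times> {..<N}"
  \<comment> \<open>The direction of \<open>x k\<close> plus or minus \<open>x l\<close>, with the
    sign that makes the angle at most a right one; both vertices then rise at least 45 degrees above
    the plane of the targets.\<close>
  obtain n where n: "norm n = 1" "1/2 \<le> (n \<bullet> x k)\<^sup>2" "1/2 \<le> (n \<bullet> x l)\<^sup>2"
  proof -
    have kk: "x k \<bullet> x k = 1" "x l \<bullet> x l = 1" using S2_inner_self[OF sites] k l by auto
    define \<sigma> where "\<sigma> = (if 0 \<le> x k \<bullet> x l then 1 else -1 :: real)"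
    define u where "u = x k + \<sigma> *\<^sub>R x l"
    have s2: "\<sigma> * \<sigma> = 1" "0 \<le> \<sigma> * (x k \<bullet> x l)" by (auto simp: \<sigma>_def)
    have uu: "u \<bullet> u = 2 + 2 * (\<sigma> * (x k \<bullet> x l))"
      using kk s2 by (simp add: u_def inner_add_left inner_add_right inner_commute[of "x l" "x k"] algebra_simps)
    have uk: "u \<bullet> x k = 1 + \<sigma> * (x k \<bullet> x l)" using kk by (simp add: u_def inner_add_left inner_commute[of "x l" "x k"])
    have ul: "u \<bullet> x l = \<sigma> * (1 + \<sigma> * (x k \<bullet> x l))" using kk s2 by (simp add: u_def inner_add_left distrib_left mult.assoc[symmetric])
    have nu: "(norm u)\<^sup>2 = 2 * (1 + \<sigma> * (x k \<bullet> x l))" using uu by (simp add: power2_norm_eq_inner)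
    have g: "1 \<le> 1 + \<sigma> * (x k \<bullet> x l)" using s2 by simp
    have nz: "0 < (norm u)\<^sup>2" unfolding nu using g by simp
    have half: "1/2 \<le> c\<^sup>2 / (norm u)\<^sup>2" if "c\<^sup>2 = (1 + \<sigma> * (x k \<bullet> x l))\<^sup>2" for c
    proof -
      have "c\<^sup>2 / (norm u)\<^sup>2 = (1 + \<sigma> * (x k \<bullet> x l)) / 2"
      proof -
        have "b\<^sup>2 / (2 * b) = b / 2" if "1 \<le> b" for b :: real using that by (simp add: power2_eq_square)
        from this[OF g] show ?thesis unfolding that nu .
      qed
      then show ?thesis using g by simp
    qed
    show ?thesis
    proof (rule that[of "(1 / norm u) *\<^sub>R u"])
      show "norm ((1 / norm u) *\<^sub>R u) = 1" using nz by simp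
      show "1/2 \<le> ((1 / norm u) *\<^sub>R u \<bullet> x k)\<^sup>2"
        using half[of "u \<bullet> x k"] uk by (simp add: power_divide)
      show "1/2 \<le> ((1 / norm u) *\<^sub>R u \<bullet> x l)\<^sup>2"
        using half[of "u \<bullet> x l"] ul s2 by (simp add: power_divide power_mult_distrib power2_eq_square[of \<sigma>])
    qed
  qed
  obtain z0 z1 where "orthonormal3 z0 z1 n" using orthonormal3_exists[OF n(1)] .
  then have o: "orthonormal3 n z0 z1" by (auto simp: orthonormal3_def inner_commute)
  define a where "a i j = (SOME c. fan_set (x k) z0 z1 i j \<subseteq> {c..c + fan_width k i j})" for i j
  have a: "fan_set (x k) z0 z1 i j \<subseteq> {a i j..a i j + fan_width k i j}" if "i < N" "j < N" "i \<noteq> j" for i j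
    unfolding a_def by (rule someI_ex) (rule fan_set_interval[OF o n(2) k that, folded fan_width_def])
  define b where "b i j = (SOME c. fan_set (x l) z0 z1 i j \<subseteq> {c..c + fan_width l i j})" for i j
  have b: "fan_set (x l) z0 z1 i j \<subseteq> {b i j..b i j + fan_width l i j}" if "i < N" "j < N" "i \<noteq> j" for i j
    unfolding b_def by (rule someI_ex) (rule fan_set_interval[OF o n(3) l that, folded fan_width_def])
  define f where "f s = (\<Sum>p\<in>?P. (indicator {a (fst p) (snd p)..a (fst p) (snd p) + fan_width k (fst p) (snd p)} s
    + indicator {b (fst p) (snd p)..b (fst p) (snd p) + fan_width l (fst p) (snd p)} s) * \<bar>v (fst p) - v (snd p)\<bar>)" for s :: real
  have fnn: "0 \<le> f s" for s unfolding f_def by (intro sum_nonneg mult_nonneg_nonneg) auto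
  have fi: "integrable lborel f" "(LINT s|lborel. f s) = (\<Sum>p\<in>?P. (fan_width k (fst p) (snd p) + fan_width l (fst p) (snd p)) * \<bar>v (fst p) - v (snd p)\<bar>)"
  proof -
    have hb: "has_bochner_integral lborel f (\<Sum>p\<in>?P. (fan_width k (fst p) (snd p) + fan_width l (fst p) (snd p)) * \<bar>v (fst p) - v (snd p)\<bar>)"
      unfolding f_def
    proof (intro has_bochner_integral_sum has_bochner_integral_mult_left has_bochner_integral_add)
      fix p
      show "has_bochner_integral lborel (indicator {a (fst p) (snd p)..a (fst p) (snd p) + fan_width k (fst p) (snd p)}) (fan_width k (fst p) (snd p))"
        using fan_width_nonneg[of k "fst p" "snd p"] by (simp add: has_bochner_integral_iff)
      show "has_bochner_integral lborel (indicator {b (fst p) (snd p)..b (fst p) (snd p) + fan_width l (fst p) (snd p)}) (fan_width l (fst p) (snd p))"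
        using fan_width_nonneg[of l "fst p" "snd p"] by (simp add: has_bochner_integral_iff)
    qed
    then show "integrable lborel f" "(LINT s|lborel. f s) = (\<Sum>p\<in>?P. (fan_width k (fst p) (snd p) + fan_width l (fst p) (snd p)) * \<bar>v (fst p) - v (snd p)\<bar>)"
      by (auto simp: has_bochner_integral_iff)
  qed
  have lower: "\<bar>v k - v l\<bar> * indicator {0..1} s \<le> f s" for s
  proof (cases "s \<in> {0..1}")
    case True
    obtain c where c: "c < N" "z0 + s *\<^sub>R z1 \<in> cone3 c" using cone3_cover .
    have "\<bar>v k - v l\<bar> \<le> \<bar>v k - v c\<bar> + \<bar>v l - v c\<bar>" by linarith
    also have "\<dots> \<le> (\<Sum>(i, j)\<in>?P. (if i \<noteq> j \<and> s \<in> fan_set (x k) z0 z1 i j then \<bar>v i - v j\<bar> else 0)) +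
        (\<Sum>(i, j)\<in>?P. (if i \<noteq> j \<and> s \<in> fan_set (x l) z0 z1 i j then \<bar>v i - v j\<bar> else 0))"
      by (intro add_mono fan_path k l c True)
    also have "\<dots> \<le> f s"
      unfolding f_def sum.distrib[symmetric]
    proof (rule sum_mono)
      fix p assume "p \<in> ?P"
      then obtain i j where p: "p = (i, j)" "i < N" "j < N" by auto
      show "(case p of (i, j) \<Rightarrow> if i \<noteq> j \<and> s \<in> fan_set (x k) z0 z1 i j then \<bar>v i - v j\<bar> else 0) +
        (case p of (i, j) \<Rightarrow> if i \<noteq> j \<and> s \<in> fan_set (x l) z0 z1 i j then \<bar>v i - v j\<bar> else 0)
        \<le> (indicator {a (fst p) (snd p)..a (fst p) (snd p) + fan_width k (fst p) (snd p)} s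
    + indicator {b (fst p) (snd p)..b (fst p) (snd p) + fan_width l (fst p) (snd p)} s) * \<bar>v (fst p) - v (snd p)\<bar>"
      proof (cases "i = j")
        case False
        have "(if s \<in> fan_set (x k) z0 z1 i j then 1 else 0) \<le> (indicator {a i j..a i j + fan_width k i j} s :: real)"
          using a[OF p(2,3) False] by (auto simp: indicator_def)
        moreover have "(if s \<in> fan_set (x l) z0 z1 i j then 1 else 0) \<le> (indicator {b i j..b i j + fan_width l i j} s :: real)"
          using b[OF p(2,3) False] by (auto simp: indicator_def)
        ultimately have "((if s \<in> fan_set (x k) z0 z1 i j then 1 else 0) + (if s \<in> fan_set (x l) z0 z1 i j then 1 else 0)) * \<bar>v i - v j\<bar>
          \<le> (indicator {a i j..a i j + fan_width k i j} s + indicator {b i j..b i j + fan_width l i j} s) * \<bar>v i - v j\<bar>"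
          by (intro mult_right_mono add_mono) auto
        then show ?thesis using False by (auto simp: p(1) split: if_splits)
      qed (simp add: p(1))
    qed
    finally show ?thesis using True by simp
  next
    case False
    then show ?thesis using fnn[of s] by simp
  qed
  have "\<bar>v k - v l\<bar> = integral\<^sup>L lborel (\<lambda>s::real. \<bar>v k - v l\<bar> * indicator {0..1} s)" by simp
  also have "\<dots> \<le> (LINT s|lborel. f s)"
    by (rule integral_mono) (use fi lower in auto)
  finally show ?thesis by (simp add: fi(2) case_prod_unfold)
qed

text \<open>Collected from the lower bound of \<open>trans\<close>, the width factor 146, the number
  of neighbours and \<open>sum_decay\<close>; the 4 comes from two vertices and the square of a
  sum.\<close>

definition sobolev_const :: real
  where "sobolev_const = sqrt (2 * C0 * (4 * neighbor_bound * 146\<^sup>2 * (80 * C1 * A)))"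

text \<open>Cauchy-Schwarz between the fan widths and the differences weighted by the root of
  \<open>trans\<close>. The bound \<open>1 \<le> 2 * C0 * trans i j\<close> for neighbours inserts
  the weights.\<close>

lemma discrete_sobolev:
  assumes k: "k < N" and l: "l < N"
  shows "\<bar>v k - v l\<bar> \<le> sobolev_const * \<bar>ln h\<bar> * sqrt (energy v)"
proof -
  let ?w = "\<lambda>i j. fan_width k i j + fan_width l i j"
  let ?P = "{..<N} \<times> {..<N}"
  define S where "S = (\<Sum>(i, j)\<in>?P. (?w i j)\<^sup>2)"
  have nbc0: "0 \<le> neighbor_bound" using C1 A by (simp add: neighbor_bound_def)
  have wle: "(\<Sum>j<N. (fan_width k i j)\<^sup>2) \<le> neighbor_bound * (146\<^sup>2 * (h / (h + norm (x i - x k)))\<^sup>2)" if i: "i < N" for i k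
  proof -
    let ?c = "146\<^sup>2 * (h / (h + norm (x i - x k)))\<^sup>2"
    have "(\<Sum>j<N. (fan_width k i j)\<^sup>2) = (\<Sum>j\<in>neighbors N x i. ?c)"
      by (rule sum.mono_neutral_cong_right) (auto simp: fan_width_def neighbors_def power_mult_distrib power_divide)
    also have "\<dots> = real (card (neighbors N x i)) * ?c" by simp
    also have "\<dots> \<le> neighbor_bound * ?c" by (intro mult_right_mono card_neighbors[OF i]) auto
    finally show ?thesis .
  qed
  have one: "(\<Sum>i<N. \<Sum>j<N. (fan_width k i j)\<^sup>2) \<le> neighbor_bound * 146\<^sup>2 * (80 * C1 * A * \<bar>ln h\<bar>)" if "k < N" for k
  proof -
    have "(\<Sum>i<N. \<Sum>j<N. (fan_width k i j)\<^sup>2) \<le> (\<Sum>i<N. neighbor_bound * (146\<^sup>2 * (h / (h + norm (x i - x k)))\<^sup>2))"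
      by (intro sum_mono wle) auto
    also have "\<dots> = neighbor_bound * 146\<^sup>2 * (\<Sum>i<N. (h / (h + norm (x i - x k)))\<^sup>2)" by (simp add: sum_distrib_left mult.assoc)
    also have "\<dots> \<le> neighbor_bound * 146\<^sup>2 * (80 * C1 * A * \<bar>ln h\<bar>)"
      by (intro mult_left_mono sum_decay sites that) (use nbc0 in simp)
    finally show ?thesis .
  qed
  have "S \<le> (\<Sum>(i, j)\<in>?P. 2 * (fan_width k i j)\<^sup>2 + 2 * (fan_width l i j)\<^sup>2)"
    unfolding S_def
  proof (intro sum_mono, clarify)
    fix i j
    show "(?w i j)\<^sup>2 \<le> 2 * (fan_width k i j)\<^sup>2 + 2 * (fan_width l i j)\<^sup>2"
      using sum_squares_bound[of "fan_width k i j" "fan_width l i j"] by (simp add: power2_sum)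
  qed
  also have "\<dots> = 2 * (\<Sum>i<N. \<Sum>j<N. (fan_width k i j)\<^sup>2) + 2 * (\<Sum>i<N. \<Sum>j<N. (fan_width l i j)\<^sup>2)"
    by (simp add: sum.cartesian_product[symmetric] sum.distrib sum_distrib_left)
  also have "\<dots> \<le> 4 * (neighbor_bound * 146\<^sup>2 * (80 * C1 * A * \<bar>ln h\<bar>))" using one[OF k] one[OF l] by simp
  finally have S: "S \<le> 4 * (neighbor_bound * 146\<^sup>2 * (80 * C1 * A * \<bar>ln h\<bar>))" .
  have S0: "0 \<le> S" unfolding S_def by (intro sum_nonneg) auto
  have sq: "(?w i j) * \<bar>v i - v j\<bar> \<le> ?w i j * (sqrt (2 * C0) * (sqrt (trans i j) * \<bar>v i - v j\<bar>))" if "i < N" for i j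
  proof (cases "j \<in> neighbors N x i")
    case True
    have "1 \<le> 2 * C0 * trans i j" using trans_lower[OF that True] C0 by (simp add: field_simps)
    then have "1 \<le> sqrt (2 * C0 * trans i j)" by simp
    then have "1 * \<bar>v i - v j\<bar> \<le> sqrt (2 * C0) * sqrt (trans i j) * \<bar>v i - v j\<bar>"
      by (intro mult_right_mono) (auto simp: real_sqrt_mult)
    then show ?thesis using fan_width_nonneg by (intro mult_left_mono) (auto simp: mult.assoc add_nonneg_nonneg)
  qed (simp add: fan_width_def)
  have "\<bar>v k - v l\<bar> \<le> (\<Sum>p\<in>?P. ?w (fst p) (snd p) * \<bar>v (fst p) - v (snd p)\<bar>)"
    using difference_le_fan_widths[OF k l] by (simp add: case_prod_unfold)
  also have "\<dots> \<le> (\<Sum>p\<in>?P. ?w (fst p) (snd p) * (sqrt (2 * C0) * (sqrt (trans (fst p) (snd p)) * \<bar>v (fst p) - v (snd p)\<bar>)))"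
    by (intro sum_mono sq) auto
  also have "\<dots> = sqrt (2 * C0) * (\<Sum>p\<in>?P. ?w (fst p) (snd p) * (sqrt (trans (fst p) (snd p)) * \<bar>v (fst p) - v (snd p)\<bar>))"
    by (simp add: sum_distrib_left mult_ac)
  also have "(\<Sum>p\<in>?P. ?w (fst p) (snd p) * (sqrt (trans (fst p) (snd p)) * \<bar>v (fst p) - v (snd p)\<bar>))
     \<le> sqrt S * sqrt (energy v)"
  proof -
    have "(\<Sum>p\<in>?P. \<bar>?w (fst p) (snd p)\<bar> * \<bar>sqrt (trans (fst p) (snd p)) * \<bar>v (fst p) - v (snd p)\<bar>\<bar>)
      \<le> L2_set (\<lambda>p. ?w (fst p) (snd p)) ?P * L2_set (\<lambda>p. sqrt (trans (fst p) (snd p)) * \<bar>v (fst p) - v (snd p)\<bar>) ?P"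
      by (rule L2_set_mult_ineq)
    moreover have "L2_set (\<lambda>p. ?w (fst p) (snd p)) ?P = sqrt S" by (simp add: L2_set_def S_def case_prod_unfold)
    moreover have "L2_set (\<lambda>p. sqrt (trans (fst p) (snd p)) * \<bar>v (fst p) - v (snd p)\<bar>) ?P = sqrt (energy v)"
      by (simp add: L2_set_def energy_def power_mult_distrib trans_nonneg sum.cartesian_product case_prod_unfold)
    moreover have "(\<Sum>p\<in>?P. \<bar>?w (fst p) (snd p)\<bar> * \<bar>sqrt (trans (fst p) (snd p)) * \<bar>v (fst p) - v (snd p)\<bar>\<bar>) =
      (\<Sum>p\<in>?P. ?w (fst p) (snd p) * (sqrt (trans (fst p) (snd p)) * \<bar>v (fst p) - v (snd p)\<bar>))"
      using fan_width_nonneg trans_nonneg by (intro sum.cong refl) (auto simp: abs_mult add_nonneg_nonneg)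
    ultimately show ?thesis by simp
  qed
  finally have "\<bar>v k - v l\<bar> \<le> sqrt (2 * C0) * (sqrt S * sqrt (energy v))" using C0 by (simp add: mult_left_mono)
  also have "\<dots> = sqrt (2 * C0 * S) * sqrt (energy v)" by (simp add: real_sqrt_mult)
  also have "\<dots> \<le> (sobolev_const * \<bar>ln h\<bar>) * sqrt (energy v)"
  proof (rule mult_right_mono)
    have "2 * C0 * S \<le> 2 * C0 * (4 * (neighbor_bound * 146\<^sup>2 * (80 * C1 * A * \<bar>ln h\<bar>)))"
      using S C0 by (intro mult_left_mono) auto
    also have "\<dots> = (2 * C0 * (4 * neighbor_bound * 146\<^sup>2 * (80 * C1 * A))) * \<bar>ln h\<bar>" by (simp add: mult_ac)
    \<comment> \<open>Multiplying by \<open>\<bar>ln h\<bar> \<ge> 1\<close> makes the radicand a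
      square in the logarithm.\<close>
    also have "\<dots> \<le> (2 * C0 * (4 * neighbor_bound * 146\<^sup>2 * (80 * C1 * A))) * (\<bar>ln h\<bar> * \<bar>ln h\<bar>)"
      using mult_left_mono[OF abs_ln_h_ge_1, of "\<bar>ln h\<bar>"] C0 C1 A nbc0
      by (intro mult_left_mono mult_nonneg_nonneg) (auto simp del: abs_mult_self_eq)
    finally have "sqrt (2 * C0 * S) \<le> sqrt ((2 * C0 * (4 * neighbor_bound * 146\<^sup>2 * (80 * C1 * A))) * (\<bar>ln h\<bar> * \<bar>ln h\<bar>))"
      by (rule real_sqrt_le_mono)
    also have "\<dots> = sobolev_const * \<bar>ln h\<bar>" by (simp add: sobolev_const_def real_sqrt_mult)
    finally show "sqrt (2 * C0 * S) \<le> sobolev_const * \<bar>ln h\<bar>" .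
  qed (simp add: energy_nonneg)
  finally show ?thesis by (simp add: mult.assoc)
qed

end

section \<open>Interpolation on the Delaunay triangulation\<close>

lemma orthogonal_pair_parallel:
  assumes "cross3 u w \<noteq> 0" "c \<bullet> u = 0" "c \<bullet> w = 0"
  shows "c = ((c \<bullet> cross3 u w) / (cross3 u w \<bullet> cross3 u w)) *\<^sub>R cross3 u w"
proof -
  let ?n = "cross3 u w"
  have nn: "?n \<bullet> ?n \<noteq> 0" using assms(1) by simp
  have "cross3 c ?n = 0" using assms(2,3) by (simp add: Lagrange)
  then have "cross3 ?n (cross3 c ?n) = 0" by simp
  moreover have "cross3 ?n (cross3 c ?n) = (?n \<bullet> ?n) *\<^sub>R c - (?n \<bullet> c) *\<^sub>R ?n"
    by (rule Lagrange)
  ultimately have "(?n \<bullet> ?n) *\<^sub>R c = (c \<bullet> ?n) *\<^sub>R ?n" using inner_commute[of ?n c] by simp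
  then have "(1 / (?n \<bullet> ?n)) *\<^sub>R ((?n \<bullet> ?n) *\<^sub>R c) = (1 / (?n \<bullet> ?n)) *\<^sub>R ((c \<bullet> ?n) *\<^sub>R ?n)" by simp
  then show ?thesis using nn by simp
qed

lemma perp_cross3_decompose:
  assumes "cross3 u w \<noteq> 0" "v \<bullet> cross3 u w = 0"
  obtains a b where "v = a *\<^sub>R u + b *\<^sub>R w"
proof -
  let ?n = "cross3 u w"
  have nn: "?n \<bullet> ?n \<noteq> 0" using assms(1) by simp
  have 1: "(?n \<bullet> ?n) *\<^sub>R v = cross3 ?n (cross3 v ?n)"
    unfolding Lagrange[of ?n v ?n] using assms(2) by (simp add: inner_commute[of ?n v])
  have 2: "cross3 v ?n = (v \<bullet> w) *\<^sub>R u - (v \<bullet> u) *\<^sub>R w" by (rule Lagrange)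
  have 3: "cross3 ?n u = - ((u \<bullet> w) *\<^sub>R u - (u \<bullet> u) *\<^sub>R w)" "cross3 ?n w = - ((w \<bullet> w) *\<^sub>R u - (w \<bullet> u) *\<^sub>R w)"
    unfolding cross_skew[of ?n u] cross_skew[of ?n w] Lagrange[of u u w] Lagrange[of w u w]
    by (rule refl)+
  have "(?n \<bullet> ?n) *\<^sub>R v = (v \<bullet> w) *\<^sub>R cross3 ?n u - (v \<bullet> u) *\<^sub>R cross3 ?n w"
    unfolding 1 2 by (simp only: Cross3.right_diff_distrib cross_mult_right)
  also have "\<dots> = ((v \<bullet> u) * (w \<bullet> w) - (v \<bullet> w) * (u \<bullet> w)) *\<^sub>R u + ((v \<bullet> w) * (u \<bullet> u) - (v \<bullet> u) * (w \<bullet> u)) *\<^sub>R w"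
    unfolding 3 scaleR_minus_right scaleR_diff_right scaleR_diff_left scaleR_scaleR
    by simp
  finally have e: "(?n \<bullet> ?n) *\<^sub>R v = ((v \<bullet> u) * (w \<bullet> w) - (v \<bullet> w) * (u \<bullet> w)) *\<^sub>R u + ((v \<bullet> w) * (u \<bullet> u) - (v \<bullet> u) * (w \<bullet> u)) *\<^sub>R w" .
  have "v = (1 / (?n \<bullet> ?n)) *\<^sub>R ((?n \<bullet> ?n) *\<^sub>R v)" using nn by simp
  then show ?thesis unfolding e scaleR_add_right scaleR_scaleR by (rule that)
qed

lemma cross3_zero_multiple:
  assumes "cross3 u w = 0" "u \<noteq> 0"
  shows "w = ((u \<bullet> w) / (u \<bullet> u)) *\<^sub>R u"
proof -
  have "cross3 u (cross3 u w) = 0" using assms by simp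
  then have "(u \<bullet> u) *\<^sub>R w = (u \<bullet> w) *\<^sub>R u" by (simp add: Lagrange)
  then have "(1 / (u \<bullet> u)) *\<^sub>R ((u \<bullet> u) *\<^sub>R w) = (1 / (u \<bullet> u)) *\<^sub>R ((u \<bullet> w) *\<^sub>R u)" by simp
  then show ?thesis using assms(2) by simp
qed

locale delaunay_mesh = uniform_voronoi N x C0 C1 A h for N x C0 C1 A h +
  assumes tiling: "(\<Union>t\<in>delaunay N x. gtri x t) = S2"
begin

abbreviation nodes :: "nat \<times> nat \<times> nat \<Rightarrow> nat set"
  where "nodes t \<equiv> {fst t, fst (snd t), snd (snd t)}"

lemma delaunayD:
  assumes "(i, j, k) \<in> delaunay N x"
  shows "i < j" "j < k" "k < N" "j \<in> neighbors N x i" "k \<in> neighbors N x j" "i \<in> neighbors N x k"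
  using assms by (auto simp: delaunay_def)

lemma cross3_sites:
  assumes "i < N" "j < N" "k < N" "i \<noteq> j" "k \<noteq> i" "k \<noteq> j"
  shows "cross3 (x j - x i) (x k - x i) \<noteq> 0"
proof
  assume z: "cross3 (x j - x i) (x k - x i) = 0"
  have "x j - x i \<noteq> 0" using sites_eq_iff assms by auto
  from cross3_zero_multiple[OF z this]
  obtain \<mu> where "x k - x i = \<mu> *\<^sub>R (x j - x i)" by blast
  then have "x k - x i = (- \<mu>) *\<^sub>R (x i - x j)" by (simp add: algebra_simps)
  then show False by (rule sites_not_collinear[OF assms(1,2,3,5,6)])
qed

lemma neighbor_vedge_other:
  assumes i: "i < N" and j: "j \<in> neighbors N x i"
  obtains c' where "c' \<in> vedge N x i j" "c' \<noteq> c"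
proof -
  have j': "j < N" "j \<noteq> i" "0 < curve_length (vedge N x i j)" using neighborsD[OF j] by auto
  have "\<exists>y\<in>vedge N x i j. \<exists>z\<in>vedge N x i j. y \<noteq> z"
  proof (rule ccontr)
    assume "\<not> ?thesis"
    then have "curve_length (vedge N x i j) = 0"
      using edge_weight_degenerate(1)[OF i j'(1)] j'(2) by blast
    then show False using j'(3) by simp
  qed
  then show ?thesis using that by metis
qed

text \<open>\<open>d\<close> is a second point of the edge between \<open>i\<close> and
  \<open>j\<close>. If \<open>k\<close> tied there too, \<open>d\<close> and \<open>c\<close> would
  be parallel unit vectors, hence antipodal, yet both lie within \<open>h\<close> of
  \<open>x i\<close>.\<close>

lemma delaunay_edge_strict:
  assumes i: "i < N" and j: "j \<in> neighbors N x i" and k: "k < N" "k \<noteq> i" "k \<noteq> j"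
    and c: "c \<in> wcell i" "c \<in> wcell j" "c \<in> wcell k"
  obtains d where "d \<bullet> x i = d \<bullet> x j" "\<And>m. m < N \<Longrightarrow> d \<bullet> x m \<le> d \<bullet> x i" "d \<bullet> x k < d \<bullet> x i"
proof -
  have j': "j < N" "j \<noteq> i" using neighborsD[OF j] by auto
  obtain d where d: "d \<in> vedge N x i j" "d \<noteq> c" using neighbor_vedge_other[OF i j] .
  have dw: "d \<in> wcell i" "d \<in> wcell j" using d(1) vedge_eq[OF i j'(1)] by auto
  have eq: "d \<bullet> x i = d \<bullet> x j" by (rule vedge_inner_eq[OF i j'(1) d(1)])
  have le: "d \<bullet> x m \<le> d \<bullet> x i" if "m < N" for m using dw(1) that by (simp add: wcell_def)
  have "d \<bullet> x k \<noteq> d \<bullet> x i"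
  proof
    assume dk: "d \<bullet> x k = d \<bullet> x i"
    let ?n = "cross3 (x j - x i) (x k - x i)"
    have n0: "?n \<noteq> 0" by (rule cross3_sites) (use i j' k in auto)
    have ci: "c \<bullet> x i = c \<bullet> x j" "c \<bullet> x i = c \<bullet> x k"
      using c i j' k by (auto simp: wcell_def intro: antisym)
    have dp: "d = ((d \<bullet> ?n) / (?n \<bullet> ?n)) *\<^sub>R ?n"
      by (rule orthogonal_pair_parallel[OF n0]) (use eq dk in \<open>auto simp: inner_diff_right\<close>)
    have cp: "c = ((c \<bullet> ?n) / (?n \<bullet> ?n)) *\<^sub>R ?n"
      by (rule orthogonal_pair_parallel[OF n0]) (use ci in \<open>auto simp: inner_diff_right\<close>)
    define \<alpha> where "\<alpha> = ((d \<bullet> ?n) / (?n \<bullet> ?n)) * norm ?n"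
    define \<beta> where "\<beta> = ((c \<bullet> ?n) / (?n \<bullet> ?n)) * norm ?n"
    define e where "e = (1 / norm ?n) *\<^sub>R ?n"
    have e: "norm e = 1" using n0 by (simp add: e_def)
    have de: "d = \<alpha> *\<^sub>R e" "c = \<beta> *\<^sub>R e"
      using dp cp n0 by (simp_all add: \<alpha>_def \<beta>_def e_def)
    have "norm d = 1" "norm c = 1" using dw c by (auto simp: wcell_def)
    then have ab: "\<bar>\<alpha>\<bar> = 1" "\<bar>\<beta>\<bar> = 1" using de e by auto
    have "\<alpha> \<noteq> \<beta>" using d(2) de by auto
    then have "\<bar>\<alpha> - \<beta>\<bar> = 2" using ab by (auto simp: abs_if split: if_splits)
    moreover have "d - c = (\<alpha> - \<beta>) *\<^sub>R e" using de by (simp add: algebra_simps)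
    ultimately have "norm (d - c) = 2" using e by simp
    moreover have "norm (d - c) \<le> 2 * h"
      using norm_wcell_le[OF i dw(1)] norm_wcell_le[OF i c(1)] norm_triangle_ineq4[of "d - x i" "c - x i"] h_eq by simp
    ultimately show False using h_le by simp
  qed
  then have "d \<bullet> x k < d \<bullet> x i" using le[OF k(1)] by simp
  then show ?thesis using that eq le by blast
qed

text \<open>The plane of a Delaunay triangle supports the polyhedral surface. Hence radial projection is
  injective on it.\<close>

lemma delaunay_support:
  assumes t: "(i, j, k) \<in> delaunay N x"
  obtains c \<sigma> where "0 < \<sigma>" "c \<bullet> x i = \<sigma>" "c \<bullet> x j = \<sigma>" "c \<bullet> x k = \<sigma>"
    "\<And>m. m < N \<Longrightarrow> c \<bullet> x m \<le> \<sigma>" "\<And>m. m < N \<Longrightarrow> m \<notin> {i, j, k} \<Longrightarrow> c \<bullet> x m < \<sigma>"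
proof -
  note d = delaunayD[OF t]
  have N: "i < N" "j < N" "k < N" using d by auto
  have ne: "i \<noteq> j" "i \<noteq> k" "j \<noteq> k" using d by auto
  obtain c where c: "c \<in> wcell i" "c \<in> wcell j" "c \<in> wcell k"
    using t N by (auto simp: delaunay_def closure_vcell)
  define \<sigma> where "\<sigma> = c \<bullet> x i"
  have ci: "c \<bullet> x i = \<sigma>" "c \<bullet> x j = \<sigma>" "c \<bullet> x k = \<sigma>"
    using c N by (auto simp: \<sigma>_def wcell_def intro: antisym)
  have le: "c \<bullet> x m \<le> \<sigma>" if "m < N" for m using c(1) that by (simp add: \<sigma>_def wcell_def)
  have cS: "c \<in> S2" using c by (simp add: wcell_def)
  have "norm (c - x i) \<le> 1/16" using norm_wcell_le[OF N(1) c(1)] h_eq h_le by simp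
  then have "(norm (c - x i))\<^sup>2 \<le> (1/16)\<^sup>2" by (intro power_mono) auto
  then have \<sigma>0: "0 < \<sigma>" using S2_inner_eq_norm[OF cS sites[OF N(1)]] by (simp add: \<sigma>_def power2_eq_square)
  \<comment> \<open>A fourth tying vertex lies in the plane of the triangle. The functionals
    obtained from the three edges make its affine coordinates nonnegative, so it is a convex
    combination of the corners; but its inner product with each corner is below 1.\<close>
  have strict: "c \<bullet> x m < \<sigma>" if m: "m < N" "m \<notin> {i, j, k}" for m
  proof (rule ccontr)
    assume "\<not> c \<bullet> x m < \<sigma>"
    then have cm: "c \<bullet> x m = \<sigma>" using le[OF m(1)] by simp
    let ?u = "x j - x i" and ?w = "x k - x i"
    let ?n = "cross3 ?u ?w"
    have n0: "?n \<noteq> 0" by (rule cross3_sites) (use N ne in auto)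
    have cp: "c = ((c \<bullet> ?n) / (?n \<bullet> ?n)) *\<^sub>R ?n"
      by (rule orthogonal_pair_parallel[OF n0]) (use ci in \<open>auto simp: inner_diff_right\<close>)
    have "(x m - x i) \<bullet> c = 0" using cm ci by (simp add: inner_diff_left inner_commute inner_diff_right)
    then have "((c \<bullet> ?n) / (?n \<bullet> ?n)) * ((x m - x i) \<bullet> ?n) = 0" by (subst (asm) cp) simp
    moreover have "(c \<bullet> ?n) / (?n \<bullet> ?n) \<noteq> 0"
    proof
      assume "(c \<bullet> ?n) / (?n \<bullet> ?n) = 0"
      then have "c = 0" by (subst cp) simp
      then show False using cS by simp
    qed
    ultimately have perp: "(x m - x i) \<bullet> ?n = 0" by (metis mult_eq_0_iff)
    obtain a b where ab: "x m - x i = a *\<^sub>R ?u + b *\<^sub>R ?w" using perp_cross3_decompose[OF n0 perp] .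
    obtain d where dij: "d \<bullet> x i = d \<bullet> x j" "\<And>m. m < N \<Longrightarrow> d \<bullet> x m \<le> d \<bullet> x i" "d \<bullet> x k < d \<bullet> x i"
      using delaunay_edge_strict[OF N(1) d(4) N(3) _ _ c(1,2,3)] ne by metis
    obtain e where ejk: "e \<bullet> x j = e \<bullet> x k" "\<And>m. m < N \<Longrightarrow> e \<bullet> x m \<le> e \<bullet> x j" "e \<bullet> x i < e \<bullet> x j"
      using delaunay_edge_strict[OF N(2) d(5) N(1) _ _ c(2,3,1)] ne by metis
    obtain f where fki: "f \<bullet> x k = f \<bullet> x i" "\<And>m. m < N \<Longrightarrow> f \<bullet> x m \<le> f \<bullet> x k" "f \<bullet> x j < f \<bullet> x k"
      using delaunay_edge_strict[OF N(3) d(6) N(2) _ _ c(3,1,2)] ne by metis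
    have dm: "g \<bullet> x m - g \<bullet> x i = a * (g \<bullet> x j - g \<bullet> x i) + b * (g \<bullet> x k - g \<bullet> x i)" for g
    proof -
      have "g \<bullet> (x m - x i) = g \<bullet> (a *\<^sub>R ?u + b *\<^sub>R ?w)" by (simp add: ab)
      then show ?thesis by (simp add: inner_diff_right inner_add_right)
    qed
    have b0: "0 \<le> b"
    proof -
      have "b * (d \<bullet> x k - d \<bullet> x i) \<le> 0" using dm[of d] dij(1) dij(2)[OF m(1)] by simp
      then show ?thesis using dij(3) by (simp add: mult_le_0_iff)
    qed
    have a0: "0 \<le> a"
    proof -
      have "a * (f \<bullet> x j - f \<bullet> x i) \<le> 0" using dm[of f] fki(1) fki(2)[OF m(1)] by simp
      then show ?thesis using fki(1,3) by (simp add: mult_le_0_iff)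
    qed
    have ab1: "0 \<le> 1 - a - b"
    proof -
      have "e \<bullet> x m - e \<bullet> x j = (1 - a - b) * (e \<bullet> x i - e \<bullet> x j)"
        using dm[of e] ejk(1) by (simp add: algebra_simps)
      then have "(1 - a - b) * (e \<bullet> x i - e \<bullet> x j) \<le> 0" using ejk(2)[OF m(1)] by simp
      then show ?thesis using ejk(3) by (simp add: mult_le_0_iff)
    qed
    have one: "x m \<bullet> x m = (1 - a - b) * (x m \<bullet> x i) + a * (x m \<bullet> x j) + b * (x m \<bullet> x k)"
      using dm[of "x m"] by (simp add: algebra_simps)
    have lt: "x m \<bullet> x l < 1" if "l \<in> {i, j, k}" for l
      using S2_inner_less_1[OF sites sites, of m l] sites_eq_iff[of m l] m N that by auto
    define M where "M = max (x m \<bullet> x i) (max (x m \<bullet> x j) (x m \<bullet> x k))"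
    have "x m \<bullet> x m \<le> (1 - a - b) * M + a * M + b * M"
      unfolding one using a0 b0 ab1 by (intro add_mono mult_left_mono) (auto simp: M_def)
    also have "\<dots> = M" by (simp add: algebra_simps)
    also have "\<dots> < 1" unfolding M_def using lt by simp
    finally show False using S2_inner_self[OF sites[OF m(1)]] by simp
  qed
  show ?thesis by (rule that[OF \<sigma>0 ci le strict])
qed

end

section \<open>Barycentric coordinates\<close>

context delaunay_mesh
begin

text \<open>The weights are indexed by all vertices and vanish outside the triangle, so that weights
  from different triangles can be compared.\<close>

definition bary :: "nat \<times> nat \<times> nat \<Rightarrow> real ^ 3 \<Rightarrow> (nat \<Rightarrow> real) \<Rightarrow> bool"
  where "bary t y b \<longleftrightarrow> (\<forall>m. 0 \<le> b m) \<and> (\<Sum>m<N. b m) = 1 \<and> (\<Sum>m<N. b m *\<^sub>R x m) = y \<and>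
    (\<forall>m. m \<notin> nodes t \<longrightarrow> b m = 0)"

lemma baryD:
  assumes "bary t y b"
  shows "0 \<le> b m" "(\<Sum>m<N. b m) = 1" "(\<Sum>m<N. b m *\<^sub>R x m) = y" "m \<notin> nodes t \<Longrightarrow> b m = 0"
  using assms by (auto simp: bary_def)

lemma nodes_less:
  assumes "t \<in> delaunay N x" "m \<in> nodes t" shows "m < N"
  using assms by (cases t) (auto simp: delaunay_def)

lemma sum_nodes:
  fixes g :: "nat \<Rightarrow> 'b::comm_monoid_add"
  assumes t: "(i, j, k) \<in> delaunay N x" and z: "\<And>m. m \<notin> {i, j, k} \<Longrightarrow> g m = 0"
  shows "(\<Sum>m<N. g m) = g i + (g j + g k)"
proof -
  note d = delaunayD[OF t]
  have "(\<Sum>m<N. g m) = (\<Sum>m\<in>{i, j, k}. g m)"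
    by (rule sum.mono_neutral_right) (use d z in auto)
  then show ?thesis using d by simp
qed

lemma ptri_iff_bary:
  assumes t: "t \<in> delaunay N x"
  shows "y \<in> ptri x t \<longleftrightarrow> (\<exists>b. bary t y b)"
proof -
  obtain i j k where tt: "t = (i, j, k)" by (cases t)
  note d = delaunayD[OF t[unfolded tt]]
  note s = sum_nodes[OF t[unfolded tt]]
  show ?thesis
  proof
    assume "y \<in> ptri x t"
    then obtain u v w where uvw: "0 \<le> u" "0 \<le> v" "0 \<le> w" "u + v + w = 1"
      "y = u *\<^sub>R x i + v *\<^sub>R x j + w *\<^sub>R x k"
      by (auto simp: ptri_def tt convex_hull_3)
    define b where "b = (\<lambda>m. if m = i then u else if m = j then v else if m = k then w else 0)"
    have bv: "b i = u" "b j = v" "b k = w" using d by (auto simp: b_def)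
    have "(\<Sum>m<N. b m) = 1" by (subst s) (use uvw bv in \<open>auto simp: b_def\<close>)
    moreover have "(\<Sum>m<N. b m *\<^sub>R x m) = y" by (subst s) (use uvw bv in \<open>auto simp: b_def\<close>)
    ultimately have "bary t y b" using uvw by (auto simp: bary_def tt b_def)
    then show "\<exists>b. bary t y b" by blast
  next
    assume "\<exists>b. bary t y b"
    then obtain b where b: "bary t y b" by blast
    note B = baryD[OF b]
    have z: "b m = 0" if "m \<notin> {i, j, k}" for m using B(4)[of m] that by (simp add: tt)
    have "(\<Sum>m<N. b m) = b i + (b j + b k)" by (rule s) (rule z)
    moreover have "(\<Sum>m<N. b m *\<^sub>R x m) = b i *\<^sub>R x i + (b j *\<^sub>R x j + b k *\<^sub>R x k)"
      by (rule s) (simp add: z)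
    ultimately have "y = b i *\<^sub>R x i + b j *\<^sub>R x j + b k *\<^sub>R x k" "b i + b j + b k = 1"
      using B(2,3) by auto
    then show "y \<in> ptri x t"
      unfolding ptri_def tt convex_hull_3 using B(1)[of i] B(1)[of j] B(1)[of k] by auto
  qed
qed

lemma delaunay_support_nodes:
  assumes t: "t \<in> delaunay N x"
  obtains c \<sigma> where "0 < \<sigma>" "\<And>m. m \<in> nodes t \<Longrightarrow> c \<bullet> x m = \<sigma>"
    "\<And>m. m < N \<Longrightarrow> c \<bullet> x m \<le> \<sigma>" "\<And>m. m < N \<Longrightarrow> m \<notin> nodes t \<Longrightarrow> c \<bullet> x m < \<sigma>"
proof -
  obtain i j k where tt: "t = (i, j, k)" by (cases t)
  show ?thesis
  proof (rule delaunay_support[OF t[unfolded tt]], goal_cases)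
    case (1 c \<sigma>)
    show ?case by (rule that[where c = c and \<sigma> = \<sigma>, OF 1(1) _ 1(5)]) (use 1 in \<open>auto simp: tt\<close>)
  qed
qed

lemma bary_inner:
  assumes b: "bary t y b" shows "c \<bullet> y = (\<Sum>m<N. b m * (c \<bullet> x m))"
  unfolding baryD(3)[OF b, symmetric] by (simp add: inner_sum_right)

lemma bary_inner_le:
  assumes b: "bary t y b" and le: "\<And>m. m < N \<Longrightarrow> c \<bullet> x m \<le> \<sigma>"
  shows "c \<bullet> y \<le> \<sigma>"
proof -
  have "c \<bullet> y \<le> (\<Sum>m<N. b m * \<sigma>)"
    unfolding bary_inner[OF b] by (intro sum_mono mult_left_mono le baryD(1)[OF b]) auto
  also have "\<dots> = \<sigma>" using baryD(2)[OF b] by (simp flip: sum_distrib_right)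
  finally show ?thesis .
qed

lemma bary_inner_eq:
  assumes b: "bary t y b" and eq: "\<And>m. m \<in> nodes t \<Longrightarrow> c \<bullet> x m = \<sigma>"
  shows "c \<bullet> y = \<sigma>"
proof -
  have "b m * (c \<bullet> x m) = b m * \<sigma>" for m using eq[of m] baryD(4)[OF b, of m] by (cases "m \<in> nodes t") auto
  then have "c \<bullet> y = (\<Sum>m<N. b m * \<sigma>)" unfolding bary_inner[OF b] by (simp only:)
  also have "\<dots> = \<sigma>" using baryD(2)[OF b] by (simp flip: sum_distrib_right)
  finally show ?thesis .
qed

text \<open>Complementary slackness: the functional supporting \<open>t\<close> attains at
  \<open>y\<close> its maximum over the vertices, so no weight can sit on a vertex where it is
  strictly smaller.\<close>

lemma bary_support:
  assumes b: "bary t y b" and t: "t \<in> delaunay N x" and b': "bary t' y b'"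
    and t': "t' \<in> delaunay N x" and m: "m \<notin> nodes t"
  shows "b' m = 0"
proof (cases "m \<in> nodes t'")
  case False
  then show ?thesis by (rule baryD(4)[OF b'])
next
  case True
  obtain c \<sigma> where c: "0 < \<sigma>" "\<And>m. m \<in> nodes t \<Longrightarrow> c \<bullet> x m = \<sigma>"
    "\<And>m. m < N \<Longrightarrow> c \<bullet> x m \<le> \<sigma>" "\<And>m. m < N \<Longrightarrow> m \<notin> nodes t \<Longrightarrow> c \<bullet> x m < \<sigma>"
    by (rule delaunay_support_nodes[OF t]) blast
  have "c \<bullet> y = \<sigma>" by (rule bary_inner_eq[OF b c(2)])
  then have "(\<Sum>m<N. b' m * (c \<bullet> x m)) = (\<Sum>m<N. b' m * \<sigma>)"
    using bary_inner[OF b', of c] baryD(2)[OF b'] by (simp flip: sum_distrib_right)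
  then have "(\<Sum>m<N. b' m * (\<sigma> - c \<bullet> x m)) = 0"
    by (simp add: algebra_simps sum_subtractf)
  moreover have "0 \<le> b' l * (\<sigma> - c \<bullet> x l)" if "l \<in> {..<N}" for l
    using c(3)[of l] baryD(1)[OF b'] that by simp
  ultimately have "\<forall>l\<in>{..<N}. b' l * (\<sigma> - c \<bullet> x l) = 0"
    by (subst (asm) sum_nonneg_eq_0_iff) auto
  then show ?thesis using c(4)[OF nodes_less[OF t' True] m] nodes_less[OF t' True] by auto
qed

text \<open>By \<open>bary_support\<close> both weights live on the corners of \<open>t\<close>,
  which are affinely independent. Comparing weights replaces any discussion of how triangles
  intersect.\<close>

lemma bary_unique:
  assumes b: "bary t y b" and t: "t \<in> delaunay N x" and b': "bary t' y b'" and t': "t' \<in> delaunay N x"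
  shows "b = b'"
proof -
  obtain i j k where tt: "t = (i, j, k)" by (cases t)
  note d = delaunayD[OF t[unfolded tt]]
  define e where "e m = b m - b' m" for m
  have e0: "e m = 0" if "m \<notin> {i, j, k}" for m
    using that bary_support[OF b t b' t', of m] baryD(4)[OF b, of m] by (simp add: e_def tt)
  have "e i + (e j + e k) = (\<Sum>m<N. e m)" by (rule sum_nodes[OF t[unfolded tt], symmetric]) (rule e0)
  also have "\<dots> = 0" using baryD(2)[OF b] baryD(2)[OF b'] by (simp add: e_def sum_subtractf)
  finally have s: "e i = - e j - e k" by simp
  have "e i *\<^sub>R x i + (e j *\<^sub>R x j + e k *\<^sub>R x k) = (\<Sum>m<N. e m *\<^sub>R x m)"
    by (rule sum_nodes[OF t[unfolded tt], symmetric]) (simp add: e0)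
  also have "\<dots> = 0" using baryD(3)[OF b] baryD(3)[OF b'] by (simp add: e_def sum_subtractf scaleR_diff_left)
  finally have z: "e j *\<^sub>R (x j - x i) + e k *\<^sub>R (x k - x i) = 0" unfolding s
    by (simp add: scaleR_diff_left scaleR_diff_right add.commute diff_diff_eq2 add_diff_eq diff_add_eq)
  let ?u = "x j - x i" and ?w = "x k - x i"
  have n0: "cross3 ?u ?w \<noteq> 0" by (rule cross3_sites) (use d in auto)
  have "cross3 ?u (e j *\<^sub>R ?u + e k *\<^sub>R ?w) = e k *\<^sub>R cross3 ?u ?w"
    by (simp only: Cross3.right_diff_distrib Cross3.cross_add_right cross_mult_right cross_refl scaleR_zero_right add_0)
  then have ek: "e k = 0" using n0 by (simp add: z)
  have "cross3 (e j *\<^sub>R ?u + e k *\<^sub>R ?w) ?w = e j *\<^sub>R cross3 ?u ?w"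
    by (simp only: Cross3.cross_add_left cross_mult_left cross_refl scaleR_zero_right add_0_right)
  then have ej: "e j = 0" using n0 by (simp add: z)
  have "e i = 0" using s ej ek by simp
  then have "e m = 0" for m using e0 ej ek by (cases "m \<in> {i, j, k}") auto
  then show ?thesis by (auto simp: e_def)
qed

lemma polysurf_bary:
  assumes "y \<in> polysurf N x"
  obtains t b where "t \<in> delaunay N x" "bary t y b" "y \<in> ptri x t"
  using assms ptri_iff_bary unfolding polysurf_def by blast

lemma zero_notin_polysurf: "0 \<notin> polysurf N x"
proof
  assume "0 \<in> polysurf N x"
  then obtain t b where t: "t \<in> delaunay N x" and b: "bary t 0 b" by (rule polysurf_bary)
  obtain c \<sigma> where c: "0 < \<sigma>" "\<And>m. m \<in> nodes t \<Longrightarrow> c \<bullet> x m = \<sigma>"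
    by (rule delaunay_support_nodes[OF t]) blast
  have "c \<bullet> (0::real^3) = \<sigma>" by (rule bary_inner_eq[OF b c(2)])
  then show False using c(1) by simp
qed

text \<open>The supporting functional of a triangle through \<open>y\<close> is positive and maximal
  there, so no point further out on the ray belongs to the surface.\<close>

lemma polysurf_scale_le:
  assumes y: "y \<in> polysurf N x" and z: "r *\<^sub>R y \<in> polysurf N x"
  shows "r \<le> 1"
proof -
  obtain t b where t: "t \<in> delaunay N x" and b: "bary t y b" using y by (rule polysurf_bary)
  obtain t' b' where b': "bary t' (r *\<^sub>R y) b'" using z by (rule polysurf_bary)
  obtain c \<sigma> where c: "0 < \<sigma>" "\<And>m. m \<in> nodes t \<Longrightarrow> c \<bullet> x m = \<sigma>" "\<And>m. m < N \<Longrightarrow> c \<bullet> x m \<le> \<sigma>"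
    by (rule delaunay_support_nodes[OF t]) blast
  have "c \<bullet> y = \<sigma>" by (rule bary_inner_eq[OF b c(2)])
  moreover have "c \<bullet> (r *\<^sub>R y) \<le> \<sigma>" by (rule bary_inner_le[OF b' c(3)])
  ultimately have "r * \<sigma> \<le> 1 * \<sigma>" by simp
  then show ?thesis using c(1) by (simp only: mult_le_cancel_right_pos)
qed

lemma radial_scale: "y \<noteq> 0 \<Longrightarrow> y = norm y *\<^sub>R radial y"
  by (simp add: radial_def)

lemma inj_radial: "inj_on radial (polysurf N x)"
proof
  fix y z assume y: "y \<in> polysurf N x" and z: "z \<in> polysurf N x" and eq: "radial y = radial z"
  have y0: "y \<noteq> 0" and z0: "z \<noteq> 0" using y z zero_notin_polysurf by metis+
  have zy: "z = (norm z / norm y) *\<^sub>R y" using radial_scale[OF z0] y0 unfolding eq[symmetric] by (simp add: radial_def divide_inverse)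
  have yz: "y = (norm y / norm z) *\<^sub>R z" using radial_scale[OF y0] z0 unfolding eq by (simp add: radial_def divide_inverse)
  have "norm z / norm y \<le> 1" by (rule polysurf_scale_le[OF y]) (use zy z in simp)
  moreover have "norm y / norm z \<le> 1" by (rule polysurf_scale_le[OF z]) (use yz y in simp)
  ultimately have "norm y = norm z" using y0 z0 by (simp add: field_simps)
  then show "y = z" using zy y0 by (auto split: if_splits)
qed

section \<open>Lifting the sphere to the polyhedral surface\<close>

lemma finite_delaunay: "finite (delaunay N x)"
proof (rule finite_subset)
  show "delaunay N x \<subseteq> {..<N} \<times> {..<N} \<times> {..<N}" by (auto simp: delaunay_def)
qed simp

lemma compact_ptri: "compact (ptri x t)"
  by (cases t) (auto simp: ptri_def intro!: finite_imp_compact_convex_hull)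

lemma compact_polysurf: "compact (polysurf N x)"
  unfolding polysurf_def by (intro compact_UN finite_delaunay compact_ptri)

lemma image_radial: "radial ` polysurf N x = S2"
  unfolding polysurf_def image_UN gtri_def[symmetric] by (rule tiling)

lemma continuous_radial: "continuous_on (polysurf N x) radial"
proof -
  have "continuous_on (polysurf N x) (\<lambda>y. inverse (norm y) *\<^sub>R y)"
    by (intro continuous_intros) (metis norm_eq_zero zero_notin_polysurf)
  then show ?thesis by (simp add: radial_def[abs_def])
qed

abbreviation lift :: "real ^ 3 \<Rightarrow> real ^ 3"
  where "lift \<equiv> inv_into (polysurf N x) radial"

lemma lift_in: "y \<in> S2 \<Longrightarrow> lift y \<in> polysurf N x"
  by (rule inv_into_into) (simp add: image_radial)

lemma radial_lift: "y \<in> S2 \<Longrightarrow> radial (lift y) = y"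
  by (rule f_inv_into_f) (simp add: image_radial)

lemma continuous_lift: "continuous_on S2 lift"
proof -
  have "continuous_on (radial ` polysurf N x) lift"
    by (rule continuous_on_inv[OF continuous_radial compact_polysurf]) (simp add: inv_into_f_f[OF inj_radial])
  then show ?thesis by (simp add: image_radial)
qed

text \<open>The tiling only provides a surface point \<open>p\<close> on the ray of
  \<open>x i\<close>, of norm at most 1 as a convex combination of unit vectors. If
  \<open>x i\<close> were not a corner, the supporting functional at \<open>p\<close> would fall
  below its value \<open>\<sigma>\<close>.\<close>

lemma site_node:
  assumes i: "i < N" obtains t where "t \<in> delaunay N x" "i \<in> nodes t"
proof -
  have xi: "x i \<in> S2" by (rule sites[OF i])
  define p where "p = lift (x i)"
  have p: "p \<in> polysurf N x" "radial p = x i" using lift_in[OF xi] radial_lift[OF xi] by (auto simp: p_def)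
  obtain t b where t: "t \<in> delaunay N x" and b: "bary t p b" using p(1) by (rule polysurf_bary)
  have p0: "p \<noteq> 0" using p(1) zero_notin_polysurf by metis
  have px: "p = norm p *\<^sub>R x i" using radial_scale[OF p0] p(2) by simp
  have "norm p \<le> (\<Sum>m<N. norm (b m *\<^sub>R x m))" unfolding baryD(3)[OF b, symmetric] by (rule norm_sum)
  also have "\<dots> = (\<Sum>m<N. b m)"
    by (rule sum.cong) (use sites baryD(1)[OF b] in auto)
  finally have np: "norm p \<le> 1" using baryD(2)[OF b] by simp
  obtain c \<sigma> where c: "0 < \<sigma>" "\<And>m. m \<in> nodes t \<Longrightarrow> c \<bullet> x m = \<sigma>" "\<And>m. m < N \<Longrightarrow> m \<notin> nodes t \<Longrightarrow> c \<bullet> x m < \<sigma>"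
    by (rule delaunay_support_nodes[OF t]) blast
  have "c \<bullet> p = \<sigma>" by (rule bary_inner_eq[OF b c(2)])
  then have s: "norm p * (c \<bullet> x i) = \<sigma>" by (subst (asm) px) simp
  have "i \<in> nodes t"
  proof (rule ccontr)
    assume "i \<notin> nodes t"
    then have lt: "c \<bullet> x i < \<sigma>" by (rule c(3)[OF i])
    have "norm p * (c \<bullet> x i) < norm p * \<sigma>" using lt p0 by simp
    also have "\<dots> \<le> 1 * \<sigma>" using np c(1) by (intro mult_right_mono) auto
    finally show False using s by simp
  qed
  then show ?thesis using that t by blast
qed

lemma bary_node:
  assumes t: "t \<in> delaunay N x" "i \<in> nodes t"
  shows "bary t (x i) (\<lambda>m. if m = i then 1 else 0)"
proof -
  have "i < N" using nodes_less[OF t] .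
  then have "(\<Sum>m<N. (if m = i then 1 else 0) *\<^sub>R x m) = x i"
    by (simp add: if_distrib[of "\<lambda>a. a *\<^sub>R _"] cong: if_cong)
  then show ?thesis using t(2) \<open>i < N\<close> by (auto simp: bary_def)
qed

lemma node_in_ptri: "t \<in> delaunay N x \<Longrightarrow> i \<in> nodes t \<Longrightarrow> x i \<in> ptri x t"
  using bary_node ptri_iff_bary by blast

lemma site_in_polysurf: "i < N \<Longrightarrow> x i \<in> polysurf N x"
  by (rule site_node) (auto simp: polysurf_def intro: node_in_ptri)

lemma lift_site: "i < N \<Longrightarrow> lift (x i) = x i"
  using inv_into_f_f[OF inj_radial site_in_polysurf, of i] sites[of i] by (simp add: radial_def)

text \<open>\<open>bary_unique\<close> removes the ambiguity of the choice, also where triangles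
  meet.\<close>

definition nodal_interpolant :: "(nat \<Rightarrow> real) \<Rightarrow> real ^ 3 \<Rightarrow> real"
  where "nodal_interpolant v y = (\<Sum>m<N. (SOME b. \<exists>t\<in>delaunay N x. bary t y b) m * v m)"

lemma nodal_interpolant_bary:
  assumes "t \<in> delaunay N x" "bary t y b"
  shows "nodal_interpolant v y = (\<Sum>m<N. b m * v m)"
proof -
  have "(SOME b. \<exists>t\<in>delaunay N x. bary t y b) = b"
    using assms bary_unique by (intro some_equality) blast+
  then show ?thesis by (simp add: nodal_interpolant_def)
qed

lemma nodal_interpolant_site: "i < N \<Longrightarrow> nodal_interpolant v (x i) = v i"
proof -
  assume i: "i < N"
  obtain t where t: "t \<in> delaunay N x" "i \<in> nodes t" using site_node[OF i] .
  show ?thesis unfolding nodal_interpolant_bary[OF t(1) bary_node[OF t]] using i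
    by (simp add: if_distrib[of "\<lambda>a. a * _"] cong: if_cong)
qed

lemma nodal_interpolant_affine:
  assumes t: "t \<in> delaunay N x"
  shows "\<exists>a b. \<forall>y\<in>ptri x t. nodal_interpolant v y = a \<bullet> y + b"
proof -
  obtain i j k where tt: "t = (i, j, k)" by (cases t)
  note d = delaunayD[OF t[unfolded tt]]
  let ?u = "x j - x i" and ?w = "x k - x i"
  let ?n = "cross3 ?u ?w"
  have n0: "?n \<noteq> 0" by (rule cross3_sites) (use d in auto)
  \<comment> \<open>\<open>cross3 ?w ?n\<close> and \<open>cross3 ?n ?u\<close>, divided by
    \<open>?n \<bullet> ?n\<close>, are the dual basis of the edge vectors \<open>?u\<close> and
    \<open>?w\<close> in the plane of the triangle.\<close>
  define a where "a = (1 / (?n \<bullet> ?n)) *\<^sub>R ((v j - v i) *\<^sub>R cross3 ?w ?n + (v k - v i) *\<^sub>R cross3 ?n ?u)"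
  have wn: "cross3 ?w ?n \<bullet> ?u = ?n \<bullet> ?n" "cross3 ?n ?u \<bullet> ?w = ?n \<bullet> ?n"
    using cross_triple[of ?u ?w ?n] cross_triple[of ?n ?u ?w] by simp_all
  have wz: "cross3 ?w ?n \<bullet> ?w = 0" "cross3 ?n ?u \<bullet> ?u = 0" by (simp_all add: dot_cross_self)
  have nn: "?n \<bullet> ?n \<noteq> 0" using n0 by simp
  have au: "a \<bullet> ?u = v j - v i" unfolding a_def inner_scaleR_left inner_add_left wn wz using nn by simp
  have aw: "a \<bullet> ?w = v k - v i" unfolding a_def inner_scaleR_left inner_add_left wn wz using nn by simp
  have av: "a \<bullet> x m + (v i - a \<bullet> x i) = v m" if "m \<in> nodes t" for m
    using that au aw by (auto simp: tt inner_diff_right)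
  show ?thesis
  proof (intro exI ballI)
    fix y assume "y \<in> ptri x t"
    then obtain b where b: "bary t y b" using ptri_iff_bary[OF t] by blast
    have "b m * v m = b m * (a \<bullet> x m) + b m * (v i - a \<bullet> x i)" for m
      using av[of m] baryD(4)[OF b, of m] by (cases "m \<in> nodes t") (auto simp flip: distrib_left)
    then have "nodal_interpolant v y = (\<Sum>m<N. b m * (a \<bullet> x m)) + (\<Sum>m<N. b m * (v i - a \<bullet> x i))"
      unfolding nodal_interpolant_bary[OF t b] by (simp add: sum.distrib)
    also have "\<dots> = a \<bullet> y + (v i - a \<bullet> x i)"
      unfolding bary_inner[OF b] using baryD(2)[OF b] by (simp flip: sum_distrib_right)
    finally show "nodal_interpolant v y = a \<bullet> y + (v i - a \<bullet> x i)" .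
  qed
qed

lemma continuous_nodal_interpolant: "continuous_on (polysurf N x) (nodal_interpolant v)"
  unfolding polysurf_def
proof (rule continuous_on_closed_Union[OF finite_delaunay])
  fix t assume t: "t \<in> delaunay N x"
  show "closed (ptri x t)" by (rule compact_imp_closed[OF compact_ptri])
  obtain a b where ab: "\<forall>y\<in>ptri x t. nodal_interpolant v y = a \<bullet> y + b" using nodal_interpolant_affine[OF t] by blast
  have "continuous_on (ptri x t) (\<lambda>y. a \<bullet> y + b)" by (intro continuous_intros)
  then show "continuous_on (ptri x t) (nodal_interpolant v)" using ab by (simp cong: continuous_on_cong)
qed

section \<open>Functions of the discrete space\<close>

lemma Uh_continuous:
  assumes "w \<in> Uh N x" shows "continuous_on S2 w"
proof -
  obtain wbar where w: "continuous_on (polysurf N x) wbar" "\<forall>y\<in>S2. w y = wbar (lift y)"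
    using assms by (auto simp: Uh_def)
  have "continuous_on S2 (\<lambda>y. wbar (lift y))"
    by (rule continuous_on_compose2[OF w(1) continuous_lift]) (use lift_in in auto)
  then show ?thesis using w(2) continuous_on_cong[of S2 S2 w "\<lambda>y. wbar (lift y)"] by simp
qed

text \<open>Arbitrary nodal values are admissible up to a constant \<open>\<kappa>\<close> that
  restores mean zero. The constant is invisible to the finite volume form and, if the data have mean
  zero, to the right-hand side.\<close>

lemma Uh_nodal:
  obtains w \<kappa> where "w \<in> Uh N x" "\<And>i. i < N \<Longrightarrow> w (x i) = v i - \<kappa>"
proof -
  define w0 where "w0 y = nodal_interpolant v (lift y)" for y
  define \<kappa> where "\<kappa> = (LINT y|surface. w0 y) / area S2"
  define w where "w y = w0 y - \<kappa>" for y
  have cw0: "continuous_on S2 w0" unfolding w0_def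
    by (rule continuous_on_compose2[OF continuous_nodal_interpolant continuous_lift]) (use lift_in in auto)
  have iw0: "integrable surface w0" by (rule integrable_surface_continuous[OF cw0])
  have "area S2 \<noteq> 0" using area_S2_pos by simp
  then have "(LINT y|surface. w y) = 0"
    unfolding w_def using iw0 by (simp add: \<kappa>_def space_surface)
  moreover have "continuous_on (polysurf N x) (\<lambda>y. nodal_interpolant v y - \<kappa>)"
    by (intro continuous_intros continuous_nodal_interpolant)
  moreover have "\<exists>a b. \<forall>y\<in>ptri x t. nodal_interpolant v y - \<kappa> = a \<bullet> y + b" if t: "t \<in> delaunay N x" for t
  proof -
    obtain a b where ab: "\<forall>y\<in>ptri x t. nodal_interpolant v y = a \<bullet> y + b" using nodal_interpolant_affine[OF t] by blast
    then have "\<forall>y\<in>ptri x t. nodal_interpolant v y - \<kappa> = a \<bullet> y + (b - \<kappa>)" by auto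
    then show ?thesis by blast
  qed
  ultimately have "w \<in> Uh N x"
    unfolding Uh_def w_def w0_def by (intro CollectI conjI exI[of _ "\<lambda>y. nodal_interpolant v y - \<kappa>"]) auto
  moreover have "w (x i) = v i - \<kappa>" if "i < N" for i
    using that by (simp add: w_def w0_def lift_site nodal_interpolant_site)
  ultimately show ?thesis using that by blast
qed

text \<open>Being affine on the triangle below \<open>y\<close>, the function takes there a convex
  combination of its corner values. Of the \<open>4 * h\<close>, one half is spent within the
  triangle and the other between \<open>y\<close> and its lift \<open>p\<close>, since
  \<open>norm p\<close> differs from 1 by at most the distance to a corner.\<close>

lemma Uh_interpolates:
  assumes w: "w \<in> Uh N x" and y: "y \<in> S2"
  obtains b where "\<And>m. 0 \<le> b m" "(\<Sum>m<N. b m) = 1" "w y = (\<Sum>m<N. b m * w (x m))"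
    "\<And>m. b m \<noteq> 0 \<Longrightarrow> norm (y - x m) \<le> 4 * h"
proof -
  obtain wbar where wbar: "\<forall>t\<in>delaunay N x. \<exists>a b. \<forall>y\<in>ptri x t. wbar y = a \<bullet> y + b"
    "\<forall>y\<in>S2. w y = wbar (lift y)"
    using w by (auto simp: Uh_def)
  define p where "p = lift y"
  have p: "p \<in> polysurf N x" "radial p = y" using lift_in[OF y] radial_lift[OF y] by (auto simp: p_def)
  obtain t b where t: "t \<in> delaunay N x" and b: "bary t p b" and pt: "p \<in> ptri x t"
    using p(1) by (rule polysurf_bary)
  note B = baryD[OF b]
  obtain a c where ac: "\<forall>y\<in>ptri x t. wbar y = a \<bullet> y + c" using wbar(1) t by blast
  have wx: "w (x m) = a \<bullet> x m + c" if "m \<in> nodes t" for m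
  proof -
    have "m < N" using nodes_less[OF t that] .
    then have "w (x m) = wbar (x m)" using wbar(2) sites lift_site by simp
    then show ?thesis using ac node_in_ptri[OF t that] by simp
  qed
  have "b m * w (x m) = b m * (a \<bullet> x m) + b m * c" for m
    using wx[of m] B(4)[of m] by (cases "m \<in> nodes t") (auto simp: distrib_left)
  then have "(\<Sum>m<N. b m * w (x m)) = a \<bullet> p + c"
    unfolding bary_inner[OF b] using B(2) by (simp add: sum.distrib flip: sum_distrib_right)
  moreover have "w y = a \<bullet> p + c" using wbar(2) y ac pt by (simp add: p_def)
  ultimately have weq: "w y = (\<Sum>m<N. b m * w (x m))" by simp
  have p0: "p \<noteq> 0" using p(1) zero_notin_polysurf by metis
  have near: "norm (y - x m) \<le> 4 * h" if "b m \<noteq> 0" for m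
  proof -
    have m: "m \<in> nodes t" using that B(4) by blast
    have mN: "m < N" using nodes_less[OF t m] .
    have xx: "norm (x l - x m) \<le> 2 * h" if l: "l \<in> nodes t" for l
    proof -
      obtain i j k where tt: "t = (i, j, k)" by (cases t)
      note d = delaunayD[OF t[unfolded tt]]
      have "norm (x i - x j) \<le> 2 * h" "norm (x j - x k) \<le> 2 * h" "norm (x k - x i) \<le> 2 * h"
        using neighbor_dist[OF _ d(4)] neighbor_dist[OF _ d(5)] neighbor_dist[OF _ d(6)] d by auto
      then show ?thesis using l m h_pos by (auto simp: tt norm_minus_commute)
    qed
    have "p - x m = (\<Sum>l<N. b l *\<^sub>R x l) - (\<Sum>l<N. b l) *\<^sub>R x m" using B(2,3) by simp
    also have "\<dots> = (\<Sum>l<N. b l *\<^sub>R (x l - x m))"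
      by (simp add: sum_subtractf scaleR_diff_right scaleR_sum_left)
    finally have "norm (p - x m) \<le> (\<Sum>l<N. norm (b l *\<^sub>R (x l - x m)))" by (simp only: norm_sum)
    also have "\<dots> \<le> (\<Sum>l<N. b l * (2 * h))"
    proof (rule sum_mono)
      fix l show "norm (b l *\<^sub>R (x l - x m)) \<le> b l * (2 * h)"
        using xx[of l] B(1)[of l] B(4)[of l] by (cases "l \<in> nodes t") (auto intro: mult_left_mono)
    qed
    also have "\<dots> = 2 * h" using B(2) by (simp flip: sum_distrib_right)
    finally have pm: "norm (p - x m) \<le> 2 * h" .
    have "y - p = (1 - norm p) *\<^sub>R y"
      using radial_scale[OF p0] p(2) by (simp add: scaleR_diff_left)
    then have "norm (y - p) = \<bar>norm (x m) - norm p\<bar>" using y sites[OF mN] by simp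
    also have "\<dots> \<le> norm (x m - p)" by (rule norm_triangle_ineq3)
    finally have "norm (y - p) \<le> 2 * h" using pm by (simp add: norm_minus_commute)
    then show ?thesis using pm norm_triangle_ineq[of "y - p" "p - x m"] by simp
  qed
  show ?thesis by (rule that[OF B(1,2) weq near])
qed

end

section \<open>Consistency of the fluxes\<close>

lemma C1_H1:
  assumes V: "C1_grad V DV" shows "V \<in> H1"
proof -
  have cV: "continuous_on S2 V" by (rule C1_grad_continuous[OF V])
  have cD: "continuous_on S2 DV" by (rule C1_grad_continuous'[OF V])
  have w: "has_weak_sgrad V (\<lambda>y. tangential y (DV y))" by (rule has_weak_sgrad_C1[OF V])
  have "V \<in> L2" unfolding L2_def
    using borel_measurable_surface_continuous[OF cV] integrable_surface_continuous[of "\<lambda>y. (V y)\<^sup>2"] cV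
    by (auto intro!: continuous_intros)
  moreover have wd: "weakly_diff V" using w by (auto simp: weakly_diff_def)
  moreover have "sderiv i V \<in> L2" for i
  proof -
    have "sgrad V \<in> borel_measurable surface"
      using weakly_diff_sgrad[OF wd] by (auto simp: has_weak_sgrad_def)
    then have m: "sderiv i V \<in> borel_measurable surface"
      unfolding sderiv_def cart_eq_inner_axis by measurable
    have c: "continuous_on S2 (\<lambda>y. (tangential y (DV y) $ i)\<^sup>2)"
      unfolding tangential_def cart_eq_inner_axis by (intro continuous_intros cD)
    have "integrable surface (\<lambda>y. (sderiv i V y)\<^sup>2)"
    proof (rule integrable_cong_AE_imp[OF integrable_surface_continuous[OF c]])
      show "(\<lambda>y. (sderiv i V y)\<^sup>2) \<in> borel_measurable surface" using m by measurable
      show "AE y in surface. (tangential y (DV y) $ i)\<^sup>2 = (sderiv i V y)\<^sup>2"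
        using sgrad_eqI[OF w] by eventually_elim (simp add: sderiv_def)
    qed
    then show ?thesis using m by (simp add: L2_def)
  qed
  ultimately show ?thesis by (simp add: H1_def)
qed

text \<open>Subtracting its mean makes \<open>V\<close> admissible. Neither side notices, because
  gradients ignore constants and \<open>f\<close> has mean zero.\<close>

lemma weak_solution_C1:
  assumes sol: "weak_solution f u" and V: "C1_grad V DV"
    and G: "AE y in surface. sgrad u y = G y" "continuous_on S2 G"
    and f: "integrable surface (\<lambda>y. f y * V y)" "integrable surface f" "(LINT y|surface. f y) = 0"
    and pos: "area S2 \<noteq> 0"
  shows "(LINT y|surface. G y \<bullet> tangential y (DV y)) = (LINT y|surface. f y * V y)"
proof -
  define \<kappa> where "\<kappa> = (LINT y|surface. V y) / area S2"
  define W where "W y = V y + (- \<kappa>)" for y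
  have W: "C1_grad W DV" unfolding W_def using C1_grad_add[OF V C1_grad_const[of "- \<kappa>"]] by simp
  have iV: "integrable surface V" by (rule integrable_surface_continuous[OF C1_grad_continuous[OF V]])
  have "(LINT y|surface. W y) = 0"
    unfolding W_def using iV pos by (simp add: \<kappa>_def space_surface)
  then have "W \<in> H10" using C1_H1[OF W] by (simp add: H10_def)
  then have eq: "(LINT y|surface. sgrad u y \<bullet> sgrad W y) = (LINT y|surface. f y * W y)"
    using sol by (simp add: weak_solution_def)
  have wu: "weakly_diff u" using sol by (simp add: weak_solution_def H10_def H1_def)
  have wW: "weakly_diff W" using \<open>W \<in> H10\<close> by (simp add: H10_def H1_def)
  have [measurable]: "sgrad u \<in> borel_measurable surface" "sgrad W \<in> borel_measurable surface"
    using weakly_diff_sgrad[OF wu] weakly_diff_sgrad[OF wW] by (auto simp: has_weak_sgrad_def)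
  have "continuous_on S2 DV" by (rule C1_grad_continuous'[OF V])
  then have "continuous_on S2 (\<lambda>y. G y \<bullet> tangential y (DV y))"
    unfolding tangential_def by (intro continuous_intros G(2))
  then have [measurable]: "(\<lambda>y. G y \<bullet> tangential y (DV y)) \<in> borel_measurable surface"
    by (rule borel_measurable_surface_continuous)
  have "(LINT y|surface. G y \<bullet> tangential y (DV y)) = (LINT y|surface. sgrad u y \<bullet> sgrad W y)"
  proof (rule integral_cong_AE)
    show "AE y in surface. G y \<bullet> tangential y (DV y) = sgrad u y \<bullet> sgrad W y"
      using G(1) sgrad_eqI[OF has_weak_sgrad_C1[OF W]] by eventually_elim simp
  qed measurable
  also have "\<dots> = (LINT y|surface. f y * V y) - (LINT y|surface. f y * \<kappa>)"
    unfolding eq W_def using f by (subst Bochner_Integration.integral_diff[symmetric]) (auto simp: algebra_simps)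
  finally show ?thesis using f(3) by simp
qed

lemma Linf_bounded:
  assumes "f \<in> Linf"
  obtains B where "AE y in surface. \<bar>f y\<bar> \<le> B" "0 \<le> B"
proof -
  have fin: "Linf_norm f < \<infinity>" using assms by (simp add: Linf_def)
  then obtain B where B: "Linf_norm f \<le> ereal B" "0 \<le> B"
  proof (cases "Linf_norm f")
    case (real r)
    then show ?thesis by (intro that[of "max r 0"]) auto
  next
    case MInf
    then show ?thesis by (intro that[of 0]) auto
  qed auto
  then show ?thesis using Linf_normD[OF B(1)] that by blast
qed

lemma integrable_Linf:
  assumes "f \<in> Linf" shows "integrable surface f"
proof -
  obtain B where "AE y in surface. \<bar>f y\<bar> \<le> B" using Linf_bounded[OF assms] .
  then show ?thesis using assms by (intro surface.integrable_const_bound[of _ B]) (auto simp: Linf_def)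
qed

context voronoi
begin

section \<open>Gradients and limits of the partition of unity\<close>

lemma soft_C1:
  "C1_grad (soft l i) (\<lambda>y. (l * soft l i y) *\<^sub>R (x i - (\<Sum>j<N. soft l j y *\<^sub>R x j)))"
  unfolding C1_grad_def
proof (intro conjI allI)
  fix y
  define E where "E k y = exp (l * (y \<bullet> x k))" for k and y :: "real ^ 3"
  define Z where "Z y = (\<Sum>k<N. E k y)" for y
  have Z0: "Z y \<noteq> 0" using soft_denom_pos[of l y] by (simp add: Z_def E_def)
  have dE: "(E k has_derivative (\<lambda>v. E k y * (l * (v \<bullet> x k)))) (at y)" for k
    unfolding E_def by (auto intro!: derivative_eq_intros)
  have dZ: "(Z has_derivative (\<lambda>v. \<Sum>k<N. E k y * (l * (v \<bullet> x k)))) (at y)"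
    unfolding Z_def by (rule has_derivative_sum) (rule dE)
  have s: "soft l k = (\<lambda>y. E k y / Z y)" for k by (auto simp: soft_def E_def Z_def)
  have "(soft l i has_derivative (\<lambda>v. (E i y * (l * (v \<bullet> x i)) * Z y - E i y * (\<Sum>k<N. E k y * (l * (v \<bullet> x k)))) / (Z y * Z y))) (at y)"
    unfolding s by (rule has_derivative_divide'[OF dE dZ Z0])
  moreover have "(E i y * (l * (v \<bullet> x i)) * Z y - E i y * (\<Sum>k<N. E k y * (l * (v \<bullet> x k)))) / (Z y * Z y)
      = v \<bullet> ((l * soft l i y) *\<^sub>R (x i - (\<Sum>j<N. soft l j y *\<^sub>R x j)))" for v
  proof -
    have "(\<Sum>k<N. E k y * (l * (v \<bullet> x k))) = l * Z y * (\<Sum>k<N. soft l k y * (v \<bullet> x k))"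
      unfolding s using Z0 by (simp add: sum_distrib_left algebra_simps)
    moreover have "v \<bullet> ((l * soft l i y) *\<^sub>R (x i - (\<Sum>j<N. soft l j y *\<^sub>R x j)))
        = l * soft l i y * (v \<bullet> x i - (\<Sum>k<N. soft l k y * (v \<bullet> x k)))"
      by (simp add: inner_diff_right inner_sum_right)
    moreover have "soft l i y = E i y / Z y" by (simp add: s)
    moreover have "(a * (l * c) * z - a * (l * z * S)) / (z * z) = l * (a / z) * (c - S)" if "z \<noteq> 0" for a c z S :: real
      using that by (simp add: field_simps)
    ultimately show ?thesis using Z0 by (simp only: if_True)
  qed
  ultimately show "GDERIV (soft l i) y :> (l * soft l i y) *\<^sub>R (x i - (\<Sum>j<N. soft l j y *\<^sub>R x j))"
    unfolding gderiv_def by simp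
qed (intro continuous_intros)

text \<open>The gradient is \<open>l\<close> times the covariance of coefficients and vertices under
  the weights \<open>soft l i y\<close>, and a covariance is half the weighted double sum of
  products of differences.\<close>

lemma soft_comb_C1:
  "C1_grad (\<lambda>y. \<Sum>i<N. e i * soft l i y)
    (\<lambda>y. (l / 2) *\<^sub>R (\<Sum>i<N. \<Sum>j<N. (soft_prod l i j y * (e i - e j)) *\<^sub>R (x i - x j)))"
proof -
  define g where "g y = (\<Sum>j<N. soft l j y *\<^sub>R x j)" for y
  have "C1_grad (\<lambda>y. \<Sum>i<N. e i * soft l i y) (\<lambda>y. \<Sum>i<N. (e i *\<^sub>R ((l * soft l i y) *\<^sub>R (x i - g y)) + soft l i y *\<^sub>R 0))"
    unfolding g_def by (intro C1_grad_sum C1_grad_mult C1_grad_const soft_C1) simp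
  moreover have "(\<Sum>i<N. (e i *\<^sub>R ((l * soft l i y) *\<^sub>R (x i - g y)) + soft l i y *\<^sub>R 0))
      = (l / 2) *\<^sub>R (\<Sum>i<N. \<Sum>j<N. (soft_prod l i j y * (e i - e j)) *\<^sub>R (x i - x j))" for y
  proof -
    let ?s = "\<lambda>i. soft l i y"
    define a where "a = (\<Sum>i<N. (?s i * e i) *\<^sub>R x i)"
    define b where "b = (\<Sum>i<N. ?s i * e i)"
    have s1: "(\<Sum>j<N. ?s j) = 1" by (rule sum_soft)
    have t: "(\<Sum>i<N. \<Sum>j<N. (?s i * ?s j) *\<^sub>R (e i *\<^sub>R x i)) = a"
    proof -
      have "(\<Sum>j<N. (?s i * ?s j) *\<^sub>R (e i *\<^sub>R x i)) = (?s i * e i) *\<^sub>R x i" for i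
      proof -
        have "(\<Sum>j<N. (?s i * ?s j) *\<^sub>R (e i *\<^sub>R x i)) = (\<Sum>j<N. ?s i * ?s j) *\<^sub>R (e i *\<^sub>R x i)"
          by (simp only: scaleR_sum_left)
        also have "(\<Sum>j<N. ?s i * ?s j) = ?s i" using s1 by (simp flip: sum_distrib_left)
        finally show ?thesis by simp
      qed
      then show ?thesis by (simp only: a_def)
    qed
    have t': "(\<Sum>i<N. \<Sum>j<N. (?s i * ?s j) *\<^sub>R (e j *\<^sub>R x j)) = a"
      by (subst sum.swap) (use t in \<open>simp only: mult.commute\<close>)
    have p: "(\<Sum>i<N. \<Sum>j<N. (?s i * ?s j) *\<^sub>R (e i *\<^sub>R x j)) = b *\<^sub>R g y"
    proof -
      have "b *\<^sub>R g y = (\<Sum>i<N. (?s i * e i) *\<^sub>R g y)" unfolding b_def by (rule scaleR_sum_left)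
      also have "\<dots> = (\<Sum>i<N. \<Sum>j<N. (?s i * ?s j) *\<^sub>R (e i *\<^sub>R x j))"
        unfolding g_def by (simp add: scaleR_sum_right mult_ac)
      finally show ?thesis by simp
    qed
    have p': "(\<Sum>i<N. \<Sum>j<N. (?s i * ?s j) *\<^sub>R (e j *\<^sub>R x i)) = b *\<^sub>R g y"
      by (subst sum.swap) (use p in \<open>simp only: mult.commute\<close>)
    have "(\<Sum>i<N. \<Sum>j<N. (soft_prod l i j y * (e i - e j)) *\<^sub>R (x i - x j))
        = (\<Sum>i<N. \<Sum>j<N. (?s i * ?s j) *\<^sub>R (e i *\<^sub>R x i) - (?s i * ?s j) *\<^sub>R (e i *\<^sub>R x j)
           - (?s i * ?s j) *\<^sub>R (e j *\<^sub>R x i) + (?s i * ?s j) *\<^sub>R (e j *\<^sub>R x j))"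
      by (simp add: soft_prod_def algebra_simps)
    also have "\<dots> = 2 *\<^sub>R (a - b *\<^sub>R g y)"
      unfolding sum.distrib sum_subtractf t t' p p' by (simp add: scaleR_2)
    finally have r: "(\<Sum>i<N. \<Sum>j<N. (soft_prod l i j y * (e i - e j)) *\<^sub>R (x i - x j)) = 2 *\<^sub>R (a - b *\<^sub>R g y)" .
    have "(\<Sum>i<N. (e i *\<^sub>R ((l * ?s i) *\<^sub>R (x i - g y)) + ?s i *\<^sub>R 0)) = l *\<^sub>R (a - b *\<^sub>R g y)"
      by (simp add: a_def b_def scaleR_diff_right sum_subtractf scaleR_sum_right scaleR_sum_left mult_ac)
    then show ?thesis unfolding r by simp
  qed
  ultimately show ?thesis by simp
qed

lemma soft_limit:
  assumes i: "i < N" and k: "k < N" and y: "y \<in> vcell N x k"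
  shows "(\<lambda>l::nat. soft (real l) i y) \<longlonglongrightarrow> indicator (vcell N x i) y"
proof (cases "i = k")
  case False
  have "y \<bullet> x i < y \<bullet> x k" using y False i by (simp add: vcell_eq[OF k])
  then have neg: "y \<bullet> (x i - x k) < 0" by (simp add: inner_diff_right)
  have "(\<lambda>l::nat. exp (real l * (y \<bullet> (x i - x k)))) \<longlonglongrightarrow> 0"
    using neg by real_asymp
  then have "(\<lambda>l::nat. soft (real l) i y) \<longlonglongrightarrow> 0"
    by (rule tendsto_sandwich[OF _ _ tendsto_const, rotated 2])
      (auto intro!: always_eventually less_imp_le[OF soft_pos] soft_le_exp[OF k])
  moreover have "y \<notin> vcell N x i" using disjoint_vcell[OF i k False] y by blast
  ultimately show ?thesis by simp
next
  case True
  have "(\<lambda>l::nat. \<Sum>j<N. exp (real l * (y \<bullet> (x j - x k)))) \<longlonglongrightarrow> (\<Sum>j<N. if j = k then 1 else 0)"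
  proof (rule tendsto_sum)
    fix j assume "j \<in> {..<N}"
    show "(\<lambda>l::nat. exp (real l * (y \<bullet> (x j - x k)))) \<longlonglongrightarrow> (if j = k then 1 else 0)"
    proof (cases "j = k")
      case False
      then have "y \<bullet> (x j - x k) < 0"
        using y \<open>j \<in> {..<N}\<close> by (simp add: vcell_eq[OF k] inner_diff_right)
      then have "(\<lambda>l::nat. exp (real l * (y \<bullet> (x j - x k)))) \<longlonglongrightarrow> 0" by real_asymp
      then show ?thesis using False by simp
    qed simp
  qed
  then have "(\<lambda>l::nat. 1 / (\<Sum>j<N. exp (real l * (y \<bullet> (x j - x k))))) \<longlonglongrightarrow> 1 / (\<Sum>j<N. if j = k then 1 else 0)"
    by (intro tendsto_divide tendsto_const) (use k in auto)
  then show ?thesis using True y k by (simp add: soft_eq_inverse)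
qed

lemma soft_comb_limit:
  assumes f: "integrable surface f"
  shows "(\<lambda>l::nat. LINT y|surface. f y * (\<Sum>i<N. e i * soft (real l) i y))
    \<longlonglongrightarrow> (LINT y|surface. f y * (\<Sum>i<N. e i * indicator (vcell N x i) y))"
proof (rule integral_dominated_convergence)
  have fm[measurable]: "f \<in> borel_measurable surface" using f by auto
  have [measurable]: "vcell N x i \<in> sets surface" if "i \<in> {..<N}" for i using that by simp
  show "(\<lambda>y. f y * (\<Sum>i<N. e i * indicator (vcell N x i) y)) \<in> borel_measurable surface" by measurable
  have [measurable]: "soft l i \<in> borel_measurable surface" for l i
    by (intro borel_measurable_surface_continuous continuous_soft continuous_on_id)
  show "(\<lambda>y. f y * (\<Sum>i<N. e i * soft (real l) i y)) \<in> borel_measurable surface" for l by measurable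
  show "integrable surface (\<lambda>y. \<bar>f y\<bar> * (\<Sum>i<N. \<bar>e i\<bar>))" using f by simp
  show "AE y in surface. (\<lambda>l::nat. f y * (\<Sum>i<N. e i * soft (real l) i y))
    \<longlonglongrightarrow> f y * (\<Sum>i<N. e i * indicator (vcell N x i) y)"
    using AE_vcell
  proof eventually_elim
    case (elim y)
    then obtain k where k: "k < N" "y \<in> vcell N x k" by blast
    show ?case by (intro tendsto_intros soft_limit[OF _ k]) simp
  qed
  show "AE y in surface. norm (f y * (\<Sum>i<N. e i * soft (real l) i y)) \<le> \<bar>f y\<bar> * (\<Sum>i<N. \<bar>e i\<bar>)" for l
  proof (rule AE_I2)
    fix y
    have "\<bar>\<Sum>i<N. e i * soft (real l) i y\<bar> \<le> (\<Sum>i<N. \<bar>e i * soft (real l) i y\<bar>)" by (rule sum_abs)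
    also have "\<dots> \<le> (\<Sum>i<N. \<bar>e i\<bar>)"
    proof (rule sum_mono)
      fix i assume "i \<in> {..<N}"
      then show "\<bar>e i * soft (real l) i y\<bar> \<le> \<bar>e i\<bar>"
        using soft_le_1[of i "real l" y] soft_pos[of "real l" i y]
        by (simp add: abs_mult mult_left_le)
    qed
    finally show "norm (f y * (\<Sum>i<N. e i * soft (real l) i y)) \<le> \<bar>f y\<bar> * (\<Sum>i<N. \<bar>e i\<bar>)"
      by (simp add: abs_mult mult_left_mono)
  qed
qed

end

lemma inner_tangential: "g \<bullet> tangential y w = w \<bullet> tangential y g"
  by (simp add: tangential_def inner_diff_right inner_commute[of g w] mult_ac)

text \<open>Factor the difference of the squared distances from \<open>y\<close>. Near an edge the
  normal component of \<open>x i - x j\<close> is thus small of second order, so the tangential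
  projection in the flux costs little.\<close>

lemma inner_chord_bound:
  assumes "a \<in> S2" "b \<in> S2" "y \<in> S2"
  shows "\<bar>(a - b) \<bullet> y\<bar> \<le> norm (a - b) * ((norm (y - a) + norm (y - b)) / 2)"
proof -
  have "(a - b) \<bullet> y = ((norm (y - b))\<^sup>2 - (norm (y - a))\<^sup>2) / 2"
    using S2_inner_eq_norm[OF assms(3,1)] S2_inner_eq_norm[OF assms(3,2)]
    by (simp add: inner_commute[of "a - b" y] inner_diff_right)
  also have "\<dots> = (norm (y - b) - norm (y - a)) * ((norm (y - a) + norm (y - b)) / 2)"
    by (simp add: power2_eq_square algebra_simps)
  finally have "\<bar>(a - b) \<bullet> y\<bar> = \<bar>norm (y - b) - norm (y - a)\<bar> * \<bar>(norm (y - a) + norm (y - b)) / 2\<bar>"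
    by (simp only: abs_mult)
  moreover have "\<bar>(norm (y - a) + norm (y - b)) / 2\<bar> = (norm (y - a) + norm (y - b)) / 2" by simp
  moreover have "\<bar>norm (y - b) - norm (y - a)\<bar> \<le> norm (a - b)"
    using norm_triangle_ineq3[of "y - b" "y - a"] by simp
  ultimately show ?thesis by (simp add: mult_right_mono)
qed

context uniform_voronoi
begin

text \<open>Some vertex is within \<open>h\<close> of \<open>y\<close> while \<open>x i\<close> is
  farther than \<open>2 * h\<close>; half the difference of the squares,
  \<open>3 / 2 * h\<^sup>2\<close>, is the gap of the inner products.\<close>

lemma soft_far_le:
  assumes i: "i < N" and y: "y \<in> S2" and far: "2 * h < norm (y - x i)" and l: "0 \<le> l"
  shows "soft l i y \<le> exp (- (3 / 2 * l * h\<^sup>2))"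
proof -
  obtain m where m: "m < N" "y \<in> wcell m" using wcell_cover[OF y] .
  have "(norm (y - x m))\<^sup>2 \<le> h\<^sup>2" using norm_wcell_le[OF m] h_eq by (intro power_mono) auto
  moreover have "(2 * h)\<^sup>2 \<le> (norm (y - x i))\<^sup>2" using far h_pos by (intro power_mono) auto
  ultimately have "y \<bullet> (x i - x m) \<le> - (3 / 2 * h\<^sup>2)"
    using S2_inner_eq_norm[OF y sites[OF i]] S2_inner_eq_norm[OF y sites[OF m(1)]]
    by (simp add: inner_diff_right power_mult_distrib)
  then have "l * (y \<bullet> (x i - x m)) \<le> l * (- (3 / 2 * h\<^sup>2))" using l by (rule mult_left_mono)
  then show ?thesis using soft_le_exp[OF m(1), of l i y] by (smt (verit) exp_le_cancel_iff mult.assoc mult.commute mult_minus_right)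
qed

lemma soft_prod_far_le:
  assumes ij: "i < N" "j < N" and y: "y \<in> S2" and far: "2 * h < norm (y - x i) \<or> 2 * h < norm (y - x j)" and l: "0 \<le> l"
  shows "soft_prod l i j y \<le> exp (- (3 / 2 * l * h\<^sup>2))"
  using far
proof
  assume "2 * h < norm (y - x i)"
  from soft_far_le[OF ij(1) y this l] show ?thesis
    using soft_le_1[OF ij(2), of l y] soft_pos[of l j y] soft_pos[of l i y]
    unfolding soft_prod_def by (smt (verit) mult_left_le)
next
  assume "2 * h < norm (y - x j)"
  from soft_far_le[OF ij(2) y this l] show ?thesis
    using soft_le_1[OF ij(1), of l y] soft_pos[of l j y] soft_pos[of l i y]
    unfolding soft_prod_def by (smt (verit) mult_left_le_one_le)
qed

text \<open>Cauchy-Schwarz over the adjacent pairs, at most \<open>real N * neighbor_bound\<close>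
  in number. As \<open>real N * h\<^sup>2\<close> is bounded, the factor \<open>h\<close> on the
  left absorbs the root of this number.\<close>

lemma sum_neighbor_differences:
  "(\<Sum>i<N. \<Sum>j\<in>neighbors N x i. \<bar>e i - e j\<bar>) * h \<le> neighbor_bound * sqrt (2 * C0) * sqrt (energy e)"
proof -
  let ?P = "SIGMA i:{..<N}. neighbors N x i"
  have nbc0: "0 \<le> neighbor_bound" using C1 A by (simp add: neighbor_bound_def)
  have fin: "finite (neighbors N x i)" for i by (simp add: neighbors_def)
  have "(\<Sum>i<N. \<Sum>j\<in>neighbors N x i. \<bar>e i - e j\<bar>)\<^sup>2 = (\<Sum>p\<in>?P. \<bar>e (fst p) - e (snd p)\<bar>)\<^sup>2"
    by (subst sum.Sigma) (use fin in \<open>auto simp: case_prod_unfold\<close>)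
  also have "\<dots> \<le> (\<Sum>p\<in>?P. \<bar>e (fst p) - e (snd p)\<bar>\<^sup>2) * real (card ?P)"
    by (rule sum_squared_le_sum_of_squares)
  also have "(\<Sum>p\<in>?P. \<bar>e (fst p) - e (snd p)\<bar>\<^sup>2) = (\<Sum>i<N. \<Sum>j\<in>neighbors N x i. (e i - e j)\<^sup>2)"
    by (subst sum.Sigma) (use fin in \<open>auto simp: case_prod_unfold\<close>)
  also have "real (card ?P) = (\<Sum>i<N. real (card (neighbors N x i)))"
    by (subst card_SigmaI) (use fin in auto)
  finally have 1: "(\<Sum>i<N. \<Sum>j\<in>neighbors N x i. \<bar>e i - e j\<bar>)\<^sup>2
      \<le> (\<Sum>i<N. \<Sum>j\<in>neighbors N x i. (e i - e j)\<^sup>2) * (\<Sum>i<N. real (card (neighbors N x i)))" .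
  have "(\<Sum>i<N. \<Sum>j\<in>neighbors N x i. (e i - e j)\<^sup>2) \<le> (\<Sum>i<N. \<Sum>j<N. 2 * C0 * (trans i j * (e i - e j)\<^sup>2))"
  proof (rule sum_mono)
    fix i assume i: "i \<in> {..<N}"
    have "(\<Sum>j\<in>neighbors N x i. (e i - e j)\<^sup>2) \<le> (\<Sum>j\<in>neighbors N x i. 2 * C0 * (trans i j * (e i - e j)\<^sup>2))"
    proof (rule sum_mono)
      fix j assume j: "j \<in> neighbors N x i"
      have "1 \<le> 2 * C0 * trans i j" using trans_lower[OF _ j] i C0 by (simp add: field_simps)
      then have "1 * (e i - e j)\<^sup>2 \<le> (2 * C0 * trans i j) * (e i - e j)\<^sup>2" by (rule mult_right_mono) simp
      then show "(e i - e j)\<^sup>2 \<le> 2 * C0 * (trans i j * (e i - e j)\<^sup>2)" by (simp add: mult.assoc)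
    qed
    also have "\<dots> \<le> (\<Sum>j<N. 2 * C0 * (trans i j * (e i - e j)\<^sup>2))"
      by (rule sum_mono2) (use trans_nonneg C0 in \<open>auto simp: neighbors_def\<close>)
    finally show "(\<Sum>j\<in>neighbors N x i. (e i - e j)\<^sup>2) \<le> (\<Sum>j<N. 2 * C0 * (trans i j * (e i - e j)\<^sup>2))" .
  qed
  also have "\<dots> = 2 * C0 * energy e" by (simp add: energy_def sum_distrib_left)
  finally have 2: "(\<Sum>i<N. \<Sum>j\<in>neighbors N x i. (e i - e j)\<^sup>2) \<le> 2 * C0 * energy e" .
  have 3: "(\<Sum>i<N. real (card (neighbors N x i))) \<le> real N * neighbor_bound"
    using sum_mono[of "{..<N}" "\<lambda>i. real (card (neighbors N x i))" "\<lambda>i. neighbor_bound"] card_neighbors by simp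
  have "((\<Sum>i<N. \<Sum>j\<in>neighbors N x i. \<bar>e i - e j\<bar>) * h)\<^sup>2 \<le> (2 * C0 * energy e) * (real N * neighbor_bound) * h\<^sup>2"
    unfolding power_mult_distrib
    by (intro mult_right_mono order_trans[OF 1] mult_mono 2 3) (use C0 in \<open>auto intro!: sum_nonneg energy_nonneg mult_nonneg_nonneg\<close>)
  also have "\<dots> = (2 * C0 * energy e) * neighbor_bound * (real N * h\<^sup>2)" by simp
  also have "\<dots> \<le> (2 * C0 * energy e) * neighbor_bound * neighbor_bound"
    by (intro mult_left_mono card_sites mult_nonneg_nonneg energy_nonneg nbc0) (use C0 in auto)
  also have "\<dots> = (neighbor_bound * sqrt (2 * C0) * sqrt (energy e))\<^sup>2"
    using C0 energy_nonneg[of e] by (simp add: power_mult_distrib power2_eq_square[of neighbor_bound])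
  finally show ?thesis
    by (rule power2_le_imp_le) (use C0 nbc0 in \<open>auto intro!: mult_nonneg_nonneg simp: energy_nonneg\<close>)
qed

lemma edge_weights_exist:
  "\<exists>T. \<forall>i j. i < N \<longrightarrow> j < N \<longrightarrow> i \<noteq> j \<longrightarrow>
      (\<lambda>l::nat. real l * (LINT y|surface. soft_prod (real l) i j y)) \<longlonglongrightarrow> T i j \<and> 0 \<le> T i j \<and>
      \<bar>T i j * norm (x i - x j) - curve_length (vedge N x i j)\<bar> \<le> 4 * h\<^sup>2 \<and> (j \<notin> neighbors N x i \<longrightarrow> T i j = 0)"
proof -
  have "\<forall>i j. \<exists>t. i < N \<longrightarrow> j < N \<longrightarrow> i \<noteq> j \<longrightarrow>
      (\<lambda>l::nat. real l * (LINT y|surface. soft_prod (real l) i j y)) \<longlonglongrightarrow> t \<and> 0 \<le> t \<and>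
      \<bar>t * norm (x i - x j) - curve_length (vedge N x i j)\<bar> \<le> 4 * h\<^sup>2 \<and> (j \<notin> neighbors N x i \<longrightarrow> t = 0)"
  proof (intro allI)
    fix i j
    show "\<exists>t. i < N \<longrightarrow> j < N \<longrightarrow> i \<noteq> j \<longrightarrow>
      (\<lambda>l::nat. real l * (LINT y|surface. soft_prod (real l) i j y)) \<longlonglongrightarrow> t \<and> 0 \<le> t \<and>
      \<bar>t * norm (x i - x j) - curve_length (vedge N x i j)\<bar> \<le> 4 * h\<^sup>2 \<and> (j \<notin> neighbors N x i \<longrightarrow> t = 0)"
    proof (cases "i < N \<and> j < N \<and> i \<noteq> j")
      case True
      then have c: "i < N" "j < N" "i \<noteq> j" by auto
      have m: "mesh_size N x \<le> 1/8" using h_eq h_le by simp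
      show ?thesis
      proof (rule edge_weight_limit[OF c m], goal_cases)
        case (1 t)
        then show ?case using h_eq by blast
      qed
    qed auto
  qed
  then show ?thesis by (simp only: choice_iff)
qed

end

text \<open>The analytic assumptions are conclusions of \<open>W2inf_regular\<close>:
  \<open>v\<close> and \<open>G\<close> represent the solution and its tangential gradient, and
  \<open>K\<close> bounds its derivatives up to second order.\<close>

locale flux_consistency = uniform_voronoi N x C0 C1 A h for N x C0 C1 A h +
  fixes v :: "real ^ 3 \<Rightarrow> real" and G :: "real ^ 3 \<Rightarrow> real ^ 3" and K :: real
  assumes K: "0 \<le> K"
    and G_bound: "\<And>y. y \<in> S2 \<Longrightarrow> norm (G y) \<le> 3 * K"
    and G_cont: "continuous_on S2 G"
    and v_lip: "\<And>y z. y \<in> S2 \<Longrightarrow> z \<in> S2 \<Longrightarrow> \<bar>v z - v y\<bar> \<le> 12 * K * norm (z - y)"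
    and v_taylor: "\<And>a b z. a \<in> S2 \<Longrightarrow> b \<in> S2 \<Longrightarrow> z \<in> S2 \<Longrightarrow>
      \<bar>v b - v a - G z \<bullet> (b - a)\<bar> \<le> 2000 * K * norm (b - a) * (norm (b - a) + norm (z - a))"
begin

abbreviation edge_flux :: "nat \<Rightarrow> nat \<Rightarrow> real ^ 3 \<Rightarrow> real"
  where "edge_flux i j y \<equiv> G y \<bullet> tangential y (x i - x j)"

text \<open>6000 is the Taylor constant 2000 times the 3 from
  \<open>norm (x i - x j) + norm (y - x j) \<le> 3 * d\<close>; the extra 3 is the normal part
  removed by \<open>tangential\<close>.\<close>

lemma edge_flux_diff_le:
  assumes ij: "i < N" "j < N" and y: "y \<in> S2" and d: "norm (y - x i) \<le> d" "norm (y - x j) \<le> d"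
  shows "\<bar>edge_flux i j y - (v (x i) - v (x j))\<bar> \<le> 6003 * K * d * norm (x i - x j)"
proof -
  let ?w = "x i - x j"
  have w: "norm ?w \<le> 2 * d" using d norm_triangle_ineq4[of "y - x j" "y - x i"] by simp
  have d0: "0 \<le> d" using d(1) norm_ge_zero[of "y - x i"] by linarith
  have "\<bar>v (x i) - v (x j) - G y \<bullet> ?w\<bar> \<le> 2000 * K * norm ?w * (norm ?w + norm (y - x j))"
    by (rule v_taylor) (use sites ij y in auto)
  also have "\<dots> \<le> 2000 * K * norm ?w * (3 * d)"
    using w d K by (intro mult_left_mono) auto
  finally have 1: "\<bar>v (x i) - v (x j) - G y \<bullet> ?w\<bar> \<le> 6000 * K * d * norm ?w" by (simp add: mult_ac)
  have "\<bar>?w \<bullet> y\<bar> \<le> norm ?w * ((norm (y - x i) + norm (y - x j)) / 2)"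
    by (rule inner_chord_bound) (use sites ij y in auto)
  also have "\<dots> \<le> norm ?w * d" using d by (intro mult_left_mono) auto
  finally have 2: "\<bar>?w \<bullet> y\<bar> \<le> norm ?w * d" .
  have "\<bar>G y \<bullet> y\<bar> \<le> norm (G y) * norm y" by (rule Cauchy_Schwarz_ineq2)
  then have 3: "\<bar>G y \<bullet> y\<bar> \<le> 3 * K" using G_bound[OF y] y by simp
  have "\<bar>(?w \<bullet> y) * (G y \<bullet> y)\<bar> \<le> (norm ?w * d) * (3 * K)"
    unfolding abs_mult by (intro mult_mono 2 3) (use d0 in auto)
  then have 4: "\<bar>(?w \<bullet> y) * (G y \<bullet> y)\<bar> \<le> 3 * K * d * norm ?w" by (simp add: mult_ac)
  have "edge_flux i j y = G y \<bullet> ?w - (?w \<bullet> y) * (G y \<bullet> y)"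
    by (simp add: tangential_def inner_diff_right)
  then show ?thesis using 1 4 by (simp add: algebra_simps abs_le_iff)
qed

lemma integrable_soft_prod: "integrable surface (soft_prod l i j)"
  unfolding soft_prod_def by (intro integrable_surface_continuous continuous_intros)

lemma integrable_soft_edge_flux: "integrable surface (\<lambda>y. soft_prod l i j y * edge_flux i j y)"
  unfolding soft_prod_def tangential_def
  by (intro integrable_surface_continuous continuous_intros G_cont)

text \<open>At distance more than \<open>2 * h\<close> from one of the two vertices some other vertex is closer by a definite
  amount, and the product is exponentially small in \<open>l\<close>; elsewhere the Taylor expansion applies.\<close>

lemma pair_consistency:
  assumes ij: "i < N" "j < N" and l: "0 \<le> l"
  shows "\<bar>l * (LINT y|surface. soft_prod l i j y * edge_flux i j y) - (v (x i) - v (x j)) * (l * (LINT y|surface. soft_prod l i j y))\<bar>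
    \<le> 12006 * K * h * norm (x i - x j) * (l * (LINT y|surface. soft_prod l i j y))
      + 24012 * K * area S2 * (l * exp (- (3 / 2 * l * h\<^sup>2)))"
proof -
  let ?s = "soft_prod l i j" and ?w = "x i - x j"
  define g where "g y = ?s y * (edge_flux i j y - (v (x i) - v (x j)))" for y
  define \<epsilon> where "\<epsilon> = exp (- (3 / 2 * l * h\<^sup>2))"
  have ig: "integrable surface g" unfolding g_def
    using integrable_soft_edge_flux[of l i j] integrable_soft_prod[of l i j] by (simp add: right_diff_distrib)
  have gb: "\<bar>g y\<bar> \<le> 12006 * K * h * norm ?w * ?s y + 24012 * K * \<epsilon>" if y: "y \<in> S2" for y
  proof (cases "2 * h < norm (y - x i) \<or> 2 * h < norm (y - x j)")
    case True
    have s: "0 \<le> ?s y" "?s y \<le> \<epsilon>" using soft_prod_bounds[OF ij] soft_prod_far_le[OF ij y True l] by (auto simp: \<epsilon>_def)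
    have n2: "norm (a - b) \<le> 2" if "a \<in> S2" "b \<in> S2" for a b :: "real ^ 3"
      using norm_triangle_ineq4[of a b] that by simp
    have "\<bar>edge_flux i j y - (v (x i) - v (x j))\<bar> \<le> 6003 * K * 2 * norm ?w"
      by (rule edge_flux_diff_le[OF ij y]) (use n2 y sites ij in auto)
    also have "\<dots> \<le> 6003 * K * 2 * 2" using n2 sites ij K by (intro mult_left_mono) auto
    finally have "\<bar>g y\<bar> \<le> \<epsilon> * (24012 * K)"
      unfolding g_def abs_mult using s by (intro mult_mono) auto
    moreover have "0 \<le> 12006 * K * h * norm ?w * ?s y" using K h_pos s by simp
    ultimately show ?thesis by (simp add: mult_ac)
  next
    case False
    then have "\<bar>edge_flux i j y - (v (x i) - v (x j))\<bar> \<le> 6003 * K * (2 * h) * norm ?w"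
      by (intro edge_flux_diff_le[OF ij y]) auto
    then have "\<bar>g y\<bar> \<le> ?s y * (6003 * K * (2 * h) * norm ?w)"
      unfolding g_def abs_mult using soft_prod_bounds[OF ij, of l y] by (intro mult_mono) auto
    moreover have "0 \<le> 24012 * K * \<epsilon>" using K by (simp add: \<epsilon>_def)
    ultimately show ?thesis by (simp add: mult_ac)
  qed
  have "\<bar>LINT y|surface. g y\<bar> \<le> (LINT y|surface. \<bar>g y\<bar>)" by (rule integral_abs_bound)
  also have "\<dots> \<le> (LINT y|surface. 12006 * K * h * norm ?w * ?s y + 24012 * K * \<epsilon>)"
    by (rule integral_mono) (use ig integrable_soft_prod[of l i j] gb in \<open>auto simp: space_surface\<close>)
  also have "\<dots> = 12006 * K * h * norm ?w * (LINT y|surface. ?s y) + 24012 * K * \<epsilon> * area S2"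
    using integrable_soft_prod[of l i j] by (simp add: space_surface)
  finally have "l * \<bar>LINT y|surface. g y\<bar> \<le> l * (12006 * K * h * norm ?w * (LINT y|surface. ?s y) + 24012 * K * \<epsilon> * area S2)"
    using l by (rule mult_left_mono)
  moreover have "(LINT y|surface. g y) = (LINT y|surface. ?s y * edge_flux i j y) - (v (x i) - v (x j)) * (LINT y|surface. ?s y)"
    unfolding g_def right_diff_distrib[of "?s _"]
    using integrable_soft_edge_flux[of l i j] integrable_soft_prod[of l i j] by (simp add: algebra_simps)
  moreover have "\<bar>l * a - d * (l * b)\<bar> \<le> p * (l * b) + q * s * (l * r)" if "l * \<bar>a - d * b\<bar> \<le> l * (p * b + q * r * s)" for a b d p q r s :: real
  proof -
    have "l * a - d * (l * b) = l * (a - d * b)" by (simp add: right_diff_distrib)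
    then have "\<bar>l * a - d * (l * b)\<bar> = l * \<bar>a - d * b\<bar>" using l by (simp add: abs_mult)
    then show ?thesis using that by (simp add: distrib_left mult_ac)
  qed
  ultimately show ?thesis unfolding \<epsilon>_def by (simp only:)
qed

lemma flux_integral:
  "(LINT y|surface. G y \<bullet> tangential y ((l / 2) *\<^sub>R (\<Sum>i<N. \<Sum>j<N. (soft_prod l i j y * (e i - e j)) *\<^sub>R (x i - x j))))
    = (1 / 2) * (\<Sum>i<N. \<Sum>j<N. (e i - e j) * (l * (LINT y|surface. soft_prod l i j y * edge_flux i j y)))"
proof -
  have "G y \<bullet> tangential y ((l / 2) *\<^sub>R (\<Sum>i<N. \<Sum>j<N. (soft_prod l i j y * (e i - e j)) *\<^sub>R (x i - x j)))
      = (l / 2) * (\<Sum>i<N. \<Sum>j<N. (e i - e j) * (soft_prod l i j y * edge_flux i j y))" for y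
    unfolding inner_tangential[of "G y"] inner_scaleR_left inner_sum_left by (simp add: mult_ac)
  then show ?thesis
    using integrable_soft_edge_flux[of l] by (simp add: sum_distrib_left mult_ac)
qed

text \<open>\<open>pair_consistency\<close> is summed and \<open>l\<close> sent to infinity, which
  removes the exponential terms and leaves half of 12006. Exchanging the limit weights for
  \<open>trans\<close> adds half of 48, so that 6003 and 24 make up 6027.\<close>

lemma consistency:
  assumes test: "\<And>l. (LINT y|surface. G y \<bullet> tangential y ((l / 2) *\<^sub>R (\<Sum>i<N. \<Sum>j<N. (soft_prod l i j y * (e i - e j)) *\<^sub>R (x i - x j))))
      = (LINT y|surface. f y * (\<Sum>i<N. e i * soft l i y))"
    and f: "integrable surface f"
  defines "F \<equiv> (LINT y|surface. f y * (\<Sum>i<N. e i * indicator (vcell N x i) y))"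
  shows "\<bar>F - (1 / 2) * (\<Sum>i<N. \<Sum>j<N. trans i j * (e i - e j) * (v (x i) - v (x j)))\<bar>
    \<le> 6027 * (C0 + 1) * K * h\<^sup>2 * (\<Sum>i<N. \<Sum>j\<in>neighbors N x i. \<bar>e i - e j\<bar>)"
proof -
  let ?w = "\<lambda>i j. norm (x i - x j)" and ?v = "\<lambda>i j. v (x i) - v (x j)"
  let ?E = "\<lambda>l::real. 24012 * K * area S2 * (l * exp (- (3 / 2 * l * h\<^sup>2)))"
  obtain T where T': "\<forall>i j. i < N \<longrightarrow> j < N \<longrightarrow> i \<noteq> j \<longrightarrow>
      (\<lambda>l::nat. real l * (LINT y|surface. soft_prod (real l) i j y)) \<longlonglongrightarrow> T i j \<and> 0 \<le> T i j \<and>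
      \<bar>T i j * norm (x i - x j) - curve_length (vedge N x i j)\<bar> \<le> 4 * h\<^sup>2 \<and> (j \<notin> neighbors N x i \<longrightarrow> T i j = 0)"
    using edge_weights_exist by (rule exE)
  have T:
    "\<And>i j. i < N \<Longrightarrow> j < N \<Longrightarrow> i \<noteq> j \<Longrightarrow> (\<lambda>l::nat. real l * (LINT y|surface. soft_prod (real l) i j y)) \<longlonglongrightarrow> T i j"
    "\<And>i j. i < N \<Longrightarrow> j < N \<Longrightarrow> i \<noteq> j \<Longrightarrow> 0 \<le> T i j"
    "\<And>i j. i < N \<Longrightarrow> j < N \<Longrightarrow> i \<noteq> j \<Longrightarrow> \<bar>T i j * norm (x i - x j) - curve_length (vedge N x i j)\<bar> \<le> 4 * h\<^sup>2"
    "\<And>i j. i < N \<Longrightarrow> j < N \<Longrightarrow> i \<noteq> j \<Longrightarrow> j \<notin> neighbors N x i \<Longrightarrow> T i j = 0"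
    using T' by simp_all
  define a where "a l i j = l * (LINT y|surface. soft_prod l i j y * edge_flux i j y)" for l i j
  define c where "c l i j = l * (LINT y|surface. soft_prod l i j y)" for l i j
  have cT: "(\<lambda>l::nat. r * (e i - e j) * c (real l) i j) \<longlonglongrightarrow> r * (e i - e j) * T i j" if "i < N" "j < N" for i j r
    using T(1)[OF that] by (cases "i = j") (auto simp: c_def intro!: tendsto_intros)
  have cT': "(\<lambda>l::nat. \<bar>e i - e j\<bar> * (12006 * K * h * ?w i j * c (real l) i j + ?E (real l))) \<longlonglongrightarrow>
      \<bar>e i - e j\<bar> * (12006 * K * h * ?w i j * T i j + 0)" if "i < N" "j < N" for i j
  proof (cases "i = j")
    case False
    have "(\<lambda>l::nat. real l * exp (- (3 / 2 * real l * h\<^sup>2))) \<longlonglongrightarrow> 0"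
      using h_pos by real_asymp
    then have "(\<lambda>l::nat. ?E (real l)) \<longlonglongrightarrow> 24012 * K * area S2 * 0" by (intro tendsto_intros)
    then have "(\<lambda>l::nat. ?E (real l)) \<longlonglongrightarrow> 0" by simp
    then show ?thesis using T(1)[OF that False] by (intro tendsto_intros) (simp add: c_def)
  qed simp
  have "(\<lambda>l::nat. (1 / 2) * (\<Sum>i<N. \<Sum>j<N. (e i - e j) * a (real l) i j)) \<longlonglongrightarrow> F"
    unfolding F_def a_def flux_integral[symmetric] test by (rule soft_comb_limit[OF f])
  moreover have "(\<lambda>l::nat. (1 / 2) * (\<Sum>i<N. \<Sum>j<N. ?v i j * (e i - e j) * c (real l) i j)) \<longlonglongrightarrow>
      (1 / 2) * (\<Sum>i<N. \<Sum>j<N. ?v i j * (e i - e j) * T i j)"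
    by (intro tendsto_mult tendsto_const tendsto_sum cT) auto
  ultimately have L1: "(\<lambda>l::nat. \<bar>(1 / 2) * (\<Sum>i<N. \<Sum>j<N. (e i - e j) * a (real l) i j)
        - (1 / 2) * (\<Sum>i<N. \<Sum>j<N. ?v i j * (e i - e j) * c (real l) i j)\<bar>)
      \<longlonglongrightarrow> \<bar>F - (1 / 2) * (\<Sum>i<N. \<Sum>j<N. ?v i j * (e i - e j) * T i j)\<bar>"
    by (intro tendsto_rabs tendsto_diff)
  have L2: "(\<lambda>l::nat. (1 / 2) * (\<Sum>i<N. \<Sum>j<N. \<bar>e i - e j\<bar> * (12006 * K * h * ?w i j * c (real l) i j + ?E (real l)))) \<longlonglongrightarrow>
      (1 / 2) * (\<Sum>i<N. \<Sum>j<N. \<bar>e i - e j\<bar> * (12006 * K * h * ?w i j * T i j + 0))"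
    by (intro tendsto_mult tendsto_const tendsto_sum cT') auto
  have P: "\<bar>(1 / 2) * (\<Sum>i<N. \<Sum>j<N. (e i - e j) * a l i j) - (1 / 2) * (\<Sum>i<N. \<Sum>j<N. ?v i j * (e i - e j) * c l i j)\<bar>
      \<le> (1 / 2) * (\<Sum>i<N. \<Sum>j<N. \<bar>e i - e j\<bar> * (12006 * K * h * ?w i j * c l i j + ?E l))" if l: "0 \<le> l" for l
  proof -
    have r1: "(\<Sum>i<N. \<Sum>j<N. (e i - e j) * a l i j) - (\<Sum>i<N. \<Sum>j<N. ?v i j * (e i - e j) * c l i j)
        = (\<Sum>i<N. \<Sum>j<N. (e i - e j) * (a l i j - ?v i j * c l i j))"
      unfolding sum_subtractf[symmetric] by (intro sum.cong refl) (simp add: algebra_simps)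
    have r2: "\<bar>\<Sum>i<N. \<Sum>j<N. (e i - e j) * (a l i j - ?v i j * c l i j)\<bar>
        \<le> (\<Sum>i<N. \<Sum>j<N. \<bar>e i - e j\<bar> * (12006 * K * h * ?w i j * c l i j + ?E l))"
    proof (rule order_trans[OF sum_abs], rule sum_mono, rule order_trans[OF sum_abs], rule sum_mono)
      fix i j assume "i \<in> {..<N}" "j \<in> {..<N}"
      then show "\<bar>(e i - e j) * (a l i j - ?v i j * c l i j)\<bar> \<le> \<bar>e i - e j\<bar> * (12006 * K * h * ?w i j * c l i j + ?E l)"
        unfolding abs_mult a_def c_def by (intro mult_left_mono pair_consistency l) auto
    qed
    have "\<bar>(1 / 2) * p - (1 / 2) * q\<bar> \<le> (1 / 2) * s" if "\<bar>p - q\<bar> \<le> s" for p q s :: real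
      using that by linarith
    from this[OF r2[folded r1]] show ?thesis .
  qed
  have 1: "\<bar>F - (1 / 2) * (\<Sum>i<N. \<Sum>j<N. ?v i j * (e i - e j) * T i j)\<bar>
      \<le> (1 / 2) * (\<Sum>i<N. \<Sum>j<N. \<bar>e i - e j\<bar> * (12006 * K * h * ?w i j * T i j + 0))"
    by (rule LIMSEQ_le[OF L1 L2]) (intro exI[of _ 0] allI impI P of_nat_0_le_iff)
  \<comment> \<open>The edge length is at most \<open>C0 * h\<close>, and the deviation
    \<open>4 * h\<^sup>2\<close> is at most \<open>h\<close>.\<close>
  have Tw: "T i j * ?w i j \<le> (C0 + 1) * h" if "i < N" "j \<in> neighbors N x i" for i j
  proof -
    have j: "j < N" "i \<noteq> j" using neighborsD[OF that(2)] by auto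
    have "4 * h\<^sup>2 \<le> 1 * h" unfolding power2_eq_square using h_pos h_le by (simp add: mult_le_cancel_right_pos)
    then show ?thesis using T(3)[OF that(1) j] edge_upper[OF that] by (simp add: distrib_right abs_le_iff)
  qed
  have nb: "(\<Sum>j<N. \<phi> j) = (\<Sum>j\<in>neighbors N x i. \<phi> j)" if "\<And>j. j < N \<Longrightarrow> j \<notin> neighbors N x i \<Longrightarrow> \<phi> j = 0" for \<phi> :: "nat \<Rightarrow> real" and i
    by (rule sum.mono_neutral_right) (use that in \<open>auto simp: neighbors_def\<close>)
  have 2: "(\<Sum>i<N. \<Sum>j<N. \<bar>e i - e j\<bar> * (12006 * K * h * ?w i j * T i j + 0))
      \<le> (\<Sum>i<N. \<Sum>j\<in>neighbors N x i. 12006 * (C0 + 1) * K * h\<^sup>2 * \<bar>e i - e j\<bar>)"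
  proof (rule sum_mono)
    fix i assume "i \<in> {..<N}"
    then have i: "i < N" by simp
    have "(\<Sum>j<N. \<bar>e i - e j\<bar> * (12006 * K * h * ?w i j * T i j + 0))
        = (\<Sum>j\<in>neighbors N x i. \<bar>e i - e j\<bar> * (12006 * K * h * ?w i j * T i j + 0))"
    proof (rule nb)
      fix j assume "j < N" "j \<notin> neighbors N x i"
      then show "\<bar>e i - e j\<bar> * (12006 * K * h * ?w i j * T i j + 0) = 0" using T(4)[OF i] by (cases "i = j") auto
    qed
    also have "\<dots> \<le> (\<Sum>j\<in>neighbors N x i. 12006 * (C0 + 1) * K * h\<^sup>2 * \<bar>e i - e j\<bar>)"
    proof (rule sum_mono)
      fix j assume j: "j \<in> neighbors N x i"
      have "\<bar>e i - e j\<bar> * (12006 * K * h) * (T i j * ?w i j) \<le> \<bar>e i - e j\<bar> * (12006 * K * h) * ((C0 + 1) * h)"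
        using K h_pos by (intro mult_left_mono Tw[OF i j]) auto
      moreover have "\<bar>e i - e j\<bar> * (12006 * K * h * ?w i j * T i j + 0) = \<bar>e i - e j\<bar> * (12006 * K * h) * (T i j * ?w i j)"
        by simp
      moreover have "12006 * (C0 + 1) * K * h\<^sup>2 * \<bar>e i - e j\<bar> = \<bar>e i - e j\<bar> * (12006 * K * h) * ((C0 + 1) * h)"
        unfolding power2_eq_square by (simp only: mult_ac)
      ultimately show "\<bar>e i - e j\<bar> * (12006 * K * h * ?w i j * T i j + 0) \<le> 12006 * (C0 + 1) * K * h\<^sup>2 * \<bar>e i - e j\<bar>"
        by (simp only:)
    qed
    finally show "(\<Sum>j<N. \<bar>e i - e j\<bar> * (12006 * K * h * ?w i j * T i j + 0))
        \<le> (\<Sum>j\<in>neighbors N x i. 12006 * (C0 + 1) * K * h\<^sup>2 * \<bar>e i - e j\<bar>)" .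
  qed
  \<comment> \<open>The weights differ by at most \<open>4 * h\<^sup>2\<close> over the distance of
    the vertices, a quotient that the Lipschitz bound of \<open>v\<close> cancels at the price of a
    factor 12.\<close>
  have 3: "\<bar>(\<Sum>i<N. \<Sum>j<N. ?v i j * (e i - e j) * T i j) - (\<Sum>i<N. \<Sum>j<N. trans i j * (e i - e j) * ?v i j)\<bar>
      \<le> (\<Sum>i<N. \<Sum>j\<in>neighbors N x i. 48 * K * h\<^sup>2 * \<bar>e i - e j\<bar>)"
  proof -
    have r1: "(\<Sum>i<N. \<Sum>j<N. ?v i j * (e i - e j) * T i j) - (\<Sum>i<N. \<Sum>j<N. trans i j * (e i - e j) * ?v i j)
        = (\<Sum>i<N. \<Sum>j<N. (T i j - trans i j) * (e i - e j) * ?v i j)"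
      unfolding sum_subtractf[symmetric] by (intro sum.cong refl) (simp add: algebra_simps)
    have r2: "(\<Sum>i<N. \<Sum>j<N. (T i j - trans i j) * (e i - e j) * ?v i j)
        = (\<Sum>i<N. \<Sum>j\<in>neighbors N x i. (T i j - trans i j) * (e i - e j) * ?v i j)"
    proof (rule sum.cong[OF refl], rule nb)
      fix i j assume "i \<in> {..<N}" "j < N" "j \<notin> neighbors N x i"
      then show "(T i j - trans i j) * (e i - e j) * ?v i j = 0"
        using T(4)[of i j] trans_not_neighbor[of j i] by (cases "i = j") auto
    qed
    have r3: "\<bar>\<Sum>i<N. \<Sum>j\<in>neighbors N x i. (T i j - trans i j) * (e i - e j) * ?v i j\<bar>
        \<le> (\<Sum>i<N. \<Sum>j\<in>neighbors N x i. 48 * K * h\<^sup>2 * \<bar>e i - e j\<bar>)"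
    proof (rule order_trans[OF sum_abs], rule sum_mono, rule order_trans[OF sum_abs], rule sum_mono)
      fix i j assume "i \<in> {..<N}" and jn: "j \<in> neighbors N x i"
      then have i: "i < N" by simp
      have j: "j < N" "i \<noteq> j" using neighborsD[OF jn] by auto
      have w0: "0 < ?w i j" using sites_eq_iff[OF i j(1)] j(2) by simp
      have "(T i j - trans i j) * ?w i j = T i j * ?w i j - curve_length (vedge N x i j)"
        using w0 by (simp add: trans_def norm_minus_commute[of "x j"] left_diff_distrib)
      then have t: "\<bar>T i j - trans i j\<bar> * ?w i j \<le> 4 * h\<^sup>2"
        using T(3)[OF i j] w0 by (metis abs_mult abs_norm_cancel)
      have vw: "\<bar>?v i j\<bar> \<le> 12 * K * ?w i j" by (rule v_lip) (use sites i j in auto)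
      have "\<bar>(T i j - trans i j) * (e i - e j) * ?v i j\<bar> \<le> \<bar>T i j - trans i j\<bar> * \<bar>e i - e j\<bar> * (12 * K * ?w i j)"
        unfolding abs_mult by (intro mult_left_mono vw) auto
      also have "\<dots> = (\<bar>T i j - trans i j\<bar> * ?w i j) * (12 * K * \<bar>e i - e j\<bar>)" by simp
      also have "\<dots> \<le> (4 * h\<^sup>2) * (12 * K * \<bar>e i - e j\<bar>)" using K by (intro mult_right_mono t) auto
      finally show "\<bar>(T i j - trans i j) * (e i - e j) * ?v i j\<bar> \<le> 48 * K * h\<^sup>2 * \<bar>e i - e j\<bar>" by (simp add: mult_ac)
    qed
    show ?thesis unfolding r1 r2 by (rule r3)
  qed
  define S where "S = (\<Sum>i<N. \<Sum>j\<in>neighbors N x i. \<bar>e i - e j\<bar>)"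
  have S0: "0 \<le> S" unfolding S_def by (intro sum_nonneg) auto
  have e2: "(\<Sum>i<N. \<Sum>j\<in>neighbors N x i. r * \<bar>e i - e j\<bar>) = r * S" for r
    by (simp add: S_def sum_distrib_left)
  have "\<bar>F - (1 / 2) * (\<Sum>i<N. \<Sum>j<N. trans i j * (e i - e j) * ?v i j)\<bar>
      \<le> (1 / 2) * (12006 * (C0 + 1) * K * h\<^sup>2 * S) + (1 / 2) * (48 * K * h\<^sup>2 * S)"
  proof -
    have "\<bar>F - (1 / 2) * q\<bar> \<le> (1 / 2) * s + (1 / 2) * t"
      if "\<bar>F - (1 / 2) * p\<bar> \<le> (1 / 2) * r" "r \<le> s" "\<bar>p - q\<bar> \<le> t" for p q r s t :: real
      using that by linarith
    from this[OF 1 2[unfolded e2] 3[unfolded e2]] show ?thesis .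
  qed
  also have "\<dots> = 6003 * (C0 + 1) * K * h\<^sup>2 * S + 24 * 1 * (K * h\<^sup>2 * S)" by simp
  also have "\<dots> \<le> 6003 * (C0 + 1) * K * h\<^sup>2 * S + 24 * (C0 + 1) * (K * h\<^sup>2 * S)"
    using C0 K S0 by (intro add_left_mono mult_right_mono mult_left_mono) auto
  also have "\<dots> = 6027 * (C0 + 1) * K * h\<^sup>2 * S" by (simp add: algebra_simps)
  finally show ?thesis by (simp only: S_def)
qed

end

lemma integrable_Linf_mult:
  assumes f: "f \<in> Linf" and V: "continuous_on S2 V"
  shows "integrable surface (\<lambda>y. f y * V y)"
proof -
  obtain B where B: "AE y in surface. \<bar>f y\<bar> \<le> B" "0 \<le> B" using Linf_bounded[OF f] .
  have "bounded (V ` S2)" by (intro compact_imp_bounded compact_continuous_image V) simp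
  then obtain M where M: "\<And>y. y \<in> S2 \<Longrightarrow> norm (V y) \<le> M" unfolding bounded_iff by blast
  have [measurable]: "f \<in> borel_measurable surface" using f by (simp add: Linf_def)
  have [measurable]: "V \<in> borel_measurable surface" by (rule borel_measurable_surface_continuous[OF V])
  show ?thesis
  proof (rule surface.integrable_const_bound)
    show "AE y in surface. norm (f y * V y) \<le> B * M"
      using B(1) AE_space
    proof eventually_elim
      case (elim y)
      then show ?case unfolding norm_mult using M[of y] B(2) by (intro mult_mono) (auto simp: space_surface)
    qed
  qed measurable
qed

context uniform_voronoi
begin

text \<open>Discrete summation by parts: \<open>trans\<close> is symmetric and the difference of
  nodal values antisymmetric, so averaging the double sum with its transpose produces a difference
  of \<open>z\<close> as well.\<close>

lemma fv_form_eq: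
  "fv_form N x w z = (1 / 2) * (\<Sum>i<N. \<Sum>j<N. trans i j * (w (x i) - w (x j)) * (z (x i) - z (x j)))"
proof -
  let ?g = "\<lambda>i j. trans i j * (w (x i) - w (x j))"
  have flux: "(\<Sum>j\<in>neighbors N x i. flux N x w i j) = (\<Sum>j<N. ?g i j)" if "i < N" for i
  proof -
    have "(\<Sum>j\<in>neighbors N x i. flux N x w i j) = (\<Sum>j\<in>neighbors N x i. ?g i j)"
      by (rule sum.cong) (simp_all add: flux_def trans_def algebra_simps flip: times_divide_eq_left diff_divide_distrib)
    also have "\<dots> = (\<Sum>j<N. ?g i j)"
      by (rule sum.mono_neutral_left) (use trans_not_neighbor in \<open>auto simp: neighbors_def\<close>)
    finally show ?thesis .
  qed
  have 1: "fv_form N x w z = (\<Sum>i<N. \<Sum>j<N. ?g i j * z (x i))"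
    unfolding fv_form_def by (intro sum.cong refl) (simp add: flux sum_distrib_left mult.commute)
  also have "\<dots> = (\<Sum>i<N. \<Sum>j<N. ?g j i * z (x j))" by (rule sum.swap)
  also have "\<dots> = (\<Sum>i<N. \<Sum>j<N. - (?g i j * z (x j)))"
  proof (intro sum.cong refl)
    fix i j
    have "trans j i = trans i j" by (rule trans_commute)
    then show "?g j i * z (x j) = - (?g i j * z (x j))" by (simp add: algebra_simps)
  qed
  finally have 2: "fv_form N x w z = (\<Sum>i<N. \<Sum>j<N. - (?g i j * z (x j)))" .
  have "fv_form N x w z + fv_form N x w z = (\<Sum>i<N. \<Sum>j<N. ?g i j * (z (x i) - z (x j)))"
    by (subst (1) 1, subst 2) (simp add: right_diff_distrib sum.distrib sum_subtractf sum_negf)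
  then show ?thesis by simp
qed

text \<open>12054 is twice the 6027 of \<open>consistency\<close>, as \<open>energy\<close> has no
  factor 1/2.\<close>

definition energy_const :: real
  where "energy_const = 12054 * (C0 + 1) * neighbor_bound * sqrt (2 * C0)"

text \<open>48 is the Lipschitz factor 12 over the distance \<open>4 * h\<close>; the leading 2 pays
  for removing the error at a reference vertex.\<close>

definition error_const :: real
  where "error_const = 2 * (48 + sobolev_const * energy_const)"

lemma energy_const_nonneg: "0 \<le> energy_const" and sobolev_const_nonneg: "0 \<le> sobolev_const"
  using C0 C1 A by (simp_all add: energy_const_def sobolev_const_def neighbor_bound_def)

text \<open>Almost every point lies in exactly one open cell, where the shift of all coefficients is
  the constant \<open>\<kappa>\<close>; it drops out because \<open>f\<close> has mean zero.\<close>

lemma LINT_Ih: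
  assumes f: "integrable surface f" "(LINT y|surface. f y) = 0" and z: "\<And>i. i < N \<Longrightarrow> z (x i) = e i - \<kappa>"
  shows "(LINT y|surface. f y * Ih N x z y) = (LINT y|surface. f y * (\<Sum>i<N. e i * indicator (vcell N x i) y))"
proof -
  have [measurable]: "f \<in> borel_measurable surface" using f by auto
  have [measurable]: "vcell N x i \<in> sets surface" if "i \<in> {..<N}" for i using that by simp
  have cell: "(\<Sum>i<N. a i * indicator (vcell N x i) y) = a k" if "k < N" "y \<in> vcell N x k" for a :: "nat \<Rightarrow> real" and k y
  proof -
    have "(\<Sum>i<N. a i * indicator (vcell N x i) y) = (\<Sum>i\<in>{k}. a i * indicator (vcell N x i) y)"
    proof (rule sum.mono_neutral_right)
      show "\<forall>i\<in>{..<N} - {k}. a i * indicator (vcell N x i) y = 0"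
      proof
        fix i assume "i \<in> {..<N} - {k}"
        then have "y \<notin> vcell N x i" using disjoint_vcell[of i k] that by auto
        then show "a i * indicator (vcell N x i) y = 0" by simp
      qed
    qed (use that in auto)
    then show ?thesis using that by simp
  qed
  have i: "integrable surface (\<lambda>y. f y * (\<Sum>i<N. e i * indicator (vcell N x i) y))"
  proof -
    have "integrable surface (\<lambda>y. \<Sum>i<N. e i * (f y * indicator (vcell N x i) y))"
      by (intro Bochner_Integration.integrable_sum integrable_mult_right integrable_real_mult_indicator f) auto
    moreover have "f y * (\<Sum>i<N. e i * indicator (vcell N x i) y) = (\<Sum>i<N. e i * (f y * indicator (vcell N x i) y))" for y
      unfolding sum_distrib_left by (intro sum.cong refl) (simp only: mult_ac)
    ultimately show ?thesis by (simp only:)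
  qed
  have "(LINT y|surface. f y * Ih N x z y) = (LINT y|surface. f y * (\<Sum>i<N. e i * indicator (vcell N x i) y) - \<kappa> * f y)"
  proof (rule integral_cong_AE)
    show "AE y in surface. f y * Ih N x z y = f y * (\<Sum>i<N. e i * indicator (vcell N x i) y) - \<kappa> * f y"
      using AE_vcell
    proof eventually_elim
      case (elim y)
      then obtain k where k: "k < N" "y \<in> vcell N x k" by blast
      have 1: "Ih N x z y = e k - \<kappa>" unfolding Ih_def cell[OF k] using z k by simp
      have 2: "(\<Sum>i<N. e i * indicator (vcell N x i) y) = e k" by (rule cell[OF k])
      show ?case unfolding 1 2 by (simp add: algebra_simps)
    qed
  qed (unfold Ih_def, measurable)
  then show ?thesis using i f by simp
qed

end

section \<open>The error estimate\<close>

locale fv_error = delaunay_mesh N x C0 C1 A h + flux_consistency N x C0 C1 A h v G K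
  for N x C0 C1 A h v G K +
  fixes f u uh :: "real ^ 3 \<Rightarrow> real"
  assumes f: "f \<in> Linf" "(LINT y|surface. f y) = 0"
    and sol: "weak_solution f u" and fv: "fv_solution N x f uh"
    and uv: "AE y in surface. u y = v y" and uG: "AE y in surface. sgrad u y = G y"
begin

definition err :: "nat \<Rightarrow> real"
  where "err i = v (x i) - uh (x i)"

lemma uh_in_Uh: "uh \<in> Uh N x"
  using fv by (simp add: fv_solution_def)

text \<open>The exact problem is tested with smooth combinations, the discrete one with an element
  of \<open>Uh\<close> having the same nodal differences. Both right-hand sides lead to
  \<open>?F\<close>, so subtraction leaves the energy of \<open>err\<close>, bounded by a multiple
  of its own root.\<close>

lemma sqrt_energy_err: "sqrt (energy err) \<le> energy_const * K * h"
proof -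
  let ?F = "LINT y|surface. f y * (\<Sum>i<N. err i * indicator (vcell N x i) y)"
  have fi: "integrable surface f" by (rule integrable_Linf[OF f(1)])
  have test: "(LINT y|surface. G y \<bullet> tangential y ((l / 2) *\<^sub>R (\<Sum>i<N. \<Sum>j<N. (soft_prod l i j y * (err i - err j)) *\<^sub>R (x i - x j))))
      = (LINT y|surface. f y * (\<Sum>i<N. err i * soft l i y))" for l
    by (rule weak_solution_C1[OF sol soft_comb_C1 uG G_cont integrable_Linf_mult[OF f(1) C1_grad_continuous[OF soft_comb_C1]] fi f(2)])
      (use area_S2_pos in simp)
  let ?V = "\<Sum>i<N. \<Sum>j<N. trans i j * (err i - err j) * (v (x i) - v (x j))"
  let ?U = "\<Sum>i<N. \<Sum>j<N. trans i j * (uh (x i) - uh (x j)) * (err i - err j)"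
  let ?S = "\<Sum>i<N. \<Sum>j\<in>neighbors N x i. \<bar>err i - err j\<bar>"
  have 1: "\<bar>?F - (1 / 2) * ?V\<bar> \<le> 6027 * (C0 + 1) * K * h\<^sup>2 * ?S"
    by (rule consistency[OF test fi])
  obtain z \<kappa> where z: "z \<in> Uh N x" "\<And>i. i < N \<Longrightarrow> z (x i) = err i - \<kappa>" by (rule Uh_nodal[where v = err]) blast
  have "fv_form N x uh z = (LINT y|surface. f y * Ih N x z y)" using fv z(1) by (simp add: fv_solution_def)
  also have "\<dots> = ?F" by (rule LINT_Ih[where e = err and \<kappa> = \<kappa>, OF fi f(2) z(2)])
  finally have 2: "fv_form N x uh z = ?F" .
  have 3: "fv_form N x uh z = (1 / 2) * ?U"
    unfolding fv_form_eq by (simp add: z(2))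
  have 4: "energy err = ?V - ?U"
    unfolding energy_def sum_subtractf[symmetric]
    by (intro sum.cong refl) (simp add: err_def power2_eq_square algebra_simps)
  have "energy err \<le> 2 * (6027 * (C0 + 1) * K * h\<^sup>2 * ?S)"
  proof -
    have "E \<le> 2 * r" if "\<bar>F - (1 / 2) * V\<bar> \<le> r" "F = (1 / 2) * U" "E = V - U" for E F U V r :: real
      using that by linarith
    from this[OF 1 _ 4] 2 3 show ?thesis by simp
  qed
  also have "\<dots> = (12054 * (C0 + 1) * K * h) * (?S * h)" by (simp add: power2_eq_square)
  also have "\<dots> \<le> (12054 * (C0 + 1) * K * h) * (neighbor_bound * sqrt (2 * C0) * sqrt (energy err))"
    by (intro mult_left_mono sum_neighbor_differences) (use C0 K h_pos in simp)
  also have "\<dots> = (energy_const * K * h) * sqrt (energy err)" by (simp add: energy_const_def)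
  finally have le: "sqrt (energy err) * sqrt (energy err) \<le> (energy_const * K * h) * sqrt (energy err)"
    using energy_nonneg[of err] by simp
  show ?thesis
  proof (cases "energy err = 0")
    case False
    then have "0 < sqrt (energy err)" using energy_nonneg[of err] by simp
    then show ?thesis using le by (simp only: mult_le_cancel_right_pos)
  qed (use energy_const_nonneg K h_pos in simp)
qed

text \<open>Only differences of nodal errors are under control so far, so the error at a reference
  vertex is split off. Between the vertices \<open>uh\<close> is a convex combination of nearby
  nodal values.\<close>

lemma pointwise_error:
  assumes y: "y \<in> S2"
  shows "\<bar>v y - uh y - err 0\<bar> \<le> (48 + sobolev_const * energy_const) * K * h * \<bar>ln h\<bar>"
proof -
  obtain b where b: "\<And>m. 0 \<le> b m" "(\<Sum>m<N. b m) = 1" "uh y = (\<Sum>m<N. b m * uh (x m))"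
    "\<And>m. b m \<noteq> 0 \<Longrightarrow> norm (y - x m) \<le> 4 * h"
    using Uh_interpolates[OF uh_in_Uh y] by blast
  define D where "D = (48 + sobolev_const * energy_const) * K * h * \<bar>ln h\<bar>"
  have m: "\<bar>b m * (v y - uh (x m) - err 0)\<bar> \<le> b m * D" if "m < N" for m
  proof (cases "b m = 0")
    case False
    have "\<bar>v y - v (x m)\<bar> \<le> 12 * K * norm (y - x m)" by (rule v_lip) (use sites that y in auto)
    also have "\<dots> \<le> 12 * K * (4 * h)" using K by (intro mult_left_mono b(4) False) auto
    also have "\<dots> = 48 * (K * h) * 1" by simp
    also have "\<dots> \<le> 48 * (K * h) * \<bar>ln h\<bar>" using K h_pos by (intro mult_left_mono abs_ln_h_ge_1) auto
    finally have 1: "\<bar>v y - v (x m)\<bar> \<le> 48 * (K * h) * \<bar>ln h\<bar>" .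
    have "\<bar>err m - err 0\<bar> \<le> sobolev_const * \<bar>ln h\<bar> * sqrt (energy err)"
      by (rule discrete_sobolev) (use that two_le_N in auto)
    also have "\<dots> \<le> sobolev_const * \<bar>ln h\<bar> * (energy_const * K * h)"
      by (intro mult_left_mono sqrt_energy_err mult_nonneg_nonneg sobolev_const_nonneg) simp
    finally have 2: "\<bar>err m - err 0\<bar> \<le> sobolev_const * \<bar>ln h\<bar> * (energy_const * K * h)" .
    have "\<bar>v y - uh (x m) - err 0\<bar> \<le> \<bar>v y - v (x m)\<bar> + \<bar>err m - err 0\<bar>"
      by (simp add: err_def)
    also have "\<dots> \<le> D" using 1 2 by (simp add: D_def algebra_simps)
    finally show ?thesis using b(1)[of m] by (simp add: abs_mult mult_left_mono)
  qed simp
  have "v y - uh y - err 0 = (\<Sum>m<N. b m) * (v y - err 0) - (\<Sum>m<N. b m * uh (x m))"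
    unfolding b(2) b(3)[symmetric] by simp
  also have "\<dots> = (\<Sum>m<N. b m * (v y - uh (x m) - err 0))"
    unfolding sum_distrib_right sum_subtractf[symmetric] by (intro sum.cong refl) (simp add: algebra_simps)
  finally have eq: "v y - uh y - err 0 = (\<Sum>m<N. b m * (v y - uh (x m) - err 0))" .
  have "\<bar>v y - uh y - err 0\<bar> \<le> (\<Sum>m<N. b m * D)"
    unfolding eq by (rule order_trans[OF sum_abs]) (rule sum_mono, use m in auto)
  also have "\<dots> = D" using b(2) by (simp flip: sum_distrib_right)
  finally show ?thesis by (simp only: D_def)
qed

lemma continuous_v: "continuous_on S2 v"
proof -
  have "lipschitz_on (12 * K) S2 v"
    by (rule lipschitz_onI) (use v_lip K in \<open>auto simp: dist_norm\<close>)
  then show ?thesis by (rule lipschitz_on_continuous_on)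
qed

text \<open>Both \<open>v\<close> and \<open>uh\<close> have mean zero, so integrating the pointwise
  estimate over the sphere isolates \<open>err 0\<close>.\<close>

lemma err_0_le: "\<bar>err 0\<bar> \<le> (48 + sobolev_const * energy_const) * K * h * \<bar>ln h\<bar>"
proof -
  define D where "D = (48 + sobolev_const * energy_const) * K * h * \<bar>ln h\<bar>"
  have iv: "integrable surface v" by (rule integrable_surface_continuous[OF continuous_v])
  have iu: "integrable surface uh" by (rule integrable_surface_continuous[OF Uh_continuous[OF uh_in_Uh]])
  have [measurable]: "u \<in> borel_measurable surface" "v \<in> borel_measurable surface"
    using sol borel_measurable_surface_continuous[OF continuous_v]
    by (auto simp: weak_solution_def H10_def H1_def L2_def)
  have "(LINT y|surface. v y) = (LINT y|surface. u y)"
    by (rule integral_cong_AE) (use uv in auto)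
  also have "\<dots> = 0" using sol by (simp add: weak_solution_def H10_def)
  finally have v0: "(LINT y|surface. v y) = 0" .
  have u0: "(LINT y|surface. uh y) = 0" using uh_in_Uh by (simp add: Uh_def)
  have i: "integrable surface (\<lambda>y. v y - uh y - err 0)" using iv iu by simp
  have "(LINT y|surface. v y - uh y - err 0) = - (err 0 * area S2)"
    using iv iu v0 u0 by (simp add: space_surface)
  then have "\<bar>err 0\<bar> * area S2 = \<bar>LINT y|surface. v y - uh y - err 0\<bar>"
    by (simp add: abs_mult)
  also have "\<dots> \<le> (LINT y|surface. \<bar>v y - uh y - err 0\<bar>)" by (rule integral_abs_bound)
  also have "\<dots> \<le> (LINT y|surface. D)"
    by (rule integral_mono) (use i pointwise_error in \<open>auto simp: space_surface D_def\<close>)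
  also have "\<dots> = D * area S2" by (simp add: space_surface)
  finally show ?thesis using area_S2_pos by (simp add: D_def)
qed

lemma Linf_error: "Linf_norm (\<lambda>y. u y - uh y) \<le> ereal (error_const * h * \<bar>ln h\<bar> * K)"
  unfolding Linf_norm_def
proof (rule esssup_I)
  have [measurable]: "u \<in> borel_measurable surface" "uh \<in> borel_measurable surface"
    using sol borel_measurable_surface_continuous[OF Uh_continuous[OF uh_in_Uh]]
    by (auto simp: weak_solution_def H10_def H1_def L2_def)
  show "(\<lambda>y. ereal \<bar>u y - uh y\<bar>) \<in> borel_measurable surface" by measurable
  show "AE y in surface. ereal \<bar>u y - uh y\<bar> \<le> ereal (error_const * h * \<bar>ln h\<bar> * K)"
    using uv AE_space
  proof eventually_elim
    case (elim y)
    then have "\<bar>v y - uh y - err 0\<bar> \<le> (48 + sobolev_const * energy_const) * K * h * \<bar>ln h\<bar>"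
      by (intro pointwise_error) (simp add: space_surface)
    then have "\<bar>u y - uh y\<bar> \<le> 2 * ((48 + sobolev_const * energy_const) * K * h * \<bar>ln h\<bar>)"
      using err_0_le elim(1) by linarith
    then show ?case by (simp add: error_const_def mult_ac)
  qed
qed

end

section \<open>Norm bounds and the final estimate\<close>

lemma W2inf_norm_bounds:
  "Linf_norm u \<le> W2inf_norm u" "Linf_norm (sderiv i u) \<le> W2inf_norm u"
  "Linf_norm (sderiv j (sderiv i u)) \<le> W2inf_norm u"
proof -
  let ?S = "{Linf_norm u} \<union> range (\<lambda>i. Linf_norm (sderiv i u)) \<union> range (\<lambda>(i, j). Linf_norm (sderiv j (sderiv i u)))"
  have fin: "finite ?S" by simp
  show "Linf_norm u \<le> W2inf_norm u" "Linf_norm (sderiv i u) \<le> W2inf_norm u"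
    unfolding W2inf_norm_def by (rule Max_ge[OF fin], simp)+
  have "(\<lambda>(i, j). Linf_norm (sderiv j (sderiv i u))) (i, j) \<in> ?S" by blast
  then show "Linf_norm (sderiv j (sderiv i u)) \<le> W2inf_norm u"
    unfolding W2inf_norm_def using Max_ge[OF fin] by simp
qed

lemma W2inf_norm_finite:
  assumes "u \<in> W2inf" shows "W2inf_norm u < \<infinity>"
  unfolding W2inf_norm_def
  by (subst Max_less_iff) (use assms in \<open>auto simp: W2inf_def Linf_def simp del: ereal_infty_less\<close>)

theorem theorem5p12:
  fixes C0 C1 :: real
  assumes "C0 > 0" and "C1 > 0"
  shows "\<exists>C h0. C > 0 \<and> 0 < h0 \<and> h0 < 1 \<and>
    (\<forall>(N::nat) (x :: nat \<Rightarrow> real ^ 3) (f :: real ^ 3 \<Rightarrow> real) (u :: real ^ 3 \<Rightarrow> real)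
        (uh :: real ^ 3 \<Rightarrow> real) (h::real).
      voronoi_delaunay N x \<longrightarrow> almost_uniform C0 C1 N x \<longrightarrow> h = mesh_size N x \<longrightarrow>
      f \<in> Linf \<longrightarrow> (LINT y|surface. f y) = 0 \<longrightarrow>
      weak_solution f u \<longrightarrow> u \<in> W2inf \<inter> H10 \<longrightarrow>
      fv_solution N x f uh \<longrightarrow>
      0 < h \<longrightarrow> h \<le> h0 \<longrightarrow>
      Linf_norm (\<lambda>y. u y - uh y)
        \<le> ereal (C * h * \<bar>ln h\<bar>) * (W2inf_norm u + Linf_norm f))"
proof -
  obtain A where A: "0 < A" "\<And>p s. p \<in> S2 \<Longrightarrow> 0 < s \<Longrightarrow> area (S2 \<inter> cball p s) \<le> A * s\<^sup>2"
    using area_cap_le by blast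
  \<comment> \<open>The maximum with 1 gives positivity without looking into
    \<open>error_const\<close>.\<close>
  define C where "C = max 1 (uniform_voronoi.error_const C0 C1 A)"
  show ?thesis
  \<comment> \<open>1/16 covers all smallness conditions: mesh size at most 1/8 for the edge
    weights, \<open>h\<close> below \<open>exp (- 1)\<close> for the logarithm, and closed cells too
    small to contain antipodal points.\<close>
  proof (rule exI[of _ C], rule exI[of _ "1/16"], intro conjI allI impI)
    fix N :: nat and x :: "nat \<Rightarrow> real ^ 3" and f u uh :: "real ^ 3 \<Rightarrow> real" and h :: real
    assume vd: "voronoi_delaunay N x" and au: "almost_uniform C0 C1 N x" and h: "h = mesh_size N x"
      and f: "f \<in> Linf" "(LINT y|surface. f y) = 0" and sol: "weak_solution f u" and u: "u \<in> W2inf \<inter> H10"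
      and fv: "fv_solution N x f uh" and h0: "0 < h" "h \<le> 1/16"
    have tiling: "(\<Union>t\<in>delaunay N x. gtri x t) = S2" using vd by (simp add: voronoi_delaunay_def)
    \<comment> \<open>A tiling of the nonempty sphere has a triangle, so there are at least two
      vertices.\<close>
    have "(axis 1 1 :: real ^ 3) \<in> S2" by (simp add: norm_axis_1)
    then obtain t where "t \<in> delaunay N x" using tiling by blast
    then have N2: "2 \<le> N" by (auto simp: delaunay_def)
    interpret delaunay_mesh N x C0 C1 A h
    proof unfold_locales
      show "x i \<in> S2" if "i < N" for i using vd that by (auto simp: voronoi_delaunay_def)
      show "inj_on x {..<N}" using vd by (simp add: voronoi_delaunay_def)
      show "h\<^sup>2 / C1 \<le> area (vcell N x i)" if "i < N" for i
        using au that by (simp add: almost_uniform_def Let_def h)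
      show "h / C0 \<le> curve_length (vedge N x i j)" "curve_length (vedge N x i j) \<le> C0 * h"
        if "i < N" "j \<in> neighbors N x i" for i j
        using au that by (simp_all add: almost_uniform_def Let_def h)
    qed (use assms A N2 h h0 tiling in auto)
    have "0 \<le> W2inf_norm u" using Linf_norm_nonneg W2inf_norm_bounds(1) by (rule order_trans)
    then obtain K where K: "W2inf_norm u = ereal K" "0 \<le> K"
      using W2inf_norm_finite[of u] u by (cases "W2inf_norm u") auto

    have uW: "u \<in> W2inf" using u by simp
    have "Linf_norm (\<lambda>y. u y - uh y) \<le> ereal (error_const * h * \<bar>ln h\<bar> * K)"
    proof (rule W2inf_regular[OF uW K(2) W2inf_norm_bounds[where u = u, unfolded K(1)]], goal_cases)
      case (1 v G)
      interpret fv_error N x C0 C1 A h v G K f u uh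
        by unfold_locales (use K(2) 1 f sol fv in auto)
      show ?case by (rule Linf_error)
    qed
    also have "\<dots> \<le> ereal (C * h * \<bar>ln h\<bar>) * ereal K"
      using K(2) h0 by (simp add: C_def mult_right_mono)
    also have "\<dots> \<le> ereal (C * h * \<bar>ln h\<bar>) * (ereal K + Linf_norm f)"
    proof (rule ereal_mult_left_mono)
      show "ereal K \<le> ereal K + Linf_norm f" using Linf_norm_nonneg[of f] by (simp add: add_increasing2)
      have "0 \<le> C" by (simp add: C_def)
      then have "0 \<le> C * h * \<bar>ln h\<bar>" using h0 by (intro mult_nonneg_nonneg) auto
      then show "0 \<le> ereal (C * h * \<bar>ln h\<bar>)" by (simp only: zero_ereal_def ereal_less_eq)
    qed
    finally show "Linf_norm (\<lambda>y. u y - uh y) \<le> ereal (C * h * \<bar>ln h\<bar>) * (W2inf_norm u + Linf_norm f)"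
      by (simp only: K(1))
  qed (auto simp: C_def)
qed

end
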